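(* The family $\{\widetilde E_\lambda(q,t)\}_{\lambda\in P}$ is a basis of the parabolic module $\mathcal R$ of the extended affine Hecke algebra $\mathcal H_X^e$ which is invariant under the Kazhdan–Lusztig involution, i.e. $\kappa(\widetilde E_\lambda(q,t))=\widetilde E_\lambda(q,t)$ for every $\lambda\in P$. Moreover: (1) $\{\widetilde E_\lambda(\infty,t)\}_{\lambda\in P}$ is the standard basis, i.e. $\widetilde E_\lambda(\infty,t)=T_{w_\lambda}\omega_{\tilde\lambda}\cdot 1$ for every $\lambda\in P$; (2) $\{\widetilde E_\lambda(0,t)\}_{\lambda\in P}$ is the dual standard basis, i.e. $\widetilde E_\lambda(0,t)=T^{-1}_{w_\lambda^{-1}}\omega_{\tilde\lambda}\cdot 1$ for every $\lambda\in P$.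
   Context: Root data. $\mathring R$ is a finite irreducible, not necessarily reduced, root system of rank $n$ in a real Euclidean space $(V,(\cdot,\cdot))$, with simple roots $\alpha_1,\dots,\alpha_n$ and positive roots $\mathring R^+$. If $\mathring R$ is reduced, short roots have square length $2$ (all roots are short if there is only one length); if nonreduced, roots have square length $1$, $2$ or $4$, and $\alpha_n$ is the simple root with $2\alpha_n\in\mathring R$. $\alpha^\vee=2\alpha/(\alpha,\alpha)$; $\mathring Q=\oplus_i\mathbb Z\alpha_i$; $P=\{\lambda\in V:(\lambda,\alpha^\vee)\in\mathbb Z\ \forall\alpha\in\mathring R\}$; $\lambda_i^\vee\in V$ is given by $(\lambda_i^\vee,\alpha_j)=\delta_{ij}$. A weight is (anti-)dominant if $(\lambda,\alpha_i^\vee)\ge0$ ($\le 0$) for $1\le i\le n$. $\theta$ is the highest short root if $\mathring R$ is reduced and the highest root otherwise; $c_0=1$ if reduced, $c_0=2$ otherwise; $\alpha_0=c_0^{-1}(\delta-\theta)$ with $\delta$ a formal symbol. Weyl groups. $\mathring W=\langle s_1,\dots,s_n\rangle$ is the finite Weyl group with longest element $w_\circ$; the affine Weyl group $W=\langle s_0,\dots,s_n\rangle$ acts on $V$ by $s_i\cdot x=s_i(x)$ ($i\ge1$), $s_0\cdot x=s_\theta(x)+c_0^{-1}\theta$, and contains the translations $\tau_\mu\cdot x=x+\mu$, $\mu\in\mathring Q$. Let $\mathcal C=\{x\in V:(x,\alpha_i)\ge0\ (1\le i\le n),\ (x,\theta)\le1\}$ and $\mathcal O_P=P\cap\mathcal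 C$. For $\lambda\in P$: $\lambda_-$ is the anti-dominant element of $\mathring W(\lambda)$; $\tilde\lambda$ is the unique element of $W\cdot\lambda$ in $\mathcal O_P$; $\mathring w_\lambda\in\mathring W$, resp. $w_\lambda\in W$, is the element whose inverse is the minimal length element of $\mathring W$, resp. $W$, with $\mathring w_\lambda^{-1}(\lambda)=\lambda_-$, resp. $w_\lambda^{-1}\cdot\lambda=\tilde\lambda$. Parameters. If $\mathring R$ is reduced: $t_s,t_\ell$ (attached to short and long roots), $t_i$ is the parameter of $\alpha_i$ for $1\le i\le n$, $t_0=t_s$, $t_{01}=t_{02}=t_{03}:=t_0$, $t_n^*:=t_n$. If nonreduced: $t_n$, $t_{03}$, $t=t_1=\dots=t_{n-1}$ (absent if $n=1$) are independent, while $t_{01}=t_{02}=1$ (a standing specialization) and $t_n^*:=t_{01}=1$. $\mathbb F$ is the field of rational functions over $\mathbb Q$ in $q^{1/m}$ and the square roots of the parameters, $m$ a positive integer with $c_0\mid m$ and $m(\mu,\lambda)\in\mathbb Z$ for $\mu\in\mathring Q,\lambda\in P$. $\mathcal R=\mathbb F[e^\lambda;\lambda\in P]$, $e^{\lambda+k\delta}:=q^{-k}e^\lambda$. Operators on $\mathcal R$. For $1\le i\le n$ with $2\alpha_i\notin\mathring R$: $T_ie^\lambda=t_i^{1/2}e^{s_i(\lambda)}+(t_i^{1/2}-t_i^{-1/2})\frac{e^\lambda-e^{s_i(\lambda)}}{1-e^{-\alpha_i}}$. If $2\alpha_n\in\mathring R$: $T_ne^\lambda=t_n^{1/2}e^{s_n(\lambda)}+\big(t_n^{1/2}-t_n^{-1/2}+(t_{03}^{1/2}-t_{03}^{-1/2})e^{-\alpha_n}\big)\frac{e^\lambda-e^{s_n(\lambda)}}{1-e^{-2\alpha_n}}$.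 With $s_0(\lambda)=s_\theta(\lambda)+c_0^{-1}(\lambda,\theta)\delta$: in the reduced case $T_{01}e^\lambda=t_0^{1/2}e^{s_0(\lambda)}+(t_0^{1/2}-t_0^{-1/2})\frac{e^\lambda-e^{s_0(\lambda)}}{1-e^{-\alpha_0}}$; in the nonreduced case (with $t_{01}=t_{02}=1$) $T_{01}e^\lambda=e^{s_0(\lambda)}$. The operators $T_{01},T_1,\dots,T_n$ satisfy the braid relations of $W$; $T^Y_w$ ($w\in W$) is their product along a reduced expression of $w$ ($T_{01}$ for $s_0$). For $\mu\in\mathring Q$, $Y_\mu=T^Y_{\tau_{\mu_1}}(T^Y_{\tau_{\mu_2}})^{-1}$ for any anti-dominant $\mu_1,\mu_2\in\mathring Q$ with $\mu=\mu_1-\mu_2$. For $u\in\mathring W$, $T_u$ is the product of the $T_i$ along a reduced expression. $T_{03}:=e^{c_0^{-1}\theta}T_{s_\theta}^{-1}$ ($e^{c_0^{-1}\theta}$ acting by multiplication). $T_{03},T_1,\dots,T_n$ also satisfy the braid relations of $W$, and $T_w$ ($w\in W$) denotes their product along a reduced expression ($T_{03}$ for $s_0$). For $\nu\in\mathcal O_P$, $\omega_\nu$ is the operator $\omega_\nu\cdot f=e^\nu\,T^{-1}_{\mathring w_\nu^{-1}}\cdot f$. The algebra generated by $T_{03},T_1,\dots,T_n$ is the affine Hecke algebra $\mathcal H_X$, and together with the $\omega_\nu$ it generates the extended affine Hecke algebra $\mathcal H_X^e$. $\chi(u)$ for $u\in \mathring W$ is the product of $t_i^{1/2}$ over the simple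 reflections $s_i$ in a reduced expression of $u$. The parabolic module is $\mathcal H_X^e\otimes_{\mathring{\mathcal H}}\mathbb F$, induced from the one-dimensional character $T_i\mapsto t_i^{1/2}$ of the finite Hecke algebra $\mathring{\mathcal H}=\langle T_1,\dots,T_n\rangle$; it is identified with $\mathcal R$ via $H\otimes1\mapsto H\cdot1$. Kazhdan–Lusztig involution on $\mathcal R$: $\kappa$ is the semilinear involution of $\mathcal R$ that inverts $q^{1/m}$ and all square roots of parameters and satisfies $\kappa(e^\lambda)=\chi(w_\circ)^{-1}T_{w_\circ}\cdot e^{w_\circ(\lambda)}$; it is compatible with the algebra involution $\kappa$ of $\mathcal H_X^e$ inverting the parameters and $T_1,\dots,T_n,T_{03}$ and fixing each $\omega_\nu$, in that $\kappa(H\cdot f)=\kappa(H)\cdot\kappa(f)$. The standard basis is $\{T_{w_\lambda}\omega_{\tilde\lambda}\cdot1\}_{\lambda\in P}$; the dual standard basis is $\{T^{-1}_{w_\lambda^{-1}}\omega_{\tilde\lambda}\cdot1\}_{\lambda\in P}$. Macdonald polynomials. $E_\lambda(q,t)$ is the unique $f\in\mathcal R$ with coefficient of $e^\lambda$ equal to 1 and $Y_\mu f=q^{(\mu,\lambda)}(t_n^*t_n)^{-\frac12(\mu,\mathring w_\lambda(\lambda_n^\vee))}\prod_{i=1}^{n-1}t_i^{-(\mu,\mathring w_\lambda(\lambda_i^\vee))}f$ for all $\mu\in\mathring Q$. $\widetilde E_\lambda(q,t):=\chi(\mathring w_\lambda)^{-1}E_\lambda(q,t)$, and $\widetilde E_\lambda(\infty,t)$,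 $\widetilde E_\lambda(0,t)$ are its coefficientwise limits as $q\to\infty$, $q\to0$ (both exist). *)

theory Defs
  imports
    "HOL-Analysis.Analysis"
    "HOL-Library.Poly_Mapping"
    "HOL-Computational_Algebra.Polynomial"
    "HOL-Computational_Algebra.Fraction_Field"
begin

section \<open>Root data\<close>

text \<open>The Euclidean space \<open>V\<close> is a type \<open>'v :: euclidean_space\<close>, and the rank is
  \<open>n = DIM('v)\<close>. The simple roots are \<open>simple D 1, \<dots>, simple D n\<close>. The positive
  integer \<open>denom D\<close> is the \<open>m\<close> in \<open>q\<^bsup>1/m\<^esup>\<close>, and \<open>param D\<close> names the parameters,
  as explained with the parameters below.\<close>

record ('v, 'p) datum =
  roots :: "'v set"
  simple :: "nat \<Rightarrow> 'v"
  denom :: nat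
  param :: "real \<Rightarrow> 'p"

definition coroot :: "'v::euclidean_space \<Rightarrow> 'v" where
  "coroot a = (2 / (a \<bullet> a)) *\<^sub>R a"

definition reflection :: "'v::euclidean_space \<Rightarrow> 'v \<Rightarrow> 'v" where
  "reflection a x = x - (x \<bullet> coroot a) *\<^sub>R a"

definition root_system :: "'v::euclidean_space set \<Rightarrow> bool" where
  "root_system R \<longleftrightarrow> finite R \<and> 0 \<notin> R \<and> span R = UNIV \<and>
     (\<forall>a\<in>R. reflection a ` R = R) \<and> (\<forall>a\<in>R. \<forall>b\<in>R. b \<bullet> coroot a \<in> \<int>)"

definition irreducible_roots :: "'v::euclidean_space set \<Rightarrow> bool" where
  "irreducible_roots R \<longleftrightarrow> R \<noteq> {} \<and>
     \<not> (\<exists>A B. A \<noteq> {} \<and> B \<noteq> {} \<and> A \<union> B = R \<and> (\<forall>a\<in>A. \<forall>b\<in>B. a \<bullet> b = 0))"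

definition reduced_roots :: "'v::euclidean_space set \<Rightarrow> bool" where
  "reduced_roots R \<longleftrightarrow> (\<forall>a\<in>R. \<forall>c. c *\<^sub>R a \<in> R \<longrightarrow> c = 1 \<or> c = -1)"

abbreviation reduced :: "('v::euclidean_space, 'p) datum \<Rightarrow> bool" where
  "reduced D \<equiv> reduced_roots (roots D)"

text \<open>The order in which \<open>y - x\<close> is a combination of simple roots with coefficients in
  the nonnegative integers.\<close>

definition root_le :: "('v::euclidean_space, 'p) datum \<Rightarrow> 'v \<Rightarrow> 'v \<Rightarrow> bool" where
  "root_le D x y \<longleftrightarrow> (\<exists>c::nat \<Rightarrow> nat. y - x = (\<Sum>i=1..DIM('v). real (c i) *\<^sub>R simple D i))"

definition simple_roots :: "('v::euclidean_space, 'p) datum \<Rightarrow> bool" where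
  "simple_roots D \<longleftrightarrow> inj_on (simple D) {1..DIM('v)} \<and> simple D ` {1..DIM('v)} \<subseteq> roots D \<and>
     independent (simple D ` {1..DIM('v)}) \<and>
     (\<forall>b\<in>roots D. root_le D 0 b \<or> root_le D b 0)"

definition sq_lengths :: "('v::euclidean_space, 'p) datum \<Rightarrow> real set" where
  "sq_lengths D = (\<lambda>a. a \<bullet> a) ` roots D"

definition normalized :: "('v::euclidean_space, 'p) datum \<Rightarrow> bool" where
  "normalized D \<longleftrightarrow>
     (if reduced D then Min (sq_lengths D) = 2
      else sq_lengths D \<subseteq> {1, 2, 4} \<and> 2 *\<^sub>R simple D (DIM('v)) \<in> roots D)"

definition c0 :: "('v::euclidean_space, 'p) datum \<Rightarrow> nat" where
  "c0 D = (if reduced D then 1 else 2)"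

definition short_roots :: "('v::euclidean_space, 'p) datum \<Rightarrow> 'v set" where
  "short_roots D = {a \<in> roots D. a \<bullet> a = Min (sq_lengths D)}"

definition theta :: "('v::euclidean_space, 'p) datum \<Rightarrow> 'v" where
  "theta D = (let S = (if reduced D then short_roots D else roots D)
              in (THE a. a \<in> S \<and> (\<forall>b\<in>S. root_le D b a)))"

definition root_lattice :: "('v::euclidean_space, 'p) datum \<Rightarrow> 'v set" where
  "root_lattice D = range (\<lambda>c::nat \<Rightarrow> int. \<Sum>i=1..DIM('v). real_of_int (c i) *\<^sub>R simple D i)"

definition weights :: "('v::euclidean_space, 'p) datum \<Rightarrow> 'v set" where
  "weights D = {x. \<forall>a\<in>roots D. x \<bullet> coroot a \<in> \<int>}"

definition fund_coweight :: "('v::euclidean_space, 'p) datum \<Rightarrow> nat \<Rightarrow> 'v" where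
  "fund_coweight D i = (THE x. \<forall>j\<in>{1..DIM('v)}. x \<bullet> simple D j = (if i = j then 1 else 0))"

definition antidominant :: "('v::euclidean_space, 'p) datum \<Rightarrow> 'v \<Rightarrow> bool" where
  "antidominant D x \<longleftrightarrow> (\<forall>i\<in>{1..DIM('v)}. x \<bullet> coroot (simple D i) \<le> 0)"

text \<open>The parameters are labelled by the elements of \<open>'p\<close>. In each case they correspond to the
  square lengths of roots: if the root system is reduced, \<open>t\<^sub>s\<close> belongs to \<open>2\<close> and \<open>t\<^sub>l\<close>
  to the other square length, if there is one; if it is not reduced, \<open>t\<^sub>n\<close> belongs to \<open>1\<close>,
  \<open>t = t\<^sub>1 = \<dots> = t\<^bsub>n-1\<^esub>\<close> to \<open>2\<close> (which does not occur if \<open>n = 1\<close>), and \<open>t\<^sub>0\<^sub>3\<close> to \<open>4\<close>.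
  The bijectivity of \<open>param D\<close> says that there are no other parameters.\<close>

definition macdonald_datum :: "('v::euclidean_space, 'p) datum \<Rightarrow> bool" where
  "macdonald_datum D \<longleftrightarrow>
     root_system (roots D) \<and> irreducible_roots (roots D) \<and> simple_roots D \<and> normalized D \<and>
     bij_betw (param D) (sq_lengths D) UNIV \<and>
     denom D > 0 \<and> c0 D dvd denom D \<and>
     (\<forall>mu\<in>root_lattice D. \<forall>l\<in>weights D. real (denom D) * (mu \<bullet> l) \<in> \<int>)"


section \<open>Weyl groups\<close>

text \<open>Elements of the finite and the affine Weyl group are represented by the maps \<open>V \<rightarrow> V\<close>
  by which they act.\<close>

definition word_prod :: "(nat \<Rightarrow> 'a \<Rightarrow> 'a) \<Rightarrow> nat list \<Rightarrow> 'a \<Rightarrow> 'a" where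
  "word_prod g ws = foldr (\<circ>) (map g ws) id"

definition s_theta :: "('v::euclidean_space, 'p) datum \<Rightarrow> 'v \<Rightarrow> 'v" where
  "s_theta D = reflection (theta D)"

definition weyl_gen :: "('v::euclidean_space, 'p) datum \<Rightarrow> nat \<Rightarrow> 'v \<Rightarrow> 'v" where
  "weyl_gen D i = (if i = 0 then (\<lambda>x. s_theta D x + (1 / real (c0 D)) *\<^sub>R theta D)
               else reflection (simple D i))"

definition fin_ix :: "('v::euclidean_space, 'p) datum \<Rightarrow> nat set" where
  "fin_ix D = {1..DIM('v)}"

definition aff_ix :: "('v::euclidean_space, 'p) datum \<Rightarrow> nat set" where
  "aff_ix D = {0..DIM('v)}"

definition weyl :: "('v::euclidean_space, 'p) datum \<Rightarrow> nat set \<Rightarrow> ('v \<Rightarrow> 'v) set" where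
  "weyl D I = word_prod (weyl_gen D) ` lists I"

abbreviation fin_weyl :: "('v::euclidean_space, 'p) datum \<Rightarrow> ('v \<Rightarrow> 'v) set" where
  "fin_weyl D \<equiv> weyl D (fin_ix D)"

abbreviation aff_weyl :: "('v::euclidean_space, 'p) datum \<Rightarrow> ('v \<Rightarrow> 'v) set" where
  "aff_weyl D \<equiv> weyl D (aff_ix D)"

definition wlen :: "('v::euclidean_space, 'p) datum \<Rightarrow> nat set \<Rightarrow> ('v \<Rightarrow> 'v) \<Rightarrow> nat" where
  "wlen D I w = (LEAST k. \<exists>ws\<in>lists I. word_prod (weyl_gen D) ws = w \<and> length ws = k)"

text \<open>A reduced expression. Every quantity defined through it below (products of operators
  satisfying the braid relations, and \<open>\<chi>\<close>) does not depend on the choice.\<close>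

definition red_word :: "('v::euclidean_space, 'p) datum \<Rightarrow> nat set \<Rightarrow> ('v \<Rightarrow> 'v) \<Rightarrow> nat list" where
  "red_word D I w =
     (SOME ws. ws \<in> lists I \<and> word_prod (weyl_gen D) ws = w \<and> length ws = wlen D I w)"

definition longest :: "('v::euclidean_space, 'p) datum \<Rightarrow> 'v \<Rightarrow> 'v" where
  "longest D = (THE w. w \<in> fin_weyl D \<and> (\<forall>v\<in>fin_weyl D. wlen D (fin_ix D) v \<le> wlen D (fin_ix D) w))"

definition min_alcove_weights :: "('v::euclidean_space, 'p) datum \<Rightarrow> 'v set" where
  "min_alcove_weights D =
     {x \<in> weights D. (\<forall>i\<in>{1..DIM('v)}. x \<bullet> simple D i \<ge> 0) \<and> x \<bullet> theta D \<le> 1}"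

definition anti :: "('v::euclidean_space, 'p) datum \<Rightarrow> 'v \<Rightarrow> 'v" where
  "anti D l = (THE x. x \<in> (\<lambda>w. w l) ` fin_weyl D \<and> antidominant D x)"

definition tilde :: "('v::euclidean_space, 'p) datum \<Rightarrow> 'v \<Rightarrow> 'v" where
  "tilde D l = (THE x. x \<in> (\<lambda>w. w l) ` aff_weyl D \<and> x \<in> min_alcove_weights D)"

text \<open>The inverse of the element of minimal length in \<open>weyl D I\<close> mapping \<open>l\<close> to \<open>x\<close>.\<close>

definition inv_min_elt ::
  "('v::euclidean_space, 'p) datum \<Rightarrow> nat set \<Rightarrow> 'v \<Rightarrow> 'v \<Rightarrow> 'v \<Rightarrow> 'v" where
  "inv_min_elt D I l x = (THE w. w \<in> weyl D I \<and> inv w l = x \<and>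
     (\<forall>v\<in>weyl D I. v l = x \<longrightarrow> wlen D I (inv w) \<le> wlen D I v))"

definition w_fin :: "('v::euclidean_space, 'p) datum \<Rightarrow> 'v \<Rightarrow> 'v \<Rightarrow> 'v" where
  "w_fin D l = inv_min_elt D (fin_ix D) l (anti D l)"

definition w_aff :: "('v::euclidean_space, 'p) datum \<Rightarrow> 'v \<Rightarrow> 'v \<Rightarrow> 'v" where
  "w_aff D l = inv_min_elt D (aff_ix D) l (tilde D l)"


section \<open>The field of parameters\<close>

text \<open>\<open>'p tfield\<close> is the field of rational functions over the rationals in the square roots of
  the parameters, and \<open>'p qtfield\<close> the field of rational functions in \<open>q\<^bsup>1/m\<^esup>\<close> over it.\<close>

type_synonym 'p tfield = "(('p \<Rightarrow>\<^sub>0 nat) \<Rightarrow>\<^sub>0 rat) fract"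
type_synonym 'p qtfield = "'p tfield poly fract"

definition qroot :: "'p::linorder qtfield" where
  "qroot = Fract [:0, 1:] 1"

definition of_tfield :: "'p::linorder tfield \<Rightarrow> 'p qtfield" where
  "of_tfield c = Fract [:c:] 1"

definition sqrt_param :: "'p::linorder \<Rightarrow> 'p qtfield" where
  "sqrt_param p = of_tfield (Fract (Poly_Mapping.single (Poly_Mapping.single p 1) 1) 1)"

text \<open>The power \<open>q\<^sup>r\<close>; it is used only if \<open>denom D * r\<close> is an integer.\<close>

definition qpow :: "('v, 'p::linorder) datum \<Rightarrow> real \<Rightarrow> 'p qtfield" where
  "qpow D r = qroot powi \<lfloor>real (denom D) * r\<rfloor>"

text \<open>The field automorphism inverting \<open>q\<^bsup>1/m\<^esup>\<close> and the square roots of the parameters.\<close>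

definition bar :: "'p::linorder qtfield \<Rightarrow> 'p qtfield" where
  "bar = (THE h. h 1 = 1 \<and> (\<forall>x y. h (x + y) = h x + h y) \<and> (\<forall>x y. h (x * y) = h x * h y) \<and>
                 h qroot = inverse qroot \<and> (\<forall>p. h (sqrt_param p) = inverse (sqrt_param p)))"

text \<open>Limits of rational functions of \<open>q\<^bsup>1/m\<^esup>\<close> over \<open>'p tfield\<close>: the value of the function at
  \<open>0\<close>, respectively at infinity, if it is regular there.\<close>

definition has_lim_0 :: "'p::linorder qtfield \<Rightarrow> 'p tfield \<Rightarrow> bool" where
  "has_lim_0 x c \<longleftrightarrow> (\<exists>a b. x = Fract a b \<and> poly b 0 \<noteq> 0 \<and> c = poly a 0 / poly b 0)"

definition has_lim_infinity :: "'p::linorder qtfield \<Rightarrow> 'p tfield \<Rightarrow> bool" where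
  "has_lim_infinity x c \<longleftrightarrow>
     (\<exists>a b. x = Fract a b \<and> b \<noteq> 0 \<and> degree a \<le> degree b \<and> c = coeff a (degree b) / lead_coeff b)"

definition t_half :: "('v::euclidean_space, 'p::linorder) datum \<Rightarrow> nat \<Rightarrow> 'p qtfield" where
  "t_half D i = sqrt_param (param D (simple D i \<bullet> simple D i))"

definition t0_half :: "('v::euclidean_space, 'p::linorder) datum \<Rightarrow> 'p qtfield" where
  "t0_half D = sqrt_param (param D 2)"

definition t03_half :: "('v::euclidean_space, 'p::linorder) datum \<Rightarrow> 'p qtfield" where
  "t03_half D = sqrt_param (param D 4)"

definition tn_star_half :: "('v::euclidean_space, 'p::linorder) datum \<Rightarrow> 'p qtfield" where
  "tn_star_half D = (if reduced D then t_half D (DIM('v)) else 1)"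

definition chi :: "('v::euclidean_space, 'p::linorder) datum \<Rightarrow> ('v \<Rightarrow> 'v) \<Rightarrow> 'p qtfield" where
  "chi D u = prod_list (map (t_half D) (red_word D (fin_ix D) u))"


section \<open>The group algebra\<close>

type_synonym ('v, 'p) galg = "'v \<Rightarrow>\<^sub>0 'p qtfield"

definition scale :: "'p::linorder qtfield \<Rightarrow> ('v::euclidean_space, 'p) galg \<Rightarrow> ('v, 'p) galg" where
  "scale c f = Poly_Mapping.single 0 c * f"

lemma vector_space_scale: "vector_space scale"
  by unfold_locales
     (simp_all add: scale_def distrib_left distrib_right single_add mult_single flip: mult.assoc)

global_interpretation galg: vector_space scale
  by (rule vector_space_scale)

text \<open>\<open>\<R> = \<F>[e\<^sup>\<lambda>; \<lambda> \<in> P]\<close>, as a subring of \<open>\<F>[e\<^sup>\<lambda>; \<lambda> \<in> V]\<close>.\<close>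

definition wt_alg :: "('v::euclidean_space, 'p::linorder) datum \<Rightarrow> ('v, 'p) galg set" where
  "wt_alg D = {f. Poly_Mapping.keys f \<subseteq> weights D}"

definition ee :: "'v \<Rightarrow> ('v::euclidean_space, 'p::linorder) galg" where
  "ee l = Poly_Mapping.single l 1"

text \<open>\<open>ee_delta D l k\<close> is \<open>e\<^bsup>\<lambda>+k\<delta>\<^esup> = q\<^bsup>-k\<^esup> e\<^sup>\<lambda>\<close>.\<close>

definition ee_delta :: "('v, 'p) datum \<Rightarrow> 'v \<Rightarrow> real \<Rightarrow> ('v::euclidean_space, 'p::linorder) galg" where
  "ee_delta D l k = scale (qpow D (- k)) (ee l)"

definition lin_ext :: "('v \<Rightarrow> ('v, 'p) galg) \<Rightarrow> ('v, 'p) galg \<Rightarrow> ('v::euclidean_space, 'p::linorder) galg" where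
  "lin_ext g f = (\<Sum>l\<in>Poly_Mapping.keys f. scale (Poly_Mapping.lookup f l) (g l))"

text \<open>The quotient of \<open>f\<close> by \<open>g\<close>, in case it exists and is unique.\<close>

definition exact_quot :: "('v, 'p) galg \<Rightarrow> ('v, 'p) galg \<Rightarrow> ('v::euclidean_space, 'p::linorder) galg" where
  "exact_quot f g = (THE h. h * g = f)"

definition coeffwise_lim ::
  "('p qtfield \<Rightarrow> 'p tfield \<Rightarrow> bool) \<Rightarrow> ('v, 'p) galg \<Rightarrow> ('v::euclidean_space, 'p::linorder) galg \<Rightarrow> bool" where
  "coeffwise_lim has_lim f g \<longleftrightarrow>
     (\<forall>l. \<exists>c. has_lim (Poly_Mapping.lookup f l) c \<and> Poly_Mapping.lookup g l = of_tfield c)"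


section \<open>Operators on the group algebra\<close>

definition T_fin_gen ::
  "('v, 'p) datum \<Rightarrow> nat \<Rightarrow> ('v::euclidean_space, 'p::linorder) galg \<Rightarrow> ('v, 'p) galg" where
  "T_fin_gen D i = lin_ext (\<lambda>l.
     let a = simple D i; t = t_half D i; u = t03_half D; sl = weyl_gen D i l in
     if 2 *\<^sub>R a \<notin> roots D
     then scale t (ee sl) + scale (t - inverse t) (exact_quot (ee l - ee sl) (1 - ee (- a)))
     else scale t (ee sl) +
          (scale (t - inverse t) 1 + scale (u - inverse u) (ee (- a))) *
          exact_quot (ee l - ee sl) (1 - ee (- (2 *\<^sub>R a))))"

text \<open>\<open>T\<^sub>0\<^sub>1\<close>. Here \<open>\<alpha>\<^sub>0 = c\<^sub>0\<^sup>-\<^sup>1 (\<delta> - \<theta>)\<close>.\<close>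

definition T01 ::
  "('v, 'p) datum \<Rightarrow> ('v::euclidean_space, 'p::linorder) galg \<Rightarrow> ('v, 'p) galg" where
  "T01 D = lin_ext (\<lambda>l.
     let c = real (c0 D); t = t0_half D;
         e_s0l = ee_delta D (s_theta D l) ((l \<bullet> theta D) / c);
         e_minus_a0 = ee_delta D ((1 / c) *\<^sub>R theta D) (- (1 / c)) in
     if reduced D
     then scale t e_s0l + scale (t - inverse t) (exact_quot (ee l - e_s0l) (1 - e_minus_a0))
     else e_s0l)"

definition inv_op ::
  "('v, 'p) datum \<Rightarrow> (('v, 'p) galg \<Rightarrow> ('v, 'p) galg) \<Rightarrow> ('v::euclidean_space, 'p::linorder) galg \<Rightarrow> ('v, 'p) galg" where
  "inv_op D A = the_inv_into (wt_alg D) A"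

definition T_fin ::
  "('v, 'p) datum \<Rightarrow> ('v \<Rightarrow> 'v) \<Rightarrow> ('v::euclidean_space, 'p::linorder) galg \<Rightarrow> ('v, 'p) galg" where
  "T_fin D u = word_prod (T_fin_gen D) (red_word D (fin_ix D) u)"

definition T03 ::
  "('v, 'p) datum \<Rightarrow> ('v::euclidean_space, 'p::linorder) galg \<Rightarrow> ('v, 'p) galg" where
  "T03 D f = ee ((1 / real (c0 D)) *\<^sub>R theta D) * inv_op D (T_fin D (s_theta D)) f"

definition T_Y ::
  "('v, 'p) datum \<Rightarrow> ('v \<Rightarrow> 'v) \<Rightarrow> ('v::euclidean_space, 'p::linorder) galg \<Rightarrow> ('v, 'p) galg" where
  "T_Y D w = word_prod (\<lambda>i. if i = 0 then T01 D else T_fin_gen D i) (red_word D (aff_ix D) w)"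

definition T_X ::
  "('v, 'p) datum \<Rightarrow> ('v \<Rightarrow> 'v) \<Rightarrow> ('v::euclidean_space, 'p::linorder) galg \<Rightarrow> ('v, 'p) galg" where
  "T_X D w = word_prod (\<lambda>i. if i = 0 then T03 D else T_fin_gen D i) (red_word D (aff_ix D) w)"

definition transl :: "'v::euclidean_space \<Rightarrow> 'v \<Rightarrow> 'v" where
  "transl mu x = x + mu"

text \<open>The operator does not depend on the choice of \<open>\<mu>\<^sub>1\<close> and \<open>\<mu>\<^sub>2\<close>.\<close>

definition Y_op ::
  "('v, 'p) datum \<Rightarrow> 'v \<Rightarrow> ('v::euclidean_space, 'p::linorder) galg \<Rightarrow> ('v, 'p) galg" where
  "Y_op D mu =
     (let (mu1, mu2) = (SOME (x, y). x \<in> root_lattice D \<and> y \<in> root_lattice D \<and>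
                          antidominant D x \<and> antidominant D y \<and> mu = x - y)
      in T_Y D (transl mu1) \<circ> inv_op D (T_Y D (transl mu2)))"

definition omega ::
  "('v, 'p) datum \<Rightarrow> 'v \<Rightarrow> ('v::euclidean_space, 'p::linorder) galg \<Rightarrow> ('v, 'p) galg" where
  "omega D nu f = ee nu * inv_op D (T_fin D (inv (w_fin D nu))) f"

text \<open>The Kazhdan--Lusztig involution: the map, semilinear with respect to \<open>bar\<close>, with
  \<open>e\<^sup>\<lambda> \<mapsto> \<chi>(w\<^sub>\<circ>)\<^sup>-\<^sup>1 T\<^bsub>w\<circ>\<^esub> e\<^bsup>w\<circ>(\<lambda>)\<^esup>\<close>.\<close>

definition kappa ::
  "('v, 'p) datum \<Rightarrow> ('v::euclidean_space, 'p::linorder) galg \<Rightarrow> ('v, 'p) galg" where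
  "kappa D f = (\<Sum>l\<in>Poly_Mapping.keys f. scale (bar (Poly_Mapping.lookup f l))
     (scale (inverse (chi D (longest D))) (T_fin D (longest D) (ee (longest D l)))))"

definition std_basis ::
  "('v, 'p) datum \<Rightarrow> 'v \<Rightarrow> ('v::euclidean_space, 'p::linorder) galg" where
  "std_basis D l = T_X D (w_aff D l) (omega D (tilde D l) 1)"

definition dual_std_basis ::
  "('v, 'p) datum \<Rightarrow> 'v \<Rightarrow> ('v::euclidean_space, 'p::linorder) galg" where
  "dual_std_basis D l = inv_op D (T_X D (inv (w_aff D l))) (omega D (tilde D l) 1)"


section \<open>Nonsymmetric Macdonald polynomials\<close>

text \<open>The eigenvalue
  \<open>q\<^bsup>(\<mu>,\<lambda>)\<^esup> (t\<^sub>n\<^sup>* t\<^sub>n)\<^bsup>-(\<mu>,w(\<lambda>\<^sub>n\<^sup>\<or>))/2\<^esup> \<Prod>\<^bsub>i<n\<^esub> t\<^sub>i\<^bsup>-(\<mu>,w(\<lambda>\<^sub>i\<^sup>\<or>))\<^esup>\<close>, written in terms of the square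
  roots of the parameters; \<open>w\<close> stands for \<open>w_fin D l\<close>. The pairings below are integers
  for \<open>\<mu>\<close> in the root lattice.\<close>

definition Y_eigenvalue ::
  "('v::euclidean_space, 'p::linorder) datum \<Rightarrow> 'v \<Rightarrow> 'v \<Rightarrow> 'p qtfield" where
  "Y_eigenvalue D l mu =
     (let k = (\<lambda>i. \<lfloor>mu \<bullet> w_fin D l (fund_coweight D i)\<rfloor>); n = DIM('v) in
      qpow D (mu \<bullet> l) * (tn_star_half D * t_half D n) powi (- k n) *
      (\<Prod>i\<in>{1..<n}. ((t_half D i)\<^sup>2) powi (- k i)))"

definition macdonald_E ::
  "('v, 'p) datum \<Rightarrow> 'v \<Rightarrow> ('v::euclidean_space, 'p::linorder) galg" where
  "macdonald_E D l = (THE f. f \<in> wt_alg D \<and> Poly_Mapping.lookup f l = 1 \<and>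
     (\<forall>mu\<in>root_lattice D. Y_op D mu f = scale (Y_eigenvalue D l mu) f))"

definition E_tilde ::
  "('v, 'p) datum \<Rightarrow> 'v \<Rightarrow> ('v::euclidean_space, 'p::linorder) galg" where
  "E_tilde D l = scale (inverse (chi D (w_fin D l))) (macdonald_E D l)"

end

(* The operators T_i (with T_03 for i = 0) intertwine joint eigenvectors of the Y_mu: if v is an eigenvector
   for the weight l and alpha_i is positive at l, then T_i v + a v is one for s_i . l, where the scalar a
   depends only on a ratio of eigenvalues. Starting from the vectors e^nu, nu in the alcove, a reduced word
   of w_l therefore writes E~_l as a product of factors T_i + a_i. Triangularity in a Bruhat-type order on weights
   makes the eigenvectors unique and the family a basis. The involution kappa commutes with T_i + a, since
   a minus its conjugate is t_i^(-1/2) - t_i^(1/2). As q tends to infinity a tends to 0; as q tends to 0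
   it tends to t_i^(-1/2) - t_i^(1/2), which turns T_i into T_i^(-1). *)
theory Submission imports Defs begin

text \<open>Most objects of the statement involve a choice: a reduced word in every
  \<open>T_w\<close>, a definite description in \<open>macdonald_E\<close>, in \<open>w_fin\<close>
  and in the inverse operators. Hence the Weyl groups are studied through signs of affine roots at
  one point of the alcove, Matsumoto's theorem is proved, and the braid relations of the
  \<open>TT i\<close> are checked in rank two. The eigenvector property is tested at short roots
  only, since these generate the root lattice. For a positive short root both \<open>Y\<close> and
  multiplication by its exponential have closed formulas, with a single \<open>TT 0\<close> in the
  one and a single \<open>T03\<close> in the other; comparing them gives the cross relations between
  \<open>T03\<close> and the \<open>Y\<close>'s. The ratio of eigenvalues met at a step is a
  positive power of \<open>qroot\<close> times a scalar free of q. This makes the denominators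
  nonzero and yields both limits and the effect of \<open>bar\<close>. The factor \<open>chi\<close>
  is what keeps the leading coefficient correct at every step. Limits pass through the generators
  because their matrix entries are free of q, and they are followed along the very word chosen in
  \<open>T_X\<close>.\<close>

abbreviation pairing :: "'a::euclidean_space => 'a => real" (infix "\<cdot>" 70) where "x \<cdot> a \<equiv> x \<bullet> coroot a"
abbreviation "lookup \<equiv> Poly_Mapping.lookup"
abbreviation "keys \<equiv> Poly_Mapping.keys"
abbreviation "single \<equiv> Poly_Mapping.single"

section \<open>Root systems and finite Weyl groups\<close>

lemma inner_coroot_self: "a ~= 0 ==> a \<cdot> a = 2"
 by (simp add: coroot_def)

lemma coroot_scaleR: "coroot (c *\<^sub>R a) = (1 / c) *\<^sub>R coroot a"
 by (cases "c = 0") (simp_all add: coroot_def field_simps)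

lemma coroot_minus [simp]: "coroot (- a) = - coroot a"
 by (simp add: coroot_def)

lemma reflection_minus: "reflection (- a) = reflection a"
 by (rule ext) (simp add: reflection_def)

lemma reflection_scaleR: "c ~= 0 ==> reflection (c *\<^sub>R a) = reflection a"
 by (rule ext) (simp add: reflection_def coroot_scaleR)

lemma linear_reflection: "linear (reflection a)"
 by (rule linearI) (simp_all add: reflection_def inner_add_left algebra_simps)

lemma reflection_swap: "reflection a x \<bullet> y = x \<bullet> reflection a y"
 by (simp add: reflection_def coroot_def inner_diff_left inner_diff_right inner_commute)

lemma reflection_self: "reflection a a = - a"
 by (cases "a = 0") (simp_all add: reflection_def inner_coroot_self scaleR_2)

lemma reflection_reflection [simp]: "reflection a (reflection a x) = x"
proof -
 have "reflection a (reflection a x) = reflection a x - (x \<cdot> a) *\<^sub>R reflection a a"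
  unfolding reflection_def[of a x] linear_diff[OF linear_reflection] linear_scale[OF linear_reflection] by simp
 thus ?thesis by (simp add: reflection_self) (simp add: reflection_def)
qed

lemma reflection_inner: "reflection a x \<bullet> reflection a y = x \<bullet> y"
 by (simp add: reflection_swap)

lemma reflection_orth: "x \<bullet> a = 0 ==> reflection a x = x"
 by (simp add: reflection_def coroot_def)

lemma coroot_isometry:
 assumes "linear f" and "!!x y. f x \<bullet> f y = x \<bullet> y"
 shows "coroot (f a) = f (coroot a)"
 by (simp add: coroot_def assms(2) linear_scale[OF assms(1)])

lemma reflection_isometry:
 assumes "linear f" and "!!x y. f x \<bullet> f y = x \<bullet> y"
 shows "reflection (f a) (f x) = f (reflection a x)"
 by (simp add: reflection_def coroot_isometry[OF assms] assms(2) linear_diff[OF assms(1)] linear_scale[OF assms(1)])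

lemma word_prod_Nil [simp]: "word_prod g [] = id"
 by (simp add: word_prod_def)

lemma word_prod_Cons [simp]: "word_prod g (i # ws) = g i o word_prod g ws"
 by (simp add: word_prod_def)

lemma word_prod_append: "word_prod g (us @ ws) = word_prod g us o word_prod g ws"
 by (induction us) (simp_all add: comp_assoc)

section \<open>Simple coordinates, heights and positive roots\<close>

locale mac =
 fixes D :: "('v::euclidean_space, 'p::linorder) datum"
 assumes mac: "macdonald_datum D"
begin

abbreviation "R \<equiv> roots D"
abbreviation "al \<equiv> simple D"
abbreviation "ix \<equiv> fin_ix D"
abbreviation "fw \<equiv> fund_coweight D"

lemma finite_ix [simp]: "finite ix"
 by (simp add: fin_ix_def)

lemma
 shows finite_R: "finite R" and zero_R: "0 \<notin> R" and span_R: "span R = UNIV"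
  and refl_image_R: "a \<in> R ==> reflection a ` R = R"
  and int_R: "a \<in> R ==> b \<in> R ==> b \<cdot> a \<in> \<int>"
 using mac by (auto simp: macdonald_datum_def root_system_def)

lemma root_nonzero: "a \<in> R ==> a ~= 0"
 using zero_R by blast

lemma root_sq_pos: "a \<in> R ==> a \<bullet> a > 0"
 using root_nonzero by simp

lemma refl_R: "a \<in> R ==> b \<in> R ==> reflection a b \<in> R"
 using refl_image_R by blast

lemma minus_R: "a \<in> R ==> - a \<in> R"
 using refl_R[of a a] by (simp add: reflection_self)

lemma minus_R_iff [simp]: "- a \<in> R \<longleftrightarrow> a \<in> R"
 using minus_R[of a] minus_R[of "- a"] by auto

lemma
 shows inj_al: "inj_on al ix" and al_R: "i \<in> ix ==> al i \<in> R" and indep_al: "independent (al ` ix)"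
  and pos_or_neg: "b \<in> R ==> root_le D 0 b | root_le D b 0"
 using mac by (auto simp: macdonald_datum_def simple_roots_def fin_ix_def)

lemma irred: "R = A \<union> B ==> A ~= {} ==> B ~= {} ==> \<exists>a\<in>A. \<exists>b\<in>B. a \<bullet> b ~= 0"
 using mac unfolding macdonald_datum_def irreducible_roots_def by metis

lemma R_nonempty: "R ~= {}"
 using mac unfolding macdonald_datum_def irreducible_roots_def by blast

lemma span_al: "span (al ` ix) = UNIV"
proof -
 have "card (al ` ix) = DIM('v)" using inj_al by (simp add: card_image fin_ix_def)
 hence "UNIV \<subseteq> span (al ` ix)"
  by (intro card_ge_dim_independent[OF _ indep_al]) auto
 thus ?thesis by blast
qed

text \<open>The simple roots form a basis, so the functional dual to \<open>al i\<close> exists and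
  is unique; the vector representing it, obtained as an adjoint, satisfies the definite description
  in \<open>fund_coweight\<close>.\<close>

lemma fw_inner:
 assumes "i \<in> ix" "j \<in> ix"
 shows "fw i \<bullet> al j = (if i = j then 1 else 0)"
proof -
 have "\<exists>!x. \<forall>j\<in>ix. x \<bullet> al j = (if i = j then 1 else 0)"
 proof -
  obtain g :: "'v => real" where g: "linear g" "\<forall>b\<in>al ` ix. g b = (if b = al i then 1 else 0)"
   using linear_independent_extend[OF indep_al, of "%b. if b = al i then 1 else 0"] by blast
  define x where "x = adjoint g 1"
  have x: "\<forall>j\<in>ix. x \<bullet> al j = (if i = j then 1 else 0)"
  proof
   fix j assume j: "j \<in> ix"
   have "x \<bullet> al j = g (al j)"
    using adjoint_works[OF g(1), of "al j" 1] by (simp add: x_def inner_commute)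
   thus "x \<bullet> al j = (if i = j then 1 else 0)"
    using g(2) j assms(1) inj_onD[OF inj_al] by auto
  qed
  moreover have "y = x" if y: "\<forall>j\<in>ix. y \<bullet> al j = (if i = j then 1 else 0)" for y
  proof -
   have "\<forall>b\<in>al ` ix. (y - x) \<bullet> b = 0" using x y by (auto simp: inner_diff_left)
   hence "(y - x) \<bullet> z = 0" for z
    using orthogonal_to_span[of z "al ` ix" "y - x"] span_al
    by (auto simp: orthogonal_def inner_commute)
   hence "(y - x) \<bullet> (y - x) = 0" .
   thus ?thesis by simp
  qed
  ultimately show ?thesis by blast
 qed
 from theI'[OF this] show ?thesis using assms(2) unfolding fund_coweight_def fin_ix_def by blast
qed

lemma expand: "x = (\<Sum>i\<in>ix. (x \<bullet> fw i) *\<^sub>R al i)"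
proof -
 have "x \<in> span (al ` ix)" using span_al by simp
 then obtain u where "x = (\<Sum>b\<in>al ` ix. u b *\<^sub>R b)"
  using span_finite[of "al ` ix"] by auto
 hence x: "x = (\<Sum>i\<in>ix. u (al i) *\<^sub>R al i)"
  by (simp add: sum.reindex[OF inj_al])
 have "x \<bullet> fw i = u (al i)" if "i \<in> ix" for i
 proof -
  have "x \<bullet> fw i = (\<Sum>j\<in>ix. u (al j) * (al j \<bullet> fw i))"
   by (subst x) (simp add: inner_sum_left)
  also have "... = (\<Sum>j\<in>ix. if i = j then u (al j) else 0)"
   using that by (intro sum.cong) (auto simp: inner_commute[of _ "fw i"] fw_inner)
  also have "... = u (al i)" using that by simp
  finally show ?thesis .
 qed
 thus ?thesis using x by simp
qed

lemma inner_expand: "x \<bullet> y = (\<Sum>i\<in>ix. (x \<bullet> fw i) * (al i \<bullet> y))"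
 by (subst expand[of x]) (simp add: inner_sum_left)

lemma eq_al_iff: "(!!i. i \<in> ix ==> x \<bullet> al i = 0) ==> x = 0"
 using inner_expand[of x x] by (simp add: inner_commute)

lemma crd_sum: "i \<in> ix ==> (\<Sum>j\<in>ix. c j *\<^sub>R al j) \<bullet> fw i = c i"
proof -
 assume i: "i \<in> ix"
 have "(\<Sum>j\<in>ix. c j *\<^sub>R al j) \<bullet> fw i = (\<Sum>j\<in>ix. if i = j then c j else 0)"
  unfolding inner_sum_left using i by (intro sum.cong) (auto simp: inner_commute[of _ "fw i"] fw_inner)
 thus ?thesis using i by simp
qed

lemma root_le_iff: "root_le D x y \<longleftrightarrow> (\<forall>i\<in>ix. (y - x) \<bullet> fw i \<in> \<nat>)"
proof
 assume "root_le D x y"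
 then obtain c :: "nat => nat" where "y - x = (\<Sum>i\<in>ix. real (c i) *\<^sub>R al i)"
  unfolding root_le_def fin_ix_def by blast
 thus "\<forall>i\<in>ix. (y - x) \<bullet> fw i \<in> \<nat>" by (simp add: crd_sum)
next
 assume r: "\<forall>i\<in>ix. (y - x) \<bullet> fw i \<in> \<nat>"
 have "\<forall>i. \<exists>c. i \<in> ix --> (y - x) \<bullet> fw i = real c" using r by (metis Nats_cases)
 then obtain c where c: "!!i. i \<in> ix ==> (y - x) \<bullet> fw i = real (c i)" by metis
 have "y - x = (\<Sum>i\<in>ix. real (c i) *\<^sub>R al i)"
  by (subst expand) (simp add: c)
 thus "root_le D x y" unfolding root_le_def fin_ix_def by auto
qed

text \<open>Pairing with this vector is the height of a root; rescaled, the same vector becomes the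
  point \<open>pp\<close> inside the alcove.\<close>

definition rho_check :: 'v where "rho_check = (\<Sum>i\<in>ix. fw i)"

lemma rho_check_al: "i \<in> ix ==> rho_check \<bullet> al i = 1"
 by (simp add: rho_check_def inner_sum_left fw_inner)

text \<open>All coordinates of a root have one sign, so the sign of the height decides positivity
  (\<open>posr_root_le\<close>); a single linear inequality is easier to handle than a condition on
  every coordinate.\<close>

definition posr :: "'v => bool" where "posr a \<longleftrightarrow> 0 < rho_check \<bullet> a"

lemma rho_check_sum: "rho_check \<bullet> x = (\<Sum>i\<in>ix. x \<bullet> fw i)"
 using inner_expand[of x rho_check] by (simp add: inner_commute[of _ rho_check] rho_check_al)

lemma crd_int: "a \<in> R ==> i \<in> ix ==> a \<bullet> fw i \<in> \<int>"
 using pos_or_neg[of a] Nats_subset_Ints by (auto simp: root_le_iff)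

lemma root_le_0: "root_le D 0 a ==> i \<in> ix ==> a \<bullet> fw i >= 0"
 by (auto simp: root_le_iff elim!: Nats_cases)

lemma root_le_0': "root_le D a 0 ==> i \<in> ix ==> a \<bullet> fw i <= 0"
 unfolding root_le_iff by (metis Nats_cases diff_0 inner_minus_left neg_0_le_iff_le of_nat_0_le_iff)

lemma crd_nonzero: "x ~= 0 ==> \<exists>i\<in>ix. x \<bullet> fw i ~= 0"
 using expand[of x] by (metis (no_types, lifting) scaleR_zero_left sum.neutral)

lemma posr_crd: assumes "a \<in> R" "posr a" "i \<in> ix" shows "a \<bullet> fw i >= 0"
proof -
 have "~ root_le D a 0"
  using root_le_0'[of a] assms(2) sum_nonpos[of ix "%i. a \<bullet> fw i"] unfolding posr_def rho_check_sum by force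
 thus ?thesis using pos_or_neg[OF assms(1)] root_le_0 assms(3) by blast
qed

lemma not_posr: assumes "a \<in> R" shows "~ posr a \<longleftrightarrow> posr (- a)"
proof -
 have "rho_check \<bullet> a ~= 0"
 proof
  assume 0: "rho_check \<bullet> a = 0"
  obtain i where i: "i \<in> ix" "a \<bullet> fw i ~= 0" using crd_nonzero root_nonzero[OF assms] by blast
  from pos_or_neg[OF assms] show False
  proof
   assume "root_le D 0 a"
   thus False using i 0 root_le_0[of a] sum_nonneg_eq_0_iff[of ix "%i. a \<bullet> fw i"]
    by (auto simp: rho_check_sum)
  next
   assume "root_le D a 0"
   thus False using i 0 root_le_0'[of a] sum_nonneg_eq_0_iff[of ix "%i. - (a \<bullet> fw i)"]
    by (auto simp: rho_check_sum sum_negf)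
  qed
 qed
 thus ?thesis by (auto simp: posr_def)
qed

lemma posr_al: "i \<in> ix ==> posr (al i)"
 by (simp add: posr_def rho_check_al)

lemma posr_root_le: assumes "a \<in> R" shows "posr a \<longleftrightarrow> root_le D 0 a"
proof
 assume p: "posr a"
 have "~ root_le D a 0"
  using root_le_0'[of a] p sum_nonpos[of ix "%i. a \<bullet> fw i"] unfolding posr_def rho_check_sum by force
 thus "root_le D 0 a" using pos_or_neg[OF assms] by blast
next
 assume p: "root_le D 0 a"
 hence "rho_check \<bullet> a >= 0" unfolding rho_check_sum using root_le_0 by (intro sum_nonneg)
 thus "posr a" using not_posr[OF assms] by (force simp: posr_def)
qed

lemma posr_inner_dominant:
 assumes "a \<in> R" "posr a" "!!i. i \<in> ix ==> x \<bullet> al i >= 0"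
 shows "x \<bullet> a >= 0"
 unfolding inner_commute[of x] inner_expand[of a x]
 by (rule sum_nonneg) (use assms posr_crd in \<open>simp add: inner_commute[of "al _"]\<close>)

lemma crd_refl: "i \<in> ix ==> j \<in> ix ==> i ~= j ==> reflection (al i) x \<bullet> fw j = x \<bullet> fw j"
 by (simp add: reflection_def inner_diff_left inner_commute[of "al i"] fw_inner)

text \<open>A simple reflection changes only the coordinate at \<open>al i\<close>. If the image
  were negative, every other coordinate would be both nonnegative and nonpositive, leaving a
  multiple of \<open>al i\<close>.\<close>

lemma posr_refl:
 assumes a: "a \<in> R" "posr a" and i: "i \<in> ix" and nm: "!!c. a ~= c *\<^sub>R al i"
 shows "posr (reflection (al i) a)"
proof (rule ccontr)
 assume "~ posr (reflection (al i) a)"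
 hence neg: "posr (- reflection (al i) a)" and r: "- reflection (al i) a \<in> R"
  using not_posr refl_R[OF al_R[OF i] a(1)] by auto
 have "a \<bullet> fw j = 0" if "j \<in> ix" "j ~= i" for j
  using posr_crd[OF r neg, of j] posr_crd[OF a, of j] crd_refl[OF i, of j a] that by auto
 hence "a = (\<Sum>j\<in>ix. if i = j then (a \<bullet> fw i) *\<^sub>R al i else 0)"
  by (subst expand[of a], intro sum.cong) auto
 hence "a = (a \<bullet> fw i) *\<^sub>R al i" using i by simp
 with nm show False by blast
qed

lemma posr_ex_pos: assumes "a \<in> R" "posr a" shows "\<exists>i\<in>ix. a \<bullet> al i > 0"
proof (rule ccontr)
 assume "~ ?thesis"
 hence "a \<bullet> a <= 0" unfolding inner_expand[of a a]
  using posr_crd[OF assms] by (intro sum_nonpos) (auto simp: inner_commute[of a] mult_nonneg_nonpos not_less)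
 thus False using root_sq_pos[OF assms(1)] by simp
qed

text \<open>Otherwise reflecting \<open>al j\<close> in \<open>al i\<close> would produce a root
  with coordinate 1 at \<open>j\<close> and a negative coordinate at \<open>i\<close>.\<close>

lemma al_inner_nonpos: assumes "i \<in> ix" "j \<in> ix" "i ~= j" shows "al i \<bullet> al j <= 0"
proof (rule ccontr)
 assume c: "~ ?thesis"
 let ?a = "reflection (al i) (al j)"
 have aR: "?a \<in> R" using refl_R al_R assms by blast
 have j1: "?a \<bullet> fw j = 1" using crd_refl[OF assms] fw_inner[OF assms(2) assms(2)] by (simp add: inner_commute)
 have "al j \<cdot> al i > 0" using c root_sq_pos[OF al_R[OF assms(1)]] by (simp add: coroot_def inner_commute)
 hence i1: "?a \<bullet> fw i < 0" using assms
  by (simp add: reflection_def inner_diff_left inner_commute[of "al _" "fw _"] fw_inner)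
 show False using posr_crd[OF aR _ assms(1)] posr_crd[of "- ?a" j] not_posr[OF aR] aR i1 j1 assms by auto
qed

section \<open>The finite Weyl group\<close>

abbreviation "W \<equiv> fin_weyl D"
abbreviation "wd \<equiv> word_prod (weyl_gen D)"

lemma weyl_gen_fin: "i \<in> ix ==> weyl_gen D i = reflection (al i)"
 by (auto simp: weyl_gen_def fin_ix_def)

lemma weyl_id: "id \<in> weyl D I"
 unfolding weyl_def using image_iff[of id wd "lists I"] word_prod_Nil by (metis lists.Nil)

lemma weyl_comp: "u \<in> weyl D I ==> w \<in> weyl D I ==> u o w \<in> weyl D I"
 unfolding weyl_def by (smt (verit) append_in_lists_conv imageE imageI word_prod_append)

lemma weyl_gen_in: "i \<in> I ==> weyl_gen D i \<in> weyl D I"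
 unfolding weyl_def using image_iff[of _ wd "lists I"] by (metis lists.simps word_prod_Cons word_prod_Nil comp_id)

lemma W_induct [consumes 1, case_names id step]:
 assumes "w \<in> W" "P id" "!!i w. i \<in> ix ==> w \<in> W ==> P w ==> P (reflection (al i) o w)"
 shows "P w"
proof -
 have "P (wd ws)" if "ws \<in> lists ix" for ws using that
 proof (induction ws)
  case Nil show ?case using assms(2) unfolding word_prod_Nil .
 next
  case (Cons i ws)
  hence "wd ws \<in> W" by (auto simp: weyl_def fin_ix_def)
  moreover have "i \<in> ix" "P (wd ws)" using Cons by auto
  ultimately show ?case using assms(3)[of i "wd ws"] unfolding word_prod_Cons by (metis weyl_gen_fin)
 qed
 thus ?thesis using assms(1) by (auto simp: weyl_def fin_ix_def)
qed

lemma W_linear: "w \<in> W ==> linear w"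
 by (induction rule: W_induct) (blast intro: linear_compose linear_reflection linear_id)+

lemma W_inner: "w \<in> W ==> w x \<bullet> w y = x \<bullet> y"
 by (induction rule: W_induct) (auto simp: reflection_inner)

lemma W_R: "w \<in> W ==> a \<in> R ==> w a \<in> R"
 by (induction rule: W_induct) (auto intro: refl_R al_R)

lemma W_inv: "w \<in> W ==> \<exists>v\<in>W. v o w = id & w o v = id"
proof (induction rule: W_induct)
 case id thus ?case using weyl_id by (intro bexI[of _ id]) auto
next
 case (step i w)
 then obtain v where v: "v \<in> W" "v o w = id" "w o v = id" by blast
 have "reflection (al i) \<in> W" using weyl_gen_in[of i "fin_ix D"] step(1) by (simp add: fin_ix_def weyl_gen_fin)
 hence "v o reflection (al i) \<in> W" using v weyl_comp by blast
 moreover have "(v o reflection (al i)) o (reflection (al i) o w) = id"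
  using v by (auto simp: fun_eq_iff)
 moreover have "(reflection (al i) o w) o (v o reflection (al i)) = id"
  using v by (auto simp: fun_eq_iff)
 ultimately show ?case by blast
qed

lemma W_bij: "w \<in> W ==> bij w" and W_inv_in: "w \<in> W ==> inv w \<in> W"
proof -
 assume w: "w \<in> W"
 obtain v where v: "v \<in> W" "v o w = id" "w o v = id" using W_inv[OF w] by blast
 show "bij w" using v by (metis o_bij)
 show "inv w \<in> W" using v inv_unique_comp by metis
qed

lemma W_inv_l [simp]: "w \<in> W ==> inv w (w x) = x" and W_inv_r [simp]: "w \<in> W ==> w (inv w x) = x"
 using W_bij by (auto simp: bij_def surj_f_inv_f)

lemma W_inner_inv: "w \<in> W ==> w x \<bullet> y = x \<bullet> inv w y"
 using W_inner[of w x "inv w y"] by simp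

lemma W_coroot: "w \<in> W ==> coroot (w a) = w (coroot a)"
 using coroot_isometry[of w] W_linear[of w] W_inner[of w] by blast

lemma W_refl: "w \<in> W ==> reflection (w a) o w = w o reflection a"
 using reflection_isometry[of w a] W_linear[of w] W_inner[of w] by (auto simp: fun_eq_iff)

lemma W_minus: "w \<in> W ==> w (- x) = - w x"
 using W_linear linear_neg by blast

lemma refl_al_W: "i \<in> ix ==> reflection (al i) \<in> W"
 using weyl_gen_in[of i "fin_ix D"] by (simp add: fin_ix_def weyl_gen_fin)

text \<open>Induction on the height: some simple root has positive inner product with a positive
  root, and reflecting in it lowers the height unless the root is a multiple of it. The factor
  \<open>c\<close> absorbs the sign and divisibility.\<close>

lemma root_conj_simple: assumes "a \<in> R" shows "\<exists>w\<in>W. \<exists>i\<in>ix. \<exists>c. a = c *\<^sub>R w (al i)"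
proof -
 have pos: "\<exists>w\<in>W. \<exists>i\<in>ix. \<exists>c. a = c *\<^sub>R w (al i)" if "a \<in> R" "posr a" for a
 proof -
  have "rho_check \<bullet> a \<in> \<int>" unfolding rho_check_sum using crd_int[OF that(1)] by (intro Ints_sum) auto
  hence "\<exists>m::nat. rho_check \<bullet> a = m" using that(2) unfolding posr_def
   by (metis Ints_cases less_le of_int_of_nat_eq of_int_0_le_iff zero_le_imp_eq_int)
  then obtain m :: nat where "rho_check \<bullet> a = m" by blast
  thus ?thesis using that
  proof (induction m arbitrary: a rule: less_induct)
   case (less m)
   obtain i where i: "i \<in> ix" "a \<bullet> al i > 0" using posr_ex_pos less.prems by blast
   show ?case
   proof (cases "\<exists>c. a = c *\<^sub>R al i")
    case True thus ?thesis using weyl_id i(1) by (metis id_apply)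
   next
    case False
    let ?b = "reflection (al i) a"
    have b: "?b \<in> R" "posr ?b" using posr_refl less.prems i False refl_R al_R by auto
    have k: "a \<cdot> al i > 0" using i root_sq_pos[OF al_R[OF i(1)]] by (simp add: coroot_def)
    have ht: "rho_check \<bullet> ?b = rho_check \<bullet> a - a \<cdot> al i"
     using rho_check_al[OF i(1)] by (simp add: reflection_def inner_diff_right)
    have "rho_check \<bullet> ?b \<in> \<int>" unfolding rho_check_sum using crd_int[OF b(1)] by (intro Ints_sum) auto
    then obtain m' :: nat where m': "rho_check \<bullet> ?b = m'" using b(2) unfolding posr_def
     by (metis Ints_cases less_le of_int_of_nat_eq of_int_0_le_iff zero_le_imp_eq_int)
    have "real m' < real m" using ht k m' less.prems by simp
    then obtain w j c where w: "w \<in> W" "j \<in> ix" "?b = c *\<^sub>R w (al j)"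
     using less.IH[of m' ?b] b m' by auto
    have "a = c *\<^sub>R (reflection (al i) o w) (al j)"
    proof -
     have "a = reflection (al i) ?b" by simp
     also have "... = c *\<^sub>R reflection (al i) (w (al j))"
      unfolding w(3) by (rule linear_scale[OF linear_reflection])
     finally show ?thesis by simp
    qed
    thus ?thesis using w weyl_comp refl_al_W i(1) by blast
   qed
  qed
 qed
 show ?thesis
 proof (cases "posr a")
  case False
  then obtain w i c where "w \<in> W" "i \<in> ix" "- a = c *\<^sub>R w (al i)" using pos[of "- a"] not_posr[OF assms] assms minus_R by blast
  hence "w \<in> W" "i \<in> ix" "a = (- c) *\<^sub>R w (al i)"
   by (auto simp: scaleR_minus_left) (metis minus_minus)
  thus ?thesis by blast
 qed (use pos assms in blast)
qed

lemma refl_W: assumes "a \<in> R" shows "reflection a \<in> W"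
proof -
 obtain w i c where w: "w \<in> W" "i \<in> ix" "a = c *\<^sub>R w (al i)" using root_conj_simple[OF assms] by blast
 have "c ~= 0" using w root_nonzero[OF assms] by auto
 hence "reflection a = reflection (w (al i))" using w reflection_scaleR by blast
 also have "... = (w o reflection (al i)) o inv w"
  using W_refl[OF w(1), of "al i"] w(1) by (auto simp: fun_eq_iff) (metis W_inv_r)
 finally show ?thesis using w W_inv_in weyl_comp refl_al_W by metis
qed

text \<open>Split the roots into those that meet the orbit of \<open>b\<close> and the rest.
  Irreducibility yields nonorthogonal \<open>x\<close> and \<open>y\<close> on the two sides, and
  reflecting a conjugate of \<open>b\<close> in \<open>x\<close> makes it meet \<open>y\<close> as
  well.\<close>

lemma irred_orbit: assumes "b \<in> R" "c \<in> R" shows "\<exists>w\<in>W. w b \<bullet> c ~= 0"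
proof (rule ccontr)
 assume neg: "~ ?thesis"
 let ?A = "{a\<in>R. \<exists>w\<in>W. w b \<bullet> a ~= 0}"
 have "b \<in> ?A" using assms(1) root_sq_pos[OF assms(1)] weyl_id by (auto intro!: bexI[of _ id])
 moreover have "c \<in> R - ?A" using neg assms by blast
 ultimately obtain x y where x: "x \<in> ?A" and y: "y \<in> R - ?A" and xy: "x \<bullet> y ~= 0"
  using irred[of ?A "R - ?A"] by blast
 then obtain w where w: "w \<in> W" "w b \<bullet> x ~= 0" by blast
 have "(reflection x o w) b \<bullet> y = w b \<bullet> y - (w b \<cdot> x) * (x \<bullet> y)"
  by (simp add: reflection_def inner_diff_left)
 moreover have "w b \<bullet> y = 0" using y w by blast
 moreover have "w b \<cdot> x ~= 0" using w x root_nonzero by (auto simp: coroot_def)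
 ultimately have "(reflection x o w) b \<bullet> y ~= 0" using xy by simp
 moreover have "reflection x o w \<in> W" using refl_W x w weyl_comp by blast
 ultimately show False using y by blast
qed

section \<open>Short roots, the dominant short root and theta\<close>

abbreviation "Sh \<equiv> short_roots D"
abbreviation "msq \<equiv> Min (sq_lengths D)"

lemma finite_sq: "finite (sq_lengths D)" and sq_in: "a \<in> R ==> a \<bullet> a \<in> sq_lengths D"
 using finite_R by (simp_all add: sq_lengths_def)

lemma msq_le: "a \<in> R ==> msq <= a \<bullet> a"
 using finite_sq sq_in by simp

lemma Sh_R: "a \<in> Sh ==> a \<in> R" and Sh_sq: "a \<in> Sh ==> a \<bullet> a = msq"
 by (simp_all add: short_roots_def)

lemma ShI: "a \<in> R ==> a \<bullet> a = msq ==> a \<in> Sh"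
 by (simp add: short_roots_def)

lemma msq_ex: "\<exists>a\<in>R. a \<bullet> a = msq"
proof -
 have "sq_lengths D ~= {}" using R_nonempty by (simp add: sq_lengths_def)
 then obtain m where m: "m = msq" "m \<in> sq_lengths D" using finite_sq by simp
 from m(2) obtain a where "a \<in> R" "a \<bullet> a = m" unfolding sq_lengths_def by blast
 thus ?thesis using m by blast
qed

lemma Sh_nonempty: "Sh ~= {}"
 using msq_ex ShI by blast

lemma finite_Sh: "finite Sh"
 by (rule finite_subset[OF _ finite_R]) (auto dest: Sh_R)

lemma normalized_D: "normalized D"
 using mac by (simp add: macdonald_datum_def)

lemma DIM_ix: "DIM('v) \<in> ix"
 by (simp add: fin_ix_def Suc_leI)

lemma msq_red: "reduced D ==> msq = 2"
 using normalized_D by (simp add: normalized_def)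

lemma nonred_sq: "~ reduced D ==> a \<in> R ==> a \<bullet> a \<in> {1, 2, 4}"
 using normalized_D sq_in[of a] by (auto simp: normalized_def)

lemma nonred_n: "~ reduced D ==> 2 *\<^sub>R al (DIM('v)) \<in> R"
 using normalized_D by (simp add: normalized_def)

lemma double_sq: assumes "~ reduced D" "a \<in> R" "2 *\<^sub>R a \<in> R" shows "a \<bullet> a = 1"
 using nonred_sq[OF assms(1,2)] nonred_sq[OF assms(1,3)] by auto

lemma nonred_al_n: "~ reduced D ==> al (DIM('v)) \<bullet> al (DIM('v)) = 1"
 using double_sq nonred_n al_R[OF DIM_ix] by blast

lemma msq_nonred: assumes "~ reduced D" shows "msq = 1"
proof -
 have "msq <= 1" using msq_le[OF al_R[OF DIM_ix]] nonred_al_n[OF assms] by simp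
 moreover obtain a where a: "a \<in> R" "a \<bullet> a = msq" using msq_ex by blast
 hence "msq >= 1" using nonred_sq[OF assms a(1)] unfolding a(2)[symmetric] by auto
 ultimately show ?thesis by simp
qed

lemma msq_pos: "msq > 0"
 using msq_red msq_nonred by (cases "reduced D") auto

lemma Sh_refl: "a \<in> R ==> b \<in> Sh ==> reflection a b \<in> Sh"
 by (rule ShI) (use refl_R Sh_R in \<open>simp_all add: reflection_inner Sh_sq\<close>)

lemma Sh_W: "w \<in> W ==> b \<in> Sh ==> w b \<in> Sh"
 by (rule ShI) (use W_R Sh_R in \<open>simp_all add: W_inner Sh_sq\<close>)

lemma Sh_minus: "a \<in> Sh ==> - a \<in> Sh"
 by (simp add: short_roots_def)

text \<open>The hypotheses give (b,a) >= (a,a) >= (b,b), so the square length of b - a is at most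
  0.\<close>

lemma short_pair_ge2:
 assumes "b \<in> Sh" "a \<in> R" "b \<cdot> a >= 2"
 shows "b = a"
proof -
 have p: "a \<bullet> a > 0" using root_sq_pos assms by blast
 have "b \<cdot> a = 2 * (b \<bullet> a) / (a \<bullet> a)" by (simp add: coroot_def)
 hence "b \<bullet> a >= a \<bullet> a" using assms(3) p by (simp add: field_simps)
 moreover have "b \<bullet> b <= a \<bullet> a" using msq_le[OF assms(2)] Sh_sq[OF assms(1)] by simp
 ultimately have "(b - a) \<bullet> (b - a) <= 0" by (simp add: inner_diff inner_commute)
 thus ?thesis by (metis eq_iff_diff_eq_0 inner_ge_zero inner_eq_zero_iff order_antisym)
qed

lemma short_pair:
 assumes "b \<in> Sh" "a \<in> R"
 shows "b \<cdot> a \<in> {-1, 0, 1} | b = a | b = - a"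
proof -
 obtain k :: int where k: "b \<cdot> a = k" using int_R Sh_R assms Ints_cases by metis
 consider "k >= 2" | "k <= -2" | "k \<in> {-1,0,1}" by force
 thus ?thesis
 proof cases
  case 1 thus ?thesis using short_pair_ge2[OF assms] k by simp
 next
  case 2 thus ?thesis using short_pair_ge2[OF assms(1), of "- a"] assms k by simp
 qed (use k in auto)
qed

text \<open>If short roots \<open>d\<close> and \<open>c\<close> pair to 1, the product of the
  reflections in \<open>c\<close>, \<open>d\<close>, \<open>c\<close> carries \<open>d\<close> to
  \<open>c\<close>. Irreducibility supplies a conjugate of \<open>b\<close> that pairs nontrivially
  with \<open>c\<close>, and a wrong sign is repaired by a reflection.\<close>

lemma short_trans: assumes "b \<in> Sh" "c \<in> Sh" shows "\<exists>w\<in>W. w b = c"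
proof -
 obtain w where w: "w \<in> W" "w b \<bullet> c ~= 0" using irred_orbit Sh_R assms by metis
 have key: "\<exists>v\<in>W. v d = c" if d: "d \<in> Sh" "d \<cdot> c = 1" for d
 proof -
  have sym: "c \<cdot> d = 1" using d(2) Sh_sq[OF d(1)] Sh_sq[OF assms(2)] by (simp add: coroot_def inner_commute)
  have "(reflection c o (reflection d o reflection c)) d = c"
  proof -
   have 1: "reflection c d = d - c" using d(2) by (simp add: reflection_def)
   have "reflection d (d - c) = reflection d d - reflection d c" using linear_diff linear_reflection by blast
   also have "... = - c" using sym by (simp add: reflection_self) (simp add: reflection_def)
   finally have "reflection d (reflection c d) = - c" using 1 by simp
   thus ?thesis by (metis comp_apply minus_minus reflection_reflection reflection_self)
  qed
  moreover have "reflection c o (reflection d o reflection c) \<in> W"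
   using refl_W Sh_R d assms weyl_comp by metis
  ultimately show ?thesis by blast
 qed
 have wb: "w b \<in> Sh" using Sh_W w assms by blast
 have nz: "w b \<cdot> c ~= 0" using w root_nonzero[OF Sh_R[OF assms(2)]] by (simp add: coroot_def)
 consider "w b = c" | "w b = - c" | "w b \<cdot> c = 1" | "w b \<cdot> c = -1"
  using short_pair[OF wb Sh_R[OF assms(2)]] nz by auto
 thus ?thesis
 proof cases
  case 1 thus ?thesis using w by blast
 next
  case 2
  hence "(reflection c o w) b = c" by (metis comp_apply reflection_reflection reflection_self)
  thus ?thesis using w refl_W Sh_R assms weyl_comp by metis
 next
  case 3
  then obtain v where "v \<in> W" "v (w b) = c" using key wb by blast
  hence "(v o w) b = c" "v o w \<in> W" using w weyl_comp by auto
  thus ?thesis by blast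
 next
  case 4
  then obtain v where v: "v \<in> W" "v (- w b) = c" using key[OF Sh_minus[OF wb]] by auto
  hence "(v o reflection (w b) o w) b = c" by (simp add: reflection_self)
  moreover have "v o reflection (w b) o w \<in> W" using v w refl_W[OF Sh_R[OF wb]] weyl_comp by blast
  ultimately show ?thesis by blast
 qed
qed

definition dominant :: "'v => bool" where "dominant x \<longleftrightarrow> (\<forall>i\<in>ix. x \<bullet> al i >= 0)"

lemma root_le_refl: "root_le D x x" by (simp add: root_le_iff)

lemma root_le_trans: "root_le D x y ==> root_le D y z ==> root_le D x z"
 unfolding root_le_iff
proof (intro ballI)
 fix i assume "\<forall>i\<in>ix. (y - x) \<bullet> fw i \<in> \<nat>" "\<forall>i\<in>ix. (z - y) \<bullet> fw i \<in> \<nat>" "i \<in> ix"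
 hence "(y - x) \<bullet> fw i + (z - y) \<bullet> fw i \<in> \<nat>" by (intro Nats_add) auto
 thus "(z - x) \<bullet> fw i \<in> \<nat>" by (simp add: inner_diff_left)
qed

lemma root_le_antisym: assumes "root_le D x y" "root_le D y x" shows "x = y"
proof (rule ccontr)
 assume "x ~= y"
 then obtain i where i: "i \<in> ix" "(y - x) \<bullet> fw i ~= 0" using crd_nonzero[of "y - x"] by auto
 have "(y - x) \<bullet> fw i >= 0" "(x - y) \<bullet> fw i >= 0" using assms i by (auto simp: root_le_iff elim!: Nats_cases)
 thus False using i by (simp add: inner_diff_left)
qed

lemma root_le_add: "root_le D a b ==> root_le D c d ==> root_le D (a + c) (b + d)"
 unfolding root_le_iff
proof (intro ballI)
 fix i assume "\<forall>i\<in>ix. (b - a) \<bullet> fw i \<in> \<nat>" "\<forall>i\<in>ix. (d - c) \<bullet> fw i \<in> \<nat>" "i \<in> ix"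
 hence "(b - a) \<bullet> fw i + (d - c) \<bullet> fw i \<in> \<nat>" by (intro Nats_add) auto
 thus "(b + d - (a + c)) \<bullet> fw i \<in> \<nat>" by (simp add: inner_diff_left inner_add_left algebra_simps)
qed

lemma root_le_step: "i \<in> ix ==> c \<in> \<nat> ==> root_le D x (x + c *\<^sub>R al i)"
 unfolding root_le_iff by (auto simp: inner_commute[of "al _"] fw_inner)

text \<open>A root of maximal height among the short roots above \<open>g\<close> is dominant, since
  a negative pairing with a simple root would allow a reflection to a higher one.\<close>

lemma dominant_above:
 assumes "g \<in> Sh" shows "\<exists>d\<in>Sh. root_le D g d & dominant d"
proof -
 let ?S = "{d\<in>Sh. root_le D g d}"
 have "finite ?S" "?S ~= {}" using finite_Sh assms root_le_refl by auto
 hence "Max ((\<bullet>) rho_check ` ?S) \<in> (\<bullet>) rho_check ` ?S" by (intro Max_in) auto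
 then obtain d where d: "d \<in> ?S" and "Max ((\<bullet>) rho_check ` ?S) = rho_check \<bullet> d" by blast
 hence mx: "!!e. e \<in> ?S ==> rho_check \<bullet> e <= rho_check \<bullet> d"
  using Max_ge[of "(\<bullet>) rho_check ` ?S"] \<open>finite ?S\<close> by (metis (no_types, lifting) finite_imageI imageI)
 have "dominant d" unfolding dominant_def
 proof (rule ballI, rule ccontr)
  fix i assume i: "i \<in> ix" and c: "~ d \<bullet> al i >= 0"
  have neg: "d \<cdot> al i < 0" using c root_sq_pos[OF al_R[OF i]] by (simp add: coroot_def field_simps mult_less_0_iff divide_neg_pos)
  obtain k :: int where k: "d \<cdot> al i = k" using int_R[OF al_R[OF i] Sh_R] d Ints_cases by blast
  define e where "e = reflection (al i) d"
  have e: "e = d + (real (nat (- k))) *\<^sub>R al i" using k neg by (simp add: e_def reflection_def)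
  have "e \<in> ?S" using d Sh_refl[OF al_R[OF i]] root_le_step[OF i, of "real (nat (-k))" d] root_le_trans
   unfolding e[symmetric] by (auto simp: e_def)
  moreover have "rho_check \<bullet> e > rho_check \<bullet> d" using rho_check_al[OF i] k neg by (simp add: e inner_add_right inner_diff_right)
  ultimately show False using mx by force
 qed
 thus ?thesis using d by blast
qed

text \<open>Dominance makes the simple roots with zero coefficient orthogonal to those with positive
  coefficient. The orbit of one of the latter then stays in their span, which irreducibility
  forbids.\<close>

lemma dominant_full_support:
 assumes "g \<in> R" "dominant g" "i \<in> ix" shows "g \<bullet> fw i > 0"
proof (rule ccontr)
 assume z: "~ ?thesis"
 have "posr g"
 proof (rule ccontr)
  assume "~ posr g"
  hence "posr (- g)" "- g \<in> R" using not_posr assms by auto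
  then obtain i where "i \<in> ix" "(- g) \<bullet> al i > 0" using posr_ex_pos by blast
  thus False using assms by (force simp: dominant_def)
 qed
 hence nn: "g \<bullet> fw j >= 0" if "j \<in> ix" for j using posr_crd assms that by blast
 let ?Z = "{j\<in>ix. g \<bullet> fw j = 0}"
 have iZ: "i \<in> ?Z" using nn[OF assms(3)] z assms(3) by simp
 obtain j where j: "j \<in> ix" "g \<bullet> fw j ~= 0" using crd_nonzero root_nonzero[OF assms(1)] by blast
 have orth: "al k \<bullet> al l = 0" if k: "k \<in> ix - ?Z" and l: "l \<in> ?Z" for k l
 proof -
  have "g \<bullet> al l = (\<Sum>m\<in>ix. (g \<bullet> fw m) * (al m \<bullet> al l))" by (rule inner_expand)
  moreover have nonpos: "(g \<bullet> fw m) * (al m \<bullet> al l) <= 0" if "m \<in> ix" for m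
   using nn[OF that] al_inner_nonpos[of m l] l that by (cases "m = l") (auto simp: mult_nonneg_nonpos)
  moreover have "g \<bullet> al l >= 0" using assms(2) l by (simp add: dominant_def)
  ultimately have "(\<Sum>m\<in>ix. - ((g \<bullet> fw m) * (al m \<bullet> al l))) = 0"
   using sum_nonpos[of ix "%m. (g \<bullet> fw m) * (al m \<bullet> al l)"] by (simp add: sum_negf)
  hence "\<forall>m\<in>ix. - ((g \<bullet> fw m) * (al m \<bullet> al l)) = 0"
   by (subst (asm) sum_nonneg_eq_0_iff) (use nonpos in auto)
  thus ?thesis using k by auto
 qed
 have orth2: "x \<bullet> al l = 0" if "x \<in> span (al ` (ix - ?Z))" "l \<in> ?Z" for x l
  using orthogonal_to_span[of x "al ` (ix - ?Z)" "al l"] that orth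
  by (auto simp: orthogonal_def inner_commute)
 have inv: "w (al j) \<in> span (al ` (ix - ?Z))" if "w \<in> W" for w using that
 proof (induction rule: W_induct)
  case id show ?case using j by (auto intro: span_base)
 next
  case (step m w)
  show ?case
  proof (cases "m \<in> ?Z")
   case True thus ?thesis using orth2[OF step(3) True] step(3) by (simp add: reflection_orth)
  next
   case False
   hence "al m \<in> span (al ` (ix - ?Z))" using step(1) by (auto intro: span_base)
   thus ?thesis using step(3) by (simp add: reflection_def span_diff span_scale)
  qed
 qed
 obtain w where w: "w \<in> W" "w (al j) \<bullet> al i ~= 0"
  using irred_orbit[OF al_R[OF j(1)] al_R[OF assms(3)]] by blast
 show False using orth2[OF inv[OF w(1)] iZ] w(2) by simp
qed

lemma dominant_posr: assumes "g \<in> R" "dominant g" shows "posr g"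
 unfolding posr_def rho_check_sum using dominant_full_support[OF assms] DIM_ix by (intro sum_pos) auto

text \<open>Full support makes the inner product of two dominant short roots positive, so distinct
  ones pair to 1 and their difference \<open>c\<close> is a root. Its inner products with
  \<open>g\<close> and \<open>h\<close> have opposite signs, whereas dominance ties both to the sign
  of \<open>c\<close>.\<close>

lemma dominant_short_unique:
 assumes g: "g \<in> Sh" "dominant g" and h: "h \<in> Sh" "dominant h" shows "g = h"
proof (rule ccontr)
 assume ne: "g ~= h"
 have gp: "posr g" "posr h" using dominant_posr g h Sh_R by auto
 have "g ~= - h" using gp by (auto simp: posr_def)
 hence k: "g \<cdot> h \<in> {-1,0,1}" using short_pair[OF g(1) Sh_R[OF h(1)]] ne by auto
 have gh: "g \<cdot> h = 2 * (g \<bullet> h) / msq" using Sh_sq h by (simp add: coroot_def)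
 have "g \<bullet> h > 0"
 proof -
  obtain j where j: "j \<in> ix" "al j \<bullet> h ~= 0" using eq_al_iff[of h] root_nonzero Sh_R h by (auto simp: inner_commute)
  have "0 < (g \<bullet> fw j) * (al j \<bullet> h)" using j dominant_full_support[OF Sh_R[OF g(1)] g(2) j(1)] h(2)
   by (auto simp: dominant_def inner_commute less_le)
  also have "... <= (\<Sum>m\<in>ix. (g \<bullet> fw m) * (al m \<bullet> h))"
   using j posr_crd[OF Sh_R[OF g(1)] gp(1)] h(2)
   by (intro member_le_sum) (auto simp: dominant_def inner_commute)
  finally show ?thesis using inner_expand[of g h] by simp
 qed
 hence half: "g \<bullet> h = msq / 2" using gh k msq_pos by (auto simp: field_simps)
 define c where "c = g - h"
 have cR: "c \<in> R" using refl_R[OF Sh_R[OF h(1)] Sh_R[OF g(1)]] gh half msq_pos by (simp add: c_def reflection_def)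
 have 1: "c \<bullet> g > 0" "c \<bullet> h < 0"
  using half Sh_sq[OF g(1)] Sh_sq[OF h(1)] msq_pos inner_commute[of h g] by (simp_all add: c_def inner_diff_left)
 show False
 proof (cases "posr c")
  case True
  hence "h \<bullet> c >= 0" using posr_inner_dominant cR h by (simp add: dominant_def)
  thus False using 1 by (simp add: inner_commute)
 next
  case False
  hence "g \<bullet> (- c) >= 0" using posr_inner_dominant[of "- c" g] cR g not_posr[OF cR] by (simp add: dominant_def)
  thus False using 1 by (simp add: inner_commute)
 qed
qed

text \<open>The dominant short root. \<open>theta D\<close> is \<open>c0 D\<close> times it, so the
  affine reflection can be written with \<open>bt\<close> alone, whether or not the root system is
  reduced.\<close>

definition bt :: 'v where "bt = (THE b. b \<in> Sh & dominant b)"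

lemma bt_Sh: "bt \<in> Sh" and bt_dom: "dominant bt"
proof -
 have "\<exists>!b. b \<in> Sh & dominant b" using dominant_above dominant_short_unique Sh_nonempty by blast
 from theI'[OF this] show "bt \<in> Sh" "dominant bt" by (auto simp: bt_def)
qed

lemma bt_max: "g \<in> Sh ==> root_le D g bt"
 using dominant_above dominant_short_unique bt_Sh bt_dom by metis

lemma bt_R: "bt \<in> R" using bt_Sh Sh_R by blast

lemma posr_bt: "posr bt" using dominant_posr bt_R bt_dom by blast

lemma bt_nonzero: "bt ~= 0" using bt_R root_nonzero by blast

lemma nonred_double: assumes "~ reduced D" "b \<in> Sh" shows "2 *\<^sub>R b \<in> R"
proof -
 have "al (DIM('v)) \<in> Sh" using al_R[OF DIM_ix] nonred_al_n msq_nonred assms by (intro ShI) auto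
 then obtain w where w: "w \<in> W" "w (al (DIM('v))) = b" using short_trans assms(2) by blast
 have "w (2 *\<^sub>R al (DIM('v))) \<in> R" using W_R w nonred_n assms by blast
 thus ?thesis using w linear_scale[OF W_linear[OF w(1)]] by simp
qed

text \<open>A short root that is not orthogonal to \<open>a\<close> has inner product 2 or -2 with
  it, which is equality in Cauchy-Schwarz for square lengths 1 and 4.\<close>

lemma nonred_len4: assumes "~ reduced D" "a \<in> R" "a \<bullet> a = 4" shows "\<exists>g\<in>Sh. a = 2 *\<^sub>R g"
proof -
 obtain w where w: "w \<in> W" "w bt \<bullet> a ~= 0" using irred_orbit[OF bt_R assms(2)] by blast
 define b where "b = w bt"
 have b: "b \<in> Sh" "b \<bullet> a ~= 0" using w Sh_W bt_Sh by (auto simp: b_def)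
 have sq: "b \<bullet> b = 1" using Sh_sq b msq_nonred assms by simp
 have ab: "b \<cdot> a = (b \<bullet> a) / 2" using assms by (simp add: coroot_def)
 consider "b = a | b = - a" | "b \<bullet> a = 2" | "b \<bullet> a = -2"
  using short_pair[OF b(1) assms(2)] b(2) unfolding ab by auto
 thus ?thesis
 proof cases
  case 1 thus ?thesis using sq assms by auto
 next
  case 2
  hence "(a - 2 *\<^sub>R b) \<bullet> (a - 2 *\<^sub>R b) = 0" using sq assms
   by (simp add: inner_diff inner_commute)
  hence "a = 2 *\<^sub>R b" by simp
  thus ?thesis using b by blast
 next
  case 3
  hence "(a - 2 *\<^sub>R (- b)) \<bullet> (a - 2 *\<^sub>R (- b)) = 0" using sq assms
   by (simp add: inner_diff inner_add inner_commute)
  hence "a = 2 *\<^sub>R (- b)" by (metis inner_eq_zero_iff eq_iff_diff_eq_0)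
  thus ?thesis using b Sh_minus by blast
 qed
qed

text \<open>Every root is a short root or a sum of two short roots, and each short root lies below
  \<open>bt\<close>.\<close>

lemma nonred_bt2_max: assumes "~ reduced D" "a \<in> R" shows "root_le D a (2 *\<^sub>R bt)"
proof -
 have dbl: "root_le D (b + c) (2 *\<^sub>R bt)" if "b \<in> Sh" "c \<in> Sh" for b c
  using root_le_add[OF bt_max bt_max] that by (simp add: scaleR_2)
 have "a \<bullet> a = 1 | a \<bullet> a = 2 | a \<bullet> a = 4" using nonred_sq[OF assms] by auto
 thus ?thesis
 proof (elim disjE)
  assume "a \<bullet> a = 1"
  hence "a \<in> Sh" using assms msq_nonred by (intro ShI) auto
  hence "root_le D (a + 0) (bt + bt)" using bt_max posr_root_le[OF bt_R] posr_bt root_le_add by blast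
  thus ?thesis by (simp add: scaleR_2)
 next
  assume "a \<bullet> a = 4"
  thus ?thesis using nonred_len4[OF assms] dbl by (metis scaleR_2)
 next
  assume a2: "a \<bullet> a = 2"
  obtain w where w: "w \<in> W" "w bt \<bullet> a ~= 0" using irred_orbit[OF bt_R assms(2)] by blast
  have wS: "w bt \<in> Sh" using w Sh_W bt_Sh by blast
  have ab: "w bt \<cdot> a = w bt \<bullet> a" using a2 by (simp add: coroot_def)
  have "w bt ~= a & w bt ~= - a" using Sh_sq[OF wS] msq_nonred assms a2 by auto
  hence "w bt \<bullet> a = 1 | w bt \<bullet> a = -1" using short_pair[OF wS assms(2)] w unfolding ab by auto
  then obtain b where b: "b \<in> Sh" "b \<bullet> a = 1" using wS Sh_minus by (metis inner_minus_left minus_minus)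
  have "- reflection a b \<in> Sh" using Sh_refl Sh_minus assms b by blast
  moreover have "a = b + - reflection a b" using b a2 by (simp add: reflection_def coroot_def)
  ultimately show ?thesis using dbl b(1) by metis
 qed
qed

lemma theta_eq: "theta D = real (c0 D) *\<^sub>R bt"
proof (cases "reduced D")
 case True
 have "(THE a. a \<in> Sh & (\<forall>b\<in>Sh. root_le D b a)) = bt"
  using bt_Sh bt_max root_le_antisym by (intro the_equality) auto
 thus ?thesis using True by (simp add: theta_def c0_def)
next
 case False
 have "(THE a. a \<in> R & (\<forall>b\<in>R. root_le D b a)) = 2 *\<^sub>R bt"
  using nonred_bt2_max[OF False] nonred_double[OF False bt_Sh] root_le_antisym by (intro the_equality) auto
 thus ?thesis using False by (simp add: theta_def c0_def)
qed

lemma bt_theta: "(1 / real (c0 D)) *\<^sub>R theta D = bt"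
 by (simp add: theta_eq c0_def)

lemma theta_R: "theta D \<in> R"
 using bt_R nonred_double[OF _ bt_Sh] by (auto simp: theta_eq c0_def)

text \<open>The normalization of lengths enters here: the square length of \<open>bt\<close> is 2 in
  the reduced case and 1 otherwise, while \<open>theta D\<close> is \<open>bt\<close>, respectively
  its double. The wall of the alcove given by theta is thus an ordinary coroot hyperplane.\<close>

lemma coroot_bt: "coroot bt = theta D"
 using Sh_sq[OF bt_Sh] msq_red msq_nonred by (auto simp: coroot_def theta_eq c0_def)

lemma s_theta_bt: "s_theta D = reflection bt"
 by (simp add: s_theta_def theta_eq reflection_scaleR c0_def)

lemma s_theta_W: "s_theta D \<in> W"
 using refl_W bt_R by (simp add: s_theta_bt)

end

section \<open>Alcoves, lengths and reduced words\<close>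

context mac begin

abbreviation "s \<equiv> weyl_gen D"
abbreviation "aix \<equiv> aff_ix D"

lemma aix_eq: "aix = insert 0 ix" and ix_aix: "ix \<subseteq> aix" and zero_ix [simp]: "0 \<notin> ix"
 by (auto simp: aff_ix_def fin_ix_def)

lemma zero_aix [simp]: "0 \<in> aix"
 by (simp add: aff_ix_def)

section \<open>Affine simple roots and positivity of affine roots\<close>

definition rt :: "nat => 'v" where "rt i = (if i = 0 then - bt else al i)"

text \<open>The affine simple roots as functions on \<open>V\<close>, normalized by coroots:
  \<open>s i\<close> subtracts \<open>A i x\<close> times \<open>rt i\<close> also for i = 0, so
  finite and affine generators are treated alike.\<close>

definition A :: "nat => 'v => real" where "A i x = (if i = 0 then 1 else 0) + x \<cdot> rt i"

lemma rt_R: "i \<in> aix ==> rt i \<in> R"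
 using al_R bt_R by (auto simp: rt_def aix_eq)

lemma rt_nonzero: "i \<in> aix ==> rt i ~= 0"
 using rt_R root_nonzero by blast

lemma A_0: "A 0 x = 1 - x \<bullet> theta D"
 by (simp add: A_def rt_def coroot_bt)

lemma A_fin: "i \<in> ix ==> A i x = x \<cdot> al i"
 by (auto simp: A_def rt_def)

lemma s_0: "s 0 x = reflection bt x + bt"
 by (simp add: weyl_gen_def s_theta_bt bt_theta)

lemma s_eq: "i \<in> aix ==> s i x = x - A i x *\<^sub>R rt i"
 by (cases "i = 0") (auto simp: s_0 A_def rt_def reflection_def aix_eq weyl_gen_fin algebra_simps)

lemma A_shift: "A i (x + y) = A i x + y \<cdot> rt i"
 by (simp add: A_def inner_add_left)

lemma A_s: "i \<in> aix ==> A i (s i x) = - A i x"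
 using inner_coroot_self[OF rt_nonzero[of i]] by (simp add: s_eq A_def inner_diff_left algebra_simps)

lemma s_s [simp]: "i \<in> aix ==> s i (s i x) = x"
 using s_eq[of i "s i x"] s_eq[of i x] A_s[of i x] by simp

lemma s_comp_s: "i \<in> aix ==> s i o s i = id"
 by (simp add: fun_eq_iff)

lemma s_dist: "i \<in> aix ==> s i x - s i y = reflection (rt i) (x - y)"
 by (auto simp: s_0 weyl_gen_fin aix_eq rt_def reflection_minus linear_diff[OF linear_reflection])

text \<open>The indivisible roots. With them every root hyperplane with an integral shift belongs to
  exactly two affine roots, opposite to each other, even if the root system is not reduced.\<close>

definition RI :: "'v set" where "RI = {a \<in> R. (1/2) *\<^sub>R a \<notin> R}"

lemma RI_R: "a \<in> RI ==> a \<in> R" by (simp add: RI_def)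

lemma RI_W: "w \<in> W ==> a \<in> RI ==> w a \<in> RI"
proof -
 assume w: "w \<in> W" and a: "a \<in> RI"
 have "(1/2) *\<^sub>R w a \<in> R ==> inv w ((1/2) *\<^sub>R w a) \<in> R" using W_R W_inv_in w by blast
 moreover have "inv w ((1/2) *\<^sub>R w a) = (1/2) *\<^sub>R a"
  using linear_scale[OF W_linear[OF W_inv_in[OF w]]] w by simp
 ultimately show ?thesis using a w W_R by (auto simp: RI_def)
qed

lemma RI_refl: "b \<in> R ==> a \<in> RI ==> reflection b a \<in> RI"
 using RI_W refl_W by blast

lemma RI_minus: "a \<in> RI ==> - a \<in> RI"
 by (simp add: RI_def)

lemma Sh_RI: assumes "a \<in> Sh" shows "a \<in> RI"
proof -
 have "((1/2) *\<^sub>R a) \<bullet> ((1/2) *\<^sub>R a) < msq" using Sh_sq[OF assms] msq_pos by simp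
 thus ?thesis using msq_le[of "(1/2) *\<^sub>R a"] Sh_R assms by (force simp: RI_def)
qed

lemma al_RI: assumes "i \<in> ix" shows "al i \<in> RI"
proof -
 have "(1/2) *\<^sub>R al i \<notin> R"
 proof
  assume "(1/2) *\<^sub>R al i \<in> R"
  from crd_int[OF this assms] have "(1/2::real) \<in> \<int>" using fw_inner[OF assms assms] by (simp add: inner_commute)
  then obtain k :: int where "(1/2::real) = k" using Ints_cases by blast
  hence "(1::real) = real_of_int (2 * k)" by simp
  hence "1 = 2 * k" using of_int_eq_iff[of 1 "2*k", where 'a=real] by simp
  thus False by presburger
 qed
 thus ?thesis using al_R assms by (simp add: RI_def)
qed

lemma rt_RI: "i \<in> aix ==> rt i \<in> RI"
 using al_RI Sh_RI[OF bt_Sh] RI_minus by (auto simp: rt_def aix_eq)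

text \<open>The factor is a coordinate of \<open>a\<close>, hence an integer, and 2 divided by it is
  a coroot pairing, hence an integer too; the value 2 would make \<open>a\<close> divisible.\<close>

lemma RI_multiple: assumes "a \<in> RI" "posr a" "i \<in> ix" "a = c *\<^sub>R al i" shows "a = al i"
proof -
 have c: "a \<bullet> fw i = c" using assms fw_inner[OF assms(3,3)] by (simp add: inner_commute)
 obtain m :: int where m: "c = m" using c crd_int[OF RI_R] assms Ints_cases by metis
 have "c > 0" using assms(2,4) rho_check_al[OF assms(3)] by (simp add: posr_def)
 hence "m >= 1" using m by simp
 have "al i \<cdot> a = 2 / c"
  using assms inner_coroot_self[OF root_nonzero[OF al_R[OF assms(3)]]] by (simp add: coroot_scaleR)
 hence "2 / c \<in> \<int>" using int_R[OF RI_R[OF assms(1)] al_R[OF assms(3)]] by simp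
 then obtain k :: int where "2 / c = k" using Ints_cases by blast
 hence "real_of_int (k * m) = 2" using m \<open>c > 0\<close> by (simp add: field_simps)
 hence km: "k * m = 2" by linarith
 hence "m dvd 2" by (metis dvd_triv_right)
 hence "m = 1 | m = 2" using \<open>m >= 1\<close> zdvd_imp_le[of m 2] by auto
 moreover have "m ~= 2" using assms m al_R[OF assms(3)] by (auto simp: RI_def)
 ultimately show ?thesis using assms m by simp
qed

text \<open>A point inside the fundamental alcove. It lies on no wall, so the signs of affine roots
  at \<open>w pp\<close> record the inversions of \<open>w\<close>.\<close>

definition pp :: 'v where
 "pp = (1 / (1 + Max ((%a. \<bar>rho_check \<cdot> a\<bar>) ` R))) *\<^sub>R rho_check"

lemma pp_pos: "\<exists>e>0. pp = e *\<^sub>R rho_check"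
 and pp_lt1: "a \<in> R ==> \<bar>pp \<cdot> a\<bar> < 1"
proof -
 let ?M = "Max ((%a. \<bar>rho_check \<cdot> a\<bar>) ` R)"
 have le: "\<bar>rho_check \<cdot> a\<bar> <= ?M" if "a \<in> R" for a using finite_R that by (intro Max_ge) auto
 have M: "?M >= 0" using le[OF bt_R] by linarith
 thus "\<exists>e>0. pp = e *\<^sub>R rho_check" unfolding pp_def
  by (intro exI[of _ "1 / (1 + ?M)"]) auto
 assume "a \<in> R"
 hence "\<bar>rho_check \<cdot> a\<bar> < 1 + ?M" using le by fastforce
 thus "\<bar>pp \<cdot> a\<bar> < 1" unfolding pp_def using M by (simp add: abs_mult)
qed

lemma pp_posr: "a \<in> R ==> pp \<bullet> a > 0 \<longleftrightarrow> posr a"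
 using pp_pos by (auto simp: posr_def zero_less_mult_iff)

lemma coroot_sign: "a \<in> R ==> x \<cdot> a > 0 \<longleftrightarrow> x \<bullet> a > 0"
 and coroot_zero: "a \<in> R ==> x \<cdot> a = 0 \<longleftrightarrow> x \<bullet> a = 0"
proof -
 assume a: "a \<in> R"
 have c: "x \<cdot> a = (2 / (a \<bullet> a)) * (x \<bullet> a)" "2 / (a \<bullet> a) > 0" using root_sq_pos[OF a] by (simp_all add: coroot_def)
 show "x \<cdot> a > 0 \<longleftrightarrow> x \<bullet> a > 0" "x \<cdot> a = 0 \<longleftrightarrow> x \<bullet> a = 0"
  unfolding c(1) using c(2) zero_less_mult_pos mult_pos_pos by (metis, metis mult_eq_0_iff less_irrefl)
qed

lemma pp_coroot: "a \<in> R ==> pp \<cdot> a > 0 \<longleftrightarrow> posr a"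
 using coroot_sign pp_posr by blast

lemma pp_coroot_nz: "a \<in> R ==> pp \<cdot> a ~= 0"
 using pp_coroot[of a] pp_coroot[of "- a"] not_posr[of a] by auto

definition aff :: "'v => int => 'v => real" where "aff a m x = x \<cdot> a + real_of_int m"

text \<open>Affine roots for \<open>I = aix\<close> and finite roots for \<open>I = ix\<close>: one
  family, so that lengths in both Weyl groups are studied at once.\<close>

definition Phi :: "nat set => ('v => real) set" where
 "Phi I = {aff a m | a m. a \<in> RI & (0 \<notin> I --> m = 0)}"

lemma aff_pp: assumes "a \<in> R" shows "aff a m pp > 0 \<longleftrightarrow> m >= 1 | m = 0 & posr a"
  and "aff a m pp ~= 0"
proof -
 have lt: "\<bar>pp \<cdot> a\<bar> < 1" using pp_lt1 assms by blast
 consider "m >= 1" | "m = 0" | "m <= -1" by linarith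
 hence "(aff a m pp > 0 \<longleftrightarrow> m >= 1 | m = 0 & posr a) & aff a m pp ~= 0"
 proof cases
  case 1
  hence "real_of_int m >= 1" by linarith
  hence "aff a m pp > 0" using lt unfolding aff_def by linarith
  thus ?thesis using 1 by auto
 next
  case 3
  hence "real_of_int m <= -1" by linarith
  hence "aff a m pp < 0" using lt unfolding aff_def by linarith
  thus ?thesis using 3 by auto
 qed (use pp_coroot[OF assms] pp_coroot_nz[OF assms] in \<open>auto simp: aff_def\<close>)
 thus "aff a m pp > 0 \<longleftrightarrow> m >= 1 | m = 0 & posr a" "aff a m pp ~= 0" by auto
qed

lemma A_aff: "i \<in> ix ==> A i = aff (al i) 0" "A 0 = aff (- bt) 1"
 by (auto simp: fun_eq_iff A_fin aff_def A_def rt_def)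

lemma coroot_refl: "coroot (reflection b a) = reflection b (coroot a)"
 by (rule coroot_isometry[OF linear_reflection reflection_inner])

lemma aff_s_fin: "i \<in> ix ==> aff a m (s i x) = aff (reflection (al i) a) m x"
 by (simp add: aff_def weyl_gen_fin coroot_refl reflection_swap)

lemma bt_coroot_int: "a \<in> R ==> \<exists>k::int. bt \<cdot> a = k"
 using int_R bt_R Ints_cases by metis

lemma aff_s_0: "bt \<cdot> a = real_of_int k ==> aff a m (s 0 x) = aff (reflection bt a) (m + k) x"
 by (simp add: aff_def s_0 coroot_refl reflection_swap inner_add_left)

lemma Phi_A: "I \<subseteq> aix ==> i \<in> I ==> A i \<in> Phi I"
 using A_aff al_RI Sh_RI[OF bt_Sh, THEN RI_minus] unfolding Phi_def aix_eq by fastforce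

lemma Phi_s: assumes "I \<subseteq> aix" "i \<in> I" "b \<in> Phi I" shows "b o s i \<in> Phi I"
proof -
 obtain a m where b: "b = aff a m" "a \<in> RI" "0 \<notin> I --> m = 0" using assms(3) by (auto simp: Phi_def)
 show ?thesis
 proof (cases "i = 0")
  case True
  obtain k :: int where "bt \<cdot> a = k" using bt_coroot_int RI_R b by blast
  hence "b o s i = aff (reflection bt a) (m + k)" using aff_s_0 True b by (simp add: fun_eq_iff)
  thus ?thesis using RI_refl bt_R b True assms by (auto simp: Phi_def)
 next
  case False
  hence i: "i \<in> ix" using assms by (auto simp: aix_eq)
  hence "b o s i = aff (reflection (al i) a) m" using aff_s_fin b by (simp add: fun_eq_iff)
  thus ?thesis using RI_refl al_R[OF i] b by (auto simp: Phi_def)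
 qed
qed

lemma Phi_minus: "b \<in> Phi I ==> (%x. - b x) \<in> Phi I"
proof -
 assume "b \<in> Phi I"
 then obtain a m where b: "b = aff a m" "a \<in> RI" "0 \<notin> I --> m = 0" by (auto simp: Phi_def)
 hence "(%x. - b x) = aff (- a) (- m)" by (simp add: fun_eq_iff aff_def)
 thus ?thesis unfolding Phi_def using RI_minus[OF b(2)] b(3)
  by (intro CollectI exI[of _ "- a"] exI[of _ "- m"]) auto
qed

lemma Phi_pp: "b \<in> Phi I ==> b pp ~= 0"
 using aff_pp(2) RI_R by (auto simp: Phi_def)

lemma A_pp: "i \<in> aix ==> A i pp > 0"
 using aff_pp(1)[OF al_R] aff_pp(1)[of "- bt"] bt_R by (auto simp: A_aff aix_eq posr_al)

lemma bt_coroot_cases: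
 assumes "a \<in> RI" "posr a"
 shows "bt \<cdot> a = 0 | bt \<cdot> a = 1 | a = bt & bt \<cdot> a = 2"
proof -
 have "bt \<bullet> a >= 0" using posr_inner_dominant RI_R assms bt_dom by (simp add: dominant_def)
 hence "bt \<cdot> a >= 0" using coroot_sign coroot_zero RI_R[OF assms(1)] by (metis less_eq_real_def)
 moreover have "bt = - a ==> False" using posr_bt assms by (auto simp: posr_def)
 moreover have "bt = a ==> bt \<cdot> a = 2" using inner_coroot_self bt_nonzero by blast
 ultimately show ?thesis using short_pair[OF bt_Sh RI_R[OF assms(1)]] by auto
qed

lemma refl_bt_posr: assumes "a \<in> R" shows "bt \<bullet> a > 0 ==> ~ posr (reflection bt a)"
  "bt \<bullet> a < 0 ==> posr (reflection bt a)" "bt \<bullet> a = 0 ==> reflection bt a = a"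
proof -
 have r: "reflection bt a \<in> R" using refl_R bt_R assms by blast
 have e: "bt \<bullet> reflection bt a = - (bt \<bullet> a)" by (metis inner_minus_left reflection_self reflection_swap)
 have pos: "bt \<bullet> c >= 0" if "c \<in> R" "posr c" for c
  using posr_inner_dominant that bt_dom by (simp add: dominant_def)
 show "bt \<bullet> a > 0 ==> ~ posr (reflection bt a)" using pos[OF r] e by auto
 show "bt \<bullet> a < 0 ==> posr (reflection bt a)" using pos[of "- reflection bt a"] e r not_posr[OF r] by fastforce
 show "bt \<bullet> a = 0 ==> reflection bt a = a" by (simp add: reflection_orth inner_commute)
qed

text \<open>The fact behind the length function: \<open>A i\<close> is the only positive affine root
  that \<open>s i\<close> makes negative. For i = 0 the constant term changes by the pairing
  \<open>k\<close> of \<open>bt\<close> with the gradient, for which \<open>bt_coroot_cases\<close>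
  leaves few values.\<close>

lemma Phi_pos_s:
 assumes "I \<subseteq> aix" "i \<in> I" "b \<in> Phi I" "b pp > 0" "b ~= A i"
 shows "b (s i pp) > 0"
proof -
 obtain a m where b: "b = aff a m" "a \<in> RI" using assms(3) by (auto simp: Phi_def)
 have aR: "a \<in> R" using b RI_R by blast
 have m: "m >= 1 | m = 0 & posr a" using assms(4) aff_pp(1)[OF aR] b by simp
 show ?thesis
 proof (cases "i = 0")
  case False
  hence i: "i \<in> ix" using assms by (auto simp: aix_eq)
  have "posr (reflection (al i) a)" if "m = 0"
   using posr_refl[OF aR _ i] RI_multiple[OF b(2) _ i] m that assms(5) b A_aff(1)[OF i] by fastforce
  hence "aff (reflection (al i) a) m pp > 0" using m aff_pp(1)[OF refl_R[OF al_R[OF i] aR]] by blast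
  thus ?thesis using aff_s_fin[OF i] b by simp
 next
  case True
  obtain k :: int where k: "bt \<cdot> a = k" using bt_coroot_int aR by blast
  have rR: "reflection bt a \<in> R" using refl_R bt_R aR by blast
  have "m + k >= 1 | m + k = 0 & posr (reflection bt a)"
  proof (cases "posr a")
   case True
   hence "k \<in> {0, 1, 2}" using bt_coroot_cases[OF b(2)] k by auto
   moreover have "k = 0 ==> reflection bt a = a" using refl_bt_posr(3)[OF aR] coroot_zero[OF aR] k by auto
   ultimately show ?thesis using m True by auto
  next
   case False
   hence na: "posr (- a)" "- a \<in> RI" using not_posr[OF aR] RI_minus b by auto
   then consider "k = 0" | "k = -1" | "- a = bt" "k = -2" using bt_coroot_cases[OF na(2,1)] k by force
   thus ?thesis
   proof cases
    case 1 thus ?thesis using m False by auto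
   next
    case 2
    have "bt \<bullet> a < 0" using coroot_sign[of "- a" bt] k 2 aR by simp
    thus ?thesis using refl_bt_posr(2)[OF aR] m 2 False by auto
   next
    case 3
    hence abt: "a = - bt" by (metis minus_minus)
    have "m ~= 1" using assms(5) True b abt A_aff(2) by auto
    moreover have "reflection bt a = bt" using abt reflection_self[of bt] linear_neg[OF linear_reflection, of bt bt] by simp
    ultimately show ?thesis using m 3 False posr_bt by auto
   qed
  qed
  hence "aff (reflection bt a) (m + k) pp > 0" using aff_pp(1)[OF rR] by blast
  thus ?thesis using aff_s_0[OF k] True b by simp
 qed
qed

subsection \<open>Affine Weyl groups\<close>

lemma weyl_induct [consumes 2, case_names id step]:
 assumes "I \<subseteq> aix" "w \<in> weyl D I" "P id" "!!i w. i \<in> I ==> w \<in> weyl D I ==> P w ==> P (s i o w)"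
 shows "P w"
proof -
 have "P (wd ws)" if "ws \<in> lists I" for ws using that
 proof (induction ws)
  case Nil show ?case using assms(3) unfolding word_prod_Nil .
 next
  case (Cons i ws)
  hence "wd ws \<in> weyl D I" by (auto simp: weyl_def)
  moreover have "i \<in> I" "P (wd ws)" using Cons by auto
  ultimately show ?case using assms(4)[of i "wd ws"] unfolding word_prod_Cons by blast
 qed
 thus ?thesis using assms(2) by (auto simp: weyl_def)
qed

lemma weyl_affine: assumes "I \<subseteq> aix" "w \<in> weyl D I" shows "\<exists>L\<in>W. \<forall>x y. w x - w y = L (x - y)"
 using assms
proof (induction rule: weyl_induct)
 case id show ?case using weyl_id by (intro bexI[of _ id]) auto
next
 case (step i w)
 then obtain L where L: "L \<in> W" "\<forall>x y. w x - w y = L (x - y)" by blast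
 have i: "i \<in> aix" using step assms by blast
 have "reflection (rt i) o L \<in> W" using weyl_comp refl_W rt_R[OF i] L by blast
 moreover have "(s i o w) x - (s i o w) y = (reflection (rt i) o L) (x - y)" for x y
  using s_dist[OF i] L(2) by simp
 ultimately show ?case by blast
qed

lemma coroot_coroot: "a ~= 0 ==> coroot (coroot a) = a"
 by (simp add: coroot_def field_simps)

text \<open>An affine root determines its reflection: if \<open>w\<close> pulls \<open>A i\<close>
  back to \<open>A j\<close>, its linear part carries \<open>rt j\<close> to \<open>rt i\<close>,
  which is recovered from the coroots by taking the coroot twice.\<close>

lemma refl_det:
 assumes I: "I \<subseteq> aix" and w: "w \<in> weyl D I" and ij: "i \<in> aix" "j \<in> aix" and e: "A i o w = A j"
 shows "s i o w = w o s j"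
proof -
 obtain L where L: "L \<in> W" "\<forall>x y. w x - w y = L (x - y)" using weyl_affine[OF I w] by blast
 have "x \<bullet> inv L (coroot (rt i)) = x \<cdot> rt j" for x
 proof -
  have "A j (0 + x) - A j 0 = A i (w x) - A i (w 0)" using fun_cong[OF e] by (metis add_0 comp_apply)
  also have "... = (w x - w 0) \<cdot> rt i" by (simp add: A_def inner_diff_left)
  also have "... = L x \<cdot> rt i" using L(2) by (metis diff_zero)
  finally show ?thesis using W_inner_inv[OF L(1)] unfolding A_shift by simp
 qed
 hence "inv L (coroot (rt i)) = coroot (rt j)" by (meson vector_eq_rdot inner_commute vector_eq_ldot)
 hence "coroot (rt i) = L (coroot (rt j))" using W_inv_r L(1) by metis
 hence "coroot (coroot (rt i)) = L (coroot (coroot (rt j)))" using W_coroot L(1) by metis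
 hence rr: "L (rt j) = rt i"
  by (simp add: coroot_coroot[OF rt_nonzero[OF ij(1)]] coroot_coroot[OF rt_nonzero[OF ij(2)]])
 show ?thesis
 proof
  fix x
  have "w (s j x) = w x - L (x - s j x)" using L(2) by (metis add_diff_cancel_left' diff_add_cancel minus_diff_eq diff_diff_eq2)
  also have "x - s j x = A j x *\<^sub>R rt j" using s_eq[OF ij(2)] by simp
  also have "L (A j x *\<^sub>R rt j) = A j x *\<^sub>R rt i" using linear_scale[OF W_linear[OF L(1)]] rr by simp
  finally show "(s i o w) x = (w o s j) x" using s_eq[OF ij(1)] fun_cong[OF e, of x] by simp
 qed
qed

lemma Phi_word: "I \<subseteq> aix ==> b \<in> Phi I ==> w \<in> weyl D I ==> b o w \<in> Phi I"
proof -
 assume I: "I \<subseteq> aix" and b: "b \<in> Phi I" and w: "w \<in> weyl D I"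
 from I w show "b o w \<in> Phi I" using b
 proof (induction arbitrary: b rule: weyl_induct)
  case id thus ?case by simp
 next
  case (step i w)
  hence "(b o s i) o w \<in> Phi I" using Phi_s[OF I] by blast
  thus ?case by (simp only: comp_assoc)
 qed
qed

lemma weyl_bij: assumes "I \<subseteq> aix" "w \<in> weyl D I" shows "bij w" and "inv w \<in> weyl D I"
proof -
 have "\<exists>v\<in>weyl D I. v o w = id & w o v = id" using assms
 proof (induction rule: weyl_induct)
  case id thus ?case using weyl_id by (intro bexI[of _ id]) auto
 next
  case (step i w)
  then obtain v where v: "v \<in> weyl D I" "v o w = id" "w o v = id" by blast
  have i: "i \<in> aix" using step assms by blast
  have "v o s i \<in> weyl D I" using v weyl_comp weyl_gen_in step by blast
  moreover have "(v o s i) o (s i o w) = id" "(s i o w) o (v o s i) = id"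
   using v i by (auto simp: fun_eq_iff)
  ultimately show ?case by blast
 qed
 then obtain v where "v \<in> weyl D I" "v o w = id" "w o v = id" by blast
 thus "bij w" "inv w \<in> weyl D I" using o_bij inv_unique_comp by metis+
qed

lemma weyl_inv_l [simp]: "I \<subseteq> aix ==> w \<in> weyl D I ==> inv w (w x) = x"
 and weyl_inv_r [simp]: "I \<subseteq> aix ==> w \<in> weyl D I ==> w (inv w x) = x"
 using weyl_bij(1) by (auto simp: bij_def surj_f_inv_f)

lemma wd_weyl: "ws \<in> lists I ==> wd ws \<in> weyl D I"
 by (auto simp: weyl_def)

lemma weyl_mono: "I \<subseteq> J ==> weyl D I \<subseteq> weyl D J"
 unfolding weyl_def by (intro image_mono lists_mono)

lemma wlen_le: "ws \<in> lists I ==> wlen D I (wd ws) <= length ws"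
 unfolding wlen_def by (rule Least_le) blast

lemma wlen_ex: assumes "w \<in> weyl D I" shows "\<exists>ws\<in>lists I. wd ws = w & length ws = wlen D I w"
proof -
 have "\<exists>k. \<exists>ws\<in>lists I. wd ws = w & length ws = k" using assms by (auto simp: weyl_def)
 from LeastI_ex[OF this] show ?thesis unfolding wlen_def .
qed

section \<open>Exchange condition and reduced words\<close>

definition red :: "nat set => nat list => bool" where
 "red I ws \<longleftrightarrow> ws \<in> lists I & wlen D I (wd ws) = length ws"

lemma red_ex: "w \<in> weyl D I ==> \<exists>ws. red I ws & wd ws = w"
 using wlen_ex unfolding red_def by metis

lemma red_word: assumes "w \<in> weyl D I" shows "red I (red_word D I w)" "wd (red_word D I w) = w"
proof -
 have "\<exists>ws. ws \<in> lists I & wd ws = w & length ws = wlen D I w" using wlen_ex[OF assms] by blast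
 from someI_ex[OF this] show "red I (red_word D I w)" "wd (red_word D I w) = w"
  unfolding red_word_def[symmetric] by (auto simp: red_def)
qed

lemma red_weyl: "red I ws ==> wd ws \<in> weyl D I"
 by (simp add: red_def wd_weyl)

context
 fixes I assumes I: "I \<subseteq> aix"
begin

text \<open>Along the word the sign of \<open>b\<close> has to change, and by
  \<open>Phi_pos_s\<close> it can change at a letter \<open>j\<close> only if the root pulled back
  so far is \<open>A j\<close>.\<close>

lemma exchange:
 assumes "ws \<in> lists I" "b \<in> Phi I" "b pp > 0" "b (wd ws pp) < 0"
 shows "\<exists>xs j ys. ws = xs @ j # ys & b o wd xs = A j"
 using assms
proof (induction ws arbitrary: b)
 case Nil thus ?case by simp
next
 case (Cons j ws)
 have j: "j \<in> I" "ws \<in> lists I" using Cons by auto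
 show ?case
 proof (cases "b = A j")
  case True
  hence "j # ws = [] @ j # ws & b o wd [] = A j" by (simp only: word_prod_Nil comp_id append_Nil)
  thus ?thesis by blast
 next
  case False
  have "\<exists>xs k ys. ws = xs @ k # ys & (b o s j) o wd xs = A k"
  proof (rule Cons.IH)
   show "(b o s j) pp > 0" using Phi_pos_s[OF I j(1)] Cons False by simp
   show "b o s j \<in> Phi I" using Phi_s[OF I j(1)] Cons by blast
  qed (use Cons j in simp_all)
  then obtain xs k ys where x: "ws = xs @ k # ys" "(b o s j) o wd xs = A k" by blast
  hence "j # ws = (j # xs) @ k # ys & b o wd (j # xs) = A k" by (simp only: comp_assoc word_prod_Cons append_Cons)
  thus ?thesis by blast
 qed
qed

lemma wlen_Cons_le: "i \<in> I ==> w \<in> weyl D I ==> wlen D I (s i o w) <= wlen D I w + 1"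
 using wlen_ex[of w I] wlen_le[of "i # _" I] by fastforce

lemma Ipp: "i \<in> I ==> i \<in> aix" using I by blast

text \<open>The exchange condition finds a letter \<open>j\<close> of a shortest word such that
  \<open>s i\<close>, moved through the prefix before it, cancels it.\<close>

lemma desc_neg:
 assumes w: "w \<in> weyl D I" and i: "i \<in> I" and "A i (w pp) < 0"
 shows "wlen D I (s i o w) + 1 = wlen D I w"
proof -
 obtain ws where ws: "ws \<in> lists I" "wd ws = w" "length ws = wlen D I w" using wlen_ex[OF w] by blast
 obtain xs j ys where x: "ws = xs @ j # ys" "A i o wd xs = A j"
  using exchange[OF ws(1) Phi_A[OF I i] A_pp[OF Ipp[OF i]]] assms ws by auto
 have j: "j \<in> I" "xs \<in> lists I" "ys \<in> lists I" using ws x by auto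
 have "s i o wd xs = wd xs o s j" using refl_det[OF I wd_weyl[OF j(2)]] Ipp i j x by blast
 hence "s i o w = wd xs o (s j o s j) o wd ys"
  unfolding ws(2)[symmetric] x(1) word_prod_append word_prod_Cons by (simp only: comp_assoc[symmetric])
 hence "s i o w = wd (xs @ ys)" using s_comp_s[OF Ipp[OF j(1)]] by (simp only: word_prod_append comp_id)
 hence "wlen D I (s i o w) <= length ws - 1" using wlen_le[of "xs @ ys" I] j x by simp
 moreover have "wlen D I w <= wlen D I (s i o w) + 1"
 proof -
  have "s i o (s i o w) = w" using s_comp_s[OF Ipp[OF i]] by (simp add: comp_assoc[symmetric])
  thus ?thesis using wlen_Cons_le[OF i weyl_comp[OF weyl_gen_in[OF i] w]] by simp
 qed
 ultimately show ?thesis using ws x by simp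
qed

lemma desc_pos:
 assumes w: "w \<in> weyl D I" and i: "i \<in> I" and "A i (w pp) > 0"
 shows "wlen D I (s i o w) = wlen D I w + 1"
proof -
 have "wlen D I (s i o (s i o w)) + 1 = wlen D I (s i o w)"
  using desc_neg[OF weyl_comp[OF weyl_gen_in[OF i] w] i] A_s[OF Ipp[OF i]] assms by simp
 moreover have "s i o (s i o w) = w" using s_comp_s[OF Ipp[OF i]] by (simp add: comp_assoc[symmetric])
 ultimately show ?thesis by simp
qed

lemma A_word_nz: "w \<in> weyl D I ==> i \<in> I ==> A i (w pp) ~= 0"
 using Phi_pp[OF Phi_word[OF I Phi_A[OF I]], of i w] by simp

lemma red_Nil: "red I []"
proof -
 have "[] \<in> lists I" by simp
 thus ?thesis using wlen_le[of "[]" I] unfolding red_def by (simp only: list.size le_0_eq)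
qed

lemma red_Cons: "red I (i # us) \<longleftrightarrow> i \<in> I & red I us & A i (wd us pp) > 0"
proof
 assume r: "red I (i # us)"
 hence i: "i \<in> I" "us \<in> lists I" by (auto simp: red_def)
 have w: "wd us \<in> weyl D I" using wd_weyl i by blast
 have l: "wlen D I (s i o wd us) = length us + 1" using r by (simp add: red_def)
 have "wlen D I (wd us) = length us" using wlen_le[OF i(2)] wlen_Cons_le[OF i(1) w] l by simp
 moreover have "~ A i (wd us pp) < 0" using desc_neg[OF w i(1)] l calculation by auto
 ultimately show "i \<in> I & red I us & A i (wd us pp) > 0" using i A_word_nz[OF w i(1)] by (auto simp: red_def)
next
 assume a: "i \<in> I & red I us & A i (wd us pp) > 0"
 thus "red I (i # us)" using desc_pos[OF red_weyl] by (auto simp: red_def)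
qed

lemma wd_rev: "ws \<in> lists I ==> wd (rev ws) o wd ws = id"
proof (induction ws)
 case Nil show ?case by (simp only: rev.simps word_prod_Nil comp_id)
next
 case (Cons i ws)
 hence "wd (rev (i # ws)) o wd (i # ws) = wd (rev ws) o (s i o s i) o wd ws"
  by (simp only: rev.simps word_prod_append word_prod_Cons word_prod_Nil comp_id comp_assoc)
 moreover have "s i o s i = id" using Cons s_comp_s[OF Ipp, of i] by simp
 moreover have "wd (rev ws) o wd ws = id" by (rule Cons.IH) (use Cons.prems in simp)
 ultimately show ?case by (simp only: comp_id)
qed

lemma wd_rev_inv: assumes "ws \<in> lists I" shows "wd (rev ws) = inv (wd ws)"
proof -
 have "wd (rev (rev ws)) o wd (rev ws) = id" by (rule wd_rev) (use assms in auto)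
 thus ?thesis using wd_rev[OF assms] inv_unique_comp by (metis rev_rev_ident)
qed

lemma wlen_inv: assumes "w \<in> weyl D I" shows "wlen D I (inv w) = wlen D I w"
proof -
 have le: "wlen D I (inv w) <= wlen D I w" if w: "w \<in> weyl D I" for w
 proof -
  obtain ws where "ws \<in> lists I" "wd ws = w" "length ws = wlen D I w" using wlen_ex[OF w] by blast
  moreover have "rev ws \<in> lists I" using calculation by (simp add: in_lists_conv_set)
  ultimately show ?thesis using wlen_le[of "rev ws" I] wd_rev_inv[of ws] by simp
 qed
 show ?thesis using le[OF assms] le[OF weyl_bij(2)[OF I assms]] inv_inv_eq weyl_bij(1)[OF I assms] by fastforce
qed

lemma red_rev: "red I ws ==> red I (rev ws)"
 unfolding red_def using wd_rev_inv[of ws] wlen_inv[OF wd_weyl, of ws] by (simp add: in_lists_conv_set)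

lemma red_snoc: "red I (us @ [i]) \<longleftrightarrow> i \<in> I & red I us & A i (inv (wd us) pp) > 0"
proof -
 have "red I (us @ [i]) \<longleftrightarrow> red I (i # rev us)"
  using red_rev[of "us @ [i]"] red_rev[of "i # rev us"] unfolding rev.simps rev_append rev_rev_ident append_Nil append_Cons by blast
 also have "... \<longleftrightarrow> i \<in> I & red I us & A i (inv (wd us) pp) > 0"
 proof (cases "red I us")
  case True
  hence "wd (rev us) = inv (wd us)" using wd_rev_inv by (simp add: red_def)
  thus ?thesis using red_Cons[of i "rev us"] red_rev[OF True] True by simp
 next
  case False
  hence "~ red I (rev us)" using red_rev[of "rev us"] by auto
  thus ?thesis using red_Cons[of i "rev us"] False by simp
 qed
 finally show ?thesis .
qed

lemma wlen_0: "w \<in> weyl D I ==> wlen D I w = 0 ==> w = id"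
 using wlen_ex[of w I] by (auto simp del: word_prod_Nil) (simp only: word_prod_Nil)

text \<open>Lengths add if no wall crossed by the first factor is crossed back by the second. This
  is the form in which every length computation below is made.\<close>

lemma red_append_additive:
 assumes "red I us" "red I vs"
  and "!!b. b \<in> Phi I ==> b pp > 0 ==> b (wd us pp) < 0 ==> b (wd us (wd vs pp)) < 0"
 shows "red I (us @ vs)"
 using assms(1,3)
proof (induction us)
 case Nil thus ?case using assms(2) by simp
next
 case (Cons i us)
 have r: "i \<in> I" "red I us" "A i (wd us pp) > 0" using Cons(2) red_Cons by auto
 have ii: "i \<in> aix" using Ipp r by blast
 have "red I (us @ vs)"
 proof (rule Cons.IH[OF r(2)])
  fix b assume b: "b \<in> Phi I" "b pp > 0" "b (wd us pp) < 0"
  have "b ~= A i" using b r by auto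
  hence "(b o s i) pp > 0" using Phi_pos_s[OF I r(1) b(1,2)] by simp
  moreover have "(b o s i) (wd (i # us) pp) < 0" using b ii by simp
  ultimately have "(b o s i) (wd (i # us) (wd vs pp)) < 0" using Cons(3) Phi_s[OF I r(1) b(1)] by blast
  thus "b (wd us (wd vs pp)) < 0" using ii by simp
 qed
 moreover have "A i (wd (i # us) (wd vs pp)) < 0"
  using Cons(3)[OF Phi_A[OF I r(1)] A_pp[OF ii]] r A_s[OF ii] by simp
 hence "A i (wd (us @ vs) pp) > 0" using A_s[OF ii] by (simp add: word_prod_append)
 ultimately show ?case using red_Cons r by simp
qed

end

section \<open>Braid relations and Matsumoto's theorem\<close>

fun desc :: "nat list => 'v => bool" where
 "desc [] x \<longleftrightarrow> True"
| "desc (k # ks) x \<longleftrightarrow> A k x < 0 & desc ks (s k x)"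

text \<open>Instead of an order m the relation records two words of equal length. The last clause
  says that the word descends from every point at which both affine roots are negative, so it splits
  off from each element having both \<open>i\<close> and \<open>j\<close> as left descents.\<close>

definition braid :: "(nat => 'b => 'b) => 'b set => nat => nat => bool" where
 "braid g S i j \<longleftrightarrow> (\<exists>us vs. us \<in> lists {i, j} & vs \<in> lists {i, j} & length us = length vs &
   wd (i # us) = wd (j # vs) & (\<forall>f\<in>S. word_prod g (i # us) f = word_prod g (j # vs) f) &
   (\<forall>x. A i x < 0 --> A j x < 0 --> desc (i # us) x))"

text \<open>The relation is imposed on pairs that can be descents at the same time. In rank one the
  two walls of the alcove are parallel, no point is negative for both, and the dihedral group is
  infinite.\<close>

definition ops :: "nat set => (nat => 'b => 'b) => 'b set => bool" where
 "ops I g S \<longleftrightarrow> (\<forall>i\<in>I. \<forall>f\<in>S. g i f \<in> S) &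
   (\<forall>i\<in>I. \<forall>j\<in>I. i ~= j --> (\<exists>x. A i x < 0 & A j x < 0) --> braid g S i j)"

lemma word_S: "ops I g S ==> ws \<in> lists I ==> f \<in> S ==> word_prod g ws f \<in> S"
 by (induction ws) (auto simp: ops_def)

context
 fixes I assumes I: "I \<subseteq> aix"
begin

lemma desc_red:
 assumes "ks \<in> lists I" "w \<in> weyl D I" "desc ks (w pp)"
 shows "wlen D I (wd (rev ks) o w) + length ks = wlen D I w"
 using assms
proof (induction ks arbitrary: w)
 case Nil thus ?case by (simp only: rev.simps word_prod_Nil id_comp list.size add_0_right)
next
 case (Cons k ks)
 have k: "k \<in> I" "ks \<in> lists I" using Cons by auto
 have wI: "w \<in> weyl D I" using Cons by blast
 have e1: "wlen D I (wd (rev ks) o (s k o w)) + length ks = wlen D I (s k o w)"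
 proof (rule Cons.IH)
  show "s k o w \<in> weyl D I" by (rule weyl_comp[OF weyl_gen_in[OF k(1)] wI])
  show "desc ks ((s k o w) pp)" using Cons.prems by simp
 qed
 have e2: "wlen D I (s k o w) + 1 = wlen D I w" using desc_neg[OF I wI k(1)] Cons.prems by simp
 have e3: "wd (rev (k # ks)) o w = wd (rev ks) o (s k o w)"
  by (simp only: rev.simps word_prod_append word_prod_Cons word_prod_Nil comp_id comp_assoc)
 show ?case unfolding e3 list.size using e1 e2 by linarith
qed

text \<open>Induction on the length. If the first letters \<open>i\<close> and \<open>j\<close>
  differ, both are left descents, so the element is the braid word times a shorter \<open>z\<close>.
  Each given word is compared with one that passes through \<open>z\<close> and has the same first
  letter, which can then be stripped.\<close>

lemma matsumoto:
 assumes "ops I g S" "red I ws" "red I ws'" "wd ws = wd ws'" "f \<in> S"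
 shows "word_prod g ws f = word_prod g ws' f"
 using assms(2-5)
proof (induction "length ws" arbitrary: ws ws' f rule: less_induct)
 case less
 have len: "length ws = length ws'" using less by (simp add: red_def)
 show ?case
 proof (cases ws)
  case Nil thus ?thesis using len by simp
 next
  case (Cons i w1)
  then obtain j w2 where ws': "ws' = j # w2" using len by (cases ws') auto
  have r1: "i \<in> I" "red I w1" "A i (wd w1 pp) > 0" using less.prems Cons red_Cons[OF I] by auto
  have r2: "j \<in> I" "red I w2" "A j (wd w2 pp) > 0" using less.prems ws' red_Cons[OF I] by auto
  have ij: "i \<in> aix" "j \<in> aix" using r1 r2 I by auto
  let ?w = "wd ws"
  have wI: "?w \<in> weyl D I" using less red_weyl by blast
  show ?thesis
  proof (cases "i = j")
   case True
   have "wd w1 = s i o wd ws" unfolding Cons word_prod_Cons using s_comp_s[OF ij(1)] by (simp only: comp_assoc[symmetric] id_comp)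
   also have "... = wd w2" unfolding less.prems(3) ws' word_prod_Cons True using s_comp_s[OF ij(2)]
    by (simp only: comp_assoc[symmetric] id_comp)
   finally have e: "wd w1 = wd w2" .
   have "length w1 < length ws" using Cons by simp
   hence "word_prod g w1 f = word_prod g w2 f" using less.hyps[OF _ r1(2) r2(2) e less.prems(4)] by blast
   thus ?thesis unfolding Cons ws' True by simp
  next
   case False
   have di: "A i (?w pp) < 0" using Cons r1 A_s[OF ij(1)] by simp
   have dj: "A j (?w pp) < 0" using less.prems(3) ws' r2 A_s[OF ij(2)] by simp
   have "braid g S i j" using assms(1) r1(1) r2(1) False di dj unfolding ops_def by blast
   then obtain us vs where uv: "us \<in> lists {i, j}" "vs \<in> lists {i, j}" "length us = length vs"
    "wd (i # us) = wd (j # vs)" "\<forall>f\<in>S. word_prod g (i # us) f = word_prod g (j # vs) f"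
    "\<forall>x. A i x < 0 --> A j x < 0 --> desc (i # us) x" unfolding braid_def by blast
   have lI: "i # us \<in> lists I" "j # vs \<in> lists I" using uv r1 r2 by auto
   define z where "z = wd (rev (i # us)) o ?w"
   have lz: "wlen D I z + length (i # us) = wlen D I ?w"
    using desc_red[OF lI(1) wI] uv di dj unfolding z_def by blast
   have zI: "z \<in> weyl D I" unfolding z_def by (rule weyl_comp[OF wd_weyl wI]) (use lI in auto)
   obtain zs where zs: "red I zs" "wd zs = z" using red_ex[OF zI] by blast
   have zl: "zs \<in> lists I" "length zs = wlen D I z" using zs by (auto simp: red_def)
   have bk: "wd (i # us) o z = ?w"
   proof -
    have "wd (i # us) o wd (rev (i # us)) = id" using wd_rev[OF I, of "rev (i # us)"] lI(1)
     unfolding rev_rev_ident by (simp add: in_lists_conv_set)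
    thus ?thesis unfolding z_def by (simp only: comp_assoc[symmetric] id_comp)
   qed
   have e1: "wd (i # us @ zs) = ?w"
    unfolding append_Cons[symmetric] word_prod_append zs(2) by (rule bk)
   have e2: "wd (j # vs @ zs) = ?w"
    unfolding append_Cons[symmetric] word_prod_append zs(2) uv(4)[symmetric] by (rule bk)
   have l1: "wlen D I ?w = length (i # us @ zs)" using lz zl(2) by simp
   have l2: "wlen D I ?w = length (j # vs @ zs)" using l1 uv(3) by simp
   have R1: "red I (i # us @ zs)" unfolding red_def e1 using lI(1) zl(1) l1 by simp
   have R2: "red I (j # vs @ zs)" unfolding red_def e2 using lI(2) zl(1) l2 by simp
   have fS: "word_prod g zs f \<in> S" by (rule word_S[OF assms(1) zl(1) less.prems(4)])
   have cancel: "x = y" if "k \<in> aix" "s k o x = s k o y" for k and x y :: "'v => 'v"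
   proof -
    have "s k o (s k o x) = s k o (s k o y)" unfolding that(2) ..
    thus ?thesis unfolding comp_assoc[symmetric] s_comp_s[OF that(1)] id_comp .
   qed
   have c1: "wd w1 = wd (us @ zs)"
    by (rule cancel[OF ij(1)], rule sym) (use e1 in \<open>unfold Cons word_prod_Cons\<close>)
   have c2: "wd w2 = wd (vs @ zs)"
    by (rule cancel[OF ij(2)], rule sym) (use e2 in \<open>unfold less.prems(3) ws' word_prod_Cons\<close>)
   have "word_prod g ws f = g i (word_prod g (us @ zs) f)"
   proof -
    have "red I (us @ zs)" using R1 red_Cons[OF I] by blast
    moreover have "length w1 < length ws" using Cons by simp
    ultimately have "word_prod g w1 f = word_prod g (us @ zs) f"
     using less.hyps[OF _ r1(2) _ c1 less.prems(4)] by blast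
    thus ?thesis unfolding Cons word_prod_Cons comp_apply by (rule arg_cong)
   qed
   also have "... = word_prod g (i # us) (word_prod g zs f)" by (simp add: word_prod_append)
   also have "... = word_prod g (j # vs) (word_prod g zs f)" using uv(5) fS by blast
   also have "... = g j (word_prod g (vs @ zs) f)" by (simp add: word_prod_append)
   also have "... = word_prod g ws' f"
   proof -
    have "red I (vs @ zs)" using R2 red_Cons[OF I] by blast
    moreover have "length w2 < length ws" using ws' len by simp
    ultimately have "word_prod g w2 f = word_prod g (vs @ zs) f"
     using less.hyps[OF _ r2(2) _ c2 less.prems(4)] by blast
    thus ?thesis unfolding ws' word_prod_Cons comp_apply by (rule arg_cong[OF sym])
   qed
   finally show ?thesis .
  qed
 qed
qed

lemma op_red:
 assumes "ops I g S" "red I ws" "f \<in> S"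
 shows "word_prod g (red_word D I (wd ws)) f = word_prod g ws f"
 using matsumoto[OF assms(1)] red_word[OF red_weyl[OF assms(2)]] assms by blast

text \<open>A wall that avoids \<open>x\<close> has \<open>x\<close> and \<open>w pp\<close> on the
  same side; a wall through \<open>x\<close> has \<open>w pp\<close> on the side of
  \<open>pp\<close>. This singles out the shortest \<open>w\<close> whose chamber has
  \<open>x\<close> in its closure, in a form suited to induction.\<close>

definition isW :: "('v => 'v) => 'v => bool" where
 "isW w x \<longleftrightarrow> w \<in> weyl D I & (\<forall>b\<in>Phi I. b pp > 0 --> (b (w pp) < 0 \<longleftrightarrow> b x < 0))"

lemma isW_step:
 assumes "isW w x" "i \<in> I" "A i x ~= 0"
 shows "isW (s i o w) (s i x)"
 unfolding isW_def
proof (intro conjI ballI impI)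
 have i: "i \<in> aix" using assms I by blast
 have w: "w \<in> weyl D I" using assms by (simp add: isW_def)
 show "s i o w \<in> weyl D I" using w weyl_comp weyl_gen_in assms by blast
 fix b assume b: "b \<in> Phi I" "b pp > 0"
 show "b ((s i o w) pp) < 0 \<longleftrightarrow> b (s i x) < 0"
 proof (cases "b = A i")
  case True
  have "A i (w pp) < 0 \<longleftrightarrow> A i x < 0" using assms(1) b True by (simp add: isW_def)
  thus ?thesis using True A_s[OF i] A_word_nz[OF I w assms(2)] assms(3) by auto
 next
  case False
  have "b o s i \<in> Phi I" "(b o s i) pp > 0" using Phi_s[OF I assms(2) b(1)] Phi_pos_s[OF I assms(2) b False] by auto
  thus ?thesis using assms(1) unfolding isW_def by (metis comp_apply)
 qed
qed

lemma isW_step_back: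
 assumes "isW (s i o w) x" "i \<in> I" "A i x ~= 0"
 shows "isW w (s i x)"
proof -
 have "s i o (s i o w) = w" using s_comp_s[of i] assms I by (auto simp: comp_assoc[symmetric])
 thus ?thesis using isW_step[OF assms] by simp
qed

lemma isW_A: "isW w x ==> i \<in> I ==> A i (w pp) < 0 \<longleftrightarrow> A i x < 0"
 using Phi_A[OF I] A_pp I by (auto simp: isW_def)

text \<open>A root negative at \<open>inv w x\<close>, transported by \<open>w\<close>, would have
  opposite signs at \<open>x\<close> and at \<open>w pp\<close>. So \<open>inv w x\<close> lies in
  the closed fundamental chamber.\<close>

lemma isW_nonneg:
 assumes "isW w x" "b \<in> Phi I" "b pp > 0" shows "b (inv w x) >= 0"
proof (rule ccontr)
 assume n: "~ ?thesis"
 have w: "w \<in> weyl D I" using assms by (simp add: isW_def)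
 let ?c = "b o inv w"
 have c: "?c \<in> Phi I" using Phi_word[OF I assms(2) weyl_bij(2)[OF I w]] .
 have cw: "?c (w pp) = b pp" using w I by simp
 show False
 proof (cases "?c pp > 0")
  case True
  hence "?c (w pp) < 0" using assms(1) c n unfolding isW_def by auto
  thus False using cw assms by simp
 next
  case False
  hence m: "- ?c pp > 0" using Phi_pp[OF c] by simp
  have "(%x. - ?c x) \<in> Phi I" using Phi_minus[OF c] .
  moreover have "\<forall>b\<in>Phi I. b pp > 0 --> (b (w pp) < 0 \<longleftrightarrow> b x < 0)" using assms(1) by (simp add: isW_def)
  ultimately have "(%x. - ?c x) pp > 0 --> ((%x. - ?c x) (w pp) < 0 \<longleftrightarrow> (%x. - ?c x) x < 0)"
   using bspec[of "Phi I" "%b. b pp > 0 --> (b (w pp) < 0 \<longleftrightarrow> b x < 0)" "%x. - ?c x"] by blast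
  hence "- ?c (w pp) < 0 \<longleftrightarrow> - ?c x < 0" using m by simp
  thus False using n cw assms by simp
 qed
qed

text \<open>Along a reduced word for \<open>v\<close> every letter fixes the point: the root of the
  letter is nonnegative before the reflection and nonnegative after it, hence zero.\<close>

lemma chamber_orbit_unique:
 assumes y: "!!b. b \<in> Phi I ==> b pp > 0 ==> b y >= 0" and "v \<in> weyl D I" "!!i. i \<in> I ==> A i (v y) >= 0"
 shows "v y = y"
proof -
 have "red I ws --> (\<forall>i\<in>I. A i (wd ws y) >= 0) --> wd ws y = y" for ws
 proof (induction ws)
  case Nil show ?case by simp
 next
  case (Cons i us)
  show ?case
  proof (intro impI)
   assume r: "red I (i # us)" and ch: "\<forall>k\<in>I. A k (wd (i # us) y) >= 0"
   have i: "i \<in> I" "red I us" "A i (wd us pp) > 0" "i \<in> aix" using r red_Cons[OF I] I by auto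
   have "(A i o wd us) \<in> Phi I" using Phi_word[OF I Phi_A[OF I i(1)] red_weyl[OF i(2)]] .
   hence "A i (wd us y) >= 0" using y[of "A i o wd us"] i by simp
   moreover have "A i (wd (i # us) y) = - A i (wd us y)" using A_s[OF i(4)] by simp
   ultimately have "A i (wd us y) = 0" using ch i(1) by fastforce
   hence e: "wd (i # us) y = wd us y" using s_eq[OF i(4)] by simp
   have "\<forall>i\<in>I. A i (wd us y) >= 0" using ch unfolding e .
   thus "wd (i # us) y = y" using Cons i(2) unfolding e by blast
  qed
 qed
 thus ?thesis using red_ex[OF assms(2)] assms(3) by blast
qed

text \<open>An inversion of \<open>w\<close> is already visible at \<open>x\<close>, so it is also
  an inversion of every \<open>v\<close> that carries \<open>inv w x\<close> to \<open>x\<close>.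
  Hence such a \<open>v\<close> is \<open>w o u\<close> with additive lengths.\<close>

lemma isW_min:
 assumes x: "isW w x" and v: "v \<in> weyl D I" "v (inv w x) = x"
 shows "wlen D I w <= wlen D I v" "wlen D I v <= wlen D I w ==> v = w"
proof -
 have w: "w \<in> weyl D I" using x by (simp add: isW_def)
 define u where "u = inv w o v"
 have u: "u \<in> weyl D I" unfolding u_def using weyl_comp weyl_bij(2)[OF I w] v by blast
 have wu: "w o u = v" using w I by (auto simp: u_def fun_eq_iff)
 obtain us where us: "red I us" "wd us = w" using red_ex[OF w] by blast
 obtain vs where vs: "red I vs" "wd vs = u" using red_ex[OF u] by blast
 have "red I (us @ vs)"
 proof (rule red_append_additive[OF I us(1) vs(1)])
  fix b assume b: "b \<in> Phi I" "b pp > 0" "b (wd us pp) < 0"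
  have "b x < 0" using x b us by (simp add: isW_def)
  hence c: "(b o v) (inv w x) < 0" using v by simp
  have cP: "b o v \<in> Phi I" using Phi_word[OF I b(1) v(1)] .
  have "~ (b o v) pp > 0" using isW_nonneg[OF x cP] c by fastforce
  hence "(b o v) pp < 0" using Phi_pp[OF cP] by linarith
  thus "b (wd us (wd vs pp)) < 0" using us vs wu by (metis comp_apply)
 qed
 hence l: "wlen D I v = wlen D I w + wlen D I u" using us vs wu
  by (simp add: red_def word_prod_append)
 thus "wlen D I w <= wlen D I v" by simp
 assume "wlen D I v <= wlen D I w"
 hence "u = id" using wlen_0[OF I u] l by simp
 thus "v = w" using wu by (simp only: comp_id)
qed

lemma isW_inv_min:
 assumes x: "isW w x"
 shows "inv_min_elt D I x (inv w x) = w"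
 unfolding inv_min_elt_def
proof (rule the_equality)
 have w: "w \<in> weyl D I" using x by (simp add: isW_def)
 have key: "wlen D I (inv w) <= wlen D I v" if v: "v \<in> weyl D I" "v x = inv w x" for v
 proof -
  have "inv v (inv w x) = x" using v I by (metis weyl_inv_l)
  hence "wlen D I w <= wlen D I (inv v)" using isW_min(1)[OF x weyl_bij(2)[OF I v(1)]] by blast
  thus ?thesis using wlen_inv[OF I] w v by simp
 qed
 thus "w \<in> weyl D I & inv w x = inv w x & (\<forall>v\<in>weyl D I. v x = inv w x --> wlen D I (inv w) <= wlen D I v)"
  using w by blast
 fix u assume u: "u \<in> weyl D I & inv u x = inv w x & (\<forall>v\<in>weyl D I. v x = inv w x --> wlen D I (inv u) <= wlen D I v)"
 hence "wlen D I (inv u) <= wlen D I (inv w)" using weyl_bij(2)[OF I w] by blast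
 hence "wlen D I u <= wlen D I w" using wlen_inv[OF I] w u by simp
 moreover have "u (inv w x) = x" using u I weyl_inv_r[OF I] by metis
 ultimately show "u = w" using isW_min(2)[OF x] u by blast
qed

end

section \<open>The fundamental alcove and orbit representatives\<close>

lemma short_meets: assumes "a \<in> R" shows "\<exists>g\<in>Sh. g \<bullet> a > 0"
proof -
 obtain w where w: "w \<in> W" "w bt \<bullet> a ~= 0" using irred_orbit[OF bt_R assms] by blast
 have "w bt \<in> Sh" using w Sh_W bt_Sh by blast
 thus ?thesis using w Sh_minus[of "w bt"] by (cases "w bt \<bullet> a > 0") (force intro: bexI[of _ "- w bt"])+
qed

text \<open>A short root and a root different from it and its negative pair to at most 1. The
  opposite pairing is then the ratio of the square lengths, an integer greater than 1.\<close>

lemma long_RI_sq: assumes a: "a \<in> RI" "a \<notin> Sh" and g: "g \<in> Sh" "g \<bullet> a > 0"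
 shows "g \<cdot> a = 1" "a \<bullet> a >= 2 * msq"
proof -
 have aR: "a \<in> R" using a RI_R by blast
 have "g ~= a" "g ~= - a" using a g Sh_minus[of g] by auto
 thus 1: "g \<cdot> a = 1"
  using short_pair[OF g(1) aR] coroot_sign[OF aR, of g] g(2) by auto
 hence 2: "2 * (g \<bullet> a) = a \<bullet> a" using root_sq_pos[OF aR] by (simp add: coroot_def field_simps)
 obtain k :: int where k: "a \<cdot> g = k" using int_R[OF Sh_R[OF g(1)] aR] Ints_cases by blast
 have k2: "real_of_int k * msq = a \<bullet> a" using k 2 Sh_sq[OF g(1)] msq_pos by (simp add: coroot_def inner_commute field_simps)
 have "a \<bullet> a > msq" using a ShI[OF aR] msq_le[OF aR] by (cases "a \<bullet> a = msq") auto
 hence "real_of_int k * msq > 1 * msq" using k2 by simp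
 hence "k >= 2" using msq_pos by (simp only: mult_less_cancel_right) linarith
 hence "real_of_int k * msq >= 2 * msq" using msq_pos by (intro mult_right_mono) auto
 thus "a \<bullet> a >= 2 * msq" using k2 by simp
qed

text \<open>A short root lies below \<open>bt\<close>. A longer indivisible root is a difference of
  two short roots, which at most doubles the bound on its inner product with \<open>x\<close>, while
  its square length is at least doubled.\<close>

lemma alcove_le1:
 assumes dom: "dominant x" and th: "x \<bullet> theta D <= 1" and a: "a \<in> RI"
 shows "x \<cdot> a <= 1"
proof -
 have short: "x \<cdot> g <= 1" if g: "g \<in> Sh" for g
 proof -
  have "x \<bullet> (bt - g) >= 0"
  proof -
   have "(bt - g) \<bullet> fw i >= 0" if "i \<in> ix" for i using bt_max[OF g] that by (auto simp: root_le_iff elim!: Nats_cases)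
   hence "(bt - g) \<bullet> x >= 0" unfolding inner_expand[of "bt - g" x]
    using dom by (intro sum_nonneg) (auto simp: dominant_def inner_commute)
   thus ?thesis by (simp add: inner_commute)
  qed
  hence "(2 / msq) * (x \<bullet> g) <= (2 / msq) * (x \<bullet> bt)" using msq_pos by (intro mult_left_mono) (auto simp: inner_diff_right)
  hence "x \<cdot> g <= x \<cdot> bt" using Sh_sq g bt_Sh by (simp add: coroot_def)
  thus ?thesis using th coroot_bt by simp
 qed
 show ?thesis
 proof (cases "a \<in> Sh")
  case False
  obtain g where g: "g \<in> Sh" "g \<bullet> a > 0" using short_meets RI_R a by blast
  have l: "g \<cdot> a = 1" "a \<bullet> a >= 2 * msq" using long_RI_sq[OF a False g] by auto
  let ?h = "reflection a g"
  have h: "?h \<in> Sh" using Sh_refl RI_R a g by blast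
  have ag: "a = g - ?h" using l by (simp add: reflection_def)
  have cg: "x \<cdot> c = (2 / msq) * (x \<bullet> c)" if "c \<in> Sh" for c using Sh_sq that by (simp add: coroot_def)
  have "(2 / msq) * (x \<bullet> a) = x \<cdot> g + x \<cdot> (- ?h)"
   unfolding cg[OF g(1)] cg[OF Sh_minus[OF h]] by (subst ag) (simp add: inner_diff_right algebra_simps)
  also have "... <= 2" using short[OF g(1)] short[OF Sh_minus[OF h]] by linarith
  finally have "x \<bullet> a <= msq" using msq_pos by (simp add: field_simps)
  hence "2 * (x \<bullet> a) <= a \<bullet> a" using l by linarith
  thus ?thesis using root_sq_pos[OF RI_R[OF a]] by (simp add: coroot_def field_simps)
 qed (use short in blast)
qed

lemma A_0_theta: "A 0 x >= 0 \<longleftrightarrow> x \<bullet> theta D <= 1"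
 by (simp add: A_0)

lemma dominant_A: "dominant x \<longleftrightarrow> (\<forall>i\<in>ix. A i x >= 0)"
proof -
 have "A i x >= 0 \<longleftrightarrow> x \<bullet> al i >= 0" if "i \<in> ix" for i
  using coroot_sign[OF al_R[OF that], of x] coroot_zero[OF al_R[OF that], of x] A_fin[OF that] by (metis less_eq_real_def)
 thus ?thesis by (auto simp: dominant_def)
qed

lemma dominant_coroot: "dominant x ==> a \<in> R ==> posr a ==> x \<cdot> a >= 0"
 using posr_inner_dominant[of a x] coroot_sign coroot_zero unfolding dominant_def by (metis less_eq_real_def)

text \<open>Roots with zero constant term are governed by dominance; for a positive constant term
  \<open>alcove_le1\<close> is applied to the opposite gradient.\<close>

lemma chamber_nonneg:
 assumes I: "I = ix | I = aix" and ch: "!!i. i \<in> I ==> A i x >= 0" and b: "b \<in> Phi I" "b pp > 0"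
 shows "b x >= 0"
proof -
 obtain a m where bm: "b = aff a m" "a \<in> RI" "0 \<notin> I --> m = 0" using b(1) by (auto simp: Phi_def)
 have aR: "a \<in> R" using bm RI_R by blast
 have dom: "dominant x" using ch I ix_aix by (auto simp: dominant_A)
 have m: "m >= 1 | m = 0 & posr a" using b(2) aff_pp(1)[OF aR] bm by simp
 show ?thesis
 proof (cases "m >= 1")
  case False thus ?thesis using m bm dominant_coroot[OF dom aR] by (simp add: aff_def)
 next
  case True
  hence "I = aix" using bm I zero_ix by auto
  hence th: "x \<bullet> theta D <= 1" using ch[of 0] A_0_theta by simp
  have "x \<cdot> (- a) <= 1" using alcove_le1[OF dom th] RI_minus bm by blast
  thus ?thesis using True bm by (simp add: aff_def)
 qed
qed

lemma finite_Neg: "finite {b \<in> Phi I. b pp > 0 & b x < 0}"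
proof -
 let ?M = "Max ((%a. \<lceil>\<bar>x \<cdot> a\<bar>\<rceil>) ` R)"
 have "{b \<in> Phi I. b pp > 0 & b x < 0} \<subseteq> (%(a, m). aff a m) ` (R \<times> {0..?M})"
 proof
  fix b assume b: "b \<in> {b \<in> Phi I. b pp > 0 & b x < 0}"
  then obtain a m where bm: "b = aff a m" "a \<in> RI" by (auto simp: Phi_def)
  have aR: "a \<in> R" using bm RI_R by blast
  have "m >= 0" using b aff_pp(1)[OF aR] bm by auto
  moreover have "real_of_int m < \<bar>x \<cdot> a\<bar>" using b unfolding mem_Collect_eq bm(1) by (simp add: aff_def) linarith
  hence "m <= \<lceil>\<bar>x \<cdot> a\<bar>\<rceil>" by linarith
  moreover have "\<lceil>\<bar>x \<cdot> a\<bar>\<rceil> <= ?M" using aR finite_R by (intro Max_ge) auto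
  ultimately show "b \<in> (%(a, m). aff a m) ` (R \<times> {0..?M})" using aR bm by force
 qed
 thus ?thesis using finite_R finite_subset by blast
qed

text \<open>Induction on the number of walls separating \<open>x\<close> from \<open>pp\<close>:
  reflecting in a simple wall at which \<open>x\<close> is negative lowers it.\<close>

lemma isW_ex: assumes "I = ix | I = aix" shows "\<exists>w. isW I w x"
proof -
 have I: "I \<subseteq> aix" using assms ix_aix by auto
 show ?thesis
 proof (induction "card {b \<in> Phi I. b pp > 0 & b x < 0}" arbitrary: x rule: less_induct)
  case less
  show ?case
  proof (cases "\<exists>i\<in>I. A i x < 0")
   case False
   hence "b x >= 0" if "b \<in> Phi I" "b pp > 0" for b using chamber_nonneg[OF assms _ that, of x] by (meson not_less)
   hence "isW I id x" using weyl_id unfolding isW_def[OF I] by (force simp: not_less[symmetric])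
   thus ?thesis by blast
  next
   case True
   then obtain i where i: "i \<in> I" "A i x < 0" by blast
   have ii: "i \<in> aix" using i I by blast
   let ?N = "%x. {b \<in> Phi I. b pp > 0 & b x < 0}"
   have sub: "(%b. b o s i) ` ?N (s i x) \<subseteq> ?N x - {A i}"
   proof
    fix c assume "c \<in> (%b. b o s i) ` ?N (s i x)"
    then obtain b where b: "c = b o s i" "b \<in> Phi I" "b pp > 0" "b (s i x) < 0" by blast
    have ne: "b ~= A i" using b i A_s[OF ii] by auto
    have "c \<in> Phi I" "c pp > 0" "c x < 0"
     using Phi_s[OF I i(1) b(2)] Phi_pos_s[OF I i(1) b(2,3) ne] b by auto
    moreover have "c ~= A i"
    proof
     assume "c = A i"
     hence "A i (s i pp) = b (s i (s i pp))" using b(1) by (metis comp_apply)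
     thus False using A_s[OF ii] A_pp[OF ii] b(3) ii by simp
    qed
    ultimately show "c \<in> ?N x - {A i}" by blast
   qed
   have "inj_on (%b. b o s i) (?N (s i x))"
   proof (rule inj_onI)
    fix b c assume "b o s i = c o s i"
    hence "b o (s i o s i) = c o (s i o s i)" by (simp only: comp_assoc[symmetric])
    thus "b = c" using s_comp_s[OF ii] by (simp only: comp_id)
   qed
   hence "card (?N (s i x)) = card ((%b. b o s i) ` ?N (s i x))" by (simp add: card_image)
   also have "... <= card (?N x - {A i})" using sub finite_Neg by (intro card_mono) auto
   also have "... < card (?N x)"
    using Phi_A[OF I i(1)] A_pp[OF ii] i finite_Neg by (intro card_Diff1_less) auto
   finally obtain w where w: "isW I w (s i x)" using less by blast
   have "isW I (s i o w) (s i (s i x))" using isW_step[OF I w i(1)] i A_s[OF ii] by simp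
   thus ?thesis using ii by auto
  qed
 qed
qed

lemma weights_refl: "a \<in> R ==> l \<in> weights D ==> reflection a l \<in> weights D"
 unfolding weights_def using refl_R by (auto simp: reflection_swap coroot_refl[symmetric])

lemma R_weights: "a \<in> R ==> a \<in> weights D"
 unfolding weights_def using int_R by blast

lemma weights_add: "x \<in> weights D ==> y \<in> weights D ==> x + y \<in> weights D"
 unfolding weights_def by (auto simp: inner_add_left)

lemma weights_minus: "x \<in> weights D ==> - x \<in> weights D"
 unfolding weights_def by auto

lemma weights_0: "0 \<in> weights D"
 unfolding weights_def by auto

lemma weights_s: "i \<in> aix ==> l \<in> weights D ==> s i l \<in> weights D"
 using weights_refl al_R bt_R weights_add R_weights by (auto simp: aix_eq s_0 weyl_gen_fin)

lemma weights_weyl: "w \<in> aff_weyl D ==> l \<in> weights D ==> w l \<in> weights D"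
proof -
 assume "w \<in> aff_weyl D" "l \<in> weights D"
 from order_refl this show "w l \<in> weights D"
  by (induction rule: weyl_induct) (auto intro: weights_s)
qed

lemma w_aff_tilde: assumes "isW aix w l" "l \<in> weights D"
 shows "w_aff D l = w" "tilde D l = inv w l"
proof -
 have w: "w \<in> weyl D aix" using assms unfolding isW_def[OF order_refl] by blast
 have nn: "b \<in> Phi aix ==> b pp > 0 ==> b (inv w l) >= 0" for b using isW_nonneg[OF order_refl assms(1)] .
 have ch: "A i (inv w l) >= 0" if "i \<in> aix" for i using nn[OF Phi_A[OF order_refl that]] A_pp[OF that] .
 have eqC: "x \<in> min_alcove_weights D \<longleftrightarrow> x \<in> weights D & (\<forall>i\<in>aix. A i x >= 0)" for x
  using A_0_theta[of x] dominant_A[of x] unfolding min_alcove_weights_def dominant_def aix_eq fin_ix_def by auto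
 have t: "x = inv w l" if x: "x \<in> (%w. w l) ` aff_weyl D" "x \<in> min_alcove_weights D" for x
 proof -
  obtain v where v: "v \<in> aff_weyl D" "x = v l" using x by blast
  have vw: "v o w \<in> aff_weyl D" using weyl_comp v w by blast
  have vx: "(v o w) (inv w l) = x" using v weyl_inv_r[OF order_refl w] by simp
  have "(v o w) (inv w l) = inv w l"
   by (rule chamber_orbit_unique[OF order_refl nn vw]) (use x(2) eqC vx in auto)
  thus ?thesis using vx by simp
 qed
 have iw: "inv w \<in> aff_weyl D" by (rule weyl_bij(2)[OF order_refl w])
 show tt: "tilde D l = inv w l"
  unfolding tilde_def
 proof (rule the_equality)
  show "inv w l \<in> (%w. w l) ` aff_weyl D & inv w l \<in> min_alcove_weights D"
   using weights_weyl[OF iw assms(2)] eqC ch iw by auto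
 qed (use t in blast)
 show "w_aff D l = w" unfolding w_aff_def tt by (rule isW_inv_min[OF order_refl assms(1)])
qed

lemma ix_sub: "ix \<subseteq> aix" by (rule ix_aix)

text \<open>Antidominance of a weight is dominance of its negative, so the chamber results are
  applied to \<open>- l\<close>; the finite Weyl group is linear, hence the sign passes
  through.\<close>

lemma W_w_fin: assumes "isW ix w (- l)"
 shows "w_fin D l = w" "anti D l = inv w l"
proof -
 have w: "w \<in> W" using assms unfolding isW_def[OF ix_sub] by blast
 have iw: "inv w \<in> W" by (rule weyl_bij(2)[OF ix_sub w])
 have nn: "b \<in> Phi ix ==> b pp > 0 ==> b (inv w (- l)) >= 0" for b using isW_nonneg[OF ix_sub assms] .
 have ch: "A i (inv w (- l)) >= 0" if "i \<in> ix" for i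
  using nn[OF Phi_A[OF ix_sub that]] A_pp ix_aix that by blast
 have anti: "antidominant D x \<longleftrightarrow> (\<forall>i\<in>ix. A i (- x) >= 0)" for x
  by (auto simp: antidominant_def A_fin fin_ix_def)
 have m: "inv w (- l) = - inv w l" using W_minus[OF iw] .
 have t: "x = inv w l" if x: "x \<in> (%w. w l) ` W" "antidominant D x" for x
 proof -
  obtain v where v: "v \<in> W" "x = v l" using x by blast
  have vw: "v o w \<in> W" using weyl_comp v w by blast
  have vx: "(v o w) (inv w (- l)) = - x" using v W_minus[OF v(1)] w by simp
  have "(v o w) (inv w (- l)) = inv w (- l)"
   by (rule chamber_orbit_unique[OF ix_sub nn vw]) (use x(2) anti vx in auto)
  thus ?thesis using vx m by simp
 qed
 show tt: "anti D l = inv w l" unfolding anti_def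
 proof (rule the_equality)
  show "inv w l \<in> (%w. w l) ` W & antidominant D (inv w l)"
   using anti ch iw m by auto
 qed (use t in blast)
 have "inv_min_elt D ix (- l) (inv w (- l)) = w" by (rule isW_inv_min[OF ix_sub assms])
 moreover have "inv_min_elt D ix (- l) (inv w (- l)) = inv_min_elt D ix l (inv w l)"
 proof -
  have e: "v (- l) = - inv w l \<longleftrightarrow> v l = inv w l" if "v \<in> W" for v using W_minus[OF that] by simp
  have "(v \<in> W & inv v (- l) = - inv w l & (\<forall>u\<in>W. u (- l) = - inv w l --> wlen D ix (inv v) <= wlen D ix u)) \<longleftrightarrow>
    (v \<in> W & inv v l = inv w l & (\<forall>u\<in>W. u l = inv w l --> wlen D ix (inv v) <= wlen D ix u))" for v
   using e W_inv_in by blast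
  thus ?thesis unfolding inv_min_elt_def m by presburger
 qed
 ultimately show "w_fin D l = w" unfolding w_fin_def tt by simp
qed

end

section \<open>Demazure--Lusztig operators\<close>

type_synonym ('v, 'p) gop = "('v, 'p) galg => ('v, 'p) galg"

section \<open>Linear operators on the group algebra\<close>

lemma scale_mult_left: "scale c f * g = scale c (f * g)"
 by (simp add: scale_def mult.assoc)

lemma scale_mult_right: "f * scale c g = scale c (f * g)"
 by (simp add: scale_def mult.left_commute)

lemma ee_add: "ee (a + b) = ee a * ee b"
 by (simp add: ee_def mult_single)

lemma ee_0: "ee 0 = 1"
 by (simp add: ee_def)

lemma scale_ee: "scale c (ee l) = single l c"
 by (simp add: scale_def ee_def mult_single)

lemma scale_1_mult: "scale c 1 * f = scale c f"
 by (simp add: scale_def)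

lemma lookup_scale: "lookup (scale c f) l = c * lookup f l"
proof -
 have "scale c f = Poly_Mapping.map ((*) c) f" by (simp add: scale_def mult_map_scale_conv_mult)
 thus ?thesis by (simp add: Poly_Mapping.map.rep_eq when_def)
qed

lemma keys_scale: "keys (scale c f) \<subseteq> keys f"
 by (auto simp: in_keys_iff lookup_scale)

lemma galg_expand: "f = (\<Sum>l\<in>keys f. scale (lookup f l) (ee l))"
proof (rule poly_mapping_eqI)
 fix k
 have "lookup (\<Sum>l\<in>keys f. scale (lookup f l) (ee l)) k
   = (\<Sum>l\<in>keys f. if k = l then lookup f l else 0)"
  unfolding lookup_sum scale_ee by (intro sum.cong) (auto simp: lookup_single when_def)
 also have "... = lookup f k"
  by (simp add: sum.delta in_keys_iff)
 finally show "lookup f k = lookup (\<Sum>l\<in>keys f. scale (lookup f l) (ee l)) k"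
  by simp
qed

text \<open>Here \<open>L\<close> may be the weight lattice, a larger lattice adapted to two roots,
  or just a set of exponents that bounds a support.\<close>

definition Lg :: "'v set => ('v::euclidean_space, 'p::linorder) galg set" where
 "Lg L = {f. keys f \<subseteq> L}"

lemma Lg_0: "0 \<in> Lg L" by (simp add: Lg_def)

lemma Lg_add: "f \<in> Lg L ==> g \<in> Lg L ==> f + g \<in> Lg L"
 unfolding Lg_def using keys_add[of f g] by blast

lemma Lg_scale: "f \<in> Lg L ==> scale c f \<in> Lg L"
 unfolding Lg_def using keys_scale[of c f] by blast

lemma Lg_minus: "f \<in> Lg L ==> - f \<in> Lg L"
 using Lg_scale[of f L "-1"] by (simp add: scale_def single_uminus)

lemma Lg_diff: "f \<in> Lg L ==> g \<in> Lg L ==> f - g \<in> Lg L"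
 using Lg_add[of f L "- g"] Lg_minus by auto

lemma Lg_sum: "(!!i. i \<in> I ==> f i \<in> Lg L) ==> sum f I \<in> Lg L"
 by (induction I rule: infinite_finite_induct) (auto intro: Lg_0 Lg_add)

lemma Lg_ee: "l \<in> L ==> ee l \<in> Lg L"
 by (simp add: Lg_def ee_def)

lemma Lg_induct [consumes 1, case_names zero add scale]:
 assumes "f \<in> Lg L" "P 0" "!!f g. f \<in> Lg L ==> g \<in> Lg L ==> P f ==> P g ==> P (f + g)"
  "!!c l. l \<in> L ==> P (scale c (ee l))"
 shows "P f"
proof -
 have "P (\<Sum>l\<in>K. scale (lookup f l) (ee l)) & (\<Sum>l\<in>K. scale (lookup f l) (ee l)) \<in> Lg L"
  if "finite K" "K \<subseteq> L" for K using that
  by (induction rule: finite_induct) (auto intro!: assms Lg_0 Lg_add Lg_scale Lg_ee)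
 from this[of "keys f"] show ?thesis
  using assms(1) galg_expand[of f] by (simp add: Lg_def)
qed

definition linop :: "('v::euclidean_space, 'p::linorder) gop => bool" where
 "linop F \<longleftrightarrow> (\<forall>f g. F (f + g) = F f + F g) & (\<forall>c f. F (scale c f) = scale c (F f))"

lemma linop_add: "linop F ==> F (f + g) = F f + F g"
 and linop_scale: "linop F ==> F (scale c f) = scale c (F f)"
 by (simp_all add: linop_def)

lemma linop_0: "linop F ==> F 0 = 0"
 using linop_scale[of F 0 0] by (simp add: scale_def)

lemma linop_minus: "linop F ==> F (- f) = - F f"
 using linop_add[of F f "- f"] linop_0[of F] by (simp add: minus_unique)

lemma linop_diff: "linop F ==> F (f - g) = F f - F g"
 using linop_add[of F f "- g"] linop_minus[of F g] by simp

lemma linop_sum: "linop F ==> F (sum f I) = (\<Sum>i\<in>I. F (f i))"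
 by (induction I rule: infinite_finite_induct) (auto simp: linop_0 linop_add)

lemma linop_comp: "linop F ==> linop G ==> linop (%f. F (G f))"
 by (simp add: linop_def)

lemma linop_mult: "linop (%f. u * f)"
 by (simp add: linop_def distrib_left scale_mult_right)

lemma linop_plus: "linop F ==> linop G ==> linop (%f. F f + G f)"
 by (simp add: linop_def galg.scale_right_distrib algebra_simps)

lemma linop_scaleop: "linop F ==> linop (%f. scale c (F f))"
 by (simp add: linop_def galg.scale_right_distrib mult.commute)

lemma linop_id: "linop (%f. f)"
 by (simp add: linop_def)

lemma linop_eq: "linop F ==> linop G ==> (!!l. l \<in> L ==> F (ee l) = G (ee l)) ==> f \<in> Lg L ==> F f = G f"
 by (erule Lg_induct) (simp_all add: linop_0 linop_add linop_scale)

lemma lin_ext_supset: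
 assumes "finite K" "keys f \<subseteq> K"
 shows "lin_ext g f = (\<Sum>l\<in>K. scale (lookup f l) (g l))"
 unfolding lin_ext_def using assms
 by (intro sum.mono_neutral_left) (auto simp: in_keys_iff scale_def)

lemma linop_lin_ext:
 fixes g :: "'a::euclidean_space => ('a, 'b::linorder) galg"
 shows "linop (lin_ext g)"
 unfolding linop_def
proof (intro conjI allI)
 fix f f' :: "('a, 'b) galg"
 let ?K = "keys f \<union> keys f'"
 have "keys (f + f') \<subseteq> ?K" by (rule keys_add)
 thus "lin_ext g (f + f') = lin_ext g f + lin_ext g f'"
  by (simp add: lin_ext_supset[of ?K] lookup_add galg.scale_left_distrib sum.distrib)
next
 fix c and f :: "('a, 'b) galg"
 show "lin_ext g (scale c f) = scale c (lin_ext g f)"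
  using keys_scale[of c f] lin_ext_supset[of "keys f" "scale c f" g]
  by (simp add: lin_ext_supset[of "keys f" f g] lookup_scale galg.scale_sum_right)
qed

lemma lin_ext_ee: "lin_ext g (ee l) = g l"
 by (simp add: lin_ext_def ee_def)

section \<open>One Demazure-Lusztig operator for all generators\<close>

definition dnm :: "'v => 'p qtfield => ('v::euclidean_space, 'p::linorder) galg" where
 "dnm g Q = 1 - scale (inverse Q) (ee (- g))"

definition sop :: "'v => 'p qtfield => ('v::euclidean_space, 'p::linorder) gop" where
 "sop g Q = lin_ext (%l. scale (Q powi (- \<lfloor>l \<cdot> g\<rfloor>)) (ee (reflection g l)))"

definition Dop :: "'v => 'p qtfield => ('v::euclidean_space, 'p::linorder) gop" where
 "Dop g Q = lin_ext (%l. exact_quot (ee l - sop g Q (ee l)) (dnm g Q))"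

text \<open>All generators at once: \<open>g\<close> becomes \<open>al i\<close>, its double if that
  is a root, or minus theta; \<open>Q\<close> carries the power of q for i = 0; \<open>e\<close>
  carries the second parameter in the nonreduced case. With \<open>h = 1\<close> and
  \<open>e = 0\<close> only the twisted reflection remains, which is the nonreduced
  \<open>T01\<close>.\<close>

definition DL :: "'v => 'p qtfield => 'p qtfield => 'p qtfield => ('v::euclidean_space, 'p::linorder) gop" where
 "DL g Q h e f = scale h (sop g Q f) +
   (scale (h - inverse h) 1 + scale e (ee (- ((1/2) *\<^sub>R g)))) * Dop g Q f"

text \<open>If the product vanishes, \<open>f\<close> equals a multiple of e^(-g) times itself, so
  its finite support would be closed under translation by \<open>g\<close>.\<close>

lemma cancel_dnm_0:
 assumes "g ~= 0" "f * dnm g Q = 0" shows "f = 0"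
proof (rule ccontr)
 assume "f ~= 0"
 have e: "f = scale (inverse Q) (ee (- g)) * f" using assms(2) by (simp add: dnm_def algebra_simps)
 have lk: "lookup (scale c (ee a) * f) (a + k) = c * lookup f k" for c a k
 proof -
  have "scale c (ee a) * f = (\<Sum>l\<in>keys f. single (a + l) (c * lookup f l))"
   by (subst galg_expand[of f]) (simp add: scale_ee sum_distrib_left mult_single)
  hence "lookup (scale c (ee a) * f) (a + k) =
    (\<Sum>l\<in>keys f. if k = l then c * lookup f l else 0)"
   unfolding lookup_sum by (auto simp: lookup_sum lookup_single when_def intro!: sum.cong)
  thus ?thesis by (simp add: sum.delta in_keys_iff)
 qed
 have step: "k \<in> keys f ==> g + k \<in> keys f" for k
  using lk[of "inverse Q" "- g" "g + k"] e by (auto simp: in_keys_iff)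
 obtain k where k: "k \<in> keys f" using \<open>f ~= 0\<close> by (metis ex_in_conv keys_eq_empty)
 have "k + real n *\<^sub>R g \<in> keys f" for n
 proof (induction n)
  case (Suc n)
  thus ?case using step[OF Suc] by (simp add: algebra_simps)
 qed (use k in simp)
 hence "range (%n. k + real n *\<^sub>R g) \<subseteq> keys f" by blast
 moreover have "inj (%n. k + real n *\<^sub>R g)" using assms(1) by (auto simp: inj_on_def)
 ultimately show False using finite_keys[of f] finite_subset range_inj_infinite by blast
qed

lemma cancel_dnm: "g ~= 0 ==> f * dnm g Q = f' * dnm g Q ==> f = f'"
 using cancel_dnm_0[of g "f - f'" Q] by (simp add: left_diff_distrib)

lemma exact_quot_eq: "g ~= 0 ==> h * dnm g Q = f ==> exact_quot f (dnm g Q) = h"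
 unfolding exact_quot_def by (rule the_equality) (auto dest: cancel_dnm)

definition lattice :: "'v::euclidean_space set => bool" where
 "lattice L \<longleftrightarrow> 0 \<in> L & (\<forall>x\<in>L. \<forall>y\<in>L. x + y \<in> L) & (\<forall>x\<in>L. - x \<in> L)"

lemma lattice_diff: "lattice L ==> x \<in> L ==> y \<in> L ==> x - y \<in> L"
 unfolding lattice_def by (metis add_uminus_conv_diff)

lemma lattice_int: assumes "lattice L" "x \<in> L" shows "of_int k *\<^sub>R x \<in> L"
proof -
 have n: "real n *\<^sub>R x \<in> L" for n using assms by (induction n) (auto simp: lattice_def algebra_simps)
 show ?thesis
 proof (cases "k >= 0")
  case True thus ?thesis using n[of "nat k"] by simp
 next
  case False
  hence "of_int k *\<^sub>R x = - (real (nat (- k)) *\<^sub>R x)" by simp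
  thus ?thesis using n assms(1) unfolding lattice_def by metis
 qed
qed

lemma Lg_mult: "lattice L ==> f \<in> Lg L ==> g \<in> Lg L ==> f * g \<in> Lg L"
 unfolding Lg_def lattice_def using keys_mult[of f g] by blast

lemma Lg_1: "lattice L ==> 1 \<in> Lg L"
 using Lg_ee[of 0 L] by (simp add: lattice_def ee_0)

lemma Lg_power: "lattice L ==> f \<in> Lg L ==> f ^ n \<in> Lg L"
 by (induction n) (auto intro: Lg_mult Lg_1)

locale dl =
 fixes g :: "'v::euclidean_space" and Q h e :: "'p::linorder qtfield" and L :: "'v set"
 assumes g0: "g ~= 0" and Q0: "Q ~= 0" and h0: "h ~= 0" and e0: "e = 0 | Q = 1"
  and lat: "lattice L" and gL: "g \<in> L" and g2L: "e ~= 0 ==> (1/2) *\<^sub>R g \<in> L"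
  and pair: "!!l. l \<in> L ==> l \<cdot> g \<in> \<int>"
begin

abbreviation "S \<equiv> Lg L :: ('v, 'p) galg set"
abbreviation "so \<equiv> sop g Q"
abbreviation "Do \<equiv> Dop g Q"
abbreviation "T \<equiv> DL g Q h e"
abbreviation "k l \<equiv> \<lfloor>l \<cdot> g\<rfloor>"
abbreviation "d \<equiv> h - inverse h"

definition cc :: "('v, 'p) galg" where "cc = scale d 1 + scale e (ee (- ((1/2) *\<^sub>R g)))"

lemma T_eq: "T f = scale h (so f) + cc * Do f"
 by (simp add: DL_def cc_def)

lemma k_eq: "l \<in> L ==> real_of_int (k l) = l \<cdot> g"
 using pair by (auto elim: Ints_cases)

lemma g_pair: "g \<cdot> g = 2" using g0 by (rule inner_coroot_self)

definition x :: "('v, 'p) galg" where "x = scale (inverse Q) (ee (- g))"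
definition y :: "('v, 'p) galg" where "y = scale Q (ee g)"

lemma xy: "x * y = 1"
 using Q0 by (simp add: x_def y_def scale_mult_left scale_mult_right flip: ee_add) (simp add: ee_0)

lemma dnm_x: "dnm g Q = 1 - x" by (simp add: dnm_def x_def)

lemma linop_so: "linop so" and linop_Do: "linop Do" and linop_T: "linop T"
proof -
 show s: "linop so" and D: "linop Do" unfolding sop_def Dop_def by (rule linop_lin_ext)+
 show "linop T" unfolding T_eq[abs_def]
  by (intro linop_plus linop_scaleop s linop_comp[OF linop_mult D])
qed

lemma so_ee: "l \<in> L ==> so (ee l) = scale (Q powi (- k l)) (ee (l - of_int (k l) *\<^sub>R g))"
 by (simp add: sop_def lin_ext_ee reflection_def k_eq)

lemma so_ee_pos: "l \<in> L ==> k l = int n ==> so (ee l) = x ^ n * ee l"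
proof -
 have "x ^ n = scale (inverse Q ^ n) (ee (- (real n *\<^sub>R g)))"
  by (induction n) (simp_all add: x_def ee_0 scale_mult_left scale_mult_right algebra_simps flip: ee_add)
 thus "l \<in> L ==> k l = int n ==> so (ee l) = x ^ n * ee l"
  by (simp add: so_ee scale_mult_left power_int_minus power_inverse flip: ee_add)
qed

lemma so_ee_neg: "l \<in> L ==> k l = - int n ==> so (ee l) = y ^ n * ee l"
proof -
 have "y ^ n = scale (Q ^ n) (ee (real n *\<^sub>R g))"
  by (induction n) (simp_all add: y_def ee_0 scale_mult_left scale_mult_right algebra_simps flip: ee_add)
 thus "l \<in> L ==> k l = - int n ==> so (ee l) = y ^ n * ee l"
  by (simp add: so_ee scale_mult_left add.commute flip: ee_add)
qed

lemma xS: "x \<in> S" and yS: "y \<in> S"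
 unfolding x_def y_def by (intro Lg_scale Lg_ee, use gL lat in \<open>simp add: lattice_def\<close>)+

lemma quot_pos: "k l = int n ==> l \<in> L ==> ((\<Sum>r<n. x ^ r) * ee l) * dnm g Q = ee l - so (ee l)"
proof -
 assume a: "k l = int n" "l \<in> L"
 have "(\<Sum>r<n. x ^ r) * ee l * (1 - x) = ((1 - x) * (\<Sum>r<n. x ^ r)) * ee l" by (simp only: ac_simps)
 also have "... = ee l - x ^ n * ee l" unfolding one_diff_power_eq[symmetric] by (simp add: left_diff_distrib)
 finally show ?thesis unfolding dnm_x so_ee_pos[OF a(2,1)] .
qed

lemma quot_neg: "k l = - int n ==> l \<in> L ==> (- (\<Sum>r<n. y ^ Suc r) * ee l) * dnm g Q = ee l - so (ee l)"
proof -
 assume a: "k l = - int n" "l \<in> L"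
 have y: "- y * (1 - x) = 1 - y" using xy by (simp add: algebra_simps)
 have "- (\<Sum>r<n. y ^ Suc r) = - y * (\<Sum>r<n. y ^ r)" by (simp add: sum_distrib_left sum_negf)
 hence "- (\<Sum>r<n. y ^ Suc r) * ee l * (1 - x) = (- y * (1 - x)) * (\<Sum>r<n. y ^ r) * ee l" by (simp only: ac_simps)
 also have "... = ee l - y ^ n * ee l" unfolding y one_diff_power_eq[symmetric] by (simp add: left_diff_distrib)
 finally show ?thesis unfolding dnm_x so_ee_neg[OF a(2,1)] .
qed

lemma Do_ee_pos: "k l = int n ==> l \<in> L ==> Do (ee l) = (\<Sum>r<n. x ^ r) * ee l"
 unfolding Dop_def lin_ext_ee by (rule exact_quot_eq[OF g0 quot_pos])

lemma Do_ee_neg: "k l = - int n ==> l \<in> L ==> Do (ee l) = - (\<Sum>r<n. y ^ Suc r) * ee l"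
 unfolding Dop_def lin_ext_ee by (rule exact_quot_eq[OF g0 quot_neg])

lemma k_cases: obtains n where "k l = int n" | n where "k l = - int n"
 by (metis int_cases2)

lemma Do_ee: "l \<in> L ==> Do (ee l) * dnm g Q = ee l - so (ee l)" and Do_ee_S: "l \<in> L ==> Do (ee l) \<in> S"
proof -
 assume l: "l \<in> L"
 have "Do (ee l) * dnm g Q = ee l - so (ee l) & Do (ee l) \<in> S"
 proof (rule k_cases[of l])
  fix n assume n: "k l = int n"
  have "(\<Sum>r<n. x ^ r) * ee l \<in> S" by (intro Lg_mult lat Lg_sum Lg_power xS Lg_ee l)
  thus ?thesis using Do_ee_pos[OF n l] quot_pos[OF n l] by simp
 next
  fix n assume n: "k l = - int n"
  have "- (\<Sum>r<n. y ^ Suc r) * ee l \<in> S" by (intro Lg_mult lat Lg_minus Lg_sum Lg_power yS Lg_ee l)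
  thus ?thesis using Do_ee_neg[OF n l] quot_neg[OF n l] by simp
 qed
 thus "Do (ee l) * dnm g Q = ee l - so (ee l)" "Do (ee l) \<in> S" by auto
qed

lemma linop_Lg: "linop F ==> (!!l. l \<in> L ==> F (ee l) \<in> S) ==> f \<in> S ==> F f \<in> S"
 by (erule Lg_induct) (auto simp: linop_0 linop_add linop_scale intro: Lg_0 Lg_add Lg_scale)

lemma so_S: "f \<in> S ==> so f \<in> S"
 by (rule linop_Lg[OF linop_so])
  (auto simp: so_ee intro!: Lg_scale Lg_ee lattice_diff lattice_int lat gL)

lemma Do_S: "f \<in> S ==> Do f \<in> S"
 by (rule linop_Lg[OF linop_Do Do_ee_S])

lemma Do_dnm: "f \<in> S ==> Do f * dnm g Q = f - so f"
proof (erule Lg_induct)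
 show "Do 0 * dnm g Q = 0 - so 0" by (simp add: linop_0 linop_so linop_Do)
next
 fix c l assume "l \<in> L"
 thus "Do (scale c (ee l)) * dnm g Q = scale c (ee l) - so (scale c (ee l))"
  by (simp add: linop_scale[OF linop_so] linop_scale[OF linop_Do] scale_mult_left Do_ee galg.scale_right_diff_distrib)
qed (simp add: linop_add[OF linop_so] linop_add[OF linop_Do] algebra_simps)

lemma so_mult: assumes "f \<in> S" "f' \<in> S" shows "so (f * f') = so f * so f'"
proof -
 have ee: "so (ee l * ee m) = so (ee l) * so (ee m)" if "l \<in> L" "m \<in> L" for l m
 proof -
  have lm: "l + m \<in> L" using lat that by (simp add: lattice_def)
  have "real_of_int (k (l + m)) = real_of_int (k l + k m)"
   unfolding of_int_add k_eq[OF lm] k_eq[OF that(1)] k_eq[OF that(2)] by (rule inner_add_left)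
  hence "k (l + m) = k l + k m" by (simp only: of_int_eq_iff)
  moreover have "Q powi (- k l - k m) = Q powi (- k l) * Q powi (- k m)"
   using power_int_add[of Q "- k l" "- k m"] Q0 by simp
  ultimately show ?thesis by (simp add: so_ee that lm scale_mult_left scale_mult_right
   algebra_simps flip: ee_add)
 qed
 have "so (ee l * f') = so (ee l) * so f'" if "l \<in> L" for l
  by (rule linop_eq[of "%f. so (ee l * f)" "%f. so (ee l) * so f", OF _ _ _ assms(2)])
   (rule linop_comp[OF linop_so linop_mult], rule linop_comp[OF linop_mult linop_so], simp add: ee that)
 note e2 = this
 from assms(1) show ?thesis
 proof (induction rule: Lg_induct)
  case zero show ?case by (simp add: linop_0[OF linop_so])
 next
  case (add f h) thus ?case by (simp add: distrib_right linop_add[OF linop_so])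
 next
  case (scale c l) thus ?case by (simp add: scale_mult_left linop_scale[OF linop_so] e2)
 qed
qed

lemma so_so: assumes "f \<in> S" shows "so (so f) = f"
proof (rule linop_eq[of "%f. so (so f)" "%f. f", OF _ _ _ assms])
 show "linop (%f. so (so f))" by (rule linop_comp[OF linop_so linop_so])
 show "linop (%f::('v, 'p) galg. f)" by (simp add: linop_def)
 fix l assume l: "l \<in> L"
 let ?m = "l - of_int (k l) *\<^sub>R g"
 have m: "?m \<in> L" by (intro lattice_diff lattice_int lat gL l)
 have e1: "?m \<cdot> g = - (l \<cdot> g)"
  unfolding inner_diff_left inner_scaleR_left g_pair using k_eq[OF l] by linarith
 have "real_of_int (k ?m) = real_of_int (- k l)"
  using e1 k_eq[OF m] k_eq[OF l] by linarith
 hence "k ?m = - k l" by (simp only: of_int_eq_iff)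
 thus "so (so (ee l)) = ee l" using Q0 by (simp add: so_ee[OF l] linop_scale[OF linop_so] so_ee[OF m] power_int_minus)
qed

text \<open>The twisted Leibniz rule. It is checked after multiplication by the denominator, which
  can be cancelled; it is the source of all cross relations with monomials.\<close>

lemma Do_mult: assumes "f \<in> S" "f' \<in> S" shows "Do (f * f') = Do f * f' + so f * Do f'"
proof (rule cancel_dnm[OF g0])
 have "f * f' \<in> S" using Lg_mult lat assms by blast
 hence "Do (f * f') * dnm g Q = f * f' - so f * so f'" using Do_dnm so_mult assms by simp
 also have "... = (f - so f) * f' + so f * (f' - so f')" by (simp add: algebra_simps)
 also have "... = (Do f * dnm g Q) * f' + so f * (Do f' * dnm g Q)" using Do_dnm assms by simp
 finally show "Do (f * f') * dnm g Q = (Do f * f' + so f * Do f') * dnm g Q" by (simp add: algebra_simps)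
qed

lemma cc_e0: "e = 0 ==> cc = scale d 1"
 unfolding cc_def by simp

lemma ccS: "cc \<in> S"
proof (cases "e = 0")
 case True thus ?thesis unfolding cc_e0[OF True] by (intro Lg_scale Lg_1 lat)
next
 case False
 hence "- ((1/2) *\<^sub>R g) \<in> L" using g2L lat unfolding lattice_def by blast
 thus ?thesis unfolding cc_def by (intro Lg_add Lg_scale Lg_1 lat Lg_ee)
qed

lemma T_S: "f \<in> S ==> T f \<in> S"
 unfolding T_eq by (intro Lg_add Lg_scale Lg_mult lat so_S Do_S ccS)

lemma T_mult: "u \<in> S ==> f \<in> S ==> T (u * f) = so u * T f + cc * Do u * f"
 unfolding T_eq so_mult Do_mult by (simp add: scale_mult_right distrib_left mult_ac)

lemma so_Do: assumes "f \<in> S" shows "so (Do f) = x * Do f" and "Do (so f) = - Do f" and "Do (Do f) = Do f"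
proof -
 have sx: "so x = y"
 proof -
  have m: "- g \<in> L" using gL lat by (simp add: lattice_def)
  have "k (- g) = -2" using g_pair by simp
  thus ?thesis using Q0 so_ee[OF m] by (simp add: x_def y_def linop_scale[OF linop_so] scaleR_2)
    (simp add: power2_eq_square)
 qed
 have s1: "so 1 = 1" using so_ee[of 0] lat by (simp add: ee_0 lattice_def)
 show 1: "so (Do f) = x * Do f"
 proof (rule cancel_dnm[OF g0])
  have "so (Do f * dnm g Q) = so f - f" using Do_dnm[OF assms] linop_diff[OF linop_so] so_so[OF assms] by simp
  moreover have "dnm g Q \<in> S" unfolding dnm_x by (intro Lg_diff Lg_1 lat xS)
  ultimately have "so (Do f) * (1 - y) = so f - f"
   using so_mult[OF Do_S[OF assms]] unfolding dnm_x by (simp add: linop_diff[OF linop_so] s1 sx)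
  hence "so (Do f) * (x * (1 - y)) = x * (so f - f)" by (metis mult.left_commute)
  moreover have "x * (1 - y) = - dnm g Q" unfolding dnm_x using xy by (simp add: algebra_simps)
  ultimately have "so (Do f) * - dnm g Q = x * (so f - f)" by simp
  hence "- (so (Do f) * dnm g Q) = - (x * (f - so f))" by (simp add: right_diff_distrib)
  hence "so (Do f) * dnm g Q = x * (f - so f)" by (simp only: neg_equal_iff_equal)
  thus "so (Do f) * dnm g Q = x * Do f * dnm g Q" using Do_dnm[OF assms] by (simp add: mult.assoc)
 qed
 show "Do (so f) = - Do f"
  by (rule cancel_dnm[OF g0, of _ Q]) (simp only: mult_minus_left Do_dnm so_S assms so_so minus_diff_eq)
 show "Do (Do f) = Do f"
 proof (rule cancel_dnm[OF g0, of _ Q])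
  have "Do (Do f) * dnm g Q = Do f - x * Do f" by (simp only: Do_dnm Do_S assms 1)
  thus "Do (Do f) * dnm g Q = Do f * dnm g Q" by (simp add: dnm_x algebra_simps)
 qed
qed

lemma cc_rel: "Do cc + so cc = scale d 1" "x * so cc = cc - scale d (1 - x)"
proof -
 have s1: "so 1 = 1" using so_ee[of 0] lat by (simp add: ee_0 lattice_def)
 have D1: "Do 1 = 0" using Do_ee_pos[of 0 0] lat by (simp add: ee_0 lattice_def)
 have "Do cc + so cc = scale d 1 & x * so cc = cc - scale d (1 - x)"
 proof (cases "e = 0")
  case True
  show ?thesis unfolding cc_e0[OF True] by (simp add: linop_scale[OF linop_so] linop_scale[OF linop_Do] s1 D1
   scale_mult_right galg.scale_right_diff_distrib)
 next
  case False
  hence Q1: "Q = 1" using e0 by blast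
  let ?m = "- ((1/2) *\<^sub>R g)"
  have m: "?m \<in> L" using g2L[OF False] lat unfolding lattice_def by blast
  have "?m \<cdot> g = real_of_int (- 1)" using g_pair by simp
  hence km: "k ?m = - 1" by (simp only: floor_of_int)
  have sm: "so (ee ?m) = y * ee ?m" using so_ee_neg[OF m, of 1] km by simp
  have Dm: "Do (ee ?m) = - y * ee ?m" using Do_ee_neg[OF _ m, of 1] km by simp
  have xm: "x * (y * ee ?m) = ee ?m" by (simp add: mult.assoc[symmetric] xy)
  have "Do cc + so cc = scale d 1"
   by (simp add: cc_def linop_add[OF linop_so] linop_add[OF linop_Do] linop_scale[OF linop_so] linop_scale[OF linop_Do]
    s1 D1 sm Dm galg.scale_minus_right)
  moreover have "x * so cc = cc - scale d (1 - x)"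
   by (simp add: cc_def linop_add[OF linop_so] linop_scale[OF linop_so] s1 sm distrib_left scale_mult_right xm
    galg.scale_right_diff_distrib)
  ultimately show ?thesis by blast
 qed
 thus "Do cc + so cc = scale d 1" "x * so cc = cc - scale d (1 - x)" by auto
qed

text \<open>The quadratic relation. Once \<open>so\<close> and \<open>Do\<close> are applied to
  \<open>T f\<close>, the factor \<open>cc\<close> enters through the two identities of
  \<open>cc_rel\<close> only; they hold for the extra term because half of \<open>g\<close> pairs to
  1 with \<open>g\<close>.\<close>

lemma T_T: assumes f: "f \<in> S" shows "T (T f) = f + scale d (T f)"
proof -
 have sT: "so (T f) = scale h f + so cc * (x * Do f)"
  unfolding T_eq by (simp add: linop_add[OF linop_so] linop_scale[OF linop_so] so_so[OF f]
   so_mult[OF ccS Do_S[OF f]] so_Do[OF f])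
 have DT: "Do (T f) = - scale h (Do f) + (Do cc + so cc) * Do f"
  unfolding T_eq by (simp add: linop_add[OF linop_Do] linop_scale[OF linop_Do] so_Do[OF f]
   Do_mult[OF ccS Do_S[OF f]] galg.scale_minus_right distrib_right)
 have xs: "so cc * (x * Do f) = cc * Do f - scale d (f - so f)"
 proof -
  have "so cc * (x * Do f) = (x * so cc) * Do f" by (simp add: algebra_simps)
  also have "... = cc * Do f - scale d (Do f * dnm g Q)" unfolding cc_rel(2) dnm_x
   unfolding left_diff_distrib[of cc] scale_mult_left mult.commute[of "1 - x"] ..
  finally show ?thesis using Do_dnm[OF f] by simp
 qed
 have "T (T f) = scale h (so (T f)) + cc * Do (T f)" by (rule T_eq)
 also have "... = scale (h * h) f + scale h (cc * Do f - scale d (f - so f))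
   + cc * (- scale h (Do f) + scale d (Do f))"
  unfolding sT DT xs cc_rel(1) by (simp add: galg.scale_right_distrib scale_1_mult)
 also have "... = scale (h * h - h * d) f + scale d (scale h (so f) + cc * Do f)"
  by (simp add: galg.scale_right_distrib galg.scale_right_diff_distrib galg.scale_left_diff_distrib
   scale_mult_right distrib_left algebra_simps del: galg.scale_scale) (simp add: mult.commute)
 also have "h * h - h * d = 1" using h0 by (simp add: algebra_simps)
 finally show ?thesis by (simp add: T_eq)
qed

definition Ti :: "('v, 'p) gop" where "Ti f = T f - scale d f"

lemma linop_Ti: "linop Ti"
 unfolding Ti_def[abs_def] linop_def
 by (simp add: linop_add[OF linop_T] linop_scale[OF linop_T] galg.scale_right_distrib
  galg.scale_right_diff_distrib galg.scale_left_commute)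

lemma Ti_S: "f \<in> S ==> Ti f \<in> S"
 unfolding Ti_def by (intro Lg_diff T_S Lg_scale)

lemma T_Ti [simp]: "f \<in> S ==> T (Ti f) = f" and Ti_T [simp]: "f \<in> S ==> Ti (T f) = f"
 unfolding Ti_def by (simp_all add: linop_diff[OF linop_T] linop_scale[OF linop_T] T_T)

lemma T_0: assumes "l \<in> L" "k l = 0" "f \<in> S" shows "T (ee l * f) = ee l * T f"
 using T_mult[OF Lg_ee[OF assms(1)] assms(3)] so_ee_pos[of l 0] Do_ee_pos[of l 0] assms by simp

lemma Ti_0: assumes "l \<in> L" "k l = 0" "f \<in> S" shows "Ti (ee l * f) = ee l * Ti f"
 unfolding Ti_def using T_0[OF assms] by (simp add: right_diff_distrib scale_mult_right)

text \<open>The cross relation for pairing 1. The reflected exponent is \<open>l - g\<close>, and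
  the term with \<open>e\<close> sits at the midpoint between it and \<open>l\<close>.\<close>

lemma Ti_1: assumes "l \<in> L" "k l = 1" "f \<in> S"
 shows "Ti (ee l * f) = scale (inverse Q) (ee (l - g)) * T f + scale e (ee (l - (1/2) *\<^sub>R g)) * f"
proof -
 have "T (ee l * f) = x * ee l * T f + cc * ee l * f"
  using T_mult[OF Lg_ee[OF assms(1)] assms(3)] so_ee_pos[of l 1] Do_ee_pos[of l 1] assms by simp
 moreover have "x * ee l = scale (inverse Q) (ee (l - g))" by (simp add: x_def scale_mult_left flip: ee_add)
 moreover have "cc * ee l = scale d (ee l) + scale e (ee (l - (1/2) *\<^sub>R g))"
  by (simp add: cc_def distrib_right scale_mult_left flip: ee_add)
 ultimately show ?thesis unfolding Ti_def
  by (simp add: distrib_right scale_mult_left)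
qed

lemma Ti_2: assumes "l \<in> L" "k l = 2" "f \<in> S" "e = 0"
 shows "Ti (ee l * f) = scale (inverse Q ^ 2) (ee (l - 2 *\<^sub>R g)) * T f + scale (d * inverse Q) (ee (l - g)) * f"
proof -
 have "Do (ee l) = ee l + x * ee l" "so (ee l) = x * x * ee l"
  using so_ee_pos[of l 2] Do_ee_pos[of l 2] assms
  by (simp_all add: power2_eq_square numeral_2_eq_2 distrib_right)
 moreover have "cc = scale d 1" using cc_e0[OF assms(4)] .
 ultimately have "T (ee l * f) = x * x * ee l * T f + scale d (ee l + x * ee l) * f"
  using T_mult[OF Lg_ee[OF assms(1)] assms(3)] by (simp add: scale_1_mult)
 moreover have "x * ee l = scale (inverse Q) (ee (l - g))" by (simp add: x_def scale_mult_left flip: ee_add)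
 moreover have "x * x * ee l = scale (inverse Q ^ 2) (ee (l - 2 *\<^sub>R g))"
  by (simp add: x_def scale_mult_left scale_mult_right power2_eq_square scaleR_2 algebra_simps flip: ee_add)
 ultimately show ?thesis unfolding Ti_def
  by (simp add: distrib_right scale_mult_left galg.scale_right_distrib)
qed

end

section \<open>Braid relations\<close>

text \<open>Monomials graded by their pairings with two roots. The braid argument only follows these
  two degrees, and it does not matter which monomial of a degree is taken.\<close>

definition Mon :: "'v::euclidean_space set => 'v => 'v => int => int => ('v, 'p::linorder) galg set" where
 "Mon L g g' a b = {scale c (ee l) | c l. l \<in> L & l \<cdot> g = of_int a & l \<cdot> g' = of_int b}"

lemma Mon_sym: "Mon L g g' a b = Mon L g' g b a"
 unfolding Mon_def by blast

lemma MonE: assumes "u \<in> Mon L g g' a b"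
 obtains c l where "u = scale c (ee l)" "l \<in> L" "l \<cdot> g = of_int a" "l \<cdot> g' = of_int b"
 using assms unfolding Mon_def by blast

lemma MonI: "l \<in> L ==> l \<cdot> g = of_int a ==> l \<cdot> g' = of_int b ==> scale c (ee l) \<in> Mon L g g' a b"
 unfolding Mon_def by blast

lemma Mon_Lg: "u \<in> Mon L g g' a b ==> u \<in> Lg L"
 unfolding Mon_def by (auto intro: Lg_scale Lg_ee)

context dl
begin

lemma Mon_0:
 assumes "u \<in> Mon L g g' 0 b" "f \<in> S"
 shows "T (u * f) = u * T f" "Ti (u * f) = u * Ti f"
proof -
 obtain c l where u: "u = scale c (ee l)" "l \<in> L" "l \<cdot> g = of_int 0" using assms(1) by (rule MonE)
 have k: "k l = 0" using u(3) by simp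
 show "T (u * f) = u * T f" "Ti (u * f) = u * Ti f"
  using T_0[OF u(2) k assms(2)] Ti_0[OF u(2) k assms(2)]
  by (simp_all add: u(1) scale_mult_left linop_scale[OF linop_T] linop_scale[OF linop_Ti])
qed

lemma half_pair:
 assumes "g \<cdot> g' = of_int N" "l \<in> L" "l \<cdot> g = 1" "l \<cdot> g' = of_int b" "e ~= 0"
  and g': "!!l. l \<in> L ==> l \<cdot> g' \<in> \<int>"
 shows "\<exists>b'. 2 * b' = 2 * b - N & scale c (ee (l - (1/2) *\<^sub>R g)) \<in> Mon L g g' 0 b'"
proof -
 have hL: "(1/2) *\<^sub>R g \<in> L" using g2L assms by blast
 then obtain m :: int where m: "((1/2) *\<^sub>R g) \<cdot> g' = of_int m" using g' Ints_cases by metis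
 have "real_of_int N = real_of_int (2 * m)" using m assms(1) by simp
 hence N: "N = 2 * m" by (simp only: of_int_eq_iff)
 have "l - (1/2) *\<^sub>R g \<in> L" by (rule lattice_diff[OF lat assms(2) hL])
 moreover have "(l - (1/2) *\<^sub>R g) \<cdot> g = of_int 0" using assms(3) g_pair by (simp add: inner_diff_left)
 moreover have "(l - (1/2) *\<^sub>R g) \<cdot> g' = of_int (b - m)" using assms(4) m unfolding inner_diff_left by simp
 ultimately have "scale c (ee (l - (1/2) *\<^sub>R g)) \<in> Mon L g g' 0 (b - m)" by (rule MonI)
 thus ?thesis using N by (intro exI[of _ "b - m"]) auto
qed

lemma Mon_1_pair:
 assumes l: "l \<in> L" "l \<cdot> g = of_int 1" "l \<cdot> g' = of_int b" and N: "g \<cdot> g' = of_int N"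
  and g': "!!l. l \<in> L ==> l \<cdot> g' \<in> \<int>"
 shows "\<exists>z. scale (c * inverse Q) (ee (l - g)) \<in> Mon L g g' (-1) (b - N) &
  (z = 0 | e ~= 0 & (\<exists>b'. 2 * b' = 2 * b - N & z \<in> Mon L g g' 0 b')) &
  (\<forall>f\<in>S. Ti (scale c (ee l) * f) = scale (c * inverse Q) (ee (l - g)) * T f + z * f)"
proof (intro exI[of _ "scale (c * e) (ee (l - (1/2) *\<^sub>R g))"] conjI)
 have k: "k l = 1" using l(2) by simp
 show "scale (c * inverse Q) (ee (l - g)) \<in> Mon L g g' (-1) (b - N)"
  by (rule MonI) (use l N gL lat g_pair in \<open>auto intro: lattice_diff simp: inner_diff_left\<close>)
 show "scale (c * e) (ee (l - (1/2) *\<^sub>R g)) = 0 | e ~= 0 &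
  (\<exists>b'. 2 * b' = 2 * b - N & scale (c * e) (ee (l - (1/2) *\<^sub>R g)) \<in> Mon L g g' 0 b')"
  using half_pair[OF N l(1) _ l(3) _ g', of "c * e"] l(2) by (cases "e = 0") auto
 show "\<forall>f\<in>S. Ti (scale c (ee l) * f) = scale (c * inverse Q) (ee (l - g)) * T f + scale (c * e) (ee (l - (1/2) *\<^sub>R g)) * f"
  using Ti_1[OF l(1) k] by (simp add: scale_mult_left linop_scale[OF linop_Ti] galg.scale_right_distrib)
qed

lemma Mon_1:
 assumes u: "u \<in> Mon L g g' 1 b" and N: "g \<cdot> g' = of_int N"
  and g': "!!l. l \<in> L ==> l \<cdot> g' \<in> \<int>"
 shows "\<exists>u'\<in>Mon L g g' (-1) (b - N). \<exists>z. (z = 0 | e ~= 0 & (\<exists>b'. 2 * b' = 2 * b - N & z \<in> Mon L g g' 0 b')) &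
  (\<forall>f\<in>S. Ti (u * f) = u' * T f + z * f)"
 using u Mon_1_pair[OF _ _ _ N g'] by (elim MonE) blast

lemma Mon_1':
 assumes u': "u' \<in> Mon L g g' (-1) b" and N: "g \<cdot> g' = of_int N"
  and g': "!!l. l \<in> L ==> l \<cdot> g' \<in> \<int>"
 shows "\<exists>u\<in>Mon L g g' 1 (b + N). \<exists>z. (z = 0 | e ~= 0 & (\<exists>b'. 2 * b' = 2 * b + N & z \<in> Mon L g g' 0 b')) &
  (\<forall>f\<in>S. Ti (u * f) = u' * T f + z * f)"
proof -
 obtain c l' where u: "u' = scale c (ee l')" "l' \<in> L" "l' \<cdot> g = of_int (-1)" "l' \<cdot> g' = of_int b"
  using u' by (rule MonE)
 have l: "l' + g \<in> L" "(l' + g) \<cdot> g = of_int 1" "(l' + g) \<cdot> g' = of_int (b + N)"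
  using u N gL lat g_pair by (auto simp: lattice_def inner_add_left)
 have e: "scale (c * Q * inverse Q) (ee (l' + g - g)) = u'" "2 * (b + N) - N = 2 * b + N" using Q0 by (simp_all add: u(1))
 show ?thesis using Mon_1_pair[OF l N g', of "c * Q", unfolded e] MonI[OF l, of "c * Q"] by blast
qed

lemma Mon_2:
 assumes u: "u \<in> Mon L g g' 2 b" and N: "g \<cdot> g' = of_int N" and e: "e = 0"
 shows "\<exists>u'\<in>Mon L g g' (-2) (b - 2 * N). \<exists>z\<in>Mon L g g' 0 (b - N). \<forall>f\<in>S. Ti (u * f) = u' * T f + z * f"
proof -
 obtain c l where u: "u = scale c (ee l)" "l \<in> L" "l \<cdot> g = of_int 2" "l \<cdot> g' = of_int b"
  using u by (rule MonE)
 have k: "k l = 2" using u(3) by simp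
 have g2: "2 *\<^sub>R g \<in> L" using lattice_int[OF lat gL, of 2] by simp
 let ?u' = "scale (c * inverse Q ^ 2) (ee (l - 2 *\<^sub>R g))" and ?z = "scale (c * (d * inverse Q)) (ee (l - g))"
 have "?u' \<in> Mon L g g' (-2) (b - 2 * N)" "?z \<in> Mon L g g' 0 (b - N)"
  by (rule MonI; use u N g2 gL lat g_pair in \<open>auto intro: lattice_diff simp: inner_diff_left\<close>)+
 moreover have "\<forall>f\<in>S. Ti (u * f) = ?u' * T f + ?z * f"
  using Ti_2[OF u(2) k _ e] by (simp add: u(1) scale_mult_left linop_scale[OF linop_Ti] galg.scale_right_distrib)
 ultimately show ?thesis by blast
qed

lemma Mon_2':
 assumes u': "u' \<in> Mon L g g' (-2) b" and N: "g \<cdot> g' = of_int N" and e: "e = 0"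
 shows "\<exists>u\<in>Mon L g g' 2 (b + 2 * N). \<exists>z\<in>Mon L g g' 0 (b + N). \<forall>f\<in>S. Ti (u * f) = u' * T f + z * f"
proof -
 obtain c l' where u: "u' = scale c (ee l')" "l' \<in> L" "l' \<cdot> g = of_int (-2)" "l' \<cdot> g' = of_int b"
  using u' by (rule MonE)
 have g2: "2 *\<^sub>R g \<in> L" using lattice_int[OF lat gL, of 2] by simp
 define l where "l = l' + 2 *\<^sub>R g"
 have l: "l \<in> L" "l \<cdot> g = of_int 2" "l \<cdot> g' = of_int (b + 2 * N)"
  using u N g2 lat g_pair by (auto simp: l_def lattice_def inner_add_left)
 have k: "k l = 2" using l(2) by simp
 let ?u = "scale (c * Q ^ 2) (ee l)" and ?z = "scale (c * Q ^ 2 * (d * inverse Q)) (ee (l - g))"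
 have "?u \<in> Mon L g g' 2 (b + 2 * N)" by (rule MonI[OF l])
 moreover have "?z \<in> Mon L g g' 0 (b + N)"
  by (rule MonI) (use l N gL lat g_pair in \<open>auto intro: lattice_diff simp: inner_diff_left\<close>)
 moreover have "\<forall>f\<in>S. Ti (?u * f) = u' * T f + ?z * f"
  using Ti_2[OF l(1) k _ e] Q0
  by (simp add: u(1) l_def scale_mult_left linop_scale[OF linop_Ti] galg.scale_right_distrib flip: power_mult_distrib)
 ultimately show ?thesis by blast
qed

end

section \<open>Rank two braid relations by closure under monomials\<close>

definition isoS :: "('v::euclidean_space, 'p::linorder) galg set => ('v, 'p) gop => ('v, 'p) gop => bool" where
 "isoS S F G \<longleftrightarrow> linop F & linop G & (\<forall>f\<in>S. F f \<in> S & G f \<in> S & F (G f) = f & G (F f) = f)"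

lemma isoS_comp: "isoS S F F' ==> isoS S G G' ==> isoS S (%f. F (G f)) (%f. G' (F' f))"
 unfolding isoS_def by (auto intro: linop_comp)

lemma isoS_D: "isoS S F G ==> f \<in> S ==> F f \<in> S" "isoS S F G ==> f \<in> S ==> G f \<in> S"
 "isoS S F G ==> f \<in> S ==> F (G f) = f" "isoS S F G ==> f \<in> S ==> G (F f) = f"
 by (auto simp: isoS_def)

text \<open>\<open>P\<close> and \<open>P'\<close> play the two sides of a braid relation, and
  \<open>T P' = P U\<close> moves a letter from the left end to the right end. As \<open>T\<close>
  and \<open>U\<close> have the same correction \<open>d\<close> in their inverses, agreement of the
  inverse words at \<open>v\<close> passes to \<open>Ti v\<close>.\<close>

lemma V0_stable:
 assumes T: "isoS S T Ti" and U: "isoS S U Ui" and P: "isoS S P Pj" and P': "isoS S P' Pj'"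
  and rel: "!!f. f \<in> S ==> T (P' f) = P (U f)"
  and d: "!!f. Ti f = T f - scale d f" "!!f. Ui f = U f - scale d f"
  and v: "v \<in> S" "Pj v = Pj' v"
 shows "Pj (Ti v) = Pj' (Ti v)"
proof -
 have S: "Pj v \<in> S" "Pj' v \<in> S" using isoS_D[OF P] isoS_D[OF P'] v(1) by auto
 have 1: "Pj (T v) = U (Pj' v)"
 proof -
  have "T v = P (U (Pj' v))" using rel[OF S(2)] isoS_D(3)[OF P' v(1)] by simp
  thus ?thesis using isoS_D(4)[OF P] isoS_D(1)[OF U S(2)] by simp
 qed
 have 2: "Pj' (Ti v) = Ui (Pj v)"
 proof -
  have uS: "Ui (Pj v) \<in> S" using isoS_D[OF U] S by blast
  have "T (P' (Ui (Pj v))) = v" using rel[OF uS] isoS_D(3)[OF U S(1)] isoS_D(3)[OF P v(1)] by simp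
  hence "P' (Ui (Pj v)) = Ti v" using isoS_D(4)[OF T isoS_D(1)[OF P' uS]] by simp
  thus ?thesis using isoS_D(4)[OF P' uS] by simp
 qed
 have "Pj (Ti v) = U (Pj' v) - scale d (Pj v)"
  unfolding d using P 1 by (simp add: isoS_def linop_diff linop_scale)
 thus ?thesis using 2 d v(2) by simp
qed

text \<open>\<open>surj\<close> wants a lattice with every pair of pairings. Weights can fail this
  (on weights of B2 the pairings with two orthogonal short roots have equal parity), so the locale
  is used with a larger lattice and the results are restricted to weights.\<close>

locale dl2 = d1: dl g1 Q1 h1 e1 L + d2: dl g2 Q2 h2 e2 L
 for g1 :: "'v::euclidean_space" and Q1 h1 e1 :: "'p::linorder qtfield" and L
  and g2 and Q2 h2 e2 :: "'p qtfield" +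
 fixes N12 N21 :: int
 assumes N12: "g1 \<cdot> g2 = of_int N12" and N21: "g2 \<cdot> g1 = of_int N21"
  and surj: "!!a b::int. \<exists>l\<in>L. l \<cdot> g1 = of_int a & l \<cdot> g2 = of_int b"
begin

abbreviation "S \<equiv> Lg L :: ('v, 'p) galg set"
abbreviation "T1 \<equiv> DL g1 Q1 h1 e1"
abbreviation "T2 \<equiv> DL g2 Q2 h2 e2"
abbreviation "Ti1 \<equiv> d1.Ti"
abbreviation "Ti2 \<equiv> d2.Ti"
abbreviation "M \<equiv> Mon L g1 g2 :: int => int => ('v, 'p) galg set"

lemma iso1: "isoS S T1 Ti1" and iso2: "isoS S T2 Ti2"
 unfolding isoS_def using d1.linop_T d1.linop_Ti d1.T_S d1.Ti_S d2.linop_T d2.linop_Ti d2.T_S d2.Ti_S by auto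

lemma Ti1_T1: "Ti1 f = T1 f - scale (h1 - inverse h1) f" and Ti2_T2: "Ti2 f = T2 f - scale (h2 - inverse h2) f"
 by (simp_all add: d1.Ti_def d2.Ti_def)

definition stable :: "('v, 'p) galg set => bool" where
 "stable V \<longleftrightarrow> V \<subseteq> S & 1 \<in> V & (\<forall>f\<in>V. \<forall>f'\<in>V. f + f' \<in> V) & (\<forall>f\<in>V. \<forall>c. scale c f \<in> V) &
   (\<forall>f\<in>V. Ti1 f \<in> V & Ti2 f \<in> V)"

definition good :: "('v, 'p) galg set => int => int => bool" where
 "good V a b \<longleftrightarrow> (\<forall>u\<in>M a b. \<forall>v\<in>V. u * v \<in> V)"

lemma stable_D: assumes "stable V" "f \<in> V"
 shows "f \<in> S" "Ti1 f \<in> V" "Ti2 f \<in> V" "T1 f \<in> V" "T2 f \<in> V" "f' \<in> V ==> f - f' \<in> V"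
proof -
 show "f \<in> S" "Ti1 f \<in> V" "Ti2 f \<in> V" using assms unfolding stable_def by auto
 have "T1 f = Ti1 f + scale (h1 - inverse h1) f" "T2 f = Ti2 f + scale (h2 - inverse h2) f"
  by (simp_all add: Ti1_T1 Ti2_T2)
 thus "T1 f \<in> V" "T2 f \<in> V" using assms unfolding stable_def by metis+
 have "f - f' = f + scale (-1) f'" by simp
 thus "f' \<in> V ==> f - f' \<in> V" using assms unfolding stable_def by metis
qed

text \<open>\<open>surj\<close> splits a monomial whose degree is a sum into factors of the two
  degrees.\<close>

lemma good_add: assumes "good V a b" "good V a' b'" shows "good V (a + a') (b + b')"
 unfolding good_def
proof (intro ballI)
 fix u v assume u: "u \<in> M (a + a') (b + b')" and v: "v \<in> V"
 obtain c l where l: "u = scale c (ee l)" "l \<in> L" "l \<cdot> g1 = of_int (a + a')" "l \<cdot> g2 = of_int (b + b')"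
  using u by (rule MonE)
 obtain m where m: "m \<in> L" "m \<cdot> g1 = of_int a" "m \<cdot> g2 = of_int b" using surj by blast
 have 1: "scale c (ee m) \<in> M a b" by (rule MonI[OF m])
 have "scale 1 (ee (l - m)) \<in> M a' b'"
  by (rule MonI) (use l m d1.lat in \<open>auto intro: lattice_diff simp: inner_diff_left\<close>)
 hence "scale 1 (ee (l - m)) * v \<in> V" using assms(2) v unfolding good_def by blast
 hence "scale c (ee m) * (scale 1 (ee (l - m)) * v) \<in> V" using assms(1) 1 unfolding good_def by blast
 moreover have "scale c (ee m) * (scale 1 (ee (l - m)) * v) = u * v"
  by (simp add: l(1) scale_mult_left mult.assoc[symmetric] flip: ee_add)
 ultimately show "u * v \<in> V" by simp
qed

lemma swap: "dl2 g2 Q2 h2 e2 L g1 Q1 h1 e1 N21 N12"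
 by (intro dl2.intro dl2_axioms.intro d1.dl_axioms d2.dl_axioms N12 N21) (use surj in blast)

text \<open>A stable space contains 1, so it is everything once it is closed under monomials of all
  degrees, and these are generated by the unit degrees and their negatives.\<close>

lemma good_all:
 assumes st: "stable V" and g: "good V 1 0" "good V (-1) 0" "good V 0 1" "good V 0 (-1)" and z: "good V 0 0"
 shows "V = S"
proof -
 have A: "good V a 0" for a
 proof (induction a rule: int_induct[of _ 0])
  case (step1 i) thus ?case using good_add[OF step1(2) g(1)] by simp
 next
  case (step2 i) thus ?case using good_add[OF step2(2) g(2)] by simp
 qed (rule z)
 have B: "good V 0 b" for b
 proof (induction b rule: int_induct[of _ 0])
  case (step1 i) thus ?case using good_add[OF step1(2) g(3)] by simp
 next
  case (step2 i) thus ?case using good_add[OF step2(2) g(4)] by simp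
 qed (rule z)
 have "good V a b" for a b using good_add[OF A[of a] B[of b]] by simp
 hence e: "scale c (ee l) \<in> V" if lL: "l \<in> L" for c l
 proof -
  obtain a where a: "l \<cdot> g1 = of_int a" using d1.pair[OF lL] by (auto elim: Ints_cases)
  obtain b where b: "l \<cdot> g2 = of_int b" using d2.pair[OF lL] by (auto elim: Ints_cases)
  have "scale c (ee l) * 1 \<in> V" using \<open>!!b a. good V a b\<close>[of a b] MonI[OF lL a b] st unfolding good_def stable_def by blast
  thus ?thesis by simp
 qed
 have "f \<in> V" if "f \<in> S" for f using that
 proof (induction rule: Lg_induct)
  case zero
  have "0 \<in> L" using d1.lat by (simp add: lattice_def)
  from e[OF this, of 0] show ?case by simp
 next
  case (add f g) thus ?case using st by (simp add: stable_def)
 next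
  case (scale c l) thus ?case using e by blast
 qed
 thus ?thesis using st by (auto simp: stable_def)
qed

text \<open>The cross relation, solved for \<open>u' * v\<close>, expresses multiplication in the
  reflected degree through multiplication in degree (1, b) and \<open>Ti1\<close>. The condition on
  \<open>b\<close> puts a nonzero correction \<open>z\<close> into degree (0, 0).\<close>

lemma good_s1:
 assumes st: "stable V" and g: "good V 1 b" and z: "good V 0 0" and b: "e1 = 0 | 2 * b = N12"
 shows "good V (-1) (b - N12)"
 unfolding good_def
proof (intro ballI)
 fix u' v assume u': "u' \<in> M (-1) (b - N12)" and v: "v \<in> V"
 obtain u z where u: "u \<in> M 1 b" and zz: "z = 0 | e1 ~= 0 & (\<exists>b'. 2 * b' = 2 * (b - N12) + N12 & z \<in> M 0 b')"
  and r: "\<forall>f\<in>S. Ti1 (u * f) = u' * T1 f + z * f"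
  using d1.Mon_1'[OF u' N12 d2.pair] by auto
 have w: "Ti1 v \<in> V" using stable_D(2)[OF st v] .
 have "Ti1 (u * Ti1 v) \<in> V" using g u w stable_D(2)[OF st] unfolding good_def by blast
 moreover have "z * Ti1 v \<in> V"
 proof (cases "z = 0")
  case True
  have "scale 0 v \<in> V" using st v unfolding stable_def by blast
  thus ?thesis using True by simp
 next
  case False
  then obtain b' where b': "2 * b' = 2 * (b - N12) + N12" "z \<in> M 0 b'" "e1 ~= 0" using zz by blast
  hence "b' = 0" using b by auto
  thus ?thesis using z b' w unfolding good_def by blast
 qed
 moreover have "u' * v = Ti1 (u * Ti1 v) - z * Ti1 v"
  using r stable_D(1)[OF st w] stable_D(1)[OF st v] by simp
 ultimately show "u' * v \<in> V" using stable_D(6)[OF st] by metis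
qed

lemma good_s1_2:
 assumes st: "stable V" and g: "good V 2 b" and z: "good V 0 0" and b: "e1 = 0" "b = N12"
 shows "good V (-2) (b - 2 * N12)"
 unfolding good_def
proof (intro ballI)
 fix u' v assume u': "u' \<in> M (-2) (b - 2 * N12)" and v: "v \<in> V"
 obtain u z where u: "u \<in> M 2 b" and zz: "z \<in> M 0 0"
  and r: "\<forall>f\<in>S. Ti1 (u * f) = u' * T1 f + z * f"
  using d1.Mon_2'[OF u' N12 b(1)] b(2) by auto
 have w: "Ti1 v \<in> V" using stable_D(2)[OF st v] .
 have "Ti1 (u * Ti1 v) \<in> V" "z * Ti1 v \<in> V" using g u w z zz stable_D(2)[OF st] unfolding good_def by blast+
 moreover have "u' * v = Ti1 (u * Ti1 v) - z * Ti1 v"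
  using r stable_D(1)[OF st w] stable_D(1)[OF st v] by simp
 ultimately show "u' * v \<in> V" using stable_D(6)[OF st] by metis
qed

lemma good_s2:
 assumes "stable V" "good V a 1" "good V 0 0" "e2 = 0 | 2 * a = N21"
 shows "good V (a - N21) (-1)"
 using dl2.good_s1[OF swap, of V a] assms
 unfolding dl2.stable_def[OF swap] dl2.good_def[OF swap] stable_def good_def Mon_sym[of L g2 g1] by auto

text \<open>The subspace on which the two sides of a braid relation agree. It is stable under both
 operators, so it suffices to see that it is closed under multiplication by enough monomials.\<close>

definition V0 :: "('v, 'p) gop => ('v, 'p) gop => ('v, 'p) galg set" where
 "V0 Pj Pj' = {v \<in> S. Pj v = Pj' v}"

lemma V0_eq: assumes P: "isoS S P Pj" "isoS S P' Pj'" and st: "stable (V0 Pj Pj')"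
 and inv: "!!f. f \<in> V0 Pj Pj' ==> P' f \<in> V0 Pj Pj'" and f: "f \<in> V0 Pj Pj'"
 shows "P f = P' f"
proof -
 have fS: "f \<in> S" "P' f \<in> S" using f isoS_D[OF P(2)] by (auto simp: V0_def)
 have "Pj (P' f) = f" using inv[OF f] isoS_D(4)[OF P(2) fS(1)] by (simp add: V0_def)
 thus ?thesis using isoS_D(3)[OF P(1) fS(2)] by simp
qed

lemma T_one: "T1 1 = scale h1 1" "T2 1 = scale h2 1"
proof -
 have z: "0 \<in> L" using d1.lat by (simp add: lattice_def)
 have "d1.so 1 = 1" "d1.Do 1 = 0" "d2.so 1 = 1" "d2.Do 1 = 0"
  using d1.so_ee_pos[OF z, of 0] d1.Do_ee_pos[of 0 0] d2.so_ee_pos[OF z, of 0] d2.Do_ee_pos[of 0 0] z by (simp_all add: ee_0)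
 thus "T1 1 = scale h1 1" "T2 1 = scale h2 1" by (simp_all add: d1.T_eq d2.T_eq)
qed

lemma Ti_one: "Ti1 1 = scale (inverse h1) 1" "Ti2 1 = scale (inverse h2) 1"
 unfolding Ti1_T1 Ti2_T2 T_one by (simp_all flip: galg.scale_left_diff_distrib)

lemma S1: "1 \<in> S" by (rule Lg_1[OF d1.lat])

lemma V0_stableI:
 assumes P: "isoS S P Pj" "isoS S P' Pj'" and one: "Pj 1 = Pj' 1"
  and 1: "!!v. v \<in> S ==> Pj v = Pj' v ==> Pj (Ti1 v) = Pj' (Ti1 v)"
  and 2: "!!v. v \<in> S ==> Pj v = Pj' v ==> Pj (Ti2 v) = Pj' (Ti2 v)"
 shows "stable (V0 Pj Pj')"
 unfolding stable_def V0_def using one 1 2 S1 isoS_D(2)[OF iso1] isoS_D(2)[OF iso2] P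
 by (auto simp: isoS_def linop_add linop_scale intro: Lg_add Lg_scale)

lemma M00: "u \<in> M 0 0 ==> f \<in> S ==> Ti1 (u * f) = u * Ti1 f & Ti2 (u * f) = u * Ti2 f"
 using d1.Mon_0(2)[of u g2 0 f] d2.Mon_0(2)[of u g1 0 f] unfolding Mon_sym[of L g2 g1 0 0] by blast

lemmas iso_simps = isoS_D[OF iso1] isoS_D[OF iso2]

lemma MS: "u \<in> M a b ==> f \<in> S ==> u * f \<in> S"
 using Mon_Lg Lg_mult d1.lat by blast

lemma step1: assumes "u \<in> M 1 b" "e1 = 0"
 shows "\<exists>u'\<in>M (-1) (b - N12). \<forall>f\<in>S. Ti1 (u * f) = u' * T1 f"
 using d1.Mon_1[OF assms(1) N12 d2.pair] assms(2) by fastforce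

lemma step1z: assumes "u \<in> M 1 b" "2 * b = N12"
 shows "\<exists>u'\<in>M (-1) (- b). \<exists>z. (z = 0 | z \<in> M 0 0) & (\<forall>f\<in>S. Ti1 (u * f) = u' * T1 f + z * f)"
proof -
 obtain u' z where u: "u' \<in> M (-1) (b - N12)" "z = 0 | e1 ~= 0 & (\<exists>b'. 2 * b' = 2 * b - N12 & z \<in> M 0 b')"
  "\<forall>f\<in>S. Ti1 (u * f) = u' * T1 f + z * f"
  using d1.Mon_1[OF assms(1) N12 d2.pair] by auto
 have "b - N12 = - b" using assms by simp
 moreover have "z = 0 | z \<in> M 0 0" using u(2) assms(2) by auto
 ultimately show ?thesis using u by auto
qed

lemma step2: assumes "u \<in> M a 1" "e2 = 0"
 shows "\<exists>u'\<in>M (a - N21) (-1). \<forall>f\<in>S. Ti2 (u * f) = u' * T2 f"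
 using dl2.step1[OF swap, of u a] assms unfolding Mon_sym[of L g2 g1] by blast

lemma step2z: assumes "u \<in> M a 1" "2 * a = N21"
 shows "\<exists>u'\<in>M (- a) (-1). \<exists>z. (z = 0 | z \<in> M 0 0) & (\<forall>f\<in>S. Ti2 (u * f) = u' * T2 f + z * f)"
 using dl2.step1z[OF swap, of u a] assms unfolding Mon_sym[of L g2 g1] by blast

lemma zero_M00: "z = 0 | z \<in> M 0 0 ==> f \<in> S ==> Ti1 (z * f) = z * Ti1 f & Ti2 (z * f) = z * Ti2 f"
 using M00 d1.linop_Ti d2.linop_Ti by (auto simp: linop_0)

lemma Ti_add: "Ti1 (f + f') = Ti1 f + Ti1 f'" "Ti2 (f + f') = Ti2 f + Ti2 f'"
 using d1.linop_Ti d2.linop_Ti by (simp_all add: linop_add)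

lemma comm0_1: "u \<in> M 0 b ==> f \<in> S ==> Ti1 (u * f) = u * Ti1 f"
 using d1.Mon_0(2) by blast

lemma comm0_2: "u \<in> M a 0 ==> f \<in> S ==> Ti2 (u * f) = u * Ti2 f"
 unfolding Mon_sym[of L g1 g2 a 0] by (rule d2.Mon_0(2))

lemma V0_goodI:
 assumes "!!u v. u \<in> M a b ==> v \<in> V0 Pj Pj' ==> v \<in> S ==> Pj (u * v) = Pj' (u * v)"
 shows "good (V0 Pj Pj') a b"
 using assms MS by (auto simp: good_def V0_def)

text \<open>What the four braid relations share. Agreement of the inverse words is stable under both
  generators by \<open>V0_stable\<close>; as \<open>P'\<close> preserves every stable space,
  agreement passes from the inverses to \<open>P\<close> and \<open>P'\<close>.\<close>

lemma braid_base:
 assumes P: "isoS S P Pj" "isoS S P' Pj'" and one: "Pj 1 = Pj' 1"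
  and U: "isoS S U1 U1i" "!!f. U1i f = U1 f - scale (h1 - inverse h1) f" "!!f. T1 (P' f) = P (U1 f)"
   "isoS S U2 U2i" "!!f. U2i f = U2 f - scale (h2 - inverse h2) f" "!!f. T2 (P f) = P' (U2 f)"
  and inv: "\<forall>V. stable V --> (\<forall>f\<in>V. P' f \<in> V)"
  and M: "\<forall>u\<in>M 0 0. \<forall>f\<in>S. Pj (u * f) = u * Pj f & Pj' (u * f) = u * Pj' f"
 shows "stable (V0 Pj Pj')" "good (V0 Pj Pj') 0 0" "!!v. v \<in> V0 Pj Pj' ==> P v = P' v"
proof -
 show st: "stable (V0 Pj Pj')"
 proof (rule V0_stableI[OF P one])
  show "Pj (Ti1 v) = Pj' (Ti1 v)" if "v \<in> S" "Pj v = Pj' v" for v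
   by (rule V0_stable[OF iso1 U(1) P U(3) Ti1_T1 U(2) that])
  show "Pj (Ti2 v) = Pj' (Ti2 v)" if "v \<in> S" "Pj v = Pj' v" for v
   using V0_stable[OF iso2 U(4) P(2,1) U(6) Ti2_T2 U(5) that(1) that(2)[symmetric]] by simp
 qed
 show "P v = P' v" if "v \<in> V0 Pj Pj'" for v using V0_eq[OF P st _ that] inv st by blast
 show "good (V0 Pj Pj') 0 0" by (rule V0_goodI) (use M in \<open>auto simp: V0_def\<close>)
qed

text \<open>Closure under degree (1, 0) only; degree (0, 1) follows by exchanging the two
  roots.\<close>

lemma braid2_half:
 assumes N: "N12 = 0" "N21 = 0"
 defines "V \<equiv> V0 (%f. Ti2 (Ti1 f)) (%f. Ti1 (Ti2 f))"
 shows "stable V" "good V 0 0" "good V 1 0" "!!v. v \<in> V ==> T1 (T2 v) = T2 (T1 v)"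
proof -
 note B = braid_base[OF isoS_comp[OF iso1 iso2] isoS_comp[OF iso2 iso1] _ iso1 Ti1_T1 refl iso2 Ti2_T2 refl, folded V_def]
 have o: "Ti2 (Ti1 1) = Ti1 (Ti2 1)" by (simp add: Ti_one linop_scale d1.linop_Ti d2.linop_Ti mult.commute)
 have i: "\<forall>V. stable V --> (\<forall>f\<in>V. T2 (T1 f) \<in> V)" by (intro allI impI ballI) (simp add: stable_D)
 have m: "\<forall>u\<in>M 0 0. \<forall>f\<in>S. Ti2 (Ti1 (u * f)) = u * Ti2 (Ti1 f) & Ti1 (Ti2 (u * f)) = u * Ti1 (Ti2 f)"
  using M00 iso_simps by simp
 show st: "stable V" and "good V 0 0" and eq: "!!v. v \<in> V ==> T1 (T2 v) = T2 (T1 v)" using B[OF o i m] by blast+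
 show "good V 1 0" unfolding V_def
 proof (rule V0_goodI, fold V_def)
  fix u v assume u: "u \<in> M 1 0" and v: "v \<in> V" and vS: "v \<in> S"
  obtain u' z where u': "u' \<in> M (-1) 0" "z = 0 | z \<in> M 0 0" "\<forall>f\<in>S. Ti1 (u * f) = u' * T1 f + z * f"
   using step1z[OF u] N by auto
  have "Ti2 (T1 v) = T1 (Ti2 v)" using arg_cong[OF eq[OF stable_D(3)[OF st v]], of Ti2] vS iso_simps by simp
  thus "Ti2 (Ti1 (u * v)) = Ti1 (Ti2 (u * v))"
   using u'(3) vS zero_M00[OF u'(2)] comm0_2[OF u'(1)] comm0_2[OF u] iso_simps by (simp add: Ti_add)
 qed
qed

lemma braid2:
 assumes N: "N12 = 0" "N21 = 0" and f: "f \<in> S"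
 shows "T1 (T2 f) = T2 (T1 f)"
proof -
 let ?V = "V0 (%f. Ti2 (Ti1 f)) (%f. Ti1 (Ti2 f))"
 note B = braid2_half[OF N]
 have "dl2.V0 L (%f. Ti1 (Ti2 f)) (%f. Ti2 (Ti1 f)) = ?V" unfolding V0_def dl2.V0_def[OF swap] by auto
 hence g2: "good ?V 0 1"
  using dl2.braid2_half(3)[OF swap N(2,1)] unfolding good_def dl2.good_def[OF swap] Mon_sym[of L g2 g1] by simp
 have "good ?V (-1) 0" "good ?V 0 (-1)" using good_s1[OF B(1,3,2)] good_s2[OF B(1) g2 B(2)] N by simp_all
 hence "?V = S" using good_all[OF B(1,3) _ g2 _ B(2)] by blast
 thus ?thesis using B(4) f by blast
qed

text \<open>The degrees (0, 1), (1, -1), (-1, 0) are the orbit of a minuscule weight of A2. Moving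
  such a monomial to the left through either inverse word leaves the last monomial times a mixed
  word applied to \<open>v\<close>, and the two mixed words agree because the space is
  stable.\<close>

lemma braid3:
 assumes N: "N12 = -1" "N21 = -1" and e: "e1 = 0" "e2 = 0" and h: "h1 = h2" and f: "f \<in> S"
 shows "T1 (T2 (T1 f)) = T2 (T1 (T2 f))"
proof -
 let ?Pi = "%f. Ti1 (Ti2 (Ti1 f))" and ?Pi' = "%f. Ti2 (Ti1 (Ti2 f))"
 let ?V = "V0 ?Pi ?Pi'"
 note P = isoS_comp[OF iso1 isoS_comp[OF iso2 iso1]] isoS_comp[OF iso2 isoS_comp[OF iso1 iso2]]
 have d: "Ti2 f = T2 f - scale (h1 - inverse h1) f" "Ti1 f = T1 f - scale (h2 - inverse h2) f" for f
  using Ti1_T1 Ti2_T2 h by auto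
 have o: "?Pi 1 = ?Pi' 1" by (simp add: Ti_one linop_scale d1.linop_Ti d2.linop_Ti) (simp add: h)
 have i: "\<forall>V. stable V --> (\<forall>f\<in>V. T2 (T1 (T2 f)) \<in> V)" by (intro allI impI ballI) (simp add: stable_D)
 have m: "\<forall>u\<in>M 0 0. \<forall>f\<in>S. ?Pi (u * f) = u * ?Pi f & ?Pi' (u * f) = u * ?Pi' f"
  using M00 iso_simps by simp
 note B = braid_base[OF P o iso2 d(1) refl iso1 d(2) refl i m]
 have g2: "good ?V 0 1"
 proof (rule V0_goodI)
  fix u v assume u: "u \<in> M 0 1" and v: "v \<in> ?V" and vS: "v \<in> S"
  obtain u1 where u1: "u1 \<in> M 1 (-1)" "\<forall>f\<in>S. Ti2 (u * f) = u1 * T2 f" using step2[OF u e(2)] N by auto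
  obtain u2 where u2: "u2 \<in> M (-1) 0" "\<forall>f\<in>S. Ti1 (u1 * f) = u2 * T1 f" using step1[OF u1(1) e(1)] N by auto
  have "T1 (T2 (Ti1 v)) = Ti2 (T1 (T2 v))"
   using arg_cong[OF B(3)[OF stable_D(2)[OF B(1) v]], of Ti2] vS iso_simps by simp
  thus "?Pi (u * v) = ?Pi' (u * v)"
   using comm0_1[OF u vS] u1(2) u2(2) vS iso_simps comm0_2[OF u2(1)] by simp
 qed
 have "good ?V 1 (-1)" using good_s2[OF B(1) g2 B(2)] N e by simp
 moreover have "good ?V (-1) 0" using good_s1[OF B(1) calculation B(2)] N e by simp
 ultimately have "?V = S"
  using good_all[OF B(1) _ _ g2 _ B(2)] good_add[OF g2, of 1 "-1"] good_add[of ?V 1 "-1" "-1" 0] by simp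
 thus ?thesis using B(3) f by blast
qed

text \<open>Here the orbit is (1, 0), (-1, 1), (1, -1), (-1, 0), of type B2. If \<open>e2\<close> is
  nonzero, the middle step produces a correction, but its degree is (0, 0), so it commutes with both
  generators.\<close>

lemma braid4:
 assumes N: "N12 = -1" "N21 = -2" and e: "e1 = 0" and f: "f \<in> S"
 shows "T1 (T2 (T1 (T2 f))) = T2 (T1 (T2 (T1 f)))"
proof -
 let ?Pi = "%f. Ti2 (Ti1 (Ti2 (Ti1 f)))" and ?Pi' = "%f. Ti1 (Ti2 (Ti1 (Ti2 f)))"
 let ?V = "V0 ?Pi ?Pi'"
 note P = isoS_comp[OF isoS_comp[OF iso1 iso2] isoS_comp[OF iso1 iso2]] isoS_comp[OF isoS_comp[OF iso2 iso1] isoS_comp[OF iso2 iso1]]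
 have o: "?Pi 1 = ?Pi' 1" by (simp add: Ti_one linop_scale d1.linop_Ti d2.linop_Ti mult_ac)
 have i: "\<forall>V. stable V --> (\<forall>f\<in>V. T2 (T1 (T2 (T1 f))) \<in> V)" by (intro allI impI ballI) (simp add: stable_D)
 have m: "\<forall>u\<in>M 0 0. \<forall>f\<in>S. ?Pi (u * f) = u * ?Pi f & ?Pi' (u * f) = u * ?Pi' f"
  using M00 iso_simps by simp
 note B = braid_base[OF P o iso1 Ti1_T1 refl iso2 Ti2_T2 refl i m]
 have g1: "good ?V 1 0"
 proof (rule V0_goodI)
  fix u v assume u: "u \<in> M 1 0" and v: "v \<in> ?V" and vS: "v \<in> S"
  obtain u1 where u1: "u1 \<in> M (-1) 1" "\<forall>f\<in>S. Ti1 (u * f) = u1 * T1 f" using step1[OF u e] N by auto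
  obtain u2 z where u2: "u2 \<in> M 1 (-1)" "z = 0 | z \<in> M 0 0" "\<forall>f\<in>S. Ti2 (u1 * f) = u2 * T2 f + z * f"
   using step2z[OF u1(1)] N by auto
  obtain u3 where u3: "u3 \<in> M (-1) 0" "\<forall>f\<in>S. Ti1 (u2 * f) = u3 * T1 f" using step1[OF u2(1) e] N by auto
  have "Ti2 (T1 (T2 (T1 v))) = T1 (T2 (T1 (Ti2 v)))"
   using arg_cong[OF B(3)[OF stable_D(3)[OF B(1) v]], of Ti2] vS iso_simps by simp
  thus "?Pi (u * v) = ?Pi' (u * v)"
   using u1(2) u2(3) u3(2) vS zero_M00[OF u2(2)] comm0_2[OF u3(1)] comm0_2[OF u] iso_simps by (simp add: Ti_add)
 qed
 have a: "good ?V (-1) 1" using good_s1[OF B(1) g1 B(2)] N e by simp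
 have b: "good ?V 1 (-1)" using good_s2[OF B(1) a B(2)] N by simp
 have c: "good ?V (-1) 0" using good_s1[OF B(1) b B(2)] N e by simp
 have "?V = S" using good_all[OF B(1) g1 c _ _ B(2)] good_add[OF g1 a] good_add[OF b c] by simp
 thus ?thesis using B(3) f by blast
qed

lemma step1_2: assumes "u \<in> M 2 b" "e1 = 0" "b = N12"
 shows "\<exists>u'\<in>M (-2) (- b). \<exists>z\<in>M 0 0. \<forall>f\<in>S. Ti1 (u * f) = u' * T1 f + z * f"
 using d1.Mon_2[OF assms(1) N12 assms(2)] assms(3) by auto

text \<open>The six degrees met are the short roots of G2, nonzero weights of the seven-dimensional
  representation. The one step with pairing 2 produces a correction of degree (0, 0), the zero
  weight of that representation.\<close>

lemma braid6:
 assumes N: "N12 = -1" "N21 = -3" and e: "e1 = 0" "e2 = 0" and f: "f \<in> S"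
 shows "T1 (T2 (T1 (T2 (T1 (T2 f))))) = T2 (T1 (T2 (T1 (T2 (T1 f)))))"
proof -
 let ?Pi = "%f. Ti2 (Ti1 (Ti2 (Ti1 (Ti2 (Ti1 f)))))" and ?Pi' = "%f. Ti1 (Ti2 (Ti1 (Ti2 (Ti1 (Ti2 f)))))"
 let ?V = "V0 ?Pi ?Pi'"
 note P = isoS_comp[OF isoS_comp[OF iso1 iso2] isoS_comp[OF isoS_comp[OF iso1 iso2] isoS_comp[OF iso1 iso2]]]
  isoS_comp[OF isoS_comp[OF iso2 iso1] isoS_comp[OF isoS_comp[OF iso2 iso1] isoS_comp[OF iso2 iso1]]]
 have o: "?Pi 1 = ?Pi' 1" by (simp add: Ti_one linop_scale d1.linop_Ti d2.linop_Ti mult_ac)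
 have i: "\<forall>V. stable V --> (\<forall>f\<in>V. T2 (T1 (T2 (T1 (T2 (T1 f))))) \<in> V)" by (intro allI impI ballI) (simp add: stable_D)
 have m: "\<forall>u\<in>M 0 0. \<forall>f\<in>S. ?Pi (u * f) = u * ?Pi f & ?Pi' (u * f) = u * ?Pi' f"
  using M00 iso_simps by simp
 note B = braid_base[OF P o iso1 Ti1_T1 refl iso2 Ti2_T2 refl i m]
 have g1: "good ?V 1 0"
 proof (rule V0_goodI)
  fix u v assume u: "u \<in> M 1 0" and v: "v \<in> ?V" and vS: "v \<in> S"
  obtain u1 where u1: "u1 \<in> M (-1) 1" "\<forall>f\<in>S. Ti1 (u * f) = u1 * T1 f" using step1[OF u e(1)] N by auto
  obtain u2 where u2: "u2 \<in> M 2 (-1)" "\<forall>f\<in>S. Ti2 (u1 * f) = u2 * T2 f" using step2[OF u1(1) e(2)] N by auto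
  obtain u3 z where u3: "u3 \<in> M (-2) 1" "z \<in> M 0 0" "\<forall>f\<in>S. Ti1 (u2 * f) = u3 * T1 f + z * f"
   using step1_2[OF u2(1) e(1)] N by auto
  obtain u4 where u4: "u4 \<in> M 1 (-1)" "\<forall>f\<in>S. Ti2 (u3 * f) = u4 * T2 f" using step2[OF u3(1) e(2)] N by auto
  obtain u5 where u5: "u5 \<in> M (-1) 0" "\<forall>f\<in>S. Ti1 (u4 * f) = u5 * T1 f" using step1[OF u4(1) e(1)] N by auto
  have "Ti2 (T1 (T2 (T1 (T2 (T1 v))))) = T1 (T2 (T1 (T2 (T1 (Ti2 v)))))"
   using arg_cong[OF B(3)[OF stable_D(3)[OF B(1) v]], of Ti2] vS iso_simps by simp
  thus "?Pi (u * v) = ?Pi' (u * v)"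
   using u1(2) u2(2) u3(3) u4(2) u5(2) vS M00[OF u3(2)] comm0_2[OF u5(1)] comm0_2[OF u] iso_simps by (simp add: Ti_add)
 qed
 have a: "good ?V (-1) 1" using good_s1[OF B(1) g1 B(2)] N e by simp
 have b: "good ?V 2 (-1)" using good_s2[OF B(1) a B(2)] N e by simp
 have c: "good ?V (-2) 1" using good_s1_2[OF B(1) b B(2)] N e by simp
 have d: "good ?V 1 (-1)" using good_s2[OF B(1) c B(2)] N e by simp
 have f': "good ?V (-1) 0" using good_s1[OF B(1) d B(2)] N e by simp
 have "?V = S" using good_all[OF B(1) g1 f' _ _ B(2)] good_add[OF g1 a] good_add[OF d f'] by simp
 thus ?thesis using B(3) f by blast
qed

end

lemma qroot_nz: "qroot ~= 0"
 unfolding qroot_def Zero_fract_def by (subst eq_fract(1)) simp_all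

lemma single_nz: "single k (1::'a::zero_neq_one) ~= 0"
 by (metis lookup_single_eq lookup_zero zero_neq_one)

lemma of_tfield_eq_0: "of_tfield c = 0 \<longleftrightarrow> c = 0"
 by (simp add: of_tfield_def Zero_fract_def eq_fract)

lemma sqrt_param_nz: "sqrt_param p ~= 0"
 unfolding sqrt_param_def of_tfield_eq_0 by (simp add: Zero_fract_def eq_fract single_nz)

context mac
begin

section \<open>The operators of the two affine Hecke algebras\<close>

text \<open>The root whose exponential stands in the denominator of the operator. It is
  \<open>rt i\<close> or its double, hence two Cartan matrices have to be kept apart below.\<close>

definition gg :: "nat => 'v" where
 "gg i = (if i = 0 then - theta D else if 2 *\<^sub>R al i \<in> R then 2 *\<^sub>R al i else al i)"

definition QQ :: "nat => 'p qtfield" where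
 "QQ i = (if i = 0 then inverse (qpow D 1) else 1)"

definition hh :: "nat => 'p qtfield" where
 "hh i = (if i = 0 then if reduced D then t0_half D else 1 else t_half D i)"

definition uu :: "nat => 'p qtfield" where
 "uu i = (if i ~= 0 & 2 *\<^sub>R al i \<in> R then t03_half D - inverse (t03_half D) else 0)"

definition dd :: "nat => 'p qtfield" where "dd i = hh i - inverse (hh i)"

definition TT :: "nat => ('v, 'p) galg => ('v, 'p) galg" where
 "TT i = (if i = 0 then T01 D else T_fin_gen D i)"

abbreviation "wt \<equiv> wt_alg D"
abbreviation "P \<equiv> weights D"

lemma wt_Lg: "wt = Lg P"
 by (simp add: wt_alg_def Lg_def)

lemma qpow_nz: "qpow D r ~= 0"
 by (simp add: qpow_def qroot_nz)

lemma qpow_int: "qpow D (of_int k) = qpow D 1 powi k"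
proof -
 have "\<lfloor>real (denom D) * real_of_int k\<rfloor> = int (denom D) * k"
  by (metis floor_of_int of_int_mult of_int_of_nat_eq)
 moreover have "\<lfloor>real (denom D) * 1\<rfloor> = int (denom D)" by simp
 ultimately show ?thesis unfolding qpow_def by (simp only: power_int_mult)
qed

lemma hh_nz: "hh i ~= 0"
 by (simp add: hh_def t0_half_def t_half_def sqrt_param_nz)

lemma gg_R: "i \<in> aix ==> gg i \<in> R"
 using theta_R al_R by (auto simp: gg_def aix_eq)

lemma c0_pos: "c0 D > 0" by (simp add: c0_def)

lemma gg_rt: "\<exists>m. (m = 1 | m = 2) & gg i = m *\<^sub>R rt i"
 by (auto simp: gg_def rt_def theta_eq c0_def)

lemma coroot_theta: "coroot (theta D) = (1 / real (c0 D)) *\<^sub>R theta D"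
 using coroot_bt by (simp add: theta_eq coroot_scaleR)

text \<open>Stated for all exponents that pair integrally with \<open>gg i\<close>, because the rank
  two argument runs in a lattice larger than the weights.\<close>

lemma TT_DL:
 assumes i: "i \<in> aix" and f: "keys f \<subseteq> {l. l \<cdot> gg i \<in> \<int>}"
 shows "TT i f = DL (gg i) (QQ i) (hh i) (uu i) f"
proof -
 have lin: "linop (DL (gg i) (QQ i) (hh i) (uu i))"
  unfolding DL_def[abs_def] sop_def Dop_def
  by (intro linop_plus linop_scaleop linop_lin_ext linop_comp[OF linop_mult linop_lin_ext])
 have "\<exists>F. TT i = lin_ext F" unfolding TT_def T01_def T_fin_gen_def by auto
 then obtain F where F: "TT i = lin_ext F" by blast
 have "lin_ext F f = DL (gg i) (QQ i) (hh i) (uu i) f"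
 proof (rule linop_eq[OF linop_lin_ext lin, of "{l. l \<cdot> gg i \<in> \<int>}"])
  show "f \<in> Lg {l. l \<cdot> gg i \<in> \<int>}" using f by (simp add: Lg_def)
  fix l assume "l \<in> {l. l \<cdot> gg i \<in> \<int>}"
  then obtain k :: int where k: "l \<cdot> gg i = of_int k" by (auto elim: Ints_cases)
  show "lin_ext F (ee l) = DL (gg i) (QQ i) (hh i) (uu i) (ee l)"
  proof (cases "i = 0")
   case True
   have k0: "l \<cdot> theta D = - of_int k" using k True by (simp add: gg_def)
   hence k1: "(l \<bullet> theta D) / real (c0 D) = - of_int k" by (simp add: coroot_theta field_simps)
   have r: "reflection (gg i) l = s_theta D l" using True by (simp add: gg_def s_theta_def reflection_minus)
   have q: "inverse (qpow D 1) powi (- k) = qpow D (- ((l \<bullet> theta D) / real (c0 D)))"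
    unfolding k1 by (simp add: qpow_int power_int_minus power_int_inverse)
   have so: "sop (gg i) (QQ i) (ee l) = ee_delta D (s_theta D l) ((l \<bullet> theta D) / real (c0 D))"
    unfolding sop_def lin_ext_ee k r ee_delta_def using True q by (simp add: QQ_def)
   show ?thesis
   proof (cases "reduced D")
    case red: True
    have c: "c0 D = 1" using red by (simp add: c0_def)
    have dn: "dnm (gg i) (QQ i) = 1 - ee_delta D ((1 / real (c0 D)) *\<^sub>R theta D) (- (1 / real (c0 D)))"
     using True by (simp add: dnm_def gg_def QQ_def ee_delta_def c)
    show ?thesis unfolding DL_def Dop_def lin_ext_ee so dn F[symmetric] using True red
     by (simp add: TT_def T01_def lin_ext_ee Let_def hh_def uu_def scale_1_mult)
   next
    case red: False
    show ?thesis unfolding DL_def so F[symmetric] using True red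
     by (simp add: TT_def T01_def lin_ext_ee Let_def hh_def uu_def)
   qed
  next
   case False
   have so: "sop (gg i) (QQ i) (ee l) = ee (weyl_gen D i l)"
    unfolding sop_def lin_ext_ee using False
    by (simp add: QQ_def gg_def weyl_gen_def reflection_scaleR)
   show ?thesis unfolding DL_def Dop_def lin_ext_ee so F[symmetric] using False
    by (simp add: TT_def T_fin_gen_def lin_ext_ee Let_def hh_def uu_def dnm_def QQ_def gg_def scale_1_mult)
  qed
 qed
 thus ?thesis using F by simp
qed

lemma lattice_P: "lattice P"
 unfolding lattice_def using weights_0 weights_add weights_minus by blast

lemma half_gg: "uu i ~= 0 ==> (1/2) *\<^sub>R gg i = al i"
 by (auto simp: uu_def gg_def split: if_splits)

lemma uu_ix: "uu i ~= 0 ==> i ~= 0 & 2 *\<^sub>R al i \<in> R"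
 by (auto simp: uu_def split: if_splits)

lemma dl_ij:
 assumes i: "i \<in> aix" and L: "lattice L" "R \<subseteq> L" "!!l. l \<in> L ==> l \<cdot> gg i \<in> \<int>"
 shows "dl (gg i) (QQ i) (hh i) (uu i) L"
proof
 show "gg i ~= 0" using gg_R i root_nonzero by blast
 show "QQ i ~= 0" by (simp add: QQ_def qpow_nz)
 show "uu i = 0 | QQ i = 1" by (simp add: uu_def QQ_def)
 show "gg i \<in> L" using gg_R i L by blast
 show "(1/2) *\<^sub>R gg i \<in> L" if "uu i ~= 0"
  using half_gg[OF that] uu_ix[OF that] al_R i L by (auto simp: aix_eq)
qed (use hh_nz L in auto)

lemma dl_P: "i \<in> aix ==> dl (gg i) (QQ i) (hh i) (uu i) P"
 using dl_ij[of i P] lattice_P R_weights gg_R by (auto simp: weights_def)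

lemma TT_DL_wt: "i \<in> aix ==> f \<in> wt ==> TT i f = DL (gg i) (QQ i) (hh i) (uu i) f"
 using TT_DL[of i f] gg_R by (auto simp: wt_alg_def weights_def subset_iff)

lemma linop_TT: "linop (TT i)"
 unfolding TT_def T01_def T_fin_gen_def by (simp add: linop_lin_ext)

lemma TT_wt: "i \<in> aix ==> f \<in> wt ==> TT i f \<in> wt"
 using dl.T_S[OF dl_P] TT_DL_wt wt_Lg by simp

definition TTi :: "nat => ('v, 'p) galg => ('v, 'p) galg" where
 "TTi i f = TT i f - scale (dd i) f"

lemma TTi_dl: "i \<in> aix ==> f \<in> wt ==> TTi i f = dl.Ti (gg i) (QQ i) (hh i) (uu i) f"
 by (simp add: TTi_def TT_DL_wt dl.Ti_def[OF dl_P] dd_def)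

lemma linop_TTi: "linop (TTi i)"
 unfolding TTi_def[abs_def] linop_def
 by (simp add: linop_add[OF linop_TT] linop_scale[OF linop_TT] galg.scale_right_distrib
  galg.scale_right_diff_distrib mult.commute)

lemma iso_TT: "i \<in> aix ==> isoS wt (TT i) (TTi i)"
 unfolding isoS_def
proof (intro conjI ballI linop_TT linop_TTi)
 assume i: "i \<in> aix"
 fix f assume f: "f \<in> wt"
 interpret dl "gg i" "QQ i" "hh i" "uu i" P by (rule dl_P[OF i])
 have fS: "f \<in> S" using f wt_Lg by simp
 show "TT i f \<in> wt" "TTi i f \<in> wt"
  unfolding TT_DL_wt[OF i f] TTi_dl[OF i f] wt_Lg by (rule T_S[OF fS], rule Ti_S[OF fS])
 have w: "DL (gg i) (QQ i) (hh i) (uu i) f \<in> wt" "Ti f \<in> wt"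
  unfolding wt_Lg by (rule T_S[OF fS], rule Ti_S[OF fS])
 show "TT i (TTi i f) = f" "TTi i (TT i f) = f"
  unfolding TTi_dl[OF i f] TT_DL_wt[OF i f] TT_DL_wt[OF i w(2)] TTi_dl[OF i w(1)] using fS by simp_all
qed

subsection \<open>Braid relations for the affine Weyl group\<close>

text \<open>Negated Cartan integers of the affine simple roots, so that they are nonnegative off the
  diagonal.\<close>

definition cc :: "nat => nat => real" where "cc i j = - (rt i \<cdot> rt j)"

lemma A_rt: "A j (x - t *\<^sub>R rt i) = A j x + t * cc i j"
 by (simp add: A_def cc_def inner_diff_left)

lemma cc_self: "i \<in> aix ==> cc i i = -2"
 using inner_coroot_self[of "rt i"] rt_nonzero[of i] by (simp add: cc_def)

lemma desc_sig:
 assumes ij: "i \<in> aix" "j \<in> aix"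
  and c: "cc i j = 0 & cc j i = 0 & w = [i, j] |
   cc i j = 1 & cc j i = 1 & w = [i, j, i] |
   (cc i j = 1 & cc j i = 2 | cc i j = 2 & cc j i = 1) & w = [i, j, i, j] |
   (cc i j = 1 & cc j i = 3 | cc i j = 3 & cc j i = 1) & w = [i, j, i, j, i, j]"
  and x: "A i x < 0" "A j x < 0"
 shows "desc w x"
 using c x by (elim disjE conjE) (simp_all add: s_eq[OF ij(1)] s_eq[OF ij(2)] A_rt cc_self[OF ij(1)] cc_self[OF ij(2)])

lemma word_sig:
 assumes ij: "i \<in> aix" "j \<in> aix"
 shows "cc i j = 0 ==> cc j i = 0 ==> wd [i, j] = wd [j, i]"
  and "cc i j = 1 ==> cc j i = 1 ==> wd [i, j, i] = wd [j, i, j]"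
  and "cc i j = 1 & cc j i = 2 | cc i j = 2 & cc j i = 1 ==> wd [i, j, i, j] = wd [j, i, j, i]"
  and "cc i j = 1 & cc j i = 3 | cc i j = 3 & cc j i = 1 ==> wd [i, j, i, j, i, j] = wd [j, i, j, i, j, i]"
proof -
 note sim = s_eq[OF ij(1)] s_eq[OF ij(2)] A_rt cc_self[OF ij(1)] cc_self[OF ij(2)] word_prod_Cons word_prod_Nil comp_apply id_apply
 note alg = algebra_simps scaleR_add_left[symmetric] scaleR_scaleR[symmetric]
 show "cc i j = 0 ==> cc j i = 0 ==> wd [i, j] = wd [j, i]"
  by (rule ext) (simp only: sim, simp add: algebra_simps)
 show "cc i j = 1 ==> cc j i = 1 ==> wd [i, j, i] = wd [j, i, j]"
  by (rule ext) (simp only: sim, simp add: algebra_simps)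
 show "cc i j = 1 & cc j i = 2 | cc i j = 2 & cc j i = 1 ==> wd [i, j, i, j] = wd [j, i, j, i]"
  by (elim disjE conjE; rule ext) (simp only: sim, simp add: algebra_simps)+
 show "cc i j = 1 & cc j i = 3 | cc i j = 3 & cc j i = 1 ==> wd [i, j, i, j, i, j] = wd [j, i, j, i, j, i]"
  by (elim disjE conjE; rule ext) (simp only: sim, simp add: algebra_simps)+
qed

lemma rt_ix: "i \<in> ix ==> rt i = al i" and rt_0: "rt 0 = - bt" and ix_nz: "i \<in> ix ==> i ~= 0"
 by (auto simp: rt_def fin_ix_def)

lemma rt_inner_nonpos: assumes "i \<in> aix" "j \<in> aix" "i ~= j" shows "rt i \<bullet> rt j <= 0"
proof -
 have "bt \<bullet> al k >= 0" if "k \<in> ix" for k using bt_dom that by (simp add: dominant_def)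
 thus ?thesis using assms al_inner_nonpos by (auto simp: rt_def aix_eq inner_commute)
qed

text \<open>Distinct finite simple roots are independent. If \<open>bt\<close> is a multiple of
  \<open>al k\<close>, it is a positive one, and then \<open>A 0 x < 0\<close> and
  \<open>A k x < 0\<close> contradict each other.\<close>

lemma rt_parallel:
 assumes ij: "i \<in> aix" "j \<in> aix" "i ~= j" and par: "rt i = c *\<^sub>R rt j" and x: "A i x < 0" "A j x < 0"
 shows False
proof -
 have ne: "al a ~= c *\<^sub>R al b" if "a \<in> ix" "b \<in> ix" "a ~= b" for a b c
 proof
  assume "al a = c *\<^sub>R al b"
  hence "fw a \<bullet> al a = c * (fw a \<bullet> al b)" by simp
  thus False using fw_inner that by simp
 qed
 have key: False if k: "k \<in> ix" and p: "bt = c *\<^sub>R al k" and x: "A 0 x < 0" "A k x < 0" for k c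
 proof -
  have "bt \<bullet> fw k > 0" using dominant_full_support[OF bt_R bt_dom k] .
  hence c: "c > 0" using p fw_inner[OF k k] by (simp add: inner_commute)
  have "x \<bullet> al k < 0" using x(2) A_fin[OF k] root_sq_pos[OF al_R[OF k]] by (simp add: coroot_def mult_less_0_iff divide_less_0_iff)
  hence "x \<bullet> bt < 0" using p c by (simp add: mult_pos_neg)
  hence "x \<bullet> theta D < 0" using c0_pos by (simp add: theta_eq mult_pos_neg)
  thus False using x(1) A_0 by simp
 qed
 consider "i = 0" "j \<in> ix" | "j = 0" "i \<in> ix" | "i \<in> ix" "j \<in> ix" using ij by (auto simp: aix_eq)
 thus False
 proof cases
  case 1
  have "- bt = c *\<^sub>R al j" using par 1(1) rt_ix[OF 1(2)] rt_0 by simp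
  hence "- (- bt) = - (c *\<^sub>R al j)" by (rule arg_cong)
  hence "bt = (- c) *\<^sub>R al j" by simp
  from key[OF 1(2) this] x 1(1) show ?thesis by blast
 next
  case 2
  hence e: "al i = - (c *\<^sub>R bt)" using par rt_ix[OF 2(2)] rt_0 2(1) by simp
  hence "c ~= 0" using root_nonzero[OF al_R[OF 2(2)]] by auto
  hence "bt = (- (1 / c)) *\<^sub>R al i" using e by simp
  from key[OF 2(2) this] x 2(1) show ?thesis by blast
 next
  case 3 thus ?thesis using ne[of i j c] par ij rt_ix by simp
 qed
qed

lemma uu_even: assumes "i \<in> aix" "j \<in> aix" "uu i ~= 0" shows "\<exists>k::int. gg i \<cdot> gg j = of_int (2 * k)"
proof -
 have "al i \<cdot> gg j \<in> \<int>" using int_R gg_R al_R assms uu_ix by (auto simp: aix_eq)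
 then obtain k :: int where k: "al i \<cdot> gg j = of_int k" using Ints_cases by blast
 have "gg i = 2 *\<^sub>R al i" using uu_ix[OF assms(3)] by (simp add: gg_def)
 thus ?thesis using k by (intro exI[of _ k]) simp
qed

text \<open>Pairings -1 in both directions force equal lengths, hence equal parameters. A doubled
  root has only even pairings and therefore takes no part in such a bond.\<close>

lemma hh_equal:
 assumes "i \<in> aix" "j \<in> aix" and N: "gg i \<cdot> gg j = -1" "gg j \<cdot> gg i = -1"
 shows "uu i = 0" "uu j = 0" "hh i = hh j"
proof -
 have odd: "real_of_int (2 * k) ~= -1" for k
 proof
  assume "real_of_int (2 * k) = -1"
  hence "2 * k = -1" by linarith
  thus False by presburger
 qed
 show u: "uu i = 0" "uu j = 0" using uu_even assms odd by metis+
 have "gg i \<bullet> gg j = - (gg j \<bullet> gg j) / 2" "gg i \<bullet> gg j = - (gg i \<bullet> gg i) / 2"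
  using N root_sq_pos[OF gg_R[OF assms(1)]] root_sq_pos[OF gg_R[OF assms(2)]]
  by (simp_all add: coroot_def field_simps inner_commute)
 hence sq: "gg i \<bullet> gg i = gg j \<bullet> gg j" by simp
 have z: "reduced D" if za: "a \<in> aix" "gg 0 \<cdot> gg a = -1" for a
 proof (rule ccontr)
  assume nr: "~ reduced D"
  obtain k :: int where k: "bt \<cdot> gg a = of_int k" using bt_coroot_int[OF gg_R[OF za(1)]] by blast
  have "gg 0 \<cdot> gg a = of_int (2 * (- k))" using nr k by (simp add: gg_def theta_eq c0_def)
  thus False using odd za(2) by metis
 qed
 have t0: "hh 0 = hh a" if "a \<in> ix" "uu a = 0" "gg a \<bullet> gg a = gg 0 \<bullet> gg 0" "reduced D" for a
 proof -
  have "gg 0 \<bullet> gg 0 = 2" using that(4) Sh_sq[OF bt_Sh] msq_red by (simp add: gg_def theta_eq c0_def)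
  moreover have "2 *\<^sub>R al a \<notin> R" using that(1,4) al_R unfolding reduced_roots_def by fastforce
  ultimately show ?thesis using that by (auto simp: hh_def t0_half_def t_half_def gg_def)
 qed
 have fin: "hh i = hh j" if "i \<in> ix" "j \<in> ix"
 proof -
  have d: "2 *\<^sub>R al a \<in> R ==> gg a \<bullet> gg a = 4 & al a \<bullet> al a = 1" if "a \<in> ix" for a
  proof -
   assume a2: "2 *\<^sub>R al a \<in> R"
   have nr: "~ reduced D" using a2 that al_R unfolding reduced_roots_def by fastforce
   thus ?thesis using double_sq[OF nr al_R[OF that] a2] a2 ix_nz[OF that] by (simp add: gg_def)
  qed
  have n: "gg a = al a" if "2 *\<^sub>R al a \<notin> R" "a \<in> ix" for a using that ix_nz[of a] by (simp add: gg_def)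
  have nn: "~ (2 *\<^sub>R al a \<in> R & gg a \<cdot> gg b = -1)" if ab: "a \<in> ix" "b \<in> aix" for a b
  proof
   assume a2: "2 *\<^sub>R al a \<in> R & gg a \<cdot> gg b = -1"
   obtain k :: int where "al a \<cdot> gg b = of_int k" using int_R[OF gg_R[OF ab(2)] al_R[OF ab(1)]] Ints_cases by blast
   moreover have "gg a = 2 *\<^sub>R al a" using a2 ix_nz[OF ab(1)] by (simp add: gg_def)
   ultimately have "gg a \<cdot> gg b = of_int (2 * k)" by simp
   thus False using a2 odd by metis
  qed
  show ?thesis using nn[of i j] nn[of j i] n[of i] n[of j] that assms N sq by (auto simp: hh_def t_half_def)
 qed
 show "hh i = hh j"
 proof (cases "i = 0 | j = 0")
  case True
  show ?thesis
  proof (cases "i = j")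
   case False
   thus ?thesis using True t0[of i] t0[of j] z[of i] z[of j] assms sq u by (auto simp: aix_eq)
  qed simp
 qed (use fin assms in \<open>auto simp: aix_eq\<close>)
qed

lemma small_pairs:
 fixes a b :: int
 assumes "a >= 0" "b >= 0" "a = 0 \<longleftrightarrow> b = 0" "a * b < 4"
 shows "a = 0 & b = 0 | a = 1 & b = 1 | a = 1 & b = 2 | a = 2 & b = 1 | a = 1 & b = 3 | a = 3 & b = 1"
proof (cases "a = 0")
 case False
 hence ab: "a >= 1" "b >= 1" using assms by auto
 have "a <= a * b" "b <= a * b" using ab by auto
 hence "a < 4" "b < 4" using assms(4) by linarith+
 hence "a \<in> {1, 2, 3}" "b \<in> {1, 2, 3}" using ab by auto
 thus ?thesis using assms(4) by auto
qed (use assms in auto)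

text \<open>One Cartan matrix belongs to the roots \<open>gg\<close> in the operators, the other to
  the walls \<open>rt\<close>. Both have the same product of off-diagonal entries, but doubling a
  root may transpose a double bond, hence the disjunctions.\<close>

lemma rank2_cases:
 assumes ij: "i \<in> aix" "j \<in> aix" "i ~= j" and x: "A i x < 0" "A j x < 0"
 obtains (m2) "gg i \<cdot> gg j = 0" "gg j \<cdot> gg i = 0" "cc i j = 0" "cc j i = 0"
 | (m3) "gg i \<cdot> gg j = -1" "gg j \<cdot> gg i = -1" "cc i j = 1" "cc j i = 1"
 | (m4) "gg i \<cdot> gg j = -1 & gg j \<cdot> gg i = -2 | gg i \<cdot> gg j = -2 & gg j \<cdot> gg i = -1"
   "cc i j = 1 & cc j i = 2 | cc i j = 2 & cc j i = 1"
 | (m6) "gg i \<cdot> gg j = -1 & gg j \<cdot> gg i = -3 | gg i \<cdot> gg j = -3 & gg j \<cdot> gg i = -1"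
   "cc i j = 1 & cc j i = 3 | cc i j = 3 & cc j i = 1"
proof -
 obtain mi where mi: "mi = 1 | mi = (2::real)" "gg i = mi *\<^sub>R rt i" using gg_rt by metis
 obtain mj where mj: "mj = 1 | mj = (2::real)" "gg j = mj *\<^sub>R rt j" using gg_rt by metis
 have pos: "rt i \<bullet> rt i > 0" "rt j \<bullet> rt j > 0" using root_sq_pos rt_R ij by auto
 have le: "rt i \<bullet> rt j <= 0" using rt_inner_nonpos ij by blast
 obtain a where a: "cc i j = of_int a" using int_R[OF rt_R[OF ij(2)] rt_R[OF ij(1)]] unfolding cc_def
  by (metis Ints_cases of_int_minus)
 obtain b where b: "cc j i = of_int b" using int_R[OF rt_R[OF ij(1)] rt_R[OF ij(2)]] unfolding cc_def
  by (metis Ints_cases of_int_minus)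
 have ca: "cc i j = - 2 * (rt i \<bullet> rt j) / (rt j \<bullet> rt j)" "cc j i = - 2 * (rt i \<bullet> rt j) / (rt i \<bullet> rt i)"
  by (simp_all add: cc_def coroot_def inner_commute)
 have nn: "cc i j >= 0" "cc j i >= 0" "cc i j = 0 \<longleftrightarrow> cc j i = 0"
  unfolding ca using le pos by (auto intro!: divide_nonneg_pos simp: divide_le_0_iff)
 \<comment> \<open>Strict Cauchy-Schwarz: the part of \<open>rt i\<close> orthogonal to
   \<open>rt j\<close> is nonzero, as the walls are not parallel.\<close>
 have lt: "cc i j * cc j i < 4"
 proof -
  let ?v = "rt i - (rt i \<bullet> rt j / (rt j \<bullet> rt j)) *\<^sub>R rt j"
  have "?v ~= 0" using rt_parallel[OF ij _ x, of "rt i \<bullet> rt j / (rt j \<bullet> rt j)"] by auto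
  hence "?v \<bullet> ?v > 0" by simp
  also have "?v \<bullet> ?v = rt i \<bullet> rt i - (rt i \<bullet> rt j) ^ 2 / (rt j \<bullet> rt j)"
   using pos by (simp add: inner_diff inner_commute power2_eq_square field_simps)
  finally have "(rt i \<bullet> rt j) ^ 2 < (rt i \<bullet> rt i) * (rt j \<bullet> rt j)" using pos by (simp add: field_simps)
  thus ?thesis unfolding ca using pos by (simp add: field_simps power2_eq_square)
 qed
 have "a >= 0" "b >= 0" "a = 0 \<longleftrightarrow> b = 0" using nn unfolding a b by auto
 moreover have "real_of_int (a * b) < real_of_int 4" using lt unfolding a b by simp
 hence "a * b < 4" by (simp only: of_int_less_iff)
 ultimately have ab: "a = 0 & b = 0 | a = 1 & b = 1 | a = 1 & b = 2 | a = 2 & b = 1 | a = 1 & b = 3 | a = 3 & b = 1"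
  by (rule small_pairs)
 obtain a' where a': "gg i \<cdot> gg j = of_int a'" using int_R[OF gg_R[OF ij(2)] gg_R[OF ij(1)]] Ints_cases by blast
 obtain b' where b': "gg j \<cdot> gg i = of_int b'" using int_R[OF gg_R[OF ij(1)] gg_R[OF ij(2)]] Ints_cases by blast
 have ga: "of_int a' = - (mi / mj) * of_int a" and gb: "of_int b' = - (mj / mi) * of_int b"
  unfolding a'[symmetric] b'[symmetric] a[symmetric] b[symmetric] cc_def mi(2) mj(2) coroot_scaleR by simp_all
 have nn': "- a' >= 0" "- b' >= 0" "- a' = 0 \<longleftrightarrow> - b' = 0"
 proof -
  have "real_of_int a' <= 0" "real_of_int b' <= 0" unfolding ga gb using nn mi(1) mj(1) unfolding a b by auto
  thus "- a' >= 0" "- b' >= 0" by auto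
  have "real_of_int a' = 0 \<longleftrightarrow> real_of_int b' = 0" unfolding ga gb using nn(3) mi(1) mj(1) unfolding a b by auto
  thus "- a' = 0 \<longleftrightarrow> - b' = 0" by simp
 qed
 have "real_of_int (a' * b') = real_of_int (a * b)" unfolding of_int_mult ga gb using mi(1) mj(1) by auto
 hence pr: "(- a') * (- b') = a * b" by (simp only: of_int_eq_iff minus_mult_minus)
 have "- a' = 0 & - b' = 0 | - a' = 1 & - b' = 1 | - a' = 1 & - b' = 2 | - a' = 2 & - b' = 1
   | - a' = 1 & - b' = 3 | - a' = 3 & - b' = 1"
  using small_pairs[OF nn'] pr \<open>a * b < 4\<close> by simp
 hence ab': "a' = 0 & b' = 0 | a' = -1 & b' = -1 | a' = -1 & b' = -2 | a' = -2 & b' = -1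
   | a' = -1 & b' = -3 | a' = -3 & b' = -1" by auto
 show ?thesis
  using ab ab' pr m2 m3 m4 m6 unfolding a b a' b' by (elim disjE conjE) simp_all
qed

lemma lattice_L: "lattice {l. l \<cdot> a \<in> \<int> & l \<cdot> b \<in> \<int>}"
 unfolding lattice_def by (auto simp: inner_add_left)

lemma dl2_ij:
 assumes ij: "i \<in> aix" "j \<in> aix"
  and N: "gg i \<cdot> gg j = of_int N12" "gg j \<cdot> gg i = of_int N21" "N12 * N21 ~= 4"
 shows "dl2 (gg i) (QQ i) (hh i) (uu i) {l. l \<cdot> gg i \<in> \<int> & l \<cdot> gg j \<in> \<int>}
  (gg j) (QQ j) (hh j) (uu j) N12 N21"
  (is "dl2 _ _ _ _ ?L _ _ _ _ _ _")
proof (intro dl2.intro dl2_axioms.intro N)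
 have RL: "R \<subseteq> ?L" using int_R gg_R ij by auto
 show "dl (gg i) (QQ i) (hh i) (uu i) ?L" by (rule dl_ij[OF ij(1) lattice_L RL]) simp
 show "dl (gg j) (QQ j) (hh j) (uu j) ?L" by (rule dl_ij[OF ij(2) lattice_L RL]) simp
 fix a b :: int
 define de where "de = 4 - real_of_int N12 * real_of_int N21"
 have "real_of_int (N12 * N21) ~= real_of_int 4" using N(3) by (simp only: of_int_eq_iff not_False_eq_True)
 hence de: "de ~= 0" by (simp add: de_def)
 \<comment> \<open>Cramer's rule for the two prescribed pairings; the determinant \<open>de\<close>
   is nonzero because the product of the Cartan entries is not 4.\<close>
 define l where "l = ((2 * of_int a - of_int N21 * of_int b) / de) *\<^sub>R gg i + ((2 * of_int b - of_int N12 * of_int a) / de) *\<^sub>R gg j"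
 have self: "gg i \<cdot> gg i = 2" "gg j \<cdot> gg j = 2" using inner_coroot_self root_nonzero gg_R ij by auto
 have "l \<cdot> gg i = ((2 * of_int a - of_int N21 * of_int b) / de) * 2 + ((2 * of_int b - of_int N12 * of_int a) / de) * of_int N21"
  by (simp add: l_def inner_add_left self N)
 also have "... = (of_int a * de) / de" by (simp add: de_def algebra_simps add_divide_distrib[symmetric] diff_divide_distrib[symmetric])
 finally have 1: "l \<cdot> gg i = of_int a" using de by simp
 have "l \<cdot> gg j = ((2 * of_int a - of_int N21 * of_int b) / de) * of_int N12 + ((2 * of_int b - of_int N12 * of_int a) / de) * 2"
  by (simp add: l_def inner_add_left self N)
 also have "... = (of_int b * de) / de" by (simp add: de_def algebra_simps add_divide_distrib[symmetric] diff_divide_distrib[symmetric])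
 finally have 2: "l \<cdot> gg j = of_int b" using de by simp
 show "\<exists>l\<in>?L. l \<cdot> gg i = of_int a & l \<cdot> gg j = of_int b"
  using 1 2 by (intro bexI[of _ l]) auto
qed

lemma rank2_braid:
 assumes ij: "i \<in> aix" "j \<in> aix" "i ~= j" and f: "f \<in> wt"
 shows "gg i \<cdot> gg j = 0 ==> gg j \<cdot> gg i = 0 ==> TT i (TT j f) = TT j (TT i f)"
  and "gg i \<cdot> gg j = -1 ==> gg j \<cdot> gg i = -1 ==> TT i (TT j (TT i f)) = TT j (TT i (TT j f))"
  and "gg i \<cdot> gg j = -1 ==> gg j \<cdot> gg i = -2 ==>
   TT i (TT j (TT i (TT j f))) = TT j (TT i (TT j (TT i f)))"
  and "gg i \<cdot> gg j = -1 ==> gg j \<cdot> gg i = -3 ==>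
   TT i (TT j (TT i (TT j (TT i (TT j f))))) = TT j (TT i (TT j (TT i (TT j (TT i f)))))"
proof -
 let ?L = "{l. l \<cdot> gg i \<in> \<int> & l \<cdot> gg j \<in> \<int>}"
 have PL: "P \<subseteq> ?L" using gg_R ij by (auto simp: weights_def)
 have fL: "f \<in> Lg ?L" using f PL unfolding wt_Lg Lg_def by blast
 have ti: "TT i h = DL (gg i) (QQ i) (hh i) (uu i) h" if "h \<in> Lg ?L" for h
  using TT_DL[OF ij(1)] that by (auto simp: Lg_def)
 have tj: "TT j h = DL (gg j) (QQ j) (hh j) (uu j) h" if "h \<in> Lg ?L" for h
  using TT_DL[OF ij(2)] that by (auto simp: Lg_def)
 have odd: False if od: "gg a \<cdot> gg b = - real_of_int k" "odd k" "uu a ~= 0" "a \<in> aix" "b \<in> aix" for a b k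
 proof -
  obtain m :: int where "gg a \<cdot> gg b = of_int (2 * m)" using uu_even[OF od(4,5,3)] by blast
  hence "real_of_int k = real_of_int (- (2 * m))" using od(1) by simp
  hence "k = - (2 * m)" by (simp only: of_int_eq_iff)
  thus False using od(2) by simp
 qed
 have S: "TT i h \<in> Lg ?L" "TT j h \<in> Lg ?L" if "h \<in> Lg ?L" for h
 proof -
  have RL: "R \<subseteq> ?L" using int_R gg_R ij by auto
  have "dl (gg i) (QQ i) (hh i) (uu i) ?L" by (rule dl_ij[OF ij(1) lattice_L RL]) simp
  from dl.T_S[OF this that] show "TT i h \<in> Lg ?L" using ti[OF that] by simp
  have "dl (gg j) (QQ j) (hh j) (uu j) ?L" by (rule dl_ij[OF ij(2) lattice_L RL]) simp
  from dl.T_S[OF this that] show "TT j h \<in> Lg ?L" using tj[OF that] by simp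
 qed
 note sim = fL S ti[symmetric] tj[symmetric]
 show "gg i \<cdot> gg j = 0 ==> gg j \<cdot> gg i = 0 ==> TT i (TT j f) = TT j (TT i f)"
  using dl2.braid2[OF dl2_ij[OF ij(1,2), of 0 0] _ _ fL] by (simp add: sim)
 show "TT i (TT j (TT i f)) = TT j (TT i (TT j f))"
  if N: "gg i \<cdot> gg j = -1" "gg j \<cdot> gg i = -1"
 proof -
  have b: "DL (gg i) (QQ i) (hh i) (uu i) (DL (gg j) (QQ j) (hh j) (uu j) (DL (gg i) (QQ i) (hh i) (uu i) f))
   = DL (gg j) (QQ j) (hh j) (uu j) (DL (gg i) (QQ i) (hh i) (uu i) (DL (gg j) (QQ j) (hh j) (uu j) f))"
   by (rule dl2.braid3[OF dl2_ij[OF ij(1,2), of "-1" "-1"] _ _ _ _ _ fL]) (use hh_equal[OF ij(1,2)] N in simp_all)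
  show ?thesis using b by (simp only: sim)
 qed
 show "TT i (TT j (TT i (TT j f))) = TT j (TT i (TT j (TT i f)))"
  if "gg i \<cdot> gg j = -1" "gg j \<cdot> gg i = -2"
 proof -
  have u: "uu i = 0" using odd[of i j 1] that ij by auto
  have b: "DL (gg i) (QQ i) (hh i) (uu i) (DL (gg j) (QQ j) (hh j) (uu j) (DL (gg i) (QQ i) (hh i) (uu i) (DL (gg j) (QQ j) (hh j) (uu j) f)))
   = DL (gg j) (QQ j) (hh j) (uu j) (DL (gg i) (QQ i) (hh i) (uu i) (DL (gg j) (QQ j) (hh j) (uu j) (DL (gg i) (QQ i) (hh i) (uu i) f)))"
   by (rule dl2.braid4[OF dl2_ij[OF ij(1,2), of "-1" "-2"] _ _ _ fL]) (use u that in simp_all)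
  show ?thesis using b by (simp only: sim)
 qed
 show "TT i (TT j (TT i (TT j (TT i (TT j f))))) = TT j (TT i (TT j (TT i (TT j (TT i f)))))"
  if "gg i \<cdot> gg j = -1" "gg j \<cdot> gg i = -3"
 proof -
  have u: "uu i = 0" "uu j = 0" using odd[of i j 1] odd[of j i 3] that ij by auto
  have b: "DL (gg i) (QQ i) (hh i) (uu i) (DL (gg j) (QQ j) (hh j) (uu j) (DL (gg i) (QQ i) (hh i) (uu i) (DL (gg j) (QQ j) (hh j) (uu j)
     (DL (gg i) (QQ i) (hh i) (uu i) (DL (gg j) (QQ j) (hh j) (uu j) f)))))
   = DL (gg j) (QQ j) (hh j) (uu j) (DL (gg i) (QQ i) (hh i) (uu i) (DL (gg j) (QQ j) (hh j) (uu j) (DL (gg i) (QQ i) (hh i) (uu i)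
     (DL (gg j) (QQ j) (hh j) (uu j) (DL (gg i) (QQ i) (hh i) (uu i) f)))))"
   by (rule dl2.braid6[OF dl2_ij[OF ij(1,2), of "-1" "-3"] _ _ _ _ fL]) (use u that in simp_all)
  show ?thesis using b by (simp only: sim)
 qed
qed

lemma braidI:
 assumes ij: "i \<in> aix" "j \<in> aix" and c: "cc i j = 0 & cc j i = 0 & i # us = [i, j] & j # vs = [j, i] |
   cc i j = 1 & cc j i = 1 & i # us = [i, j, i] & j # vs = [j, i, j] |
   (cc i j = 1 & cc j i = 2 | cc i j = 2 & cc j i = 1) & i # us = [i, j, i, j] & j # vs = [j, i, j, i] |
   (cc i j = 1 & cc j i = 3 | cc i j = 3 & cc j i = 1) & i # us = [i, j, i, j, i, j] & j # vs = [j, i, j, i, j, i]"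
  and g: "!!f. f \<in> S ==> word_prod g (i # us) f = word_prod g (j # vs) f"
 shows "braid g S i j"
 unfolding braid_def
proof (rule exI[of _ us], rule exI[of _ vs], intro conjI allI impI ballI)
 show "us \<in> lists {i, j}" "vs \<in> lists {i, j}" "length us = length vs" using c by auto
 show "wd (i # us) = wd (j # vs)" using c word_sig[OF ij] by metis
 show "desc (i # us) x" if "A i x < 0" "A j x < 0" for x using desc_sig[OF ij _ that, of "i # us"] c by blast
qed (use g in blast)

lemma braid_TT: assumes ij: "i \<in> aix" "j \<in> aix" "i ~= j" and x: "A i x < 0" "A j x < 0"
 shows "braid TT wt i j"
proof (rule rank2_cases[OF ij x])
  assume "gg i \<cdot> gg j = 0" "gg j \<cdot> gg i = 0" "cc i j = 0" "cc j i = 0"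
  thus "braid TT wt i j" using rank2_braid(1)[OF ij] by (intro braidI[OF ij(1,2), of "[j]" "[i]"]) auto
 next
  assume "gg i \<cdot> gg j = -1" "gg j \<cdot> gg i = -1" "cc i j = 1" "cc j i = 1"
  thus "braid TT wt i j" using rank2_braid(2)[OF ij] by (intro braidI[OF ij(1,2), of "[j, i]" "[i, j]"]) auto
 next
  assume a: "gg i \<cdot> gg j = -1 & gg j \<cdot> gg i = -2 | gg i \<cdot> gg j = -2 & gg j \<cdot> gg i = -1"
   "cc i j = 1 & cc j i = 2 | cc i j = 2 & cc j i = 1"
  have "TT i (TT j (TT i (TT j f))) = TT j (TT i (TT j (TT i f)))" if "f \<in> wt" for f
   using rank2_braid(3)[OF ij that] rank2_braid(3)[OF ij(2,1) ij(3)[symmetric] that] a(1) by auto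
  thus "braid TT wt i j" using a(2) by (intro braidI[OF ij(1,2), of "[j, i, j]" "[i, j, i]"]) auto
 next
  assume a: "gg i \<cdot> gg j = -1 & gg j \<cdot> gg i = -3 | gg i \<cdot> gg j = -3 & gg j \<cdot> gg i = -1"
   "cc i j = 1 & cc j i = 3 | cc i j = 3 & cc j i = 1"
  have "TT i (TT j (TT i (TT j (TT i (TT j f))))) = TT j (TT i (TT j (TT i (TT j (TT i f)))))" if "f \<in> wt" for f
   using rank2_braid(4)[OF ij that] rank2_braid(4)[OF ij(2,1) ij(3)[symmetric] that] a(1) by auto
  thus "braid TT wt i j" using a(2) by (intro braidI[OF ij(1,2), of "[j, i, j, i, j]" "[i, j, i, j, i]"]) auto
qed

lemma ops_TT: "ops aix TT wt"
 unfolding ops_def using TT_wt braid_TT by blast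

text \<open>The scalars \<open>t\<^sub>i\<^sup>1\<^sup>/\<^sup>2\<close> satisfy the braid relations of the finite Weyl group as well, which makes
 \<open>\<chi>\<close> well defined.\<close>

lemma ops_t: "ops ix (%i. (*) (t_half D i)) UNIV"
 unfolding ops_def
proof (intro conjI ballI impI)
 fix i j assume ij: "i \<in> ix" "j \<in> ix" "i ~= j" and "\<exists>x. A i x < 0 & A j x < 0"
 then obtain x where x: "A i x < 0" "A j x < 0" by blast
 have ij': "i \<in> aix" "j \<in> aix" using ij ix_aix by auto
 show "braid (%i. (*) (t_half D i)) UNIV i j"
 proof (rule rank2_cases[OF ij' ij(3) x])
  assume "cc i j = 0" "cc j i = 0"
  thus ?thesis by (intro braidI[OF ij', of "[j]" "[i]"]) (auto simp: mult_ac)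
 next
  assume a: "gg i \<cdot> gg j = -1" "gg j \<cdot> gg i = -1" "cc i j = 1" "cc j i = 1"
  hence "t_half D i = t_half D j" using hh_equal(3)[OF ij'] ix_nz ij by (simp add: hh_def)
  thus ?thesis using a by (intro braidI[OF ij', of "[j, i]" "[i, j]"]) (auto simp: mult_ac)
 next
  assume "cc i j = 1 & cc j i = 2 | cc i j = 2 & cc j i = 1"
  thus ?thesis by (intro braidI[OF ij', of "[j, i, j]" "[i, j, i]"]) (auto simp: mult_ac)
 next
  assume "cc i j = 1 & cc j i = 3 | cc i j = 3 & cc j i = 1"
  thus ?thesis by (intro braidI[OF ij', of "[j, i, j, i, j]" "[i, j, i, j, i]"]) (auto simp: mult_ac)
 qed
qed auto

section \<open>Bernstein relations\<close>

abbreviation "T \<equiv> T_Y D"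

definition Tj :: "('v => 'v) => ('v, 'p) galg => ('v, 'p) galg" where
 "Tj w = word_prod TTi (rev (red_word D aix w))"

lemma T_word: "T w = word_prod TT (red_word D aix w)"
 unfolding T_Y_def TT_def ..

lemma isoS_id: "isoS S id id"
 by (simp add: isoS_def linop_def)

lemma iso_word: "ws \<in> lists aix ==> isoS wt (word_prod TT ws) (word_prod TTi (rev ws))"
proof (induction ws)
 case Nil show ?case unfolding word_prod_Nil rev.simps by (rule isoS_id)
next
 case (Cons i ws)
 have "isoS wt (TT i) (TTi i)" "isoS wt (word_prod TT ws) (word_prod TTi (rev ws))" using Cons iso_TT by auto
 from isoS_comp[OF this] show ?case
  unfolding rev.simps word_prod_append word_prod_Cons word_prod_Nil comp_id o_def id_apply .
qed

lemma red_lists: "red I ws ==> ws \<in> lists I"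
 by (simp add: red_def)

lemma iso_T: "w \<in> aff_weyl D ==> isoS wt (T w) (Tj w)"
 unfolding T_word Tj_def by (rule iso_word[OF red_lists[OF red_word(1)]])

lemma T_red: "red aix ws ==> f \<in> wt ==> T (wd ws) f = word_prod TT ws f"
 unfolding T_word by (rule op_red[OF order_refl ops_TT])

lemma T_wt: "w \<in> aff_weyl D ==> f \<in> wt ==> T w f \<in> wt"
 and Tj_wt: "w \<in> aff_weyl D ==> f \<in> wt ==> Tj w f \<in> wt"
 and T_Tj [simp]: "w \<in> aff_weyl D ==> f \<in> wt ==> T w (Tj w f) = f"
 and Tj_T [simp]: "w \<in> aff_weyl D ==> f \<in> wt ==> Tj w (T w f) = f"
 using iso_T[of w] by (auto simp: isoS_def)

lemma linop_T: "w \<in> aff_weyl D ==> linop (T w)" and linop_Tj: "w \<in> aff_weyl D ==> linop (Tj w)"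
 using iso_T[of w] by (auto simp: isoS_def)

lemma TTi_wt: "i \<in> aix ==> f \<in> wt ==> TTi i f \<in> wt"
 and TT_TTi [simp]: "i \<in> aix ==> f \<in> wt ==> TT i (TTi i f) = f"
 and TTi_TT [simp]: "i \<in> aix ==> f \<in> wt ==> TTi i (TT i f) = f"
 using iso_TT[of i] by (auto simp: isoS_def)

lemma inv_op_iso: assumes "isoS wt F G" "f \<in> wt" shows "inv_op D F f = G f"
 unfolding inv_op_def
proof (rule the_inv_into_f_eq)
 show "inj_on F wt" using assms(1) by (intro inj_on_inverseI[of _ G]) (simp add: isoS_def)
qed (use assms in \<open>auto simp: isoS_def\<close>)

lemma T_inv_eq: "w \<in> aff_weyl D ==> f \<in> wt ==> g \<in> wt ==> T w f = g \<longleftrightarrow> f = Tj w g"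
 by auto

lemma red_ix_aix: "red ix ws ==> red aix ws"
proof (induction ws)
 case Nil show ?case by (rule red_Nil[OF order_refl])
next
 case (Cons i ws)
 thus ?case using ix_aix unfolding red_Cons[OF ix_sub] red_Cons[OF order_refl] by blast
qed

lemma W_aff: "w \<in> W ==> w \<in> aff_weyl D"
 using weyl_mono[OF ix_aix] by blast

lemma T_fin_T: assumes "w \<in> W" "f \<in> wt" shows "T_fin D w f = T w f"
proof -
 have r: "red ix (red_word D ix w)" "wd (red_word D ix w) = w" using red_word[OF assms(1)] by auto
 have "word_prod (T_fin_gen D) ws = word_prod TT ws" if "ws \<in> lists ix" for ws using that
 proof (induction ws)
  case (Cons i ws) thus ?case using ix_nz by (auto simp: TT_def)
 qed simp
 hence "T_fin D w f = word_prod TT (red_word D ix w) f" unfolding T_fin_def using red_lists[OF r(1)] by simp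
 thus ?thesis using T_red[OF red_ix_aix[OF r(1)] assms(2)] r(2) by simp
qed

lemma T_up_left:
 assumes "i \<in> aix" "w \<in> aff_weyl D" "A i (w pp) > 0" "f \<in> wt"
 shows "T (s i o w) f = TT i (T w f)"
proof -
 obtain ws where ws: "red aix ws" "wd ws = w" using red_ex[OF assms(2)] by blast
 have "red aix (i # ws)" using red_Cons[OF order_refl] ws assms by blast
 from T_red[OF this assms(4)] T_red[OF ws(1) assms(4)] show ?thesis unfolding word_prod_Cons comp_apply ws(2) by simp
qed

lemma T_up_right:
 assumes "i \<in> aix" "w \<in> aff_weyl D" "A i (inv w pp) > 0" "f \<in> wt"
 shows "T (w o s i) f = T w (TT i f)"
proof -
 obtain ws where ws: "red aix ws" "wd ws = w" using red_ex[OF assms(2)] by blast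
 have "red aix (ws @ [i])" using red_snoc[OF order_refl] ws assms by blast
 from T_red[OF this assms(4)] T_red[OF ws(1) TT_wt[OF assms(1,4)]] show ?thesis
  unfolding word_prod_Cons word_prod_append word_prod_Nil comp_id comp_apply ws(2) by simp
qed

lemma T_additive:
 assumes u: "u \<in> aff_weyl D" and v: "v \<in> aff_weyl D" and f: "f \<in> wt"
  and c: "!!b. b \<in> Phi aix ==> b pp > 0 ==> b (u pp) < 0 ==> b (u (v pp)) < 0"
 shows "T (u o v) f = T u (T v f)"
proof -
 obtain us where us: "red aix us" "wd us = u" using red_ex[OF u] by blast
 obtain vs where vs: "red aix vs" "wd vs = v" using red_ex[OF v] by blast
 have "red aix (us @ vs)" using red_append_additive[OF order_refl us(1) vs(1)] c us vs by blast
 from T_red[OF this f] show ?thesis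
  using T_red[OF us(1) T_wt[OF v f]] T_red[OF vs(1) f] unfolding word_prod_append comp_apply us(2) vs(2) by simp
qed

lemma T_id: "f \<in> wt ==> T id f = f"
 using T_red[OF red_Nil[OF order_refl], of f] unfolding word_prod_Nil by simp

lemma Tj_id: "f \<in> wt ==> Tj id f = f"
 using Tj_T[OF weyl_id, of f] T_id by simp

lemma W_pp: "w \<in> W ==> i \<in> ix ==> A i (inv w pp) > 0 \<longleftrightarrow> posr (w (al i))"
proof -
 assume w: "w \<in> W" and i: "i \<in> ix"
 have "A i (inv w pp) = pp \<cdot> (w (al i))"
  using A_fin[OF i] W_coroot[OF w] W_inner_inv[OF W_inv_in[OF w]] inv_inv_eq[OF W_bij[OF w]] by simp
 thus ?thesis using pp_coroot[OF W_R[OF w al_R[OF i]]] by simp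
qed

lemma W_up_right: "w \<in> W ==> i \<in> ix ==> posr (w (al i)) ==> f \<in> wt ==> T (w o s i) f = T w (TT i f)"
 using T_up_right W_pp W_aff ix_aix by blast

lemma s_W: "i \<in> ix ==> s i \<in> W"
 using refl_al_W weyl_gen_fin by metis

lemma s_minus: "i \<in> ix ==> s i (- x) = - s i x"
 using W_minus s_W by blast

lemma s_al: "i \<in> ix ==> s i (al i) = - al i"
 by (simp add: weyl_gen_fin reflection_self)

lemma W_down_right: assumes "w \<in> W" "i \<in> ix" "posr (- w (al i))" "f \<in> wt" shows "T w f = T (w o s i) (TT i f)"
proof -
 have w: "w o s i \<in> W" using weyl_comp assms s_W by blast
 have "(w o s i) (al i) = - w (al i)" using s_al W_minus assms by simp
 hence "T ((w o s i) o s i) f = T (w o s i) (TT i f)" using W_up_right[OF w assms(2) _ assms(4)] assms(3) by simp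
 moreover have "(w o s i) o s i = w" using s_comp_s[of i] ix_aix assms(2) by (auto simp: comp_assoc)
 ultimately show ?thesis by simp
qed

lemma inv_s: "i \<in> aix ==> inv (s i) = s i"
 using inv_unique_comp[OF s_comp_s s_comp_s] by blast

lemma inv_comp: "u \<in> aff_weyl D ==> v \<in> aff_weyl D ==> inv (u o v) = inv v o inv u"
 using o_inv_distrib weyl_bij(1)[OF order_refl] by blast

lemma W_up_left_inv: assumes "w \<in> W" "i \<in> ix" "posr (w (al i))" "f \<in> wt"
 shows "T (inv (w o s i)) f = TT i (T (inv w) f)"
proof -
 have "inv (w o s i) = s i o inv w"
  using inv_comp[OF W_aff[OF assms(1)] W_aff[OF s_W[OF assms(2)]]] inv_s ix_aix assms(2) by (metis subsetD)
 thus ?thesis using T_up_left[of i "inv w" f] W_pp[OF assms(1,2)] assms ix_aix W_aff[OF W_inv_in[OF assms(1)]] by auto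
qed

lemma W_down_left_inv: assumes "w \<in> W" "i \<in> ix" "posr (- w (al i))" "f \<in> wt"
 shows "T (inv w) f = TT i (T (inv (w o s i)) f)"
proof -
 have w: "w o s i \<in> W" using weyl_comp assms s_W by blast
 have "(w o s i) (al i) = - w (al i)" using s_al W_minus assms by simp
 hence "T (inv ((w o s i) o s i)) f = TT i (T (inv (w o s i)) f)"
  using W_up_left_inv[OF w assms(2) _ assms(4)] assms(3) by simp
 moreover have "(w o s i) o s i = w" using s_comp_s[of i] ix_aix assms(2) by (auto simp: comp_assoc)
 ultimately show ?thesis by simp
qed

subsection \<open>Multiplication operators\<close>

lemma ee_wt: "l \<in> P ==> ee l \<in> wt"
 unfolding wt_Lg by (rule Lg_ee)

lemma X_wt: "l \<in> P ==> f \<in> wt ==> ee l * f \<in> wt"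
 unfolding wt_Lg by (rule Lg_mult[OF lattice_P Lg_ee])

lemma scale_wt: "f \<in> wt ==> scale c f \<in> wt" and add_wt: "f \<in> wt ==> g \<in> wt ==> f + g \<in> wt"
 and diff_wt: "f \<in> wt ==> g \<in> wt ==> f - g \<in> wt"
 unfolding wt_Lg by (rule Lg_scale Lg_add Lg_diff; assumption)+

lemma ee_cancel: "ee l * (ee (- l) * f) = f" "ee (- l) * (ee l * f) = f"
 by (simp_all add: mult.assoc[symmetric] flip: ee_add) (simp_all add: ee_0)

lemma gg_al: "i \<in> ix ==> 2 *\<^sub>R al i \<notin> R ==> gg i = al i" "i \<in> ix ==> 2 *\<^sub>R al i \<notin> R ==> uu i = 0"
 using ix_nz by (auto simp: gg_def uu_def)

lemma X_0: assumes i: "i \<in> aix" and l: "l \<in> P" "l \<cdot> rt i = 0" and f: "f \<in> wt"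
 shows "TT i (ee l * f) = ee l * TT i f"
proof -
 obtain m where m: "m = 1 | m = 2" "gg i = m *\<^sub>R rt i" using gg_rt by metis
 have "l \<cdot> gg i = 0" using l m by (simp add: coroot_scaleR)
 thus ?thesis using dl.T_0[OF dl_P[OF i] l(1) _ f[unfolded wt_Lg]] TT_DL_wt[OF i X_wt[OF l(1) f]] TT_DL_wt[OF i f] by simp
qed

lemma odd_not_double: assumes "l \<in> P" "a \<in> R" "l \<cdot> a = of_int k" "odd k" shows "2 *\<^sub>R a \<notin> R"
proof
 assume "2 *\<^sub>R a \<in> R"
 hence "l \<cdot> (2 *\<^sub>R a) \<in> \<int>" using assms(1) unfolding weights_def by blast
 then obtain m :: int where "l \<cdot> (2 *\<^sub>R a) = of_int m" using Ints_cases by blast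
 hence "real_of_int k = real_of_int (2 * m)" using assms(3) by (simp add: coroot_scaleR)
 hence "k = 2 * m" by (simp only: of_int_eq_iff)
 thus False using assms(4) by simp
qed

lemma X_1: assumes i: "i \<in> ix" and l: "l \<in> P" "l \<cdot> al i = 1" and f: "f \<in> wt"
 shows "TTi i (ee l * f) = ee (l - al i) * TT i f"
proof -
 have i': "i \<in> aix" using i ix_aix by blast
 have "2 *\<^sub>R al i \<notin> R" using odd_not_double[of l "al i" 1] l al_R i by simp
 hence g: "gg i = al i" "uu i = 0" using gg_al i by auto
 have "\<lfloor>l \<cdot> gg i\<rfloor> = 1" using l g by simp
 thus ?thesis
  using dl.Ti_1[OF dl_P[OF i'] l(1) _ f[unfolded wt_Lg]] TTi_dl[OF i' X_wt[OF l(1) f]] TT_DL_wt[OF i' f] g ix_nz[OF i]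
  by (simp add: QQ_def)
qed

lemma X_1': assumes i: "i \<in> ix" and l: "l \<in> P" "l \<cdot> al i = 1" and f: "f \<in> wt"
 shows "TT i (ee (l - al i) * f) = ee l * TTi i f"
proof -
 have i': "i \<in> aix" using i ix_aix by blast
 have h: "TTi i f \<in> wt" using TTi_wt i' f by blast
 have "TTi i (ee l * TTi i f) = ee (l - al i) * f" using X_1[OF i l h] i' f by simp
 hence "TT i (TTi i (ee l * TTi i f)) = TT i (ee (l - al i) * f)" by simp
 thus ?thesis using TT_TTi[OF i' X_wt[OF l(1) h]] by simp
qed

lemma X_01: assumes l: "l \<in> P" "l \<cdot> theta D = 1" and f: "f \<in> wt"
 shows "TT 0 (ee l * TT 0 f) = scale (inverse (qpow D 1)) (ee (l - theta D) * f)"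
proof -
 let ?m = "l - theta D"
 have m: "?m \<in> P" using l weights_add[OF l(1) weights_minus[OF R_weights[OF theta_R]]] by simp
 have "\<lfloor>?m \<cdot> gg 0\<rfloor> = 1" using l inner_coroot_self[of "theta D"] root_nonzero theta_R by (simp add: gg_def inner_diff_left)
 from dl.Ti_1[OF dl_P[OF zero_aix] m this f[unfolded wt_Lg]]
 have "TTi 0 (ee ?m * f) = scale (qpow D 1) (ee l * TT 0 f)"
  using TTi_dl[OF zero_aix X_wt[OF m f]] TT_DL_wt[OF zero_aix f] by (simp add: uu_def QQ_def gg_def scale_mult_left)
 hence "TT 0 (TTi 0 (ee ?m * f)) = scale (qpow D 1) (TT 0 (ee l * TT 0 f))" by (simp add: linop_scale[OF linop_TT])
 hence "ee ?m * f = scale (qpow D 1) (TT 0 (ee l * TT 0 f))" using TT_TTi[OF zero_aix X_wt[OF m f]] by simp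
 thus ?thesis using qpow_nz[of 1] by simp
qed

lemma bt_P: "bt \<in> P" using R_weights bt_R by blast

lemma T03_eq: "f \<in> wt ==> T03 D f = ee bt * Tj (s_theta D) f"
proof -
 assume f: "f \<in> wt"
 have "isoS wt (T (s_theta D)) (Tj (s_theta D))" using iso_T[OF W_aff[OF s_theta_W]] .
 hence "inv_op D (T_fin D (s_theta D)) f = Tj (s_theta D) f"
 proof -
  have "inj_on (T_fin D (s_theta D)) wt"
   by (rule inj_on_inverseI[of _ "Tj (s_theta D)"]) (simp add: T_fin_T s_theta_W W_aff)
  moreover have "T_fin D (s_theta D) (Tj (s_theta D) f) = f"
   using T_fin_T[OF s_theta_W Tj_wt[OF W_aff[OF s_theta_W] f]] f W_aff[OF s_theta_W] by simp
  ultimately show ?thesis unfolding inv_op_def using the_inv_into_f_eq Tj_wt[OF W_aff[OF s_theta_W] f] by metis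
 qed
 thus ?thesis unfolding T03_def bt_theta by simp
qed

abbreviation "sth \<equiv> s_theta D"

lemma sth_aff: "sth \<in> aff_weyl D" using W_aff s_theta_W by blast

lemma T03_wt: "f \<in> wt ==> T03 D f \<in> wt"
 using T03_eq X_wt bt_P Tj_wt sth_aff by simp

lemma sth_sth: "sth (sth x) = x"
 by (simp add: s_theta_def)

text \<open>The induction step common to the two descriptions of \<open>X\<^sub>\<gamma>\<close> and \<open>Y\<^sub>\<gamma>\<close> for short roots \<open>\<gamma>\<close>.\<close>

lemma short_step:
 assumes w: "w \<in> W" and i: "i \<in> ix" and up: "posr (w (al i))" and g: "posr (inv (w o s i) bt)"
 shows "posr (inv w bt)"
  and "inv w bt \<cdot> al i = 0 & inv (w o s i) bt = inv w bt & posr ((sth o w) (al i)) |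
   inv w bt \<cdot> al i = 1 & inv (w o s i) bt = inv w bt - al i & posr (- (sth o w) (al i))"
proof -
 have i': "i \<in> aix" using i ix_aix by blast
 have iw: "inv (w o s i) = s i o inv w"
  using inv_comp[OF W_aff[OF w] W_aff[OF s_W[OF i]]] inv_s[OF i'] by simp
 let ?m = "inv w bt"
 have mS: "?m \<in> Sh" using Sh_W W_inv_in w bt_Sh by blast
 have gm: "inv (w o s i) bt = reflection (al i) ?m" using iw weyl_gen_fin[OF i] by simp
 have wa: "w (al i) \<in> RI" "w (al i) \<in> R" using RI_W[OF w al_RI[OF i]] RI_R by auto
 show pm: "posr ?m"
 proof (rule ccontr)
  assume "~ posr ?m"
  hence n: "posr (- ?m)" "- ?m \<in> R" using not_posr Sh_R mS by auto
  have "~ posr (reflection (al i) (- ?m))"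
   using g gm linear_neg[OF linear_reflection, of "al i" ?m] by (simp add: posr_def)
  then obtain c where "- ?m = c *\<^sub>R al i" using posr_refl[OF n(2,1) i] by blast
  hence "- ?m = al i" using RI_multiple[OF RI_minus[OF Sh_RI[OF mS]] n(1) i] by blast
  hence "w (al i) = - bt" using W_minus[OF w, of ?m] w by simp
  thus False using up posr_bt by (simp add: posr_def)
 qed
 have k: "?m \<cdot> al i = bt \<cdot> (w (al i))"
  using W_coroot[OF w] W_inner_inv[OF W_inv_in[OF w]] inv_inv_eq[OF W_bij[OF w]] by simp
 consider "bt \<cdot> (w (al i)) = 0" | "bt \<cdot> (w (al i)) = 1" | "w (al i) = bt"
  using bt_coroot_cases[OF wa(1) up] by blast
 thus "inv w bt \<cdot> al i = 0 & inv (w o s i) bt = inv w bt & posr ((sth o w) (al i)) |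
   inv w bt \<cdot> al i = 1 & inv (w o s i) bt = inv w bt - al i & posr (- (sth o w) (al i))"
 proof cases
  case 1
  hence "reflection bt (w (al i)) = w (al i)" using refl_bt_posr(3)[OF wa(2)] coroot_zero[OF wa(2)] by blast
  hence "sth (w (al i)) = w (al i)" by (simp add: s_theta_bt)
  thus ?thesis using 1 k up unfolding gm by (simp add: reflection_def)
 next
  case 2
  hence "bt \<bullet> w (al i) > 0" using coroot_sign[OF wa(2), of bt] by simp
  hence "~ posr (reflection bt (w (al i)))" using refl_bt_posr(1)[OF wa(2)] by blast
  thus ?thesis using 2 k not_posr[OF refl_R[OF bt_R wa(2)]] unfolding gm by (simp add: s_theta_bt reflection_def)
 next
  case 3
  hence "?m = al i" using W_inv_l[OF w] by metis
  hence "reflection (al i) ?m = - al i" by (simp add: reflection_self)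
  thus ?thesis using g posr_al[OF i] unfolding gm by (simp add: posr_def)
 qed
qed

lemma W_right_induct [consumes 1, case_names id up]:
 assumes w: "w \<in> W" and id: "Q id"
  and up: "!!i w. i \<in> ix ==> w \<in> W ==> posr (w (al i)) ==> Q w ==> Q (w o s i)"
 shows "Q w"
proof -
 have "red ix us ==> Q (wd us)" for us
 proof (induction us rule: rev_induct)
  case (snoc i us)
  hence r: "i \<in> ix" "red ix us" "wd us \<in> W" "posr (wd us (al i))" using red_snoc[OF ix_sub] red_weyl W_pp by blast+
  show ?case using up[OF r(1,3,4)] snoc.IH[OF r(2)] unfolding word_prod_append word_prod_Cons word_prod_Nil comp_id by blast
 qed (use id in simp)
 thus ?thesis using red_ex[OF w] by blast
qed

lemma W_left_induct [consumes 1, case_names id up]: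
 assumes w: "w \<in> W" and id: "Q id"
  and up: "!!i w. i \<in> ix ==> w \<in> W ==> A i (w pp) > 0 ==> Q w ==> Q (s i o w)"
 shows "Q w"
proof -
 have "red ix us ==> Q (wd us)" for us
 proof (induction us)
  case (Cons i us)
  hence r: "i \<in> ix" "red ix us" "wd us \<in> W" "A i (wd us pp) > 0" using red_Cons[OF ix_sub] red_weyl by blast+
  show ?case using up[OF r(1,3,4)] Cons.IH[OF r(2)] unfolding word_prod_Cons by blast
 qed (use id in simp)
 thus ?thesis using red_ex[OF w] by blast
qed

text \<open>If \<open>inv w bt\<close> is positive, it is positive for every initial part of a
  reduced word of \<open>w\<close>, so by \<open>short_step\<close> only two kinds of letters occur:
  orthogonal to the current root, or pairing to 1 with it.\<close>

lemma short_induct [consumes 2, case_names id orth down]: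
 assumes w: "w \<in> W" "posr (inv w bt)" and id: "Q id"
  and orth: "!!i w. i \<in> ix ==> w \<in> W ==> posr (w (al i)) ==> inv w bt \<cdot> al i = 0 ==>
   inv (w o s i) bt = inv w bt ==> posr ((sth o w) (al i)) ==> Q w ==> Q (w o s i)"
  and down: "!!i w. i \<in> ix ==> w \<in> W ==> posr (w (al i)) ==> inv w bt \<cdot> al i = 1 ==>
   inv (w o s i) bt = inv w bt - al i ==> posr (- (sth o w) (al i)) ==> Q w ==> Q (w o s i)"
 shows "Q w"
 using w
proof (induction w rule: W_right_induct)
 case (up i w)
 note st = short_step[OF up(2,1,3,5)]
 show ?case using st(2) orth[OF up(1-3)] down[OF up(1-3)] up(4)[OF st(1)] by blast
qed (use id in blast)

lemma short_inv: assumes "w \<in> W" shows "inv w bt \<in> Sh" "inv w bt \<in> P"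
proof -
 show "inv w bt \<in> Sh" using Sh_W[OF W_inv_in[OF assms] bt_Sh] .
 thus "inv w bt \<in> P" using R_weights Sh_R by blast
qed

lemma sth_W: "w \<in> W ==> sth o w \<in> W"
 using weyl_comp s_theta_W by blast

text \<open>For \<open>w = id\<close> this is the definition of \<open>T03\<close>. A letter
  orthogonal to the short root commutes with its exponential; a letter pairing to 1 lowers the root
  and turns \<open>TT i\<close> into its inverse, which matches the shortening of
  \<open>sth o w\<close>.\<close>

lemma X_short:
 assumes "w \<in> W" "posr (inv w bt)" "f \<in> wt"
 shows "T w (ee (inv w bt) * f) = T03 D (T (sth o w) f)"
 using assms
proof (induction w arbitrary: f rule: short_induct)
 case id
 have "inv id bt = bt" by simp
 hence "T id (ee (inv id bt) * f) = T03 D (T sth f)"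
  using T_id[OF X_wt[OF bt_P id]] T03_eq[OF T_wt[OF sth_aff id]] Tj_T[OF sth_aff id] by metis
 thus ?case unfolding comp_id .
next
 case (orth i w)
 have i': "i \<in> aix" using orth ix_aix by blast
 note f = orth(8) and m = short_inv(2)[OF orth(2)]
 have e: "TT i (ee (inv w bt) * f) = ee (inv w bt) * TT i f" by (rule X_0[OF i' m _ f]) (use orth rt_ix in simp)
 thus ?case
  unfolding orth(5) W_up_right[OF orth(2,1,3) X_wt[OF m f]] comp_assoc[symmetric] W_up_right[OF sth_W[OF orth(2)] orth(1,6) f]
  by (simp only: e orth(7)[OF TT_wt[OF i' f]])
next
 case (down i w)
 have i': "i \<in> aix" using down ix_aix by blast
 note f = down(8) and m = short_inv(2)[OF down(2)]
 have m': "inv w bt - al i \<in> P" using short_inv(2)[OF weyl_comp[OF down(2) s_W[OF down(1)]]] down(5) by simp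
 have e: "T (sth o w) (TTi i f) = T ((sth o w) o s i) f"
  using W_down_right[OF sth_W[OF down(2)] down(1,6) TTi_wt[OF i' f], unfolded TT_TTi[OF i' f]] .
 thus ?case
  unfolding down(5) W_up_right[OF down(2,1,3) X_wt[OF m' f]] X_1'[OF down(1) m down(4) f] comp_assoc[symmetric]
  by (simp only: e down(7)[OF TTi_wt[OF i' f]])
qed

subsection \<open>The root lattice\<close>

abbreviation "RL \<equiv> root_lattice D"

lemma RL_iff: "x \<in> RL \<longleftrightarrow> (\<forall>i\<in>ix. x \<bullet> fw i \<in> \<int>)"
proof
 assume "x \<in> RL"
 then obtain c :: "nat => int" where c: "x = (\<Sum>j\<in>ix. real_of_int (c j) *\<^sub>R al j)"
  unfolding root_lattice_def fin_ix_def by blast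
 thus "\<forall>i\<in>ix. x \<bullet> fw i \<in> \<int>" using crd_sum by simp
next
 assume a: "\<forall>i\<in>ix. x \<bullet> fw i \<in> \<int>"
 have "(\<Sum>i\<in>ix. (x \<bullet> fw i) *\<^sub>R al i) = (\<Sum>i\<in>ix. real_of_int \<lfloor>x \<bullet> fw i\<rfloor> *\<^sub>R al i)"
  by (rule sum.cong) (use a in auto)
 hence "x = (\<Sum>i\<in>ix. real_of_int \<lfloor>x \<bullet> fw i\<rfloor> *\<^sub>R al i)" using expand[of x] by argo
 thus "x \<in> RL" unfolding root_lattice_def fin_ix_def by (rule range_eqI[of _ _ "%i. \<lfloor>x \<bullet> fw i\<rfloor>"])
qed

lemma lattice_RL: "lattice RL"
 unfolding lattice_def by (auto simp: RL_iff inner_add_left)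

lemma RL_add: "x \<in> RL ==> y \<in> RL ==> x + y \<in> RL" and RL_minus: "x \<in> RL ==> - x \<in> RL"
 and RL_diff: "x \<in> RL ==> y \<in> RL ==> x - y \<in> RL" and RL_0: "0 \<in> RL"
 and RL_int: "x \<in> RL ==> of_int k *\<^sub>R x \<in> RL"
 using lattice_RL lattice_diff[OF lattice_RL] lattice_int[OF lattice_RL] unfolding lattice_def by blast+

lemma R_RL: "a \<in> R ==> a \<in> RL"
 using crd_int by (simp add: RL_iff)

lemma RL_P: "x \<in> RL ==> x \<in> P"
proof -
 assume "x \<in> RL"
 hence k: "!!i. i \<in> ix ==> x \<bullet> fw i \<in> \<int>" by (simp add: RL_iff)
 show "x \<in> P"
  unfolding weights_def
 proof (intro CollectI ballI)
  fix a assume a: "a \<in> R"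
  have "x \<cdot> a = (\<Sum>i\<in>ix. (x \<bullet> fw i) * (al i \<cdot> a))" by (rule inner_expand)
  thus "x \<cdot> a \<in> \<int>" using k int_R[OF a al_R] by (auto intro!: Ints_sum Ints_mult)
 qed
qed

lemma RL_coroot: "x \<in> RL ==> a \<in> R ==> x \<cdot> a \<in> \<int>"
 using RL_P by (auto simp: weights_def)

lemma RL_refl: "a \<in> R ==> x \<in> RL ==> reflection a x \<in> RL"
proof -
 assume a: "a \<in> R" and x: "x \<in> RL"
 obtain k where "x \<cdot> a = of_int k" using RL_coroot[OF x a] Ints_cases by blast
 thus ?thesis using RL_diff[OF x RL_int[OF R_RL[OF a]]] by (simp add: reflection_def)
qed

lemma RL_W: "w \<in> W ==> x \<in> RL ==> w x \<in> RL"
 by (induction w rule: W_induct) (auto simp: RL_refl al_R)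

lemma RL_induct [consumes 1, case_names zero short add]:
 assumes x: "x \<in> RL" and 0: "Q 0" and sh: "!!g. g \<in> Sh ==> Q g"
  and add: "!!x y. x \<in> RL ==> y \<in> RL ==> Q x ==> Q y ==> Q (x + y)"
 shows "Q x"
proof -
 let ?S = "{x \<in> RL. Q x & Q (- x)}"
 have S_add: "x + y \<in> ?S" if "x \<in> ?S" "y \<in> ?S" for x y
  using that add[of x y] add[of "- x" "- y"] RL_add RL_minus by (simp add: algebra_simps)
 have S0: "0 \<in> ?S" using 0 RL_0 by simp
 have S_int: "of_int k *\<^sub>R x \<in> ?S" if x: "x \<in> ?S" for k x
 proof -
  have n: "real n *\<^sub>R y \<in> ?S" if "y \<in> ?S" for y n
  proof (induction n)
   case (Suc n)
   show ?case using S_add[OF that Suc] by (simp add: algebra_simps)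
  qed (use S0 in simp)
  obtain n where "k = int n | k = - int n" by (metis int_cases2)
  moreover have "- x \<in> ?S" using x RL_minus by simp
  ultimately show ?thesis using n[OF x, of n] n[of "- x" n] by auto
 qed
 have short: "g \<in> ?S" if "g \<in> Sh" for g
  using that sh Sh_minus R_RL Sh_R by simp
 have S_al: "al i \<in> ?S" if i: "i \<in> ix" for i
 proof (cases "al i \<in> Sh")
  case False
  obtain g where g: "g \<in> Sh" "g \<bullet> al i > 0" using short_meets[OF al_R[OF i]] by blast
  have "g \<cdot> al i = 1" using long_RI_sq(1)[OF al_RI[OF i] False g] .
  hence "al i = g + - reflection (al i) g" by (simp add: reflection_def)
  moreover have "- reflection (al i) g \<in> Sh" using Sh_minus Sh_refl[OF al_R[OF i] g(1)] by blast
  ultimately show ?thesis using S_add[OF short[OF g(1)] short] by (subst \<open>al i = _\<close>) blast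
 qed (rule short)
 have k: "!!i. i \<in> ix ==> x \<bullet> fw i = of_int \<lfloor>x \<bullet> fw i\<rfloor>" using x by (force simp: RL_iff Ints_def)
 have "(\<Sum>i\<in>J. of_int \<lfloor>x \<bullet> fw i\<rfloor> *\<^sub>R al i) \<in> ?S" if "finite J" "J \<subseteq> ix" for J
  using that
 proof (induction J)
  case (insert i J)
  thus ?case using S_add[OF S_int[OF S_al[of i]]] by simp
 qed (use S0 in simp)
 from this[of ix] have "x \<in> ?S" using expand[of x] k by simp
 thus ?thesis by blast
qed

abbreviation "tr \<equiv> transl :: 'v => 'v => 'v"

lemma tr_add: "tr (x + y) = tr x o tr y" and tr_0: "tr 0 = id"
 by (auto simp: transl_def fun_eq_iff)

lemma inv_tr: "inv (tr x) = tr (- x)"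
 by (rule inv_unique_comp) (simp_all flip: tr_add add: tr_0)

lemma tr_aff: "x \<in> RL ==> tr x \<in> aff_weyl D"
proof (induction rule: RL_induct)
 case zero
 thus ?case unfolding tr_0 by (rule weyl_id)
next
 case (add x y)
 thus ?case unfolding tr_add using weyl_comp by blast
next
 case (short g)
 have b: "tr bt = s 0 o sth" by (simp add: fun_eq_iff transl_def s_0 s_theta_bt)
 hence t: "tr bt \<in> aff_weyl D" using weyl_comp[OF weyl_gen_in[OF zero_aix] sth_aff] by simp
 obtain w where w: "w \<in> W" "w bt = g" using short_trans[OF bt_Sh short] by blast
 have "tr g = w o tr bt o inv w"
  using w W_linear[OF w(1)] by (simp add: fun_eq_iff transl_def linear_add)
 thus ?case using weyl_comp t W_aff w W_inv_in by metis
qed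

definition antiL :: "'v => bool" where
 "antiL x \<longleftrightarrow> x \<in> RL & (\<forall>i\<in>ix. x \<cdot> al i <= 0)"

lemma antiL_iff: "antiL x \<longleftrightarrow> x \<in> RL & antidominant D x"
 by (simp add: antiL_def antidominant_def fin_ix_def)

lemma antiL_RL: "antiL x ==> x \<in> RL"
 by (simp add: antiL_def)

lemma antiL_add: "antiL x ==> antiL y ==> antiL (x + y)"
 by (auto simp: antiL_def RL_add inner_add_left intro: add_nonpos_nonpos)

lemma antiL_posr: assumes "antiL x" "a \<in> R" "posr a" shows "x \<cdot> a <= 0"
proof -
 have "- x \<bullet> al i >= 0" if "i \<in> ix" for i
  using assms(1) that coroot_sign[OF al_R[OF that], of x] by (auto simp: antiL_def)
 hence "dominant (- x)" by (simp add: dominant_def)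
 thus ?thesis using dominant_coroot[of "- x"] assms by fastforce
qed

text \<open>A positive affine root made negative by an antidominant translation has positive
  gradient, and a further antidominant translation does not raise it again; so lengths add.\<close>

lemma T_tr_add: assumes "antiL x" "antiL y" "f \<in> wt" shows "T (tr (x + y)) f = T (tr x) (T (tr y) f)"
 unfolding tr_add
proof (rule T_additive)
 show "tr x \<in> aff_weyl D" "tr y \<in> aff_weyl D" "f \<in> wt" using assms tr_aff antiL_RL by auto
 fix b assume b: "b \<in> Phi aix" "b pp > 0" "b (tr x pp) < 0"
 obtain a m where a: "a \<in> RI" "b = aff a m" using b(1) by (auto simp: Phi_def)
 have aR: "a \<in> R" using a RI_R by blast
 have "x \<cdot> a < 0" using b a by (simp add: aff_def transl_def inner_add_left)
 hence "posr a" using not_posr[OF aR] antiL_posr[OF assms(1) minus_R[OF aR]] by fastforce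
 hence "y \<cdot> a <= 0" using antiL_posr[OF assms(2) aR] by blast
 thus "b (tr x (tr y pp)) < 0" using b a by (simp add: aff_def transl_def inner_add_left)
qed

text \<open>The double of the half sum of the indivisible positive roots: regular like the half sum,
  but always in the root lattice.\<close>

definition rho2 :: 'v where "rho2 = (\<Sum>a\<in>{a \<in> RI. posr a}. a)"

lemma rho2_RL: "rho2 \<in> RL"
proof -
 have "(\<Sum>a\<in>J. a) \<in> RL" if "finite J" "J \<subseteq> RI" for J
  using that by (induction J) (auto simp: RL_0 RL_add R_RL RI_R)
 moreover have "finite RI" using finite_R by (simp add: RI_def)
 ultimately show ?thesis unfolding rho2_def by simp
qed

text \<open>The reflection in \<open>al i\<close> permutes the positive indivisible roots other than
  \<open>al i\<close> and negates \<open>al i\<close>.\<close>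

lemma rho2_pair: assumes i: "i \<in> ix" shows "rho2 \<cdot> al i = 2"
proof -
 let ?B = "{a \<in> RI. posr a} - {al i}"
 have fin: "finite {a \<in> RI. posr a}" using finite_R by (simp add: RI_def)
 have st: "reflection (al i) a \<in> ?B" if a: "a \<in> ?B" for a
 proof -
  have nm: "a ~= c *\<^sub>R al i" for c using a RI_multiple[OF _ _ i] by blast
  have "reflection (al i) a ~= al i"
  proof
   assume "reflection (al i) a = al i"
   hence "a = - al i" using reflection_reflection[of "al i" a] reflection_self[of "al i"] by simp
   thus False using nm[of "-1"] by simp
  qed
  thus ?thesis using a RI_refl[OF al_R[OF i]] posr_refl[OF _ _ i nm] RI_R by simp
 qed
 have bij: "bij_betw (reflection (al i)) ?B ?B"
  using st by (intro bij_betw_byWitness[where f' = "reflection (al i)"]) auto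
 have e: "rho2 = al i + \<Sum> ?B"
  unfolding rho2_def using fin al_RI[OF i] posr_al[OF i] by (simp add: sum.remove)
 have "reflection (al i) (\<Sum> ?B) = \<Sum> ?B"
  using linear_sum[OF linear_reflection, of "al i" "%x. x" ?B] sum.reindex_bij_betw[OF bij, of "%x. x"] by simp
 hence "reflection (al i) rho2 = - al i + \<Sum> ?B"
  using e linear_add[OF linear_reflection, of "al i" "al i" "\<Sum> ?B"] reflection_self by simp
 hence "rho2 - (rho2 \<cdot> al i) *\<^sub>R al i = rho2 - 2 *\<^sub>R al i"
  unfolding e reflection_def by (simp add: scaleR_2 algebra_simps)
 thus ?thesis using root_nonzero[OF al_R[OF i]] by simp
qed

lemma pair_nonpos: "i \<in> ix ==> j \<in> ix ==> i ~= j ==> al i \<cdot> al j <= 0"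
 using al_inner_nonpos coroot_sign[OF al_R, of j "al i"] by force

lemma shift_ex: assumes "x \<in> RL" shows "\<exists>k::nat. \<forall>j\<in>ix. x \<cdot> al j <= real k"
proof (intro exI ballI)
 fix j assume "j \<in> ix"
 hence "x \<cdot> al j <= Max ((%j. x \<cdot> al j) ` ix)" by simp
 also have "... <= real (nat \<lceil>Max ((%j. x \<cdot> al j) ` ix)\<rceil>)" by linarith
 finally show "x \<cdot> al j <= real (nat \<lceil>Max ((%j. x \<cdot> al j) ` ix)\<rceil>)" .
qed

lemma shift: assumes x: "x \<in> RL" obtains m where "antiL (x + m)" "antiL m"
proof -
 obtain k :: nat where k: "\<forall>j\<in>ix. x \<cdot> al j <= real k" using shift_ex[OF x] by blast
 have "antiL (x + (- real k) *\<^sub>R rho2)" "antiL ((- real k) *\<^sub>R rho2)"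
  using k RL_int[OF rho2_RL, of "- int k"] RL_add[OF x, of "- (real k *\<^sub>R rho2)"] by (auto simp: antiL_def inner_diff_left rho2_pair)
 thus ?thesis using that by blast
qed

text \<open>The vector \<open>al i - rho2\<close> pairs to 0 with \<open>al i\<close> and to at most
  -2 with the other simple roots, so its multiples make \<open>x\<close> antidominant without
  touching the pairing with \<open>al i\<close>.\<close>

lemma shift_i: assumes x: "x \<in> RL" and i: "i \<in> ix" and np: "x \<cdot> al i <= 0"
 obtains m where "antiL (x + m)" "antiL m" "m \<cdot> al i = 0"
proof -
 obtain k :: nat where k: "\<forall>j\<in>ix. x \<cdot> al j <= real k" using shift_ex[OF x] by blast
 let ?m = "real k *\<^sub>R (al i - rho2)"
 have mi: "?m \<cdot> al i = 0"
  using rho2_pair[OF i] inner_coroot_self[OF root_nonzero[OF al_R[OF i]]] by (simp add: inner_diff_left)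
 have mj: "?m \<cdot> al j <= - real k * 2" if j: "j \<in> ix" "j ~= i" for j
 proof -
  have "(al i - rho2) \<cdot> al j <= - 2" using rho2_pair[OF j(1)] pair_nonpos[OF i j(1)] j by (simp add: inner_diff_left)
  from mult_left_mono[OF this, of "real k"] show ?thesis by simp
 qed
 have mL: "?m \<in> RL" using RL_int[OF RL_diff[OF R_RL[OF al_R[OF i]] rho2_RL], of "int k"] by simp
 have "?m \<cdot> al j <= 0 & (x + ?m) \<cdot> al j <= 0" if j: "j \<in> ix" for j
 proof (cases "j = i")
  case True thus ?thesis using mi np unfolding inner_add_left True by linarith
 next
  case False
  hence "x \<cdot> al j <= real k" "?m \<cdot> al j <= - real k * 2" using k mj j by auto
  thus ?thesis unfolding inner_add_left by auto
 qed
 hence "antiL ?m" "antiL (x + ?m)" using mL RL_add[OF x mL] by (auto simp: antiL_def)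
 thus ?thesis using that mi by blast
qed

subsection \<open>The operators Y\<close>

abbreviation "Y \<equiv> Y_op D"

lemma T_tr_comm: "antiL x ==> antiL y ==> f \<in> wt ==> T (tr x) (T (tr y) f) = T (tr y) (T (tr x) f)"
 using T_tr_add[of x y f] T_tr_add[of y x f] by (simp add: add.commute)

lemma T_Tj_comm:
 assumes "antiL x" "antiL y" "f \<in> wt" shows "T (tr x) (Tj (tr y) f) = Tj (tr y) (T (tr x) f)"
proof -
 note a = tr_aff[OF antiL_RL[OF assms(1)]] tr_aff[OF antiL_RL[OF assms(2)]]
 have "T (tr y) (T (tr x) (Tj (tr y) f)) = T (tr x) f"
  using T_tr_comm[OF assms(2,1) Tj_wt[OF a(2) assms(3)]] a assms(3) by simp
 thus ?thesis using Tj_T[OF a(2) T_wt[OF a(1) Tj_wt[OF a(2) assms(3)]]] by simp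
qed

text \<open>The choice inside \<open>Y_op\<close> is harmless: two decompositions x - y = u - v are
  compared through x + v = u + y, where \<open>T_tr_add\<close> applies.\<close>

lemma Y_eq: assumes x: "antiL x" and y: "antiL y" and f: "f \<in> wt"
 shows "Y (x - y) f = T (tr x) (Tj (tr y) f)"
proof -
 let ?p = "%(u, v). u \<in> RL & v \<in> RL & antidominant D u & antidominant D v & x - y = u - v"
 obtain u v where uv: "(SOME z. ?p z) = (u, v)" by (rule prod.exhaust)
 have xy: "?p (x, y)" using x y unfolding antiL_iff by simp
 have "?p (SOME z. ?p z)" by (rule someI[of ?p, OF xy])
 hence u: "antiL u" "antiL v" "x - y = u - v" unfolding uv by (auto simp: antiL_iff)
 hence e: "x + v = u + y" by (simp add: algebra_simps)
 note a = tr_aff[OF antiL_RL[OF x]] tr_aff[OF antiL_RL[OF y]] tr_aff[OF antiL_RL[OF u(1)]] tr_aff[OF antiL_RL[OF u(2)]]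
 define h where "h = Tj (tr v) (Tj (tr y) f)"
 have h: "h \<in> wt" "Tj (tr y) f = T (tr v) h" using Tj_wt a f by (simp_all add: h_def)
 have f': "f = T (tr v) (T (tr y) h)" using h(2) T_Tj[OF a(2) f] T_tr_comm[OF u(2) y h(1)] by simp
 have "Y (x - y) f = T (tr u) (Tj (tr v) f)"
  unfolding Y_op_def uv using inv_op_iso[OF iso_T[OF a(4)] f] by simp
 also have "... = T (tr u) (T (tr y) h)" using f' Tj_T[OF a(4) T_wt[OF a(2) h(1)]] by simp
 also have "... = T (tr x) (T (tr v) h)" using T_tr_add[OF u(1) y h(1)] T_tr_add[OF x u(2) h(1)] e by simp
 finally show ?thesis using h(2) by simp
qed

lemma Y_ex: assumes "x \<in> RL" obtains u v where "antiL u" "antiL v" "x = u - v"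
proof -
 obtain m where m: "antiL (x + m)" "antiL m" using shift[OF assms] by blast
 thus ?thesis using that[of "x + m" m] by simp
qed

lemma Y_anti: "antiL x ==> f \<in> wt ==> Y x f = T (tr x) f"
proof -
 assume x: "antiL x" and f: "f \<in> wt"
 have z: "antiL 0" by (simp add: antiL_def RL_0)
 show ?thesis using Y_eq[OF x z f] Tj_id[OF f] by (simp add: tr_0)
qed

lemma Y_wt: "x \<in> RL ==> f \<in> wt ==> Y x f \<in> wt"
 by (metis Y_ex Y_eq T_wt Tj_wt tr_aff antiL_RL)

lemma Y_0: "f \<in> wt ==> Y 0 f = f"
 using Y_anti[of 0 f] T_id by (simp add: tr_0 antiL_def RL_0)

lemma Y_lin: assumes "x \<in> RL" "f \<in> wt" "g \<in> wt"
 shows "Y x (f + g) = Y x f + Y x g" "Y x (scale c f) = scale c (Y x f)"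
proof -
 obtain u v where u: "antiL u" "antiL v" "x = u - v" using Y_ex assms by blast
 note l = linop_T[OF tr_aff[OF antiL_RL[OF u(1)]]] linop_Tj[OF tr_aff[OF antiL_RL[OF u(2)]]]
 show "Y x (f + g) = Y x f + Y x g" "Y x (scale c f) = scale c (Y x f)"
  unfolding u(3) by (simp_all add: Y_eq[OF u(1,2)] assms add_wt scale_wt linop_add[OF l(1)] linop_add[OF l(2)]
   linop_scale[OF l(1)] linop_scale[OF l(2)])
qed

lemma Y_add: assumes x: "x \<in> RL" and y: "y \<in> RL" and f: "f \<in> wt" shows "Y (x + y) f = Y x (Y y f)"
proof -
 obtain u v where u: "antiL u" "antiL v" "x = u - v" using Y_ex x by blast
 obtain u' v' where u': "antiL u'" "antiL v'" "y = u' - v'" using Y_ex y by blast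
 note a = tr_aff[OF antiL_RL]
 note a2 = a[OF antiL_add[OF u(2) u'(2)]]
 have fw: "Tj (tr v') f \<in> wt" "Tj (tr v) (Tj (tr v') f) \<in> wt" using Tj_wt a u u' f by auto
 have j: "Tj (tr (v + v')) f = Tj (tr v) (Tj (tr v') f)"
 proof -
  have "T (tr (v' + v)) (Tj (tr v) (Tj (tr v') f)) = f"
   using T_tr_add[OF u'(2) u(2) fw(2)] a u u' f fw by simp
  thus ?thesis using T_inv_eq[OF a2 fw(2) f] by (simp add: add.commute)
 qed
 have "x + y = (u + u') - (v + v')" using u u' by simp
 hence "Y (x + y) f = T (tr (u + u')) (Tj (tr (v + v')) f)"
  using Y_eq[OF antiL_add[OF u(1) u'(1)] antiL_add[OF u(2) u'(2)] f] by (simp only:)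
 also have "... = T (tr u) (T (tr u') (Tj (tr v) (Tj (tr v') f)))"
  unfolding j by (rule T_tr_add[OF u(1) u'(1) fw(2)])
 also have "... = T (tr u) (Tj (tr v) (T (tr u') (Tj (tr v') f)))" using T_Tj_comm[OF u'(1) u(2) fw(1)] by simp
 also have "... = Y x (Y y f)" using Y_eq[OF u(1,2) Y_wt[OF y f]] Y_eq[OF u'(1,2) f] u u' by simp
 finally show ?thesis .
qed

lemma Y_minus: "x \<in> RL ==> f \<in> wt ==> Y (- x) (Y x f) = f" "x \<in> RL ==> f \<in> wt ==> Y x (Y (- x) f) = f"
 using Y_add[of "- x" x f] Y_add[of x "- x" f] RL_minus Y_0 by auto

lemma A_tr: "i \<in> ix ==> A i (tr x y) = A i y + x \<cdot> al i"
 by (simp add: A_fin transl_def inner_add_left)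

lemma T_tr_0: assumes "antiL x" "i \<in> ix" "x \<cdot> al i = 0" "f \<in> wt"
 shows "TT i (T (tr x) f) = T (tr x) (TT i f)"
proof -
 have i': "i \<in> aix" using assms ix_aix by blast
 note a = tr_aff[OF antiL_RL[OF assms(1)]]
 have "s i o tr x = tr x o s i"
  using assms(2,3) by (auto simp: fun_eq_iff weyl_gen_fin transl_def reflection_def inner_add_left)
 moreover have "A i (tr x pp) > 0" "A i (inv (tr x) pp) > 0"
  using A_tr[OF assms(2)] A_pp[OF i'] assms(3) by (auto simp: inv_tr)
 ultimately show ?thesis using T_up_left[OF i' a _ assms(4)] T_up_right[OF i' a _ assms(4)] by simp
qed

lemma Y_TT_0: assumes x: "x \<in> RL" and i: "i \<in> ix" and p: "x \<cdot> al i = 0" and f: "f \<in> wt"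
 shows "TT i (Y x f) = Y x (TT i f)"
proof -
 have i': "i \<in> aix" using i ix_aix by blast
 obtain m where m: "antiL (x + m)" "antiL m" "m \<cdot> al i = 0" using shift_i[OF x i] p by auto
 note a = tr_aff[OF antiL_RL]
 have j: "TT i (Tj (tr m) f) = Tj (tr m) (TT i f)"
 proof -
  have "T (tr m) (TT i (Tj (tr m) f)) = TT i f"
   using T_tr_0[OF m(2) i m(3) Tj_wt[OF a[OF m(2)] f]] a[OF m(2)] f by simp
  thus ?thesis using T_inv_eq[OF a[OF m(2)]] TT_wt i' Tj_wt a m f by blast
 qed
 have pm: "(x + m) \<cdot> al i = 0" using p m by (simp add: inner_add_left)
 have "Y x f = T (tr (x + m)) (Tj (tr m) f)" "Y x (TT i f) = T (tr (x + m)) (Tj (tr m) (TT i f))"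
  using Y_eq[OF m(1,2)] f TT_wt[OF i'] by auto
 thus ?thesis using T_tr_0[OF m(1) i pm Tj_wt[OF a[OF m(2)] f]] j by simp
qed

text \<open>With \<open>v = s i o tr x\<close> one has \<open>tr x = s i o v\<close> and
  \<open>v o v = tr (x + s i x)\<close>, both with additive lengths. This is Bernstein's relation
  for antidominant \<open>x\<close>.\<close>

lemma T_refl_tr: assumes x: "antiL x" and i: "i \<in> ix" and p: "x \<cdot> al i = -1" and f: "f \<in> wt"
 shows "antiL (x + s i x)" and "T (tr (x + s i x)) f = TTi i (T (tr x) (TTi i (T (tr x) f)))"
proof -
 have i': "i \<in> aix" using i ix_aix by blast
 have si: "s i x = x + al i" using p by (simp add: weyl_gen_fin[OF i] reflection_def)
 have pi: "al i \<cdot> al i = 2" using inner_coroot_self root_nonzero al_R i by blast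
 show anti: "antiL (x + s i x)"
 proof -
  have "(x + (x + al i)) \<cdot> al j <= 0" if j: "j \<in> ix" for j
  proof (cases "j = i")
   case True thus ?thesis using p pi by (simp add: inner_add_left)
  next
   case False
   hence "al i \<cdot> al j <= 0" "x \<cdot> al j <= 0" using pair_nonpos i j x by (auto simp: antiL_def)
   thus ?thesis by (simp add: inner_add_left)
  qed
  thus ?thesis unfolding si using RL_add R_RL al_R i antiL_RL[OF x] by (simp add: antiL_def)
 qed
 note a = tr_aff[OF antiL_RL[OF x]]
 define v where "v = s i o tr x"
 have va: "v \<in> aff_weyl D" unfolding v_def using weyl_comp weyl_gen_in i' a by blast
 have v1: "s i o v = tr x" unfolding v_def comp_assoc[symmetric] s_comp_s[OF i'] id_comp ..
 have Ai: "A i pp < 1" using pp_lt1[OF al_R[OF i]] A_fin[OF i] by simp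
 have "A i (v pp) > 0" unfolding v_def comp_apply A_s[OF i'] using A_tr[OF i, of x pp] p Ai by simp
 hence Tx: "T (tr x) f = TT i (T v f)" if "f \<in> wt" for f using T_up_left[OF i' va _ that] v1 by simp
 have Tv: "T v f = TTi i (T (tr x) f)" if "f \<in> wt" for f
  using Tx[OF that] i' T_wt[OF va that] by simp
 have vv: "v o v = tr (x + s i x)"
  using linear_add[OF linear_reflection, of "al i"] i
  by (auto simp: v_def fun_eq_iff weyl_gen_fin transl_def add.assoc)
 have "T (v o v) f = T v (T v f)"
 proof (rule T_additive[OF va va f])
  fix b assume b: "b \<in> Phi aix" "b pp > 0" "b (v pp) < 0"
  obtain a m where a: "a \<in> RI" "b = aff a m" using b(1) by (auto simp: Phi_def)
  let ?a = "reflection (al i) a"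
  have aR: "a \<in> R" "?a \<in> R" using a RI_R refl_R al_R i by auto
  have bv: "b (v pp) = pp \<cdot> ?a + x \<cdot> ?a + m"
   unfolding a v_def comp_apply aff_s_fin[OF i] by (simp add: aff_def transl_def inner_add_left)
  have "s i x \<cdot> a = x \<cdot> ?a"
   by (simp add: weyl_gen_fin[OF i] coroot_refl reflection_swap)
  hence bvv: "b (v (v pp)) = pp \<cdot> a + x \<cdot> a + x \<cdot> ?a + m"
   using fun_cong[OF vv, of pp] unfolding a by (simp add: aff_def transl_def inner_add_left)
  have bp: "m >= 1 | m = 0 & posr a" using b(2) aff_pp[OF aR(1)] a by blast
  obtain k where k: "x \<cdot> ?a = of_int k" using RL_coroot[OF antiL_RL[OF x] aR(2)] Ints_cases by blast
  note l = pp_lt1[OF aR(1)] pp_lt1[OF aR(2)] pp_coroot[OF aR(1)] pp_coroot[OF aR(2)]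
  \<comment> \<open>The gradients \<open>al i\<close> and its negative change sign under the
    reflection and are treated apart. For the others \<open>k + m\<close> is an integer, which
    outweighs the contribution of \<open>pp\<close>, smaller than 1.\<close>
  consider (1) "a = al i" | (2) "a = - al i" | (3) "a ~= al i" "a ~= - al i" by blast
  thus "b (v (v pp)) < 0"
  proof cases
   case 1
   hence "?a = - al i" by (simp add: reflection_self)
   thus ?thesis using b(3) bp bv p Ai A_fin[OF i] by simp
  next
   case 2
   hence "?a = al i" using linear_neg[OF linear_reflection, of "al i" "al i"] by (simp add: reflection_self)
   moreover have "m >= 1" using bp 2 posr_al[OF i] by (auto simp: posr_def)
   ultimately have "b (v pp) > 0" using bv p A_pp[OF i'] A_fin[OF i] by simp
   thus ?thesis using b(3) by simp
  next
   case 3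
   show ?thesis
   proof (cases "posr a")
    case True
    have "a ~= c *\<^sub>R al i" for c using RI_multiple[OF a(1) True i] 3 by blast
    hence "posr ?a" using posr_refl[OF aR(1) True i] by blast
    hence "pp \<cdot> ?a > 0" using l by blast
    hence "k + m < 0" using b(3) bv k by linarith
    thus ?thesis using bvv k l(1) antiL_posr[OF x aR(1) True] by linarith
   next
    case False
    hence n: "posr (- a)" "- a \<in> RI" using not_posr aR RI_minus a by auto
    have "- a ~= c *\<^sub>R al i" for c using RI_multiple[OF n(2,1) i, of c] 3(2) by (metis minus_minus)
    hence "posr (reflection (al i) (- a))" using posr_refl[OF _ n(1) i] aR by simp
    hence n': "posr (- ?a)" using linear_neg[OF linear_reflection, of "al i" a] by simp
    hence "k >= 0" using antiL_posr[OF x _ n'] aR k by simp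
    hence "k + m >= 1" using bp False by linarith
    hence "b (v pp) > 0" using bv k l(2) by linarith
    thus ?thesis using b(3) by simp
   qed
  qed
 qed
 thus "T (tr (x + s i x)) f = TTi i (T (tr x) (TTi i (T (tr x) f)))"
  unfolding vv using Tv[OF f] Tv[OF T_wt[OF va f]] by simp
qed

text \<open>A shift by a lattice vector orthogonal to \<open>al i\<close>, whose \<open>Y\<close>
  commutes with \<open>TTi i\<close>, reduces the claim to antidominant \<open>x\<close>.\<close>

lemma Y_refl: assumes x: "x \<in> RL" and i: "i \<in> ix" and p: "x \<cdot> al i = -1" and f: "f \<in> wt"
 shows "Y (s i x) f = TTi i (Y x (TTi i f))"
proof -
 have i': "i \<in> aix" using i ix_aix by blast
 note a = tr_aff[OF antiL_RL]
 have main: "Y (s i y) f = TTi i (Y y (TTi i f))"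
  if y: "antiL y" "y \<cdot> al i = -1" and f: "f \<in> wt" for y f
 proof -
  have f': "Tj (tr y) f \<in> wt" using Tj_wt a y f by blast
  note r = T_refl_tr[OF y(1) i y(2) f']
  have "Y (s i y) f = T (tr (y + s i y)) (Tj (tr y) f)" using Y_eq[OF r(1) y(1) f] by simp
  also have "... = TTi i (T (tr y) (TTi i f))" using r(2) a[OF y(1)] f by simp
  finally show ?thesis using Y_anti[OF y(1) TTi_wt[OF i' f]] by simp
 qed
 obtain m where m: "antiL (x + m)" "antiL m" "m \<cdot> al i = 0" using shift_i[OF x i] p by auto
 have mL: "- m \<in> RL" "x + m \<in> RL" "m \<in> RL" using m antiL_RL RL_minus by auto
 have si: "s i (x + m) = s i x + m" "s i x \<in> RL" using m(3) RL_refl[OF al_R[OF i] x]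
  by (auto simp: weyl_gen_fin[OF i] reflection_def inner_add_left)
 have pm: "(x + m) \<cdot> al i = -1" "(- m) \<cdot> al i = 0" using p m by (auto simp: inner_add_left)
 note fi = TTi_wt[OF i' f]
 have "Y (s i x) f = Y (s i (x + m)) (Y (- m) f)"
  using Y_add[OF RL_add[OF si(2) mL(3)] mL(1) f] si(1) by simp
 also have "... = TTi i (Y (x + m) (TTi i (Y (- m) f)))" by (rule main[OF m(1) pm(1) Y_wt[OF mL(1) f]])
 also have "TTi i (Y (- m) f) = Y (- m) (TTi i f)"
 proof -
  have "TT i (Y (- m) (TTi i f)) = Y (- m) f" using Y_TT_0[OF mL(1) i pm(2) fi] i' f by simp
  thus ?thesis using TTi_TT[OF i' Y_wt[OF mL(1) fi]] by simp
 qed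
 also have "Y (x + m) (Y (- m) (TTi i f)) = Y x (TTi i f)" using Y_add[OF mL(2,1) fi] by simp
 finally show ?thesis .
qed

lemma Y_bt: assumes f: "f \<in> wt" shows "Y (- bt) f = T sth (TT 0 f)"
proof -
 have "bt \<cdot> al i >= 0" if "i \<in> ix" for i
  using dominant_coroot[OF bt_dom al_R posr_al] that by blast
 hence "antiL (- bt)" using RL_minus R_RL bt_R by (simp add: antiL_def)
 hence "Y (- bt) f = T (tr (- bt)) f" using Y_anti f by blast
 also have "tr (- bt) = sth o s 0"
  using linear_add[OF linear_reflection, of bt] reflection_self[of bt]
  by (auto simp: fun_eq_iff transl_def s_0 s_theta_bt)
 also have "T (sth o s 0) f = T sth (TT 0 f)"
 proof (rule T_up_right[OF zero_aix sth_aff _ f])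
  have "inv sth = sth" by (rule inv_equality) (simp_all add: s_theta_bt)
  moreover have "pp \<bullet> theta D > 0" using pp_coroot[OF bt_R] posr_bt coroot_bt by simp
  moreover have "sth pp \<bullet> theta D = - (pp \<bullet> theta D)"
   by (simp add: s_theta_bt reflection_swap flip: coroot_bt) (simp add: coroot_def reflection_self linear_cmul[OF linear_reflection])
  ultimately show "A 0 (inv sth pp) > 0" by (simp add: A_0)
 qed
 finally show ?thesis .
qed

lemma Tj_W_inv: assumes "w \<in> W" "i \<in> ix" "posr (w (al i))" "f \<in> wt"
 shows "Tj (inv (w o s i)) f = Tj (inv w) (TTi i f)"
proof -
 have i': "i \<in> aix" using assms(2) ix_aix by blast
 have iw: "inv w \<in> aff_weyl D" "inv (w o s i) \<in> aff_weyl D"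
  using W_aff W_inv_in weyl_comp s_W assms by (metis, metis)
 have f: "TTi i f \<in> wt" using TTi_wt i' assms(4) by blast
 have "T (inv (w o s i)) (Tj (inv w) (TTi i f)) = f"
  using W_up_left_inv[OF assms(1-3) Tj_wt[OF iw(1) f]] iw(1) f i' assms(4) by simp
 thus ?thesis by (rule T_inv_eq[OF iw(2) Tj_wt[OF iw(1) f] assms(4), THEN iffD1, THEN sym])
qed

text \<open>The counterpart of \<open>X_short\<close> with \<open>TT 0\<close> in the place of
  \<open>T03\<close>. The base case is that translation by minus \<open>bt\<close> is
  \<open>sth o s 0\<close> with additive lengths.\<close>

lemma Y_short:
 assumes "w \<in> W" "posr (inv w bt)" "f \<in> wt"
 shows "Y (- inv w bt) f = T (inv (sth o w)) (TT 0 (Tj (inv w) f))"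
 using assms
proof (induction w arbitrary: f rule: short_induct)
 case id
 have "inv id bt = bt" "inv sth = sth" "inv id = id" by (auto intro!: inv_equality simp: s_theta_bt)
 thus ?case unfolding comp_id using Y_bt Tj_id id by metis
next
 case (orth i w)
 have i': "i \<in> aix" using orth ix_aix by blast
 have fi: "TTi i f \<in> wt" using TTi_wt i' orth(8) by blast
 have L: "- inv w bt \<in> RL" using RL_minus R_RL Sh_R short_inv(1)[OF orth(2)] by blast
 have h: "TT 0 (Tj (inv w) (TTi i f)) \<in> wt" using TT_wt zero_aix Tj_wt W_aff W_inv_in orth(2) fi by blast
 show ?case
  unfolding orth(5) Tj_W_inv[OF orth(2,1,3,8)] comp_assoc[symmetric] W_up_left_inv[OF sth_W[OF orth(2)] orth(1,6) h] orth(7)[OF fi, symmetric]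
  using Y_TT_0[OF L orth(1) _ fi] orth(4) TT_TTi[OF i' orth(8)] by simp
next
 case (down i w)
 have i': "i \<in> aix" using down ix_aix by blast
 have fi: "TTi i f \<in> wt" using TTi_wt i' down(8) by blast
 have L: "- inv w bt \<in> RL" using RL_minus R_RL Sh_R short_inv(1)[OF down(2)] by blast
 let ?h = "TT 0 (Tj (inv w) (TTi i f))" and ?u = "inv ((sth o w) o s i)"
 have h: "?h \<in> wt" using TT_wt zero_aix Tj_wt W_aff W_inv_in down(2) fi by blast
 have u: "?u \<in> aff_weyl D" using W_aff W_inv_in weyl_comp s_W sth_W down(1,2) by metis
 have "Y (- inv w bt) (TTi i f) = TT i (T ?u ?h)"
  by (simp only: W_down_left_inv[OF sth_W[OF down(2)] down(1,6) h] down(7)[OF fi])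
 hence "T ?u ?h = TTi i (Y (- inv w bt) (TTi i f))" using TTi_TT[OF i' T_wt[OF u h]] by simp
 also have "... = Y (s i (- inv w bt)) f" by (rule Y_refl[OF L down(1) _ down(8), symmetric]) (use down(4) in simp)
 also have "s i (- inv w bt) = - (inv w bt - al i)" using down(4) by (simp add: weyl_gen_fin[OF down(1)] reflection_def)
 finally show ?case unfolding down(5) Tj_W_inv[OF down(2,1,3,8)] comp_assoc by (rule sym)
qed

subsection \<open>The operator \<open>T\<^sub>0\<^sub>3\<close>\<close>

lemma T03_lin: assumes "f \<in> wt" "g \<in> wt"
 shows "T03 D (f + g) = T03 D f + T03 D g" "T03 D (scale c f) = scale c (T03 D f)"
 using assms linop_add[OF linop_Tj[OF sth_aff]] linop_scale[OF linop_Tj[OF sth_aff]]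
 by (simp_all add: T03_eq add_wt scale_wt distrib_left scale_mult_right)

lemma sth_bt: "sth bt = - bt"
 by (simp add: s_theta_bt reflection_self)

lemma sth_orth: "x \<bullet> bt = 0 ==> sth x = x"
 by (simp add: s_theta_bt reflection_orth)

lemma inv_sth: "inv sth = sth"
 by (rule inv_equality) (simp_all add: s_theta_bt)

lemma sth_comp: "sth o sth = id"
 by (auto simp: s_theta_bt)

lemma X_short': assumes "w \<in> W" "posr (inv w bt)" "f \<in> wt"
 shows "T03 D f = T w (ee (inv w bt) * Tj (sth o w) f)"
proof -
 have a: "sth o w \<in> aff_weyl D" using W_aff weyl_comp s_theta_W assms by blast
 show ?thesis using X_short[OF assms(1,2) Tj_wt[OF a assms(3)]] a assms(3) by simp
qed

text \<open>The coefficient in the quadratic relation of \<open>T03\<close>: its parameter is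
  \<open>t03\<close> in the nonreduced case and \<open>t0\<close> in the reduced case.\<close>

definition d3 :: "'p qtfield" where
 "d3 = (if reduced D then dd 0 else t03_half D - inverse (t03_half D))"

lemma t03_ix: "\<exists>w\<in>W. \<exists>i\<in>ix. al i \<in> Sh & w (al i) = bt"
proof -
 obtain w i c where w: "w \<in> W" "i \<in> ix" "bt = c *\<^sub>R w (al i)" using root_conj_simple[OF bt_R] by blast
 have "w (al i) \<in> RI" using RI_W[OF w(1) al_RI[OF w(2)]] .
 have e: "inv w bt = c *\<^sub>R al i" using w W_linear[OF W_inv_in[OF w(1)]] by (simp add: linear_cmul)
 have S: "inv w bt \<in> Sh" using Sh_W W_inv_in w bt_Sh by blast
 show ?thesis
 proof (cases "posr (inv w bt)")
  case True
  hence "inv w bt = al i" using RI_multiple[OF Sh_RI[OF S] True w(2) e] by blast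
  thus ?thesis using S w(1,2) W_inv_r[OF w(1), of bt] by metis
 next
  case False
  hence p: "posr (- inv w bt)" using not_posr Sh_R S by blast
  have "- inv w bt = al i" using RI_multiple[OF RI_minus[OF Sh_RI[OF S]] p w(2), of "- c"] e by simp
  hence "al i \<in> Sh" "(w o reflection (al i)) (al i) = bt"
   using Sh_minus[OF S] W_minus[OF w(1), of "al i"] W_inv_r[OF w(1), of bt] W_minus[OF w(1), of "inv w bt"]
   by (auto simp: reflection_self)
  thus ?thesis using weyl_comp[OF w(1) refl_al_W[OF w(2)]] w(2) by blast
 qed
qed

lemma short_hh: assumes i: "i \<in> ix" and S: "al i \<in> Sh"
 shows "reduced D ==> hh i = hh 0 & gg i = al i & uu i = 0"
  and "~ reduced D ==> gg i = 2 *\<^sub>R al i & uu i = d3"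
proof -
 have nz: "i ~= 0" using ix_nz i by blast
 {
  assume r: "reduced D"
  have "2 *\<^sub>R al i \<notin> R"
  proof
   assume "2 *\<^sub>R al i \<in> R"
   hence "(2::real) = 1 | (2::real) = -1" using r al_R[OF i] unfolding reduced_roots_def by blast
   thus False by simp
  qed
  thus "hh i = hh 0 & gg i = al i & uu i = 0"
   using nz r Sh_sq[OF S] msq_red[OF r] by (simp add: hh_def gg_def uu_def t_half_def t0_half_def)
 next
  assume r: "~ reduced D"
  hence "2 *\<^sub>R al i \<in> R" using nonred_double S by blast
  thus "gg i = 2 *\<^sub>R al i & uu i = d3" using nz r by (simp add: gg_def uu_def d3_def)
 }
qed

text \<open>Take \<open>w\<close> carrying a short simple root \<open>al i\<close> to
  \<open>bt\<close>. Conjugation by \<open>T w\<close> turns \<open>T03\<close> into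
  \<open>Z\<close>, that is e^(al i) times \<open>TTi i\<close>, and the quadratic relation of
  \<open>Z\<close> is a cross relation for \<open>al i\<close> itself: pairing 2 in the reduced
  case, pairing 1 with the doubled root otherwise.\<close>

lemma T03_T03: assumes f: "f \<in> wt" shows "T03 D (T03 D f) = f + scale d3 (T03 D f)"
proof -
 obtain w i where w: "w \<in> W" "i \<in> ix" "al i \<in> Sh" "w (al i) = bt" using t03_ix by blast
 have i': "i \<in> aix" using w ix_aix by blast
 have wa: "w \<in> aff_weyl D" using W_aff w by blast
 have iw: "inv w bt = al i" using w by (metis W_inv_l)
 have alP: "al i \<in> P" using R_weights al_R w by blast
 define Z where "Z = (%g. ee (al i) * TTi i g)"
 have Zw: "Z g \<in> wt" if "g \<in> wt" for g unfolding Z_def using X_wt alP TTi_wt i' that by blast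
 have T: "T03 D g = T w (Z (Tj w g))" if g: "g \<in> wt" for g
 proof -
  have h: "TTi i (Tj w g) \<in> wt" using TTi_wt i' Tj_wt wa g by blast
  have "(sth o w) = w o s i"
   using W_refl[OF w(1), of "al i"] weyl_gen_fin[OF w(2)] w(4) s_theta_bt by simp
  hence "T (sth o w) (TTi i (Tj w g)) = g"
   using W_up_right[OF w(1,2) _ h] w(4) posr_bt i' wa g Tj_wt[OF wa g] by simp
  thus ?thesis using X_short[OF w(1) _ h] iw posr_al[OF w(2)] by (simp add: Z_def)
 qed
 have ZZ: "Z (Z g) = g + scale d3 (Z g)" if g: "g \<in> wt" for g
 proof -
  have h: "TTi i g \<in> wt" "TTi i g \<in> Lg P" using TTi_wt i' g wt_Lg by auto
  have k: "al i \<cdot> al i = 2" using inner_coroot_self root_nonzero al_R w by blast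
  note nz = ix_nz[OF w(2)]
  have TT: "DL (gg i) (QQ i) (hh i) (uu i) (TTi i g) = g" using TT_DL_wt[OF i' h(1)] i' g by simp
  have "TTi i (Z g) = ee (- al i) * g + scale d3 (TTi i g)"
  proof (cases "reduced D")
   case True
   note r = short_hh(1)[OF w(2,3) True]
   have "\<lfloor>al i \<cdot> gg i\<rfloor> = 2" "uu i = 0" "d3 = hh i - inverse (hh i)" using r k True by (auto simp: d3_def dd_def)
   thus ?thesis
    using dl.Ti_2[OF dl_P[OF i'] alP _ h(2)] TTi_dl[OF i' X_wt[OF alP h(1)]] r nz TT
    by (simp add: Z_def QQ_def ee_0 scaleR_2 scale_1_mult)
  next
   case False
   note r = short_hh(2)[OF w(2,3) False]
   have "\<lfloor>al i \<cdot> gg i\<rfloor> = 1" using r k by (simp add: coroot_scaleR)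
   thus ?thesis
    using dl.Ti_1[OF dl_P[OF i'] alP _ h(2)] TTi_dl[OF i' X_wt[OF alP h(1)]] r nz TT
    by (simp add: Z_def QQ_def ee_0 scaleR_2 scale_1_mult)
  qed
  hence "Z (Z g) = ee (al i) * (ee (- al i) * g + scale d3 (TTi i g))" by (simp add: Z_def)
  thus ?thesis by (simp add: distrib_left ee_cancel scale_mult_right Z_def)
 qed
 note g = Tj_wt[OF wa f]
 have "T03 D (T03 D f) = T w (Z (Z (Tj w f)))" using T[OF f] T[OF T_wt[OF wa Zw[OF g]]] wa Zw[OF g] by simp
 also have "... = f + scale d3 (T03 D f)"
  using ZZ[OF g] linop_add[OF linop_T[OF wa]] linop_scale[OF linop_T[OF wa]] wa f T[OF f] by simp
 finally show ?thesis .
qed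

lemma T03_inj: "f \<in> wt ==> g \<in> wt ==> T03 D f = T03 D g ==> f = g"
 using T03_T03[of f] T03_T03[of g] by (metis add_right_cancel)

lemma T03_Y_bt: "f \<in> wt ==> T03 D (Y (- bt) f) = ee bt * TT 0 f"
 using T03_eq[OF Y_wt[OF RL_minus[OF R_RL[OF bt_R]]]] Y_bt Tj_T[OF sth_aff TT_wt[OF zero_aix]] by simp

text \<open>With \<open>v bt = g\<close> and \<open>inv v bt\<close> positive, the closed formulas
  for \<open>T03\<close> and for \<open>Y\<close> run through the same elements, and the exponential
  of \<open>inv v bt\<close>, a root orthogonal to \<open>bt\<close>, commutes with
  \<open>TT 0\<close>.\<close>

lemma T03_Y_0: assumes g: "g \<in> Sh" "g \<bullet> bt = 0" and f: "f \<in> wt" shows "T03 D (Y g f) = Y g (T03 D f)"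
proof -
 have main: "T03 D (Y (- g) f) = Y (- g) (T03 D f)" if g: "g \<in> Sh" "g \<bullet> bt = 0" "posr g" and f: "f \<in> wt" for g f
 proof -
  have "\<exists>v\<in>W. v bt = g & posr (inv v bt)"
  proof -
   obtain v where v: "v \<in> W" "v bt = g" using short_trans[OF bt_Sh g(1)] by blast
   let ?m = "inv v bt"
   have m: "?m \<in> Sh" using Sh_W W_inv_in v bt_Sh by blast
   show ?thesis
   proof (cases "posr ?m")
    case False
    let ?r = "reflection ?m"
    have r: "?r \<in> W" using refl_W Sh_R m by blast
    \<comment> \<open>The reflection in \<open>?m\<close> fixes \<open>bt\<close> and reverses
      \<open>?m\<close>, so composing with it repairs the sign.\<close>
    have "bt \<bullet> ?m = 0" using W_inner_inv[OF v(1), of bt bt] v(2) g(2) by simp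
    hence "(v o ?r) bt = g" using v by (simp add: reflection_orth)
    moreover have "inv (v o ?r) bt = - ?m"
    proof -
     have "inv ?r = ?r" by (rule inv_equality) simp_all
     thus ?thesis using inv_comp[OF W_aff[OF v(1)] W_aff[OF r]] by (simp add: reflection_self)
    qed
    ultimately show ?thesis using weyl_comp[OF v(1) r] False not_posr Sh_R m by metis
   qed (use v in blast)
  qed
  then obtain v where v: "v \<in> W" "v bt = g" "posr (inv v bt)" by blast
  let ?m = "inv v bt"
  have mP: "?m \<in> P" using R_weights W_R W_inv_in v(1) bt_R by blast
  have mb: "?m \<bullet> bt = 0" using W_inner_inv[OF v(1), of bt bt] v(2) g(2) by (simp add: inner_commute)
  let ?w = "inv v" and ?w' = "inv v o sth" and ?u = "v o sth" and ?u' = "sth o v" and ?u2 = "sth o (v o sth)"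
  have iv: "inv v \<in> W" "inv (inv v) = v" using v W_inv_in W_bij inv_inv_eq by auto
  have ws: "?w \<in> W" "?w' \<in> W" "?u \<in> W" "?u' \<in> W" "?u2 \<in> W" using weyl_comp s_theta_W iv v by blast+
  note wa = W_aff[OF v(1)] W_aff[OF ws(1)] W_aff[OF ws(2)] W_aff[OF ws(3)] W_aff[OF ws(4)] W_aff[OF ws(5)]
  have inv1: "inv (sth o ?w) = ?u" using inv_comp[OF sth_aff wa(2)] iv inv_sth by simp
  have inv2: "inv ?w' = ?u'" using inv_comp[OF wa(2) sth_aff] iv inv_sth by simp
  have inv3: "inv (sth o ?w') = ?u2" using inv_comp[OF sth_aff wa(3)] inv2 inv_sth by (simp add: comp_assoc)
  have inv4: "inv ?u bt = ?m" using inv_comp[OF wa(1) sth_aff] inv_sth sth_orth[OF mb] by simp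
  have Y1: "Y (- g) h = T ?u (TT 0 (Tj v h))" if "h \<in> wt" for h
   using Y_short[OF ws(1) _ that] iv v(2) g(3) inv1 by simp
  have "inv ?w' bt = g" using inv2 v(2) sth_orth[OF g(2)] by simp
  hence Y2: "Y (- g) h = T ?u2 (TT 0 (Tj ?u' h))" if "h \<in> wt" for h
   using Y_short[OF ws(2) _ that] g(3) inv2 inv3 by simp
  have 1: "T03 D f = T v (ee ?m * Tj ?u' f)" by (rule X_short'[OF v(1,3) f])
  have h: "TT 0 (Tj ?u' f) \<in> wt" using TT_wt zero_aix Tj_wt wa f by blast
  have "Y (- g) (T03 D f) = T ?u (TT 0 (ee ?m * Tj ?u' f))"
   using Y1[OF T03_wt[OF f]] 1 Tj_T[OF wa(1) X_wt[OF mP Tj_wt[OF wa(5) f]]] by simp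
  also have "... = T ?u (ee ?m * TT 0 (Tj ?u' f))"
   using X_0[OF zero_aix mP _ Tj_wt[OF wa(5) f]] mb coroot_zero[OF bt_R, of ?m] by (simp add: rt_0)
  also have "... = T03 D (T ?u2 (TT 0 (Tj ?u' f)))"
   using X_short[OF ws(3) _ h] inv4 v(3) by simp
  also have "... = T03 D (Y (- g) f)" using Y2[OF f] by simp
  finally show ?thesis ..
 qed
 show ?thesis
 proof (cases "posr g")
  case False
  hence "posr (- g)" using not_posr Sh_R g by blast
  thus ?thesis using main[of "- g", OF Sh_minus[OF g(1)] _ _ f] g by simp
 next
  case True
  have gL: "g \<in> RL" using R_RL Sh_R g by blast
  have h: "Y g f \<in> wt" using Y_wt gL f by blast
  have "T03 D f = Y (- g) (T03 D (Y g f))" using main[OF g True h] Y_minus(1)[OF gL f] by simp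
  thus ?thesis using Y_minus(2)[OF gL T03_wt[OF h]] by simp
 qed
qed

text \<open>The reflection \<open>v\<close> in \<open>b = bt - g\<close> carries \<open>bt\<close>
  to \<open>g\<close>. Since \<open>v\<close> and \<open>sth\<close> generate a Weyl group of type
  A2, the closed formulas for \<open>g\<close> and \<open>b\<close> run through the same elements;
  what remains is the cross relation \<open>X_01\<close> of \<open>TT 0\<close>.\<close>

lemma T03_Y_1: assumes r: "reduced D" and g: "g \<in> Sh" "g \<bullet> bt = 1" and f: "f \<in> wt"
 shows "Y g f = scale (qpow D 1) (T03 D (Y (g - bt) (T03 D f)))"
proof -
 have th: "coroot bt = bt" "theta D = bt" using coroot_bt theta_eq r by (auto simp: c0_def)
 have b2: "bt \<bullet> bt = 2" using Sh_sq[OF bt_Sh] msq_red[OF r] by simp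
 have pos: "posr a" if "a \<in> R" "a \<bullet> bt = 1" for a
 proof (rule ccontr)
  assume "~ posr a"
  hence "bt \<bullet> (- a) >= 0" using posr_inner_dominant[of "- a" bt] not_posr that bt_dom by (auto simp: dominant_def)
  thus False using that by (simp add: inner_commute)
 qed
 define b where "b = bt - g"
 have sg: "sth g = - b" using g(2) th by (simp add: s_theta_bt reflection_def b_def)
 hence "- b \<in> Sh" using Sh_W[OF s_theta_W g(1)] by metis
 hence b: "b \<in> Sh" "b \<bullet> bt = 1" using Sh_minus[of "- b"] g(2) b2 by (auto simp: b_def inner_diff_left)
 have gR: "g \<in> R" "posr g" "b \<in> R" "posr b" "g \<in> P" "b \<in> P" "b \<in> RL" "g \<in> RL"
  using pos g b Sh_R R_weights R_RL by auto
 have cb: "coroot b = b" "coroot g = g" using Sh_sq b g msq_red[OF r] by (auto simp: coroot_def)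
 define v where "v = reflection b"
 have v: "v \<in> W" unfolding v_def using refl_W gR by blast
 have vbt: "v bt = g" using b(2) cb by (simp add: v_def reflection_def inner_commute) (simp add: b_def)
 have vv: "v (v x) = x" "v o v = id" for x by (auto simp: v_def)
 have iv: "inv v = v" by (rule inv_unique_comp) (simp_all add: vv)
 let ?z = "sth o (v o sth)"
 \<comment> \<open>The braid relation of \<open>v\<close> and \<open>sth\<close>: both sides are the
   reflection in \<open>g\<close>.\<close>
 have zz: "?z = v o (sth o v)"
 proof -
  have "reflection (sth b) o sth = sth o v" "reflection (v bt) o v = v o sth"
   using W_refl[OF s_theta_W, of b] W_refl[OF v, of bt] by (simp_all add: v_def s_theta_bt)
  moreover have "sth b = - g" using sg W_minus[OF s_theta_W, of b] sth_sth[of g] by (metis minus_minus)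
  ultimately have e: "reflection g o sth = sth o v" "reflection g o v = v o sth" using vbt by (auto simp: reflection_minus)
  have "?z = reflection g o (sth o sth)" unfolding comp_assoc[symmetric] e ..
  moreover have "v o (sth o v) = reflection g o (v o v)" unfolding comp_assoc[symmetric] e ..
  ultimately show ?thesis by (simp add: sth_comp vv)
 qed
 have ws: "sth o v \<in> W" "v o sth \<in> W" "?z \<in> W" using weyl_comp s_theta_W v by blast+
 note wa = W_aff[OF v] W_aff[OF ws(1)] W_aff[OF ws(2)] W_aff[OF ws(3)]
 have inv1: "inv (sth o v) = v o sth" "inv (v o sth) = sth o v" using inv_comp[OF sth_aff wa(1)] inv_comp[OF wa(1) sth_aff] iv inv_sth by simp_all
 have inv2: "inv ?z = ?z" using inv_comp[OF sth_aff wa(3)] inv1(2) inv_sth by (simp add: comp_assoc)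
 have zb: "?z bt = b" using vbt sg W_minus[OF v, of bt] W_minus[OF s_theta_W, of g] by (simp add: sth_bt)
 have sz: "sth o ?z = v o sth" unfolding comp_assoc[symmetric] sth_comp by simp
 have Y1: "Y (- g) h = T (v o sth) (TT 0 (Tj v h))" if "h \<in> wt" for h
  using Y_short[OF v _ that] iv vbt gR inv1 by simp
 have Y2: "Y (- b) h = T (sth o v) (TT 0 (Tj ?z h))" if "h \<in> wt" for h
  using Y_short[OF ws(3) _ that, unfolded inv2 zb sz inv1] gR by blast
 have X1: "T v (ee g * h) = T03 D (T (sth o v) h)" if "h \<in> wt" for h
  using X_short[OF v _ that] iv vbt gR by simp
 have X2: "T03 D h = T ?z (ee b * Tj (v o sth) h)" if "h \<in> wt" for h
  using X_short'[OF ws(3) _ that, unfolded inv2 zb sz] gR by blast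
 let ?h = "Tj (v o sth) f"
 have h: "?h \<in> wt" "TTi 0 ?h \<in> wt" using Tj_wt wa f TTi_wt zero_aix by auto
 have "T03 D (Y (- b) (T03 D f)) = T03 D (T (sth o v) (TT 0 (ee b * ?h)))"
  using Y2[OF T03_wt[OF f]] X2[OF f] Tj_T[OF wa(4) X_wt[OF gR(6) h(1)]] by simp
 also have "... = T v (ee g * TT 0 (ee b * ?h))"
  using X1[OF TT_wt[OF zero_aix X_wt[OF gR(6) h(1)]]] by simp
 also have "TT 0 (ee b * ?h) = scale (inverse (qpow D 1)) (ee (- g) * TTi 0 ?h)"
  using X_01[OF gR(6) _ h(2)] b(2) th TT_TTi[OF zero_aix h(1)] by (simp add: b_def)
 also have "T v (ee g * ...) = scale (inverse (qpow D 1)) (T v (TTi 0 ?h))"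
  by (simp add: scale_mult_right ee_cancel linop_scale[OF linop_T[OF wa(1)]])
 also have "T v (TTi 0 ?h) = Y g f"
 proof -
  have k: "T v (TTi 0 ?h) \<in> wt" using T_wt wa h by blast
  have "Y (- g) (T v (TTi 0 ?h)) = f"
   using Y1[OF k] Tj_T[OF wa(1) h(2)] TT_TTi[OF zero_aix h(1)] T_Tj[OF wa(3) f] by simp
  thus ?thesis using Y_minus(2)[OF gR(8) k] by simp
 qed
 finally show ?thesis using qpow_nz[of 1] by (simp add: b_def)
qed

section \<open>Intertwiners and joint eigenvectors\<close>

definition chr :: "('v => 'p qtfield) => bool" where
 "chr y \<longleftrightarrow> y 0 = 1 & (\<forall>u\<in>RL. \<forall>v\<in>RL. y (u + v) = y u * y v)"

definition eig :: "('v => 'p qtfield) => ('v, 'p) galg => bool" where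
 "eig y f \<longleftrightarrow> f \<in> wt & (\<forall>u\<in>RL. Y u f = scale (y u) f)"

text \<open>The action of the affine generators on characters. It takes the eigenvalues attached to
  \<open>l\<close> to those attached to \<open>s i l\<close>; the power of q stems from the
  translation part of \<open>s 0\<close>.\<close>

definition tw :: "nat => ('v => 'p qtfield) => 'v => 'p qtfield" where
 "tw i y u = (if i = 0 then qpow D (u \<bullet> bt) * y (sth u) else y (s i u))"

text \<open>The character evaluated at the affine root with gradient \<open>gg i\<close>, which is
  the ratio of eigenvalues in the intertwiner.\<close>

definition xx :: "nat => ('v => 'p qtfield) => 'p qtfield" where
 "xx i y = inverse (QQ i) * y (gg i)"

definition TX :: "nat => ('v, 'p) galg => ('v, 'p) galg" where
 "TX i = (if i = 0 then T03 D else TT i)"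

definition dX :: "nat => 'p qtfield" where
 "dX i = (if i = 0 then d3 else dd i)"

lemma chr_minus: "chr y ==> u \<in> RL ==> y u * y (- u) = 1"
 by (metis chr_def RL_minus add.right_inverse)

lemma chr_nz: "chr y ==> u \<in> RL ==> y u ~= 0"
 using chr_minus by fastforce

lemma chr_inv: "chr y ==> u \<in> RL ==> y (- u) = inverse (y u)"
 using chr_minus inverse_unique by metis

text \<open>Both \<open>Y\<close> and the character are multiplicative, so short roots suffice, and
  one sign of each is enough because the other is inverse to it.\<close>

lemma eigI: assumes y: "chr y" and f: "f \<in> wt"
 and sh: "!!g. g \<in> Sh ==> Y g f = scale (y g) f | Y (- g) f = scale (y (- g)) f"
 shows "eig y f"
proof -
 have "Y u f = scale (y u) f" if "u \<in> RL" for u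
  using that
 proof (induction rule: RL_induct)
  case zero
  thus ?case using Y_0 f y by (simp add: chr_def)
 next
  case (add u v)
  thus ?case using Y_add[OF add(1,2) f] Y_lin(2)[OF add(1) f f] y by (simp add: chr_def mult.commute)
 next
  case (short g)
  have g: "g \<in> RL" using R_RL Sh_R short by blast
  consider "Y g f = scale (y g) f" | "Y (- g) f = scale (y (- g)) f" using sh short by blast
  thus ?case
  proof cases
   case 2
   have "f = scale (y (- g)) (Y g f)" using Y_minus(2)[OF g f] 2 Y_lin(2)[OF g f f] by simp
   hence "scale (y g) f = scale (y g) (scale (y (- g)) (Y g f))" by simp
   thus ?thesis using chr_minus[OF y g] by simp
  qed
 qed
 thus ?thesis using f by (simp add: eig_def)
qed

lemma eig_wt: "eig y f ==> f \<in> wt" and eig_Y: "eig y f ==> u \<in> RL ==> Y u f = scale (y u) f"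
 by (simp_all add: eig_def)

lemma qpow_add: assumes "u \<in> RL" "v \<in> P" "r = u \<bullet> v" shows "qpow D (r + r') = qpow D r * qpow D r'"
proof -
 have "\<forall>mu\<in>RL. \<forall>l\<in>P. real (denom D) * (mu \<bullet> l) \<in> \<int>" using mac unfolding macdonald_datum_def by blast
 hence "real (denom D) * r \<in> \<int>" using assms by blast
 then obtain k where k: "real (denom D) * r = of_int k" by (rule Ints_cases)
 have "\<lfloor>real (denom D) * (r + r')\<rfloor> = k + \<lfloor>real (denom D) * r'\<rfloor>"
  unfolding distrib_left k by (simp add: add.commute)
 thus ?thesis unfolding qpow_def using power_int_add[OF disjI1[OF qroot_nz]] k by simp
qed

lemma qpow_0: "qpow D 0 = 1"
 by (simp add: qpow_def)

lemma chr_tw: assumes y: "chr y" and i: "i \<in> aix" shows "chr (tw i y)"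
proof (cases "i = 0")
 case True
 have z: "sth 0 = 0" using linear_0[OF W_linear[OF s_theta_W]] .
 show ?thesis
  using y linear_add[OF W_linear[OF s_theta_W]] RL_W[OF s_theta_W] qpow_add[OF _ bt_P refl]
  by (auto simp: chr_def tw_def True z qpow_0 inner_add_left)
next
 case False
 hence i: "i \<in> ix" using i aix_eq by simp
 have "s i 0 = 0" using linear_0[OF W_linear[OF s_W[OF i]]] .
 thus ?thesis
  using y linear_add[OF W_linear[OF s_W[OF i]]] RL_W[OF s_W[OF i]] by (auto simp: chr_def tw_def False)
qed

text \<open>The bookkeeping of all eigenvector checks. \<open>Y\<close> sends \<open>F\<close>, the
  generator applied to \<open>f\<close>, to \<open>p\<close> times \<open>F\<close> plus
  \<open>q\<close> times \<open>f\<close>, and \<open>f\<close> to \<open>y\<close> times itself;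
  the premise is the condition for \<open>F + a f\<close> to have eigenvalue
  \<open>p\<close>.\<close>

lemma scale_comb: "q + a * y = p * a ==> scale p F + scale q f + scale (a * y) f = scale p (F + scale a f)"
 by (simp add: galg.scale_right_distrib add.assoc flip: galg.scale_left_distrib)

lemma TX_wt: "i \<in> aix ==> f \<in> wt ==> TX i f \<in> wt"
 using T03_wt TT_wt by (simp add: TX_def)

text \<open>Short roots pair with \<open>al i\<close> to -1, 0 or 1, where the Bernstein relations
  apply directly, or they are \<open>al i\<close> and its negative.\<close>

lemma eig_step_fin:
 assumes y: "chr y" and f: "eig y f" and i: "i \<in> ix" and X: "xx i y ~= 1"
 shows "eig (tw i y) (TX i f + scale (- dX i / (1 - xx i y)) f)"
proof -
 have i': "i \<in> aix" and nz: "i ~= 0" using i ix_aix ix_nz by auto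
 note fw = eig_wt[OF f]
 define a where "a = - dd i / (1 - xx i y)"
 have a: "a * (xx i y - 1) = dd i" using X by (simp add: a_def field_simps)
 have xe: "xx i y = y (gg i)" using nz by (simp add: xx_def QQ_def)
 let ?f = "TT i f + scale a f"
 have alL: "al i \<in> RL" using R_RL al_R i by blast
 have TTw: "TT i f \<in> wt" using TT_wt i' fw by blast
 have fw': "?f \<in> wt" using TTw add_wt scale_wt fw by blast
 have lin: "Y u ?f = Y u (TT i f) + scale (a * y u) f" if "u \<in> RL" for u
  using Y_lin(1)[OF that TTw scale_wt[OF fw]] Y_lin(2)[OF that fw fw] eig_Y[OF f that] by simp
 have m1: "Y u ?f = scale (y (s i u)) ?f" if u: "u \<in> RL" "u \<cdot> al i = -1" for u
 proof -
  have "2 *\<^sub>R al i \<notin> R" using odd_not_double[of u "al i" "-1"] RL_P u al_R i by simp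
  hence g: "gg i = al i" using gg_al i by blast
  have su: "s i u = u + al i" using u by (simp add: weyl_gen_fin[OF i] reflection_def)
  have suL: "s i u \<in> RL" using RL_add u alL su by simp
  have "TT i (Y (s i u) f) = Y u (TTi i f)"
   using Y_refl[OF u(1) i u(2) fw] TT_TTi[OF i' Y_wt[OF u(1) TTi_wt[OF i' fw]]] by simp
  hence "Y u (TTi i f) = scale (y (s i u)) (TT i f)" using eig_Y[OF f suL] by (simp add: linop_scale[OF linop_TT])
  moreover have "TT i f = TTi i f + scale (dd i) f" by (simp add: TTi_def)
  ultimately have "Y u (TT i f) = scale (y (s i u)) (TT i f) + scale (dd i * y u) f"
   using Y_lin(1)[OF u(1) TTi_wt[OF i' fw] scale_wt[OF fw]] Y_lin(2)[OF u(1) fw fw] eig_Y[OF f u(1)] by simp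
  hence "Y u ?f = scale (y (s i u)) (TT i f) + scale (dd i * y u) f + scale (a * y u) f" using lin[OF u(1)] by simp
  also have "... = scale (y (s i u)) ?f"
  proof (rule scale_comb)
   have "y (s i u) = y u * xx i y" using y u alL su g xe by (simp add: chr_def)
   thus "dd i * y u + a * y u = y (s i u) * a" unfolding a[symmetric] by (simp add: algebra_simps)
  qed
  finally show ?thesis .
 qed
 \<comment> \<open>Here \<open>Y\<close> at minus \<open>al i\<close> is \<open>TT i\<close> after a
   conjugate \<open>Z\<close> of \<open>TT 0\<close>. So the quadratic relation of
   \<open>TT 0\<close> enters, and the condition on the scalar involves the parameters of both
   \<open>i\<close> and 0, which \<open>short_hh\<close> relates.\<close>
 have alc: "Y (al i) ?f = scale (y (- al i)) ?f" if S: "al i \<in> Sh"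
 proof -
  obtain w where w: "w \<in> W" "w (al i) = bt" using short_trans[OF S bt_Sh] by blast
  have iw: "inv w bt = al i" using w by (metis W_inv_l)
  have wa: "inv w \<in> aff_weyl D" using W_aff W_inv_in w by blast
  define Z where "Z = (%h. T (inv w) (TT 0 (Tj (inv w) h)))"
  have Zw: "Z h \<in> wt" if "h \<in> wt" for h unfolding Z_def using T_wt Tj_wt TT_wt zero_aix wa that by blast
  have "sth o w = w o s i" using W_refl[OF w(1), of "al i"] weyl_gen_fin[OF i] w(2) s_theta_bt by simp
  hence Yal: "Y (- al i) h = TT i (Z h)" if "h \<in> wt" for h
   using Y_short[OF w(1) _ that] iw posr_al[OF i] W_up_left_inv[OF w(1) i _ TT_wt[OF zero_aix Tj_wt[OF wa that]]] w(2) posr_bt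
   by (simp add: Z_def)
  have ZZ: "Z (Z h) = h + scale (dd 0) (Z h)" if h: "h \<in> wt" for h
  proof -
   note g = Tj_wt[OF wa h]
   have "TT 0 (TT 0 (Tj (inv w) h)) = Tj (inv w) h + scale (dd 0) (TT 0 (Tj (inv w) h))"
    using TTi_TT[OF zero_aix g] unfolding TTi_def by (simp add: linop_diff[OF linop_TT] linop_scale[OF linop_TT] algebra_simps)
   thus ?thesis
    using wa TT_wt[OF zero_aix g] h by (simp add: Z_def linop_add[OF linop_T[OF wa]] linop_scale[OF linop_T[OF wa]])
  qed
  have Yf: "Y (al i) (TT i f) = Z f - scale (dd 0) f"
  proof -
   have "Y (- al i) (Z f - scale (dd 0) f) = TT i (Z (Z f) - scale (dd 0) (Z f))"
    using Yal[OF diff_wt[OF Zw[OF fw] scale_wt[OF fw]]] wa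
    by (simp add: Z_def linop_diff[OF linop_T[OF wa]] linop_scale[OF linop_T[OF wa]] linop_diff[OF linop_Tj[OF wa]]
      linop_scale[OF linop_Tj[OF wa]] linop_diff[OF linop_TT] linop_scale[OF linop_TT])
   also have "... = TT i f" using ZZ[OF fw] by simp
   finally show ?thesis using Y_minus(2)[OF alL diff_wt[OF Zw[OF fw] scale_wt[OF fw]], of "dd 0"] by simp
  qed
  have "Z f = TTi i (scale (y (- al i)) f)" using Yal[OF fw] eig_Y[OF f RL_minus[OF alL]] TTi_TT[OF i' Zw[OF fw]] by simp
  hence "Z f = scale (y (- al i)) (TT i f) - scale (y (- al i) * dd i) f"
   by (simp add: linop_scale[OF linop_TTi]) (simp add: TTi_def galg.scale_right_diff_distrib)
  hence "Y (al i) ?f = scale (y (- al i)) (TT i f) + scale (- (y (- al i) * dd i) - dd 0) f + scale (a * y (al i)) f"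
   using lin[OF alL] Yf by (simp add: galg.scale_left_diff_distrib)
  also have "... = scale (y (- al i)) ?f"
  proof (rule scale_comb)
   let ?u = "y (al i)"
   have u0: "?u ~= 0" using chr_nz[OF y alL] .
   have iu: "y (- al i) = inverse ?u" using chr_inv[OF y alL] .
   show "- (y (- al i) * dd i) - dd 0 + a * y (al i) = y (- al i) * a"
   proof (cases "reduced D")
    case True
    hence "dd 0 = dd i" "gg i = al i" using short_hh(1)[OF i S] by (auto simp: dd_def)
    hence 1: "dd 0 = a * (?u - 1)" "dd i = a * (?u - 1)" using a xe by simp_all
    show ?thesis unfolding iu 1 using u0 by (simp add: field_simps)
   next
    case False
    hence "dd 0 = 0" "gg i = al i + al i" using short_hh(2)[OF i S] by (auto simp: dd_def hh_def scaleR_2)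
    hence 1: "dd 0 = 0" "dd i = a * (?u * ?u - 1)" using a xe y alL by (simp_all add: chr_def)
    show ?thesis unfolding iu 1 using u0 by (simp add: field_simps)
   qed
  qed
  finally show ?thesis .
 qed
 have "eig (tw i y) ?f"
 proof (rule eigI[OF chr_tw[OF y i'] fw'])
  fix g assume g: "g \<in> Sh"
  have gL: "g \<in> RL" using R_RL Sh_R g by blast
  have t: "tw i y u = y (s i u)" for u using nz by (simp add: tw_def)
  have sa: "s i (al i) = - al i" "s i (- al i) = al i" using s_al[OF i] s_minus[OF i, of "al i"] by auto
  consider "g \<cdot> al i = -1" | "g \<cdot> al i = 0" | "(- g) \<cdot> al i = -1" | "g = al i" | "g = - al i"
   using short_pair[OF g al_R[OF i]] by auto
  thus "Y g ?f = scale (tw i y g) ?f | Y (- g) ?f = scale (tw i y (- g)) ?f"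
  proof cases
   case 1 thus ?thesis using m1[OF gL] t by simp
  next
   case 2
   have "Y g (TT i f) = scale (y g) (TT i f)"
    using Y_TT_0[OF gL i 2 fw] eig_Y[OF f gL] by (simp add: linop_scale[OF linop_TT])
   hence "Y g ?f = scale (y g) ?f" using lin[OF gL] by (simp add: galg.scale_right_distrib mult.commute)
   moreover have "s i g = g" using 2 by (simp add: weyl_gen_fin[OF i] reflection_def)
   ultimately show ?thesis using t by simp
  next
   case 3 thus ?thesis using m1[OF RL_minus[OF gL]] t by simp
  next
   case 4 thus ?thesis using alc g t sa by simp
  next
   case 5
   hence "al i \<in> Sh" using Sh_minus[OF g] by simp
   thus ?thesis using alc 5 t sa by simp
  qed
 qed
 moreover have "TX i f + scale (- dX i / (1 - xx i y)) f = ?f" using nz by (simp add: TX_def dX_def a_def)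
 ultimately show ?thesis by simp
qed

lemma T03_eig: assumes y: "chr y" and f: "eig y f" shows "T03 D f = scale (y bt) (ee bt * TT 0 f)"
proof -
 have b: "bt \<in> RL" using R_RL bt_R by blast
 have "scale (y (- bt)) (T03 D f) = ee bt * TT 0 f"
  using T03_Y_bt[OF eig_wt[OF f]] eig_Y[OF f RL_minus[OF b]] T03_lin(2)[OF eig_wt[OF f] eig_wt[OF f]] by simp
 from this[symmetric] have "scale (y bt) (ee bt * TT 0 f) = scale (y bt * y (- bt)) (T03 D f)" by simp
 thus ?thesis using chr_minus[OF y b] by simp
qed

text \<open>\<open>Y\<close> at a short root orthogonal to \<open>bt\<close> commutes with
  \<open>T03\<close>. Short roots other than \<open>bt\<close> with positive inner product with
  \<open>bt\<close> occur in the reduced case only, where \<open>T03_Y_1\<close> applies. The root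
  \<open>bt\<close> itself is settled by rewriting \<open>Y bt\<close> through \<open>TTi 0\<close>
  and \<open>T03\<close>.\<close>

lemma eig_step_0:
 assumes y: "chr y" and f: "eig y f" and X: "xx 0 y ~= 1"
 shows "eig (tw 0 y) (TX 0 f + scale (- dX 0 / (1 - xx 0 y)) f)"
proof -
 note fw = eig_wt[OF f]
 have bL: "bt \<in> RL" using R_RL bt_R by blast
 define a where "a = - d3 / (1 - xx 0 y)"
 have a: "d3 = a * (xx 0 y - 1)" using X by (simp add: a_def field_simps)
 have xe: "xx 0 y = qpow D 1 * y (- theta D)" by (simp add: xx_def QQ_def gg_def)
 let ?F = "T03 D f" let ?f = "?F + scale a f"
 have Fw: "?F \<in> wt" "?f \<in> wt" using T03_wt add_wt scale_wt fw by auto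
 have lin: "Y u ?f = Y u ?F + scale (a * y u) f" if "u \<in> RL" for u
  using Y_lin(1)[OF that Fw(1) scale_wt[OF fw]] Y_lin(2)[OF that fw fw] eig_Y[OF f that] by simp
 have c0: "Y g ?f = scale (tw 0 y g) ?f" if g: "g \<in> Sh" "g \<bullet> bt = 0" for g
 proof -
  have gL: "g \<in> RL" using R_RL Sh_R g by blast
  have "Y g ?F = scale (y g) ?F" using T03_Y_0[OF g fw] eig_Y[OF f gL] T03_lin(2)[OF fw fw] by simp
  hence "Y g ?f = scale (y g) ?f" using lin[OF gL] by (simp add: galg.scale_right_distrib mult.commute)
  thus ?thesis using g sth_orth by (simp add: tw_def qpow_0)
 qed
 have c1: "Y g ?f = scale (tw 0 y g) ?f" if r: "reduced D" and g: "g \<in> Sh" "g \<bullet> bt = 1" for g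
 proof -
  have th: "coroot bt = bt" "theta D = bt" using coroot_bt theta_eq r by (auto simp: c0_def)
  have gL: "g \<in> RL" "g - bt \<in> RL" using R_RL Sh_R g RL_diff bL by auto
  have sg: "sth g = g - bt" using g th by (simp add: s_theta_bt reflection_def)
  let ?p = "qpow D 1 * y (g - bt)"
  have 1: "?p = y g * xx 0 y" using y gL bL RL_minus[OF bL] xe th
   by (simp add: chr_def flip: diff_conv_add_uminus) (metis diff_conv_add_uminus mult.left_commute)
  have "Y g ?F = scale (qpow D 1) (T03 D (Y (g - bt) (f + scale d3 ?F)))"
   using T03_Y_1[OF r g Fw(1)] T03_T03[OF fw] by simp
  moreover have "Y (g - bt) (f + scale d3 ?F) = scale (y (g - bt)) f + scale d3 (Y (g - bt) ?F)"
   using Y_lin[OF gL(2)] fw Fw scale_wt eig_Y[OF f gL(2)] by simp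
  moreover have "T03 D (...) = scale (y (g - bt)) ?F + scale d3 (T03 D (Y (g - bt) ?F))"
   using T03_lin fw Fw scale_wt Y_wt gL by simp
  moreover have "scale (qpow D 1) (T03 D (Y (g - bt) ?F)) = scale (y g) f"
   using T03_Y_1[OF r g fw] eig_Y[OF f gL(1)] by simp
  ultimately have "Y g ?F = scale ?p ?F + scale (d3 * y g) f"
   by (simp add: galg.scale_right_distrib mult.commute) (metis galg.scale_left_commute galg.scale_scale)
  hence "Y g ?f = scale ?p ?F + scale (d3 * y g) f + scale (a * y g) f" using lin[OF gL(1)] by simp
  also have "... = scale ?p ?f" by (rule scale_comb) (simp add: 1 a algebra_simps)
  finally show ?thesis by (simp add: tw_def g sg)
 qed
 have cb: "Y bt ?f = scale (tw 0 y bt) ?f"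
 proof -
  let ?u = "y bt" let ?q = "qpow D 1"
  have u0: "?u ~= 0" "y (- bt) = inverse ?u" using chr_nz[OF y bL] chr_inv[OF y bL] by auto
  have YF: "Y bt ?f = Y bt ?F + scale (a * ?u) f" by (rule lin[OF bL])
  let ?Z = "ee bt * TT 0 f"
  have F: "?F = scale ?u ?Z" by (rule T03_eig[OF y f])
  have Zi: "ee bt * TT 0 (TTi 0 (ee (- bt) * h)) = h" if "h \<in> wt" for h
   using TT_TTi[OF zero_aix X_wt[OF weights_minus[OF bt_P] that]] ee_cancel by simp
  have h: "TTi 0 (ee (- bt) * f) \<in> wt" using TTi_wt[OF zero_aix X_wt[OF weights_minus[OF bt_P] fw]] .
  \<comment> \<open>\<open>T03_Y_bt\<close> solved for \<open>Y bt\<close>, using that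
    \<open>T03\<close> is injective.\<close>
  have YZ: "Y bt f' = TTi 0 (ee (- bt) * T03 D f')" if f': "f' \<in> wt" for f'
  proof -
   let ?h = "TTi 0 (ee (- bt) * T03 D f')"
   have hw: "?h \<in> wt" using TTi_wt[OF zero_aix X_wt[OF weights_minus[OF bt_P] T03_wt[OF f']]] .
   have "T03 D (Y (- bt) ?h) = T03 D f'" using T03_Y_bt[OF hw] Zi[OF T03_wt[OF f']] by simp
   hence "Y (- bt) ?h = f'" using T03_inj[OF Y_wt[OF RL_minus[OF bL] hw] f'] by simp
   thus ?thesis using Y_minus(2)[OF bL hw] by simp
  qed
  have lXT: "linop (%h. TTi 0 (ee (- bt) * h))" by (rule linop_comp[OF linop_TTi linop_mult])
  have "Y bt ?F = TTi 0 (ee (- bt) * (f + scale d3 ?F))" using YZ[OF Fw(1)] T03_T03[OF fw] by simp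
  also have "... = TTi 0 (ee (- bt) * f) + scale d3 (Y bt f)"
   using linop_add[OF lXT] linop_scale[OF lXT] YZ[OF fw] by simp
  finally have 1: "Y bt ?F = TTi 0 (ee (- bt) * f) + scale (d3 * ?u) f" using eig_Y[OF f bL] by simp
  have mP: "- bt \<in> P" using weights_minus bt_P by blast
  show ?thesis
  proof (cases "reduced D")
   case True
   have th: "coroot bt = bt" "theta D = bt" using coroot_bt theta_eq True by (auto simp: c0_def)
   have b2: "bt \<bullet> bt = 2" using Sh_sq[OF bt_Sh] msq_red[OF True] by simp
   have "\<lfloor>(- bt) \<cdot> gg 0\<rfloor> = 2" using th b2 by (simp add: gg_def)
   from dl.Ti_2[OF dl_P[OF zero_aix] mP this fw[unfolded wt_Lg]]
   have 2: "TTi 0 (ee (- bt) * f) = scale (?q ^ 2) ?Z + scale (dd 0 * ?q) f"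
    using TTi_dl[OF zero_aix X_wt[OF mP fw]] TT_DL_wt[OF zero_aix fw] th
    by (simp add: QQ_def gg_def uu_def dd_def scaleR_2 ee_0 scale_1_mult scale_mult_left)
   have "d3 = dd 0" using True by (simp add: d3_def)
   hence "Y bt ?f = scale (?q ^ 2 * y (- bt)) ?F + scale (d3 * ?q + d3 * ?u) f + scale (a * ?u) f"
    using 1 2 F u0 YF by (simp add: galg.scale_left_distrib)
   also have "... = scale (?q ^ 2 * y (- bt)) ?f"
   proof (rule scale_comb)
    show "d3 * ?q + d3 * ?u + a * ?u = ?q ^ 2 * y (- bt) * a"
     unfolding a xe th(2) u0(2) using u0(1) by (simp add: field_simps power2_eq_square)
   qed
   also have "?q ^ 2 * y (- bt) = tw 0 y bt"
   proof -
    have "qpow D 2 = ?q ^ 2" using qpow_int[of 2] by (simp add: power_int_def)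
    thus ?thesis by (simp add: tw_def b2 sth_bt)
   qed
   finally show ?thesis .
  next
   case False
   have th: "theta D = 2 *\<^sub>R bt" "coroot bt = 2 *\<^sub>R bt" using coroot_bt theta_eq False by (auto simp: c0_def)
   have b2: "bt \<bullet> bt = 1" using Sh_sq[OF bt_Sh] msq_nonred[OF False] by simp
   have "coroot (2 *\<^sub>R bt) = bt" by (simp add: coroot_scaleR th(2))
   hence "\<lfloor>(- bt) \<cdot> gg 0\<rfloor> = 1" using th b2 by (simp add: gg_def)
   from dl.Ti_1[OF dl_P[OF zero_aix] mP this fw[unfolded wt_Lg]]
   have 2: "TTi 0 (ee (- bt) * f) = scale ?q ?Z"
    using TTi_dl[OF zero_aix X_wt[OF mP fw]] TT_DL_wt[OF zero_aix fw] th
    by (simp add: QQ_def gg_def uu_def scaleR_2 scale_mult_left)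
   have "Y bt ?f = scale (?q * y (- bt)) ?F + scale (d3 * ?u) f + scale (a * ?u) f"
    using 1 2 F u0 YF by simp
   also have "... = scale (?q * y (- bt)) ?f"
   proof (rule scale_comb)
    have "y (- theta D) = y (- bt) * y (- bt)" using y RL_minus[OF bL] th(1) by (simp add: chr_def scaleR_2 flip: minus_add_distrib)
      (metis minus_add_distrib)
    thus "d3 * ?u + a * ?u = ?q * y (- bt) * a"
     unfolding a xe u0(2) using u0(1) by (simp add: field_simps)
   qed
   also have "?q * y (- bt) = tw 0 y bt" by (simp add: tw_def b2 sth_bt)
   finally show ?thesis .
  qed
 qed
 have "eig (tw 0 y) ?f"
 proof (rule eigI[OF chr_tw[OF y zero_aix] Fw(2)])
  fix g assume g: "g \<in> Sh"
  show "Y g ?f = scale (tw 0 y g) ?f | Y (- g) ?f = scale (tw 0 y (- g)) ?f"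
  proof (cases "g = bt | g = - bt | g \<bullet> bt = 0")
   case True thus ?thesis using cb c0[OF g] by auto
  next
   case False
   have b0: "(c *\<^sub>R g) \<cdot> bt = 0 \<longleftrightarrow> c = 0 | g \<bullet> bt = 0" for c using coroot_zero[OF bt_R, of g] by simp
   show ?thesis
   proof (cases "reduced D")
    case True
    have "g \<bullet> bt = 1 | (- g) \<bullet> bt = 1"
     using short_pair[OF g bt_R] False coroot_bt theta_eq True by (auto simp: c0_def)
    thus ?thesis using c1[OF True g] c1[OF True Sh_minus[OF g]] by blast
   next
    case r: False
    have "g \<cdot> bt = 2 * (g \<cdot> theta D)" using coroot_bt by (simp add: coroot_theta c0_def r)
    moreover obtain k where "g \<cdot> theta D = of_int k" using int_R[OF theta_R Sh_R[OF g]] Ints_cases by blast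
    ultimately have "real_of_int (2 * k) \<in> {-1, 0, 1}" using short_pair[OF g bt_R] False by auto
    hence "real_of_int (2 * k) <= 1" "real_of_int (2 * k) >= -1" by auto
    hence "2 * k <= 1" "2 * k >= -1" by linarith+
    hence "k = 0" by presburger
    thus ?thesis using \<open>g \<cdot> bt = _\<close> \<open>g \<cdot> theta D = _\<close> b0[of 1] False by simp
   qed
  qed
 qed
 thus ?thesis by (simp add: TX_def dX_def a_def)
qed

lemma eig_step:
 assumes "chr y" "eig y f" "i \<in> aix" "xx i y ~= 1"
 shows "eig (tw i y) (TX i f + scale (- dX i / (1 - xx i y)) f)"
 using eig_step_0 eig_step_fin assms aix_eq by (cases "i = 0") auto

end

section \<open>Triangularity\<close>

context dl
begin

lemma x_power: "x ^ n = scale (inverse Q ^ n) (ee (- (real n *\<^sub>R g)))"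
proof (induction n)
 case (Suc n)
 have e: "ee (- g) * ee (- (real n *\<^sub>R g)) = (ee (- (real (Suc n) *\<^sub>R g)) :: ('v, 'p) galg)"
  unfolding ee_add[symmetric] by (simp add: algebra_simps)
 show ?case unfolding power_Suc Suc.IH scale_mult_right unfolding x_def scale_mult_left e by (simp add: mult.commute)
qed (simp add: ee_0)

lemma y_power: "y ^ n = scale (Q ^ n) (ee (real n *\<^sub>R g))"
proof (induction n)
 case (Suc n)
 have e: "ee g * ee (real n *\<^sub>R g) = (ee (real (Suc n) *\<^sub>R g) :: ('v, 'p) galg)"
  unfolding ee_add[symmetric] by (simp add: algebra_simps)
 show ?case unfolding power_Suc Suc.IH scale_mult_right unfolding y_def scale_mult_left e by (simp add: mult.commute)
qed (simp add: ee_0)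

lemma cc_mult: assumes "f \<in> Lg {l - c *\<^sub>R g |c. B c}" "!!c. B c ==> B' c" "!!c. B c ==> e ~= 0 ==> B' (c + 1/2)"
 shows "cc * f \<in> Lg {l - c *\<^sub>R g |c. B' c}"
 using assms(1)
proof (induction rule: Lg_induct)
 case (scale a u)
 then obtain c where c: "B c" "u = l - c *\<^sub>R g" by blast
 have "ee (- ((1/2) *\<^sub>R g)) * ee u = (ee (l - (c + 1/2) *\<^sub>R g) :: ('v, 'p) galg)"
  unfolding c ee_add[symmetric] by (simp add: algebra_simps)
 hence "cc * scale a (ee u) = scale (a * d) (ee u) + scale (a * e) (ee (l - (c + 1/2) *\<^sub>R g))"
  unfolding cc_def distrib_right scale_mult_left scale_mult_right by (simp add: mult.commute galg.scale_right_distrib)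
 moreover have "u \<in> {l - c *\<^sub>R g |c. B' c}" using c assms(2) by blast
 moreover have "l - (c + 1/2) *\<^sub>R g \<in> {l - c *\<^sub>R g |c. B' c}" if "e ~= 0" using c assms(3) that by blast
 ultimately show ?case by (cases "e = 0") (auto intro!: Lg_add Lg_scale Lg_ee)
qed (simp_all add: Lg_0 Lg_add distrib_left)

text \<open>The reflected exponent comes from the first summand alone, with a coefficient that can
  be read off; the second one contributes exponents strictly before it on the segment.\<close>

lemma T_ee_pos: assumes "l \<in> L" "k l = int n"
 shows "\<exists>u\<in>Lg {l - c *\<^sub>R g |c. 0 <= c & c < real n}. T (ee l) = scale (h * Q powi (- int n)) (ee (l - real n *\<^sub>R g)) + u"
proof
 have "x ^ r * ee l = scale (inverse Q ^ r) (ee (l - real r *\<^sub>R g))" for r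
  by (simp add: x_power scale_mult_left flip: ee_add)
 hence "Do (ee l) = (\<Sum>r<n. scale (inverse Q ^ r) (ee (l - real r *\<^sub>R g)))"
  using Do_ee_pos[OF assms(2,1)] by (simp add: sum_distrib_right)
 hence "Do (ee l) \<in> Lg {l - c *\<^sub>R g |c. \<exists>r<n. c = real r}"
  by (auto intro!: Lg_sum Lg_scale Lg_ee)
 thus "cc * Do (ee l) \<in> Lg {l - c *\<^sub>R g |c. 0 <= c & c < real n}" by (rule cc_mult) auto
 show "T (ee l) = scale (h * Q powi (- int n)) (ee (l - real n *\<^sub>R g)) + cc * Do (ee l)"
  unfolding T_eq so_ee[OF assms(1)] assms(2) by simp
qed

lemma T_ee_neg: assumes "l \<in> L" "k l = - int n" "n > 0"
 shows "T (ee l) \<in> Lg {l - c *\<^sub>R g |c. - real n <= c & c <= 0 & (e = 0 --> c <= -1)}"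
proof -
 have "y ^ Suc r * ee l = scale (Q ^ Suc r) (ee (l - (- real (Suc r)) *\<^sub>R g))" for r
  unfolding y_power scale_mult_left ee_add[symmetric] by (simp only: scaleR_minus_left diff_minus_eq_add add.commute)
 hence "Do (ee l) = - (\<Sum>r<n. scale (Q ^ Suc r) (ee (l - (- real (Suc r)) *\<^sub>R g)))"
  using Do_ee_neg[OF assms(2,1)] by (simp add: sum_distrib_right del: power_Suc)
 moreover have "(\<Sum>r<n. scale (Q ^ Suc r) (ee (l - (- real (Suc r)) *\<^sub>R g))) \<in> Lg {l - c *\<^sub>R g |c. \<exists>r<n. c = - real (Suc r)}"
  by (intro Lg_sum Lg_scale Lg_ee) blast
 ultimately have "Do (ee l) \<in> Lg {l - c *\<^sub>R g |c. \<exists>r<n. c = - real (Suc r)}"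
  by (simp only: Lg_minus)
 hence "cc * Do (ee l) \<in> Lg {l - c *\<^sub>R g |c. - real n <= c & c <= 0 & (e = 0 --> c <= -1)}"
  by (rule cc_mult) auto
 moreover have "so (ee l) \<in> Lg {l - c *\<^sub>R g |c. - real n <= c & c <= 0 & (e = 0 --> c <= -1)}"
 proof -
  have "l - real_of_int (k l) *\<^sub>R g \<in> {l - c *\<^sub>R g |c. - real n <= c & c <= 0 & (e = 0 --> c <= -1)}"
   using assms by (intro CollectI exI[of _ "- real n"]) auto
  thus ?thesis unfolding so_ee[OF assms(1)] by (intro Lg_scale Lg_ee)
 qed
 ultimately show ?thesis unfolding T_eq by (intro Lg_add Lg_scale)
qed

end

context mac
begin

text \<open>The order on weights generated by moving along the segment towards the reflection in a root
 hyperplane separating the weight from the fundamental alcove; it refines the Bruhat order on the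
 orbits of the affine Weyl group.\<close>

definition stp :: "'v => 'v => bool" where
 "stp v l \<longleftrightarrow> (\<exists>a\<in>RI. \<exists>m r. aff a m pp > 0 & aff a m l < 0 & 0 < r & r <= - aff a m l & v = l + r *\<^sub>R a)"

abbreviation "below \<equiv> stp\<^sup>*\<^sup>*"

definition dst :: "'v => real" where "dst x = (x - pp) \<bullet> (x - pp)"

text \<open>A point beyond a wall that moves towards its mirror image, at most up to it, comes
  closer to each point strictly on the near side, in particular to \<open>pp\<close>. Hence the
  order is antisymmetric.\<close>

lemma stp_dst: assumes "stp v l" shows "dst v < dst l"
proof -
 obtain a m r where a: "a \<in> RI" "aff a m pp > 0" "0 < r" "r <= - aff a m l" "v = l + r *\<^sub>R a"
  using assms unfolding stp_def by blast
 have aa: "a \<bullet> a > 0" using root_sq_pos RI_R a by blast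
 have "(l - pp) \<cdot> a = aff a m l - aff a m pp" by (simp add: aff_def inner_diff_left)
 hence la: "(l - pp) \<bullet> a = (a \<bullet> a) / 2 * (aff a m l - aff a m pp)" using aa by (simp add: coroot_def field_simps)
 have dv: "dst v = dst l + 2 * r * ((l - pp) \<bullet> a) + r * r * (a \<bullet> a)"
 proof -
  have "v - pp = (l - pp) + r *\<^sub>R a" using a by simp
  thus ?thesis unfolding dst_def by (simp only: inner_add_left inner_add_right inner_scaleR_left inner_scaleR_right)
    (simp add: inner_commute algebra_simps)
 qed
 have "dst v = dst l + r * (a \<bullet> a) * (aff a m l - aff a m pp + r)" unfolding dv la by (simp add: algebra_simps)
 moreover have "r * (a \<bullet> a) * (aff a m l - aff a m pp + r) < 0" using a aa by (intro mult_pos_neg) auto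
 ultimately show ?thesis by simp
qed

lemma below_dst: "below v l ==> v = l | dst v < dst l"
 by (induction rule: rtranclp_induct) (use stp_dst in force)+

lemma below_antisym: "below v l ==> below l v ==> v = l"
 using below_dst[of v l] below_dst[of l v] by auto

lemma A_aff': "i \<in> aix ==> A i = aff (rt i) (if i = 0 then 1 else 0)"
 using A_aff aix_eq rt_ix rt_0 by auto

lemma aff_inj: assumes "aff a m = aff a' m'" "a ~= 0" "a' ~= 0" shows "a = a'"
proof -
 have x: "x \<cdot> a = x \<cdot> a'" for x
  using fun_cong[OF assms(1), of x] fun_cong[OF assms(1), of 0] by (simp add: aff_def)
 have "coroot a = coroot a'" by (rule iffD1[OF vector_eq_ldot]) (intro allI x)
 thus ?thesis by (metis coroot_coroot assms(2,3))
qed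

lemma aff_s: assumes "i \<in> aix" "a \<in> R" shows "\<exists>m'. \<forall>x. aff a m (s i x) = aff (reflection (rt i) a) m' x"
proof (cases "i = 0")
 case True
 obtain k :: int where "bt \<cdot> a = k" using bt_coroot_int assms by blast
 thus ?thesis using aff_s_0 True by (auto simp: rt_0 reflection_minus)
next
 case False
 hence "i \<in> ix" using assms aix_eq by simp
 thus ?thesis using aff_s_fin rt_ix by metis
qed

text \<open>The larger of \<open>l\<close> and \<open>s i l\<close> in the order, which is the one
  farther from \<open>pp\<close>.\<close>

definition tp :: "nat => 'v => 'v" where "tp i l = (if A i l > 0 then s i l else l)"

definition sgm :: "nat => 'v => real => bool" where
 "sgm i l c \<longleftrightarrow> 0 <= c & c <= A i l | A i l <= c & c <= 0"

lemma stp_rt: assumes "i \<in> aix" "0 < r" "r <= - A i l" shows "stp (l + r *\<^sub>R rt i) l"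
 unfolding stp_def using assms A_pp[OF assms(1)] rt_RI[OF assms(1)] A_aff'[OF assms(1)] by fastforce

lemma seg_tp: assumes i: "i \<in> aix" and c: "sgm i l c" shows "below (l - c *\<^sub>R rt i) (tp i l)"
proof -
 have "\<exists>r. 0 <= r & r <= - A i (tp i l) & l - c *\<^sub>R rt i = tp i l + r *\<^sub>R rt i"
 proof (cases "A i l > 0")
  case True
  hence "A i (tp i l) = - A i l" using A_s[OF i] by (simp add: tp_def)
  moreover have "tp i l = l - A i l *\<^sub>R rt i" using True s_eq[OF i] by (simp add: tp_def)
  ultimately show ?thesis using c True unfolding \<open>A i (tp i l) = _\<close> by (intro exI[of _ "A i l - c"]) (auto simp only: sgm_def diff_add_eq scaleR_diff_left, auto)
 next
  case False
  thus ?thesis using c by (intro exI[of _ "- c"]) (auto simp: tp_def sgm_def)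
 qed
 then obtain r where r: "0 <= r" "r <= - A i (tp i l)" "l - c *\<^sub>R rt i = tp i l + r *\<^sub>R rt i" by blast
 thus ?thesis using stp_rt[OF i _ r(2)] by (cases "r = 0") auto
qed

lemma tp_below: "i \<in> aix ==> below l (tp i l)" and s_tp: "i \<in> aix ==> below (s i l) (tp i l)"
proof -
 have "sgm i l 0" "sgm i l (A i l)" by (auto simp: sgm_def)
 thus "i \<in> aix ==> below l (tp i l)" "i \<in> aix ==> below (s i l) (tp i l)"
  using seg_tp[of i l 0] seg_tp[of i l "A i l"] s_eq[of i l] by auto
qed

text \<open>If the step crosses the wall of \<open>s i\<close>, all points involved lie on one line
  in the direction \<open>rt i\<close>. Otherwise the reflected step is again a step, because
  \<open>s i\<close> keeps the root of its wall positive.\<close>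

lemma stp_s: assumes i: "i \<in> aix" and st: "stp v l" shows "below (s i v) (tp i l)"
proof -
 obtain a m r where a: "a \<in> RI" "aff a m pp > 0" "aff a m l < 0" "0 < r" "r <= - aff a m l" "v = l + r *\<^sub>R a"
  using st unfolding stp_def by blast
 note aR = RI_R[OF a(1)]
 show ?thesis
 proof (cases "aff a m = A i")
  case True
  hence ra: "a = rt i" using aff_inj[of a m "rt i"] A_aff'[OF i] root_nonzero aR rt_nonzero[OF i] by metis
  have "A i v = A i l + (r + r)"
   using inner_coroot_self[OF rt_nonzero[OF i]] by (simp add: a ra A_shift)
  hence "s i v = v - (A i l + (r + r)) *\<^sub>R rt i" using s_eq[OF i, of v] by simp
  also have "... = l - (A i l + r) *\<^sub>R rt i" unfolding a(6) ra scaleR_add_left by simp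
  finally have "s i v = l - (A i l + r) *\<^sub>R rt i" .
  moreover have "sgm i l (A i l + r)" using a True by (simp add: sgm_def)
  ultimately show ?thesis using seg_tp[OF i] by metis
 next
  case False
  have "aff a m \<in> Phi aix" unfolding Phi_def using a by auto
  hence p: "aff a m (s i pp) > 0" using Phi_pos_s[OF order_refl i _ a(2) False] by blast
  let ?a = "reflection (rt i) a"
  obtain m' where m': "aff a m (s i x) = aff ?a m' x" for x using aff_s[OF i aR] by blast
  have aI: "?a \<in> RI" using RI_refl rt_R i a by blast
  have "s i v = s i l + r *\<^sub>R ?a"
   using s_dist[OF i, of v l] linear_cmul[OF linear_reflection, of "rt i" r a] a(6) by (simp add: algebra_simps)
  moreover have "aff ?a m' pp > 0" "aff ?a m' (s i l) = aff a m l" using p m'[of pp] m'[of "s i l"] i by auto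
  ultimately have "stp (s i v) (s i l)" unfolding stp_def using aI a(3-5) by metis
  thus ?thesis using s_tp[OF i] by (meson converse_rtranclp_into_rtranclp)
 qed
qed

text \<open>The analogue of the lifting property of the Bruhat order.\<close>

lemma below_s: assumes i: "i \<in> aix" and b: "below v l" shows "below (s i v) (tp i l)"
 using b
proof (induction rule: converse_rtranclp_induct)
 case base
 show ?case using s_tp i by blast
next
 case (step v u)
 have "below u (tp i l)" using step(2) tp_below[OF i] by (meson rtranclp_trans)
 hence "below (tp i u) (tp i l)" using step(3) by (simp add: tp_def[of i u])
 thus ?case using stp_s[OF i step(1)] by (meson rtranclp_trans)
qed

lemma below_tp: assumes "i \<in> aix" "below v l" shows "below (tp i v) (tp i l)"
proof -
 have "below v (tp i l)" using assms tp_below[OF assms(1)] by (meson rtranclp_trans)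
 thus ?thesis using below_s[OF assms] by (simp add: tp_def[of i v])
qed

lemma seg_below: "i \<in> aix ==> below v l ==> sgm i v c ==> below (v - c *\<^sub>R rt i) (tp i l)"
 using seg_tp below_tp by (meson rtranclp_trans)

lemma up_dst: assumes "i \<in> aix" "A i l > 0" shows "dst l < dst (s i l)"
proof -
 have "stp (s i l + A i l *\<^sub>R rt i) (s i l)" by (rule stp_rt) (use assms A_s in auto)
 thus ?thesis using stp_dst s_eq[OF assms(1), of l] by simp
qed

text \<open>If \<open>s i l\<close> lies on the segment issuing from \<open>v\<close>, the larger of
  \<open>v\<close> and \<open>s i v\<close> is both above and below \<open>s i l\<close>, hence
  equal to it. So \<open>v\<close> is \<open>l\<close> or \<open>s i l\<close>, and the latter is
  too far from \<open>pp\<close> to lie below \<open>l\<close>.\<close>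

lemma lead: assumes i: "i \<in> aix" and b: "below v l" and A: "A i l > 0" and c: "sgm i v c" "s i l = v - c *\<^sub>R rt i"
 shows "v = l"
proof -
 have t: "tp i l = s i l" using A by (simp add: tp_def)
 have 1: "below (s i l) (tp i v)" using seg_tp[OF i c(1)] c(2) by simp
 have 2: "below (tp i v) (s i l)" using below_tp[OF i b] t by simp
 have e: "tp i v = s i l" using below_antisym 1 2 by blast
 show ?thesis
 proof (cases "A i v > 0")
  case True
  thus ?thesis using e s_s[OF i] by (metis tp_def)
 next
  case False
  hence "v = s i l" using e by (simp add: tp_def)
  thus ?thesis using below_dst[OF b] up_dst[OF i A] by force
 qed
qed

text \<open>On an eigenvector \<open>T03\<close> agrees up to a scalar with e^bt times
  \<open>TT 0\<close>, by \<open>T03_eig\<close>. In this form its effect on exponents can be read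
  off, whereas the definition of \<open>T03\<close> hides it behind the inverse of a long
  word.\<close>

definition XT :: "nat => ('v, 'p) galg => ('v, 'p) galg" where
 "XT i f = (if i = 0 then ee bt * TT 0 f else TT i f)"

lemma linop_XT: "linop (XT i)"
proof (cases "i = 0")
 case True
 have "linop (%f. ee bt * TT 0 f)" by (rule linop_comp[OF linop_mult linop_TT])
 thus ?thesis using True by (simp add: XT_def[abs_def])
next
 case False
 hence "XT i = TT i" by (simp add: XT_def[abs_def])
 thus ?thesis using linop_TT by simp
qed

lemma XT_wt: "i \<in> aix ==> f \<in> wt ==> XT i f \<in> wt"
 using TT_wt X_wt bt_P by (simp add: XT_def)

lemma gg_scale: assumes "i \<in> aix" obtains m where "m = 1 | m = 2" "gg i = m *\<^sub>R rt i" "i = 0 ==> m = real (c0 D)"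
proof (cases "i = 0")
 case True
 have "gg i = real (c0 D) *\<^sub>R rt i" using True theta_eq by (simp add: gg_def rt_0)
 thus ?thesis using that[of "real (c0 D)"] by (auto simp: c0_def)
next
 case False thus ?thesis using that gg_rt by metis
qed

lemma XT_ee: assumes i: "i \<in> aix" and l: "l \<in> P"
 shows "XT i (ee l) \<in> Lg {l - c *\<^sub>R rt i |c. sgm i l c}"
  and "A i l > 0 ==> lookup (XT i (ee l)) (s i l) = hh i * QQ i powi (- \<lfloor>l \<cdot> gg i\<rfloor>)"
proof -
 note d = dl_P[OF i]
 let ?k = "\<lfloor>l \<cdot> gg i\<rfloor>"
 obtain m where m: "m = 1 | m = 2" "gg i = m *\<^sub>R rt i" "i = 0 ==> m = real (c0 D)" using gg_scale[OF i] by blast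
 \<comment> \<open>The constant term of \<open>A i\<close>: for i = 0 the factor e^bt shifts the
   exponents by one unit of \<open>rt 0\<close>, which turns the linear reflection into the affine
   one.\<close>
 define z where "z = (if i = 0 then 1 else 0 :: real)"
 have Al: "A i l = z + m * real_of_int ?k"
  using dl.k_eq[OF d l] m(1) unfolding m(2) by (auto simp: A_def z_def coroot_scaleR)
 define sh where "sh = (%f::('v,'p) galg. if i = 0 then ee bt * f else f)"
 have XT: "XT i (ee l) = sh (DL (gg i) (QQ i) (hh i) (uu i) (ee l))"
  using TT_DL_wt[OF i ee_wt[OF l]] i by (auto simp: XT_def sh_def)
 have lsh: "linop sh" unfolding sh_def using linop_mult linop_id by (cases "i = 0") auto
 have shee: "sh (ee (l - c *\<^sub>R gg i)) = ee (l - (m * c + z) *\<^sub>R rt i)" for c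
 proof -
  have "l - (m * c + z) *\<^sub>R rt i = (if i = 0 then bt else 0) + (l - c *\<^sub>R gg i)"
   unfolding m(2) z_def by (auto simp: rt_0 algebra_simps)
  thus ?thesis by (simp only: ee_add) (simp add: sh_def ee_0)
 qed
 have shL: "sh f \<in> Lg {l - c *\<^sub>R rt i |c. B' c}"
  if f: "f \<in> Lg {l - c *\<^sub>R gg i |c. B c}" and BB: "!!c. B c ==> B' (m * c + z)" for f and B B' :: "real => bool"
  using f
 proof (induction rule: Lg_induct)
  case (scale a u)
  then obtain c where c: "B c" "u = l - c *\<^sub>R gg i" by blast
  show ?case unfolding linop_scale[OF lsh] c(2) shee by (intro Lg_scale Lg_ee) (use BB[OF c(1)] in blast)
 qed (auto simp: linop_0[OF lsh] linop_add[OF lsh] Lg_0 Lg_add)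
 have z: "0 <= z" "z <= 1" "i ~= 0 ==> z = 0" by (auto simp: z_def)
 have m1: "1 <= m" using m(1) by auto
 have "XT i (ee l) \<in> Lg {l - c *\<^sub>R rt i |c. sgm i l c} &
   (A i l > 0 --> lookup (XT i (ee l)) (s i l) = hh i * QQ i powi (- ?k))"
 proof (cases "?k >= 0")
  case True
  then obtain n where n: "?k = int n" using nonneg_int_cases by blast
  have An: "A i l = m * real n + z" using Al n by simp
  obtain u where u: "u \<in> Lg {l - c *\<^sub>R gg i |c. 0 <= c & c < real n}"
   "DL (gg i) (QQ i) (hh i) (uu i) (ee l) = scale (hh i * QQ i powi (- int n)) (ee (l - real n *\<^sub>R gg i)) + u"
   using dl.T_ee_pos[OF d l n] by blast
  have v: "sh u \<in> Lg {l - c *\<^sub>R rt i |c. 0 <= c & c < A i l}"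
   by (rule shL[OF u(1)]) (use m1 z An in auto)
  have XTe: "XT i (ee l) = scale (hh i * QQ i powi (- int n)) (ee (l - A i l *\<^sub>R rt i)) + sh u"
   unfolding XT u(2) linop_add[OF lsh] linop_scale[OF lsh] shee An ..
  have "sh u \<in> Lg {l - c *\<^sub>R rt i |c. sgm i l c}" using v unfolding Lg_def sgm_def by (auto dest!: subsetD)
  moreover have "sgm i l (A i l)" unfolding sgm_def by linarith
  ultimately have "XT i (ee l) \<in> Lg {l - c *\<^sub>R rt i |c. sgm i l c}"
   unfolding XTe by (intro Lg_add Lg_scale Lg_ee) blast+
  moreover have "lookup (sh u) (s i l) = 0"
  proof -
   have "s i l \<notin> {l - c *\<^sub>R rt i |c. 0 <= c & c < A i l}" using s_eq[OF i, of l] rt_nonzero[OF i] by auto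
   hence "s i l \<notin> keys (sh u)" using v unfolding Lg_def by blast
   thus ?thesis by (simp add: in_keys_iff)
  qed
  ultimately show ?thesis
   unfolding XTe n using s_eq[OF i, of l] by (simp add: lookup_add lookup_scale ee_def)
 next
  case False
  then obtain n where n: "?k = - int n" "n > 0" by (metis int_cases3 neg_0_le_iff_le of_nat_0_le_iff order_refl)
  have An: "A i l = z - m * real n" using Al n by simp
  have "XT i (ee l) \<in> Lg {l - c *\<^sub>R rt i |c. A i l <= c & c <= 0}"
   unfolding XT
  proof (rule shL[OF dl.T_ee_neg[OF d l n]])
   fix c assume c: "- real n <= c & c <= 0 & (uu i = 0 --> c <= -1)"
   hence "m * c >= m * (- real n)" using m1 by (intro mult_left_mono) auto
   moreover have "m * c + z <= 0"
   proof (cases "i = 0")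
    case True
    hence "c <= -1" using c by (simp add: uu_def)
    hence "m * c <= m * (-1)" using m1 by (intro mult_left_mono) auto
    thus ?thesis using m1 z by linarith
   next
    case False
    thus ?thesis using c m1 z by (simp add: mult_nonneg_nonpos)
   qed
   ultimately show "A i l <= m * c + z & m * c + z <= 0" using An by simp
  qed
  moreover have "A i l <= 0"
  proof -
   have "m * real n >= 1 * 1" by (rule mult_mono) (use m1 n in auto)
   thus ?thesis using An z by linarith
  qed
  ultimately show ?thesis unfolding Lg_def sgm_def by auto
 qed
 thus "XT i (ee l) \<in> Lg {l - c *\<^sub>R rt i |c. sgm i l c}"
  "A i l > 0 ==> lookup (XT i (ee l)) (s i l) = hh i * QQ i powi (- ?k)" by auto
qed

section \<open>Leading terms\<close>

definition supp :: "'v => ('v, 'p) galg => bool" where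
 "supp l f \<longleftrightarrow> f \<in> Lg (P \<inter> {v. below v l})"

lemma supp_add: "supp l f ==> supp l g ==> supp l (f + g)" and supp_scale: "supp l f ==> supp l (scale c f)"
 unfolding supp_def by (rule Lg_add Lg_scale; assumption)+

lemma supp_up: assumes "supp l f" "i \<in> aix" "A i l > 0"
 shows "supp (s i l) f" "lookup f (s i l) = 0"
proof -
 have "below l (s i l)" using tp_below[OF assms(2), of l] assms(3) by (simp add: tp_def)
 thus "supp (s i l) f" using assms(1) unfolding supp_def Lg_def by (auto intro: rtranclp_trans)
 have "~ below (s i l) l" using below_dst[of "s i l" l] up_dst[OF assms(2,3)] by auto
 hence "s i l \<notin> keys f" using assms(1) unfolding supp_def Lg_def by auto
 thus "lookup f (s i l) = 0" by (simp add: in_keys_iff)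
qed

lemma supp_XT: assumes f: "supp l f" and i: "i \<in> aix" and A: "A i l > 0"
 shows "supp (s i l) (XT i f)"
  and "lookup (XT i f) (s i l) = hh i * QQ i powi (- \<lfloor>l \<cdot> gg i\<rfloor>) * lookup f l"
proof -
 let ?c = "hh i * QQ i powi (- \<lfloor>l \<cdot> gg i\<rfloor>)"
 have t: "tp i l = s i l" using A by (simp add: tp_def)
 have "supp (s i l) (XT i f) & lookup (XT i f) (s i l) = ?c * lookup f l"
  using f unfolding supp_def
 proof (induction rule: Lg_induct)
  case (scale c v)
  have v: "v \<in> P" "below v l" using scale by auto
  have "XT i (ee v) \<in> Lg (P \<inter> {u. below u (s i l)})"
   using XT_ee(1)[OF i v(1)] XT_wt[OF i ee_wt[OF v(1)]] seg_below[OF i v(2)] t unfolding Lg_def wt_Lg by auto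
  moreover have "lookup (XT i (ee v)) (s i l) = (if v = l then ?c else 0)"
  proof (cases "v = l")
   case False
   have "s i l \<notin> keys (XT i (ee v))"
    using XT_ee(1)[OF i v(1)] lead[OF i v(2) A] False unfolding Lg_def by auto
   thus ?thesis using False by (simp add: in_keys_iff)
  qed (use XT_ee(2)[OF i v(1)] A in simp)
  ultimately show ?case
   unfolding linop_scale[OF linop_XT] by (simp add: Lg_scale lookup_scale ee_def lookup_single)
 qed (simp_all add: linop_0[OF linop_XT] linop_add[OF linop_XT] Lg_0 Lg_add lookup_add distrib_left)
 thus "supp (s i l) (XT i f)" "lookup (XT i f) (s i l) = ?c * lookup f l" by auto
qed

text \<open>Bounded distance bounds the pairings with the simple coroots; these are integers on
  weights and determine the weight.\<close>

lemma finite_dst: "finite {v \<in> P. dst v <= C}"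
proof -
 obtain N :: nat where N: "!!v i. dst v <= C ==> i \<in> ix ==> \<bar>v \<cdot> al i\<bar> <= real N"
 proof
  let ?M = "(sqrt \<bar>C\<bar> + norm pp) * (\<Sum>i\<in>ix. norm (coroot (al i)))"
  fix v i assume v: "dst v <= C" and i: "i \<in> ix"
  have "norm (v - pp) <= sqrt \<bar>C\<bar>" using v unfolding dst_def norm_eq_sqrt_inner by (intro real_sqrt_le_mono) simp
  hence 1: "norm v <= sqrt \<bar>C\<bar> + norm pp" using norm_triangle_ineq2[of v pp] by linarith
  have 2: "norm (coroot (al i)) <= (\<Sum>i\<in>ix. norm (coroot (al i)))" using i by (intro member_le_sum) auto
  have "\<bar>v \<cdot> al i\<bar> <= norm v * norm (coroot (al i))" by (rule Cauchy_Schwarz_ineq2)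
  also have "... <= ?M" using 1 2 by (intro mult_mono) (auto intro: sum_nonneg)
  also have "... <= real (nat \<lceil>?M\<rceil>)" by linarith
  finally show "\<bar>v \<cdot> al i\<bar> <= real (nat \<lceil>?M\<rceil>)" .
 qed
 let ?f = "%v. \<lambda>i\<in>ix. \<lfloor>v \<cdot> al i\<rfloor>"
 have "inj_on ?f P"
 proof (rule inj_onI)
  fix u v assume u: "u \<in> P" and v: "v \<in> P" and e: "?f u = ?f v"
  have "(u - v) \<bullet> al i = 0" if i: "i \<in> ix" for i
  proof -
   have "\<lfloor>u \<cdot> al i\<rfloor> = \<lfloor>v \<cdot> al i\<rfloor>" using fun_cong[OF e, of i] i by simp
   moreover have "u \<cdot> al i \<in> \<int>" "v \<cdot> al i \<in> \<int>" using u v al_R[OF i] by (auto simp: weights_def)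
   ultimately have "(u - v) \<cdot> al i = 0" by (auto simp: Ints_def inner_diff_left)
   thus ?thesis using coroot_zero[OF al_R[OF i]] by blast
  qed
  thus "u = v" using eq_al_iff[of "u - v"] by simp
 qed
 hence inj: "inj_on ?f {v \<in> P. dst v <= C}" by (rule inj_on_subset) auto
 have "?f ` {v \<in> P. dst v <= C} \<subseteq> PiE ix (%_. {- int N - 1..int N})"
 proof (intro image_subsetI)
  fix v assume v: "v \<in> {v \<in> P. dst v <= C}"
  have "\<lfloor>v \<cdot> al i\<rfloor> \<in> {- int N - 1..int N}" if "i \<in> ix" for i
  proof -
   have "\<bar>v \<cdot> al i\<bar> <= real N" using N v that by blast
   hence "- int N - 1 <= \<lfloor>v \<cdot> al i\<rfloor>" "\<lfloor>v \<cdot> al i\<rfloor> <= int N" by linarith+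
   thus ?thesis by simp
  qed
  thus "?f v \<in> PiE ix (%_. {- int N - 1..int N})" by simp
 qed
 hence "finite (?f ` {v \<in> P. dst v <= C})" by (rule finite_subset) (auto intro: finite_PiE)
 thus ?thesis using inj by (rule finite_imageD)
qed

section \<open>The eigenvalues\<close>

text \<open>Reflections change the coefficient of a short root at a short simple root by an even number,
 and all short roots are conjugate.\<close>

lemma nonred_short_simple: assumes r: "~ reduced D" and i: "i \<in> ix" and S: "al i \<in> Sh" shows "i = DIM('v)"
proof (rule ccontr)
 let ?n = "DIM('v)"
 assume ne: "i ~= ?n"
 note n = DIM_ix
 have nS: "al ?n \<in> Sh" using ShI al_R[OF n] nonred_al_n[OF r] msq_nonred[OF r] by simp
 have inv: "\<exists>k::int. (w (al ?n)) \<bullet> fw i = al ?n \<bullet> fw i + of_int (2 * k)" if "w \<in> W" for w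
  using that
 proof (induction w rule: W_induct)
  case id
  show ?case by (intro exI[of _ 0]) simp
 next
  case (step j w)
  let ?b = "w (al ?n)"
  obtain k :: int where k: "?b \<bullet> fw i = al ?n \<bullet> fw i + of_int (2 * k)" using step by blast
  show ?case
  proof (cases "j = i")
   case False
   thus ?thesis using crd_refl[OF step(1) i] k by (intro exI[of _ k]) simp
  next
   case True
   have bR: "?b \<in> R" using W_R step al_R n by blast
   have "2 *\<^sub>R al i \<in> R" using nonred_double[OF r S] .
   then obtain m where "?b \<cdot> (2 *\<^sub>R al i) = of_int m" using int_R bR Ints_cases by metis
   hence m: "?b \<cdot> al i = of_int (2 * m)" by (simp add: coroot_scaleR)
   have "reflection (al j) ?b \<bullet> fw i = al ?n \<bullet> fw i + of_int (2 * (k - m))"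
    using True k m fw_inner[OF i i] inner_commute[of "al i" "fw i"] by (simp add: reflection_def inner_diff_left)
   thus ?thesis by (intro exI[of _ "k - m"]) simp
  qed
 qed
 obtain w where w: "w \<in> W" "w (al ?n) = al i" using short_trans[OF nS S] by blast
 obtain k :: int where "al i \<bullet> fw i = al ?n \<bullet> fw i + of_int (2 * k)" using inv[OF w(1)] w(2) by metis
 hence "real_of_int 1 = of_int (2 * k)" using fw_inner[OF i i] fw_inner[OF i n] ne by (simp add: inner_commute)
 hence "1 = 2 * k" by (simp only: of_int_eq_iff)
 thus False by presburger
qed

definition tau :: "nat => 'p qtfield" where
 "tau i = (if i = DIM('v) then tn_star_half D * t_half D i else (t_half D i)\<^sup>2)"

text \<open>The part of the eigenvalue free of q, as a character of the root lattice;
  \<open>yy l\<close> is a power of q times this character at the preimage under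
  \<open>w_fin D l\<close>.\<close>

definition tm :: "'v => 'p qtfield" where
 "tm u = (\<Prod>i\<in>ix. tau i powi (- \<lfloor>u \<bullet> fw i\<rfloor>))"

abbreviation "yy \<equiv> Y_eigenvalue D"

lemma t_half_nz: "t_half D i ~= 0"
 by (simp add: t_half_def sqrt_param_nz)

lemma tau_nz: "tau i ~= 0"
 by (simp add: tau_def tn_star_half_def t_half_nz)

lemma chr_tm: "chr tm"
 unfolding chr_def
proof (intro conjI ballI)
 fix u v assume u: "u \<in> RL" "v \<in> RL"
 have "tau i powi (- \<lfloor>(u + v) \<bullet> fw i\<rfloor>) = tau i powi (- \<lfloor>u \<bullet> fw i\<rfloor>) * tau i powi (- \<lfloor>v \<bullet> fw i\<rfloor>)" if i: "i \<in> ix" for i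
 proof -
  obtain a b where "u \<bullet> fw i = of_int a" "v \<bullet> fw i = of_int b" using u i unfolding RL_iff by (metis Ints_cases)
  hence "\<lfloor>(u + v) \<bullet> fw i\<rfloor> = \<lfloor>u \<bullet> fw i\<rfloor> + \<lfloor>v \<bullet> fw i\<rfloor>" by (simp add: inner_add_left flip: of_int_add)
  thus ?thesis using power_int_add[OF disjI1[OF tau_nz], of i "- \<lfloor>u \<bullet> fw i\<rfloor>" "- \<lfloor>v \<bullet> fw i\<rfloor>"] by simp
 qed
 thus "tm (u + v) = tm u * tm v" by (simp add: tm_def prod.distrib)
qed (simp add: tm_def)

lemma tm_al: assumes i: "i \<in> ix" shows "tm (al i) = inverse (tau i)"
proof -
 have "tm (al i) = (\<Prod>j\<in>ix. if j = i then inverse (tau i) else 1)"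
  unfolding tm_def
 proof (rule prod.cong[OF refl])
  fix j assume "j \<in> ix"
  thus "tau j powi - \<lfloor>al i \<bullet> fw j\<rfloor> = (if j = i then inverse (tau i) else 1)"
   using fw_inner[of j i] i by (simp add: inner_commute power_int_minus)
 qed
 thus ?thesis using i by simp
qed

lemma wf: "isW ix (w_fin D l) (- l)" and wf_W: "w_fin D l \<in> W"
proof -
 obtain w where w: "isW ix w (- l)" using isW_ex[of ix "- l"] by blast
 thus "isW ix (w_fin D l) (- l)" using W_w_fin by metis
 thus "w_fin D l \<in> W" unfolding isW_def[OF ix_sub] by blast
qed

lemma wf_sign: assumes a: "a \<in> RI" "posr a" shows "posr (inv (w_fin D l) a) \<longleftrightarrow> ~ l \<cdot> a > 0"
proof -
 note aR = RI_R[OF a(1)]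
 have "aff a 0 \<in> Phi ix" unfolding Phi_def using a by auto
 moreover have "aff a 0 pp > 0" using aff_pp[OF aR] a by blast
 ultimately have "aff a 0 (w_fin D l pp) < 0 \<longleftrightarrow> aff a 0 (- l) < 0" using wf[of l] unfolding isW_def[OF ix_sub] by blast
 moreover have "aff a 0 (w_fin D l pp) = pp \<cdot> (inv (w_fin D l) a)"
  using W_inner_inv[OF wf_W] W_coroot[OF W_inv_in[OF wf_W]] by (simp add: aff_def)
 moreover have "inv (w_fin D l) a \<in> R" using W_R W_inv_in wf_W aR by blast
 ultimately show ?thesis using pp_coroot pp_coroot_nz by (force simp: aff_def)
qed

lemma wf_s: "i \<in> ix ==> A i l ~= 0 ==> w_fin D (s i l) = s i o w_fin D l"
proof -
 assume i: "i \<in> ix" and A: "A i l ~= 0"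
 have "isW ix (s i o w_fin D l) (s i (- l))" by (rule isW_step[OF ix_sub wf i]) (use A i A_fin in simp)
 thus ?thesis using W_w_fin(1) s_minus[OF i] by metis
qed

lemma int_P: "l \<in> P ==> a \<in> R ==> \<exists>k::int. l \<cdot> a = of_int k"
 unfolding weights_def using Ints_cases by blast

text \<open>The translation in \<open>s 0\<close> changes pairings with positive roots by 0, 1 or 2,
  and integrality of the pairings with \<open>l\<close> reconciles strict and weak inequalities. The
  single exceptional value, at the root \<open>bt\<close>, is excluded by
  \<open>A 0 l ~= 0\<close>.\<close>

lemma wf_0: assumes l: "l \<in> P" and A: "A 0 l ~= 0" shows "w_fin D (s 0 l) = sth o w_fin D l"
proof (rule W_w_fin(1))
 let ?w = "w_fin D l"
 show "isW ix (sth o ?w) (- s 0 l)"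
  unfolding isW_def[OF ix_sub]
 proof (intro conjI ballI impI)
  show "sth o ?w \<in> W" using weyl_comp s_theta_W wf_W by blast
  fix b assume b: "b \<in> Phi ix" "b pp > 0"
  then obtain a where a: "a \<in> RI" "b = aff a 0" using zero_ix unfolding Phi_def by auto
  note aR = RI_R[OF a(1)]
  have p: "posr a" using b(2) a aff_pp[OF aR] by auto
  let ?a = "reflection bt a"
  have L: "b ((sth o ?w) pp) = pp \<cdot> (inv ?w ?a)"
   using W_inner_inv[OF wf_W] W_coroot[OF W_inv_in[OF wf_W]] by (simp add: a aff_def s_theta_bt reflection_swap coroot_refl)
  have Rr: "b (- s 0 l) = - (l \<cdot> ?a) - bt \<cdot> a"
   by (simp add: a aff_def s_0 inner_diff_left inner_add_left reflection_swap coroot_refl)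
  have aI: "?a \<in> RI" "?a \<in> R" using RI_refl bt_R a RI_R by auto
  have iR: "inv ?w ?a \<in> R" "inv ?w ?a \<in> R ==> - inv ?w ?a \<in> R" using W_R W_inv_in wf_W aI by auto
  obtain k where k: "l \<cdot> ?a = of_int k" using int_P[OF l aI(2)] by blast
  have bc: "bt \<cdot> a = - (bt \<cdot> ?a)" by (simp add: coroot_refl reflection_self flip: reflection_swap)
  consider (0) "bt \<cdot> a = 0" | (1) "bt \<cdot> a = 1" | (2) "a = bt" "bt \<cdot> a = 2"
   using bt_coroot_cases[OF a(1) p] by blast
  thus "b ((sth o ?w) pp) < 0 \<longleftrightarrow> b (- s 0 l) < 0"
  proof cases
   case 0
   hence "?a = a" using refl_bt_posr(3)[OF aR] coroot_zero[OF aR] by blast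
   thus ?thesis using 0 L Rr wf_sign[OF a(1) p, of l] pp_coroot[OF iR(1)] pp_coroot_nz[OF iR(1)] by force
  next
   case 1
   hence "~ posr ?a" using refl_bt_posr(1)[OF aR] coroot_sign[OF aR, of bt] by simp
   hence "posr (- ?a)" "- ?a \<in> RI" using not_posr aI RI_minus by auto
   from wf_sign[OF this(2,1), of l] have "posr (- inv ?w ?a) \<longleftrightarrow> ~ - of_int k > (0::real)"
    using W_minus[OF W_inv_in[OF wf_W]] k by simp
   hence "b ((sth o ?w) pp) < 0 \<longleftrightarrow> k >= 0"
    unfolding L using pp_coroot[OF minus_R[OF iR(1)]] by (simp add: not_less)
   also have "... \<longleftrightarrow> b (- s 0 l) < 0" unfolding Rr k 1 by linarith
   finally show ?thesis .
  next
   case 2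
   have e: "?a = - bt" using 2 by (simp add: reflection_self)
   have "posr (- inv ?w ?a) \<longleftrightarrow> ~ l \<cdot> bt > 0"
    using wf_sign[OF Sh_RI[OF bt_Sh] posr_bt, of l] W_minus[OF W_inv_in[OF wf_W]] e by simp
   hence "b ((sth o ?w) pp) < 0 \<longleftrightarrow> ~ - of_int k > (0::real)"
    unfolding L using pp_coroot[OF minus_R[OF iR(1)]] k e by auto
   also have "... \<longleftrightarrow> b (- s 0 l) < 0"
   proof -
    have "l \<bullet> theta D = - of_int k" using k e coroot_bt by simp
    hence "real_of_int k ~= of_int (-1)" using A by (simp add: A_0)
    hence "k ~= -1" by blast
    thus ?thesis unfolding Rr k 2(2) by auto
   qed
   finally show ?thesis .
  qed
 qed
qed

lemma yy_eq: "yy l u = qpow D (u \<bullet> l) * tm (inv (w_fin D l) u)"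
proof -
 let ?n = "DIM('v)"
 have ix: "ix = insert ?n {1..<?n}" using DIM_ix by (auto simp: fin_ix_def)
 have "u \<bullet> w_fin D l x = inv (w_fin D l) u \<bullet> x" for x using W_inner_inv[OF wf_W, of l x u] by (simp add: inner_commute)
 moreover have "(\<Prod>i\<in>{1..<?n}. ((t_half D i)\<^sup>2) powi k i) = (\<Prod>i\<in>{1..<?n}. tau i powi k i)" for k :: "nat => int"
  by (rule prod.cong) (auto simp: tau_def)
 ultimately show ?thesis by (simp add: Y_eigenvalue_def Let_def tm_def ix tau_def)
qed

lemma chr_yy: assumes "l \<in> P" shows "chr (yy l)"
proof -
 have "inv (w_fin D l) u \<in> RL" if "u \<in> RL" for u using RL_W W_inv_in wf_W that by blast
 thus ?thesis
  using chr_tm qpow_add[OF _ assms refl] linear_add[OF W_linear[OF W_inv_in[OF wf_W]]] linear_0[OF W_linear[OF W_inv_in[OF wf_W]]]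
  by (simp add: chr_def yy_eq inner_add_left qpow_0)
qed

lemma tw_yy: assumes l: "l \<in> P" and i: "i \<in> aix" and A: "A i l ~= 0" and u: "u \<in> RL"
 shows "tw i (yy l) u = yy (s i l) u"
proof (cases "i = 0")
 case True
 have w: "inv (w_fin D (s 0 l)) u = inv (w_fin D l) (sth u)"
  using wf_0[OF l] A True inv_comp[OF sth_aff W_aff[OF wf_W]] inv_sth by simp
 have "u \<bullet> s 0 l = u \<bullet> bt + sth u \<bullet> l" by (simp add: s_0 s_theta_bt inner_add_right reflection_swap)
 thus ?thesis using qpow_add[OF u bt_P refl] by (simp add: tw_def True yy_eq w)
next
 case False
 hence i': "i \<in> ix" using i aix_eq by simp
 have w: "inv (w_fin D (s i l)) u = inv (w_fin D l) (s i u)"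
  using wf_s[OF i' A] inv_comp[OF W_aff[OF s_W[OF i']] W_aff[OF wf_W]] inv_s[OF i] by simp
 show ?thesis using False by (simp add: tw_def yy_eq w) (simp add: weyl_gen_fin[OF i'] reflection_swap)
qed

lemma eig_cong: "eig y f ==> (!!u. u \<in> RL ==> y u = z u) ==> eig z f"
 by (simp add: eig_def)

lemma gg_RL: "i \<in> aix ==> gg i \<in> RL"
 using gg_R R_RL by blast

text \<open>The exponent is \<open>denom D\<close> times the value at \<open>l\<close> of the affine
  root with gradient \<open>gg i\<close>, and this value is positive together with
  \<open>A i l\<close>.\<close>

lemma xx_yy: assumes l: "l \<in> P" and i: "i \<in> aix" and A: "A i l > 0"
 shows "\<exists>k::nat. \<exists>u\<in>RL. k > 0 & xx i (yy l) = qroot ^ k * tm u"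
proof -
 have "\<forall>mu\<in>RL. \<forall>l\<in>P. real (denom D) * (mu \<bullet> l) \<in> \<int>" "denom D > 0" using mac unfolding macdonald_datum_def by blast+
 then obtain z where z: "real (denom D) * (gg i \<bullet> l) = of_int z" and dp: "denom D > 0" using gg_RL[OF i] l Ints_cases by metis
 define o1 where "o1 = (if i = 0 then 1 else 0 :: int)"
 have uL: "inv (w_fin D l) (gg i) \<in> RL" using RL_W W_inv_in wf_W gg_RL i by blast
 have gl: "real_of_int o1 + gg i \<bullet> l > 0"
 proof (cases "i = 0")
  case True thus ?thesis using A by (simp add: o1_def gg_def A_0 inner_commute)
 next
  case False
  obtain m where m: "m = 1 | m = 2" "gg i = m *\<^sub>R rt i" using gg_rt by metis
  have "l \<bullet> rt i > 0" using A False coroot_sign[OF rt_R[OF i]] by (simp add: A_def)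
  thus ?thesis using m False by (auto simp: o1_def inner_commute)
 qed
 let ?k = "int (denom D) * o1 + z"
 have "of_int ?k = real (denom D) * (of_int o1 + gg i \<bullet> l)" using z by (simp add: algebra_simps)
 hence "real_of_int ?k > 0" using gl dp by simp
 hence k: "?k > 0" by (simp only: of_int_0_less_iff)
 have "inverse (QQ i) = qpow D (of_int o1)" by (simp add: QQ_def o1_def qpow_0)
 moreover have "qpow D (of_int o1) * qpow D (gg i \<bullet> l) = qroot powi ?k"
  unfolding qpow_def z by (simp add: o1_def power_int_add qroot_nz)
 ultimately have "xx i (yy l) = qroot powi ?k * tm (inv (w_fin D l) (gg i))" by (simp add: xx_def yy_eq mult.assoc[symmetric])
 hence "xx i (yy l) = qroot ^ nat ?k * tm (inv (w_fin D l) (gg i))" using k by (simp add: power_int_def)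
 thus ?thesis using k uL by (intro exI[of _ "nat ?k"] bexI) auto
qed

subsection \<open>The character of the finite Weyl group\<close>

lemma chi_word: "red ix ws ==> chi D (wd ws) = prod_list (map (t_half D) ws)"
proof -
 assume r: "red ix ws"
 have p: "word_prod (%i. (*) (t_half D i)) us 1 = prod_list (map (t_half D) us)" for us
  by (induction us) auto
 show ?thesis unfolding chi_def p[symmetric] by (rule op_red[OF ix_sub ops_t r]) simp
qed

lemma chi_id: "chi D id = 1"
 using chi_word[OF red_Nil[OF ix_sub]] unfolding word_prod_Nil by simp

lemma chi_nz: "w \<in> W ==> chi D w ~= 0"
 unfolding chi_def by (auto simp: prod_list_zero_iff t_half_nz dest: sym[of 0])

lemma chi_left: assumes "i \<in> ix" "w \<in> W" "A i (w pp) > 0" shows "chi D (s i o w) = t_half D i * chi D w"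
proof -
 obtain ws where ws: "red ix ws" "wd ws = w" using red_ex[OF assms(2)] by blast
 have "red ix (i # ws)" using red_Cons[OF ix_sub] ws assms by blast
 from chi_word[OF this] chi_word[OF ws(1)] show ?thesis unfolding word_prod_Cons ws(2) by simp
qed

lemma chi_right: assumes "i \<in> ix" "w \<in> W" "posr (w (al i))" shows "chi D (w o s i) = chi D w * t_half D i"
proof -
 obtain ws where ws: "red ix ws" "wd ws = w" using red_ex[OF assms(2)] by blast
 have "red ix (ws @ [i])" using red_snoc[OF ix_sub] ws assms W_pp by blast
 from chi_word[OF this] chi_word[OF ws(1)] show ?thesis unfolding word_prod_append word_prod_Cons word_prod_Nil comp_id ws(2) by simp
qed

lemma chi_inv: assumes "w \<in> W" shows "chi D (inv w) = chi D w"
proof -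
 obtain ws where ws: "red ix ws" "wd ws = w" using red_ex[OF assms] by blast
 have "chi D (wd (rev ws)) = chi D (wd ws)"
  using chi_word[OF ws(1)] chi_word[OF red_rev[OF ix_sub ws(1)]] by (simp add: prod_list.rev rev_map[symmetric])
 thus ?thesis using wd_rev_inv[OF ix_sub red_lists[OF ws(1)]] ws(2) by simp
qed

text \<open>Along the letters of \<open>short_induct\<close> the product of
  \<open>chi D (sth o w)\<close> and \<open>tm (inv w bt)\<close> changes by the same factors as
  \<open>chi D w\<close>, so the two are proportional. The constant is found at an element carrying
  a short simple root to \<open>bt\<close>, where composing with \<open>sth\<close> amounts to
  appending \<open>s i\<close>.\<close>

lemma chi_bt: assumes "w \<in> W" "posr (inv w bt)" shows "chi D (sth o w) * hh 0 * tm (inv w bt) = chi D w"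
proof -
 let ?K = "chi D sth * tm bt"
 have e: "x * t * y = z * (u * t)" if a: "x * y = z * u" for x y z u t :: "'p qtfield"
 proof -
  have "x * t * y = (x * y) * t" by (simp only: mult_ac)
  thus ?thesis unfolding a by (simp only: mult_ac)
 qed
 have e': "x * y * inverse t = z * u ==> t ~= 0 ==> x * y = z * (u * t)" for x y z u t :: "'p qtfield" by (simp add: field_simps)
 have main: "chi D (sth o w) * tm (inv w bt) = ?K * chi D w" if "w \<in> W" "posr (inv w bt)" for w
  using that
 proof (induction w rule: short_induct)
  case id
  have "inv id bt = bt" by simp
  thus ?case unfolding comp_id chi_id by simp
 next
  case (orth i w)
  show ?case
   unfolding orth(5) comp_assoc[symmetric] chi_right[OF orth(1-3)] chi_right[OF orth(1) sth_W[OF orth(2)] orth(6)]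
   by (rule e[OF orth(7)])
 next
  case (down i w)
  let ?m = "inv w bt" let ?t = "t_half D i" let ?u = "(sth o w) o s i"
  have L: "?m \<in> RL" "al i \<in> RL" using R_RL Sh_R short_inv(1) al_R down(1,2) by blast+
  have 1: "tau i = ?t\<^sup>2"
  proof (cases "reduced D")
   case True thus ?thesis by (simp add: tau_def tn_star_half_def power2_eq_square)
  next
   case False
   have "2 *\<^sub>R al i \<notin> R" using odd_not_double[OF short_inv(2)[OF down(2)] al_R[OF down(1)], of 1] down(4) by simp
   thus ?thesis using nonred_n[OF False] by (auto simp: tau_def)
  qed
  have 2: "tm ?m = tm (?m - al i) * inverse (tau i)"
   using chr_tm RL_diff[OF L] L(2) tm_al[OF down(1)] unfolding chr_def by (metis diff_add_cancel)
  have u: "?u \<in> W" using weyl_comp sth_W s_W down(1,2) by blast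
  have "?u o s i = sth o w" using s_comp_s[of i] ix_aix down(1) by (simp only: comp_assoc subsetD comp_id)
  moreover have "posr (?u (al i))" using down(6) s_al[OF down(1)] W_minus[OF sth_W[OF down(2)]] by simp
  ultimately have 3: "chi D (sth o w) = chi D ?u * ?t" using chi_right[OF down(1) u] by metis
  have "chi D ?u * tm (?m - al i) * inverse ?t = ?K * chi D w"
   unfolding down(7)[symmetric] 3 2 1 using t_half_nz[of i] by (simp add: field_simps power2_eq_square)
  thus ?case unfolding down(5) comp_assoc[symmetric] chi_right[OF down(1-3)] by (rule e'[OF _ t_half_nz])
 qed
 obtain v i where v: "v \<in> W" "i \<in> ix" "al i \<in> Sh" "v (al i) = bt" using t03_ix by blast
 have "inv v bt = al i" using v by (metis W_inv_l)
 hence "chi D (sth o v) * inverse (tau i) = ?K * chi D v" using main[OF v(1)] tm_al v posr_al by simp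
 moreover have "sth o v = v o s i"
  using W_refl[OF v(1), of "al i"] weyl_gen_fin[OF v(2)] v(4) s_theta_bt by simp
 moreover have "chi D (v o s i) = chi D v * t_half D i" using chi_right v posr_bt by simp
 moreover have "hh 0 * t_half D i = tau i"
 proof (cases "reduced D")
  case True
  hence "hh i = hh 0" using short_hh(1)[OF v(2,3)] by blast
  hence "t_half D i = hh 0" using ix_nz[OF v(2)] by (simp add: hh_def)
  thus ?thesis using True by (cases "i = DIM('v)") (simp_all add: tau_def tn_star_half_def power2_eq_square)
 next
  case False
  thus ?thesis using nonred_short_simple[OF False v(2,3)] by (simp add: hh_def tau_def tn_star_half_def)
 qed
 ultimately have "?K * hh 0 = 1" using chi_nz[OF v(1)] tau_nz[of i] by (simp add: field_simps)
 moreover have "chi D (sth o w) * hh 0 * tm (inv w bt) = hh 0 * (?K * chi D w)" using main[OF assms] by (simp add: mult_ac)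
 ultimately show ?thesis by (metis (no_types) mult.assoc mult.commute mult_1)
qed

end

section \<open>Scalars free of q\<close>

lemma of_tfield_0: "of_tfield 0 = 0" and of_tfield_1: "of_tfield 1 = 1"
 by (simp_all add: of_tfield_def One_fract_def Zero_fract_def one_pCons eq_fract)

lemma of_tfield_add: "of_tfield (a + b) = of_tfield a + of_tfield b"
 and of_tfield_mult: "of_tfield (a * b) = of_tfield a * of_tfield b"
 and of_tfield_minus: "of_tfield (- a) = - of_tfield a"
 by (simp_all add: of_tfield_def mult.commute)

lemma of_tfield_inverse: "of_tfield (inverse a) = inverse (of_tfield a)"
proof (cases "a = 0")
 case False
 hence "of_tfield (inverse a) * of_tfield a = 1" by (simp add: of_tfield_1 flip: of_tfield_mult)
 thus ?thesis by (metis inverse_unique mult.commute)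
qed (simp add: of_tfield_0)

definition tf :: "'p::linorder qtfield set" where "tf = range of_tfield"

lemma tf_1: "1 \<in> tf"
 unfolding tf_def by (metis of_tfield_1 rangeI)

lemma tf_add: "x \<in> tf ==> y \<in> tf ==> x + y \<in> tf" and tf_mult: "x \<in> tf ==> y \<in> tf ==> x * y \<in> tf"
 and tf_minus: "x \<in> tf ==> - x \<in> tf" and tf_inverse: "x \<in> tf ==> inverse x \<in> tf"
 unfolding tf_def by (auto simp flip: of_tfield_add of_tfield_mult of_tfield_minus of_tfield_inverse)

lemma tf_power: "x \<in> tf ==> x ^ n \<in> tf" by (induction n) (auto simp: tf_1 tf_mult)

lemma tf_powi: "x \<in> tf ==> x powi k \<in> tf"
 unfolding power_int_def using tf_power tf_inverse by auto

lemma sqrt_param_tf: "sqrt_param p \<in> tf"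
 by (simp add: sqrt_param_def tf_def)

lemma qroot_power: "qroot ^ n * of_tfield c = Fract (monom c n) 1"
proof -
 have "qroot ^ n = (Fract (monom 1 n) 1 :: 'a qtfield)"
 proof (induction n)
  case 0
  show ?case by (simp add: monom_0 flip: one_pCons One_fract_def)
 qed (simp add: qroot_def monom_Suc)
 thus ?thesis by (simp add: of_tfield_def mult_monom flip: monom_0)
qed

lemma qroot_tf: assumes "n > 0" "c \<in> tf" "d \<in> tf" "qroot ^ n * c = d" shows "c = 0"
proof -
 obtain a b where ab: "c = of_tfield a" "d = of_tfield b" using assms unfolding tf_def by blast
 hence "Fract (monom a n) 1 = Fract (monom b 0) 1" using assms(4) qroot_power[of n a] qroot_power[of 0 b] by simp
 hence "monom a n = monom b 0" by (simp add: eq_fract)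
 hence "a = 0" using assms(1) by (metis coeff_monom less_not_refl)
 thus ?thesis using ab by (simp add: of_tfield_0)
qed

context mac
begin

lemma t_half_tf: "t_half D i \<in> tf" and tau_tf: "tau i \<in> tf" and hh_tf: "hh i \<in> tf" and t03_tf: "t03_half D \<in> tf"
 by (auto simp: t_half_def tau_def tn_star_half_def hh_def t0_half_def t03_half_def sqrt_param_tf tf_1 tf_mult tf_power)

lemma tm_tf: "tm u \<in> tf"
proof -
 have "(\<Prod>i\<in>J. tau i powi (- \<lfloor>u \<bullet> fw i\<rfloor>)) \<in> tf" for J
  by (induction J rule: infinite_finite_induct) (auto simp: tf_1 intro!: tf_mult tf_powi tau_tf)
 thus ?thesis by (simp add: tm_def)
qed

lemma tm_nz: "u \<in> RL ==> tm u ~= 0"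
 using chr_nz chr_tm by blast

lemma xx_ne1: assumes "l \<in> P" "i \<in> aix" "A i l > 0" shows "xx i (yy l) ~= 1"
proof
 assume e: "xx i (yy l) = 1"
 obtain k :: nat and u where k: "k > 0" "u \<in> RL" "xx i (yy l) = qroot ^ k * tm u" using xx_yy[OF assms] by blast
 thus False using qroot_tf[OF k(1) tm_tf tf_1, of u] tm_nz e by metis
qed

section \<open>Construction of the eigenvectors\<close>

text \<open>The last clause is the normalization of \<open>E_tilde\<close>, so the step operators
  preserve it without rescaling.\<close>

definition good :: "'v => ('v, 'p) galg => bool" where
 "good l f \<longleftrightarrow> eig (yy l) f & supp l f & lookup f l = inverse (chi D (w_fin D l))"

definition stepop :: "nat => 'v => ('v, 'p) galg => ('v, 'p) galg" where
 "stepop i l f = TX i f + scale (- dX i / (1 - xx i (yy l))) f"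

text \<open>Only \<open>TX i f\<close> reaches the exponent \<open>s i l\<close>, so the leading
  coefficient is multiplied by the factor in \<open>supp_XT\<close> and, for i = 0, by the scalar of
  \<open>T03_eig\<close>. That this is the quotient of the two values of \<open>chi\<close> is
  \<open>chi_left\<close>, respectively \<open>chi_bt\<close>.\<close>

lemma good_step: assumes g: "good l f" and l: "l \<in> P" and i: "i \<in> aix" and Ap: "A i l > 0"
 shows "good (s i l) (stepop i l f)"
proof -
 have f: "eig (yy l) f" "supp l f" "lookup f l = inverse (chi D (w_fin D l))" using g by (auto simp: good_def)
 have A0: "A i l ~= 0" using Ap by simp
 have "eig (tw i (yy l)) (stepop i l f)"
  unfolding stepop_def by (rule eig_step[OF chr_yy[OF l] f(1) i xx_ne1[OF l i Ap]])
 hence 1: "eig (yy (s i l)) (stepop i l f)" by (rule eig_cong) (rule tw_yy[OF l i A0])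
 define c where "c = (if i = 0 then yy l bt else 1)"
 have TX: "TX i f = scale c (XT i f)" using T03_eig[OF chr_yy[OF l] f(1)] by (simp add: TX_def XT_def c_def)
 note S = supp_XT[OF f(2) i Ap] supp_up[OF f(2) i Ap]
 have 2: "supp (s i l) (stepop i l f)" unfolding stepop_def TX by (intro supp_add supp_scale S)
 let ?w = "w_fin D l"
 have "c * (hh i * QQ i powi (- \<lfloor>l \<cdot> gg i\<rfloor>)) * inverse (chi D ?w) = inverse (chi D (w_fin D (s i l)))"
 proof (cases "i = 0")
  case True
  obtain k where k: "l \<cdot> theta D = of_int k" using int_P[OF l theta_R] by blast
  have kb: "bt \<bullet> l = of_int k" using k bt_theta by (simp add: coroot_theta inner_commute)
  have "l \<bullet> theta D < 1" using Ap True by (simp add: A_0)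
  moreover obtain j where "l \<cdot> bt = of_int j" using int_P[OF l bt_R] by blast
  ultimately have "~ l \<cdot> bt > 0" using coroot_bt by simp
  hence p: "posr (inv ?w bt)" using wf_sign[OF Sh_RI[OF bt_Sh] posr_bt] by blast
  have "QQ i powi (- \<lfloor>l \<cdot> gg i\<rfloor>) = inverse (qpow D (of_int k))"
   using True k by (simp add: QQ_def gg_def qpow_int power_int_inverse)
  moreover have "c = qpow D (of_int k) * tm (inv ?w bt)" using True kb by (simp add: c_def yy_eq)
  ultimately have "c * (hh i * QQ i powi (- \<lfloor>l \<cdot> gg i\<rfloor>)) = hh 0 * tm (inv ?w bt)"
   using qpow_nz[of "of_int k"] True by simp
  moreover have "w_fin D (s i l) = sth o ?w" using wf_0[OF l] A0 True by simp
  moreover have "chi D (sth o ?w) * hh 0 * tm (inv ?w bt) = chi D ?w" by (rule chi_bt[OF wf_W p])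
  moreover have "chi D (sth o ?w) ~= 0" "chi D ?w ~= 0" using chi_nz weyl_comp s_theta_W wf_W by blast+
  ultimately show ?thesis by (simp add: field_simps)
 next
  case False
  hence i': "i \<in> ix" and nz: "i ~= 0" using i aix_eq by auto
  have w: "s i o ?w \<in> W" using weyl_comp s_W wf_W i' by blast
  have "A i (?w pp) < 0" using isW_A[OF ix_sub wf i', of l] Ap A_fin[OF i'] by simp
  hence "A i ((s i o ?w) pp) > 0" using A_s[OF i] by simp
  hence "chi D (s i o (s i o ?w)) = t_half D i * chi D (s i o ?w)" by (rule chi_left[OF i' w])
  hence "chi D ?w = t_half D i * chi D (s i o ?w)" unfolding comp_assoc[symmetric] s_comp_s[OF i] by simp
  moreover have "w_fin D (s i l) = s i o ?w" using wf_s[OF i' A0] .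
  ultimately show ?thesis using nz chi_nz[OF w] t_half_nz[of i] by (simp add: c_def QQ_def hh_def field_simps)
 qed
 hence "lookup (stepop i l f) (s i l) = inverse (chi D (w_fin D (s i l)))"
  unfolding stepop_def TX lookup_add lookup_scale S(2,4) f(3) by (simp add: mult.assoc)
 thus ?thesis using 1 2 by (simp add: good_def)
qed

lemma TT_ee_0: assumes i: "i \<in> aix" and l: "l \<in> P" and p: "l \<cdot> gg i = 0"
 shows "TT i (ee l) = scale (hh i) (ee l)"
proof -
 have "\<lfloor>l \<cdot> gg i\<rfloor> = int 0" using p by simp
 from dl.T_ee_pos[OF dl_P[OF i] l this] obtain u where u: "u \<in> Lg {l - c *\<^sub>R gg i |c. 0 <= c & c < real 0}"
  "TT i (ee l) = scale (hh i) (ee l) + u" using TT_DL_wt[OF i ee_wt[OF l]] by auto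
 have "keys u \<subseteq> {}" using u(1) unfolding Lg_def by fastforce
 thus ?thesis using u(2) by simp
qed

lemma TT_ee_m1: assumes i: "i \<in> aix" and l: "l \<in> P" and p: "l \<cdot> gg i = -1" and u: "uu i = 0"
 shows "TT i (ee l) = scale (inverse (hh i) * QQ i) (ee (l + gg i))"
proof -
 note d = dl_P[OF i]
 have k: "\<lfloor>l \<cdot> gg i\<rfloor> = - int 1" using p floor_of_int[of "-1"] by simp
 have e: "ee (l + gg i) = (ee (gg i) * ee l :: ('v, 'p) galg)" by (simp add: add.commute flip: ee_add)
 show ?thesis
  unfolding TT_DL_wt[OF i ee_wt[OF l]] dl.T_eq[OF d] dl.cc_e0[OF d u] dl.Do_ee_neg[OF d k l] dl.so_ee_neg[OF d l k] e
  by (simp add: dl.y_def[OF d] scale_mult_left scale_mult_right algebra_simps flip: galg.scale_left_diff_distrib)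
qed

definition alc :: "'v => bool" where "alc v \<longleftrightarrow> v \<in> P & (\<forall>i\<in>aix. A i v >= 0)"

lemma alc_dom: "alc v ==> dominant v" "alc v ==> v \<bullet> theta D <= 1" "alc v ==> v \<in> P"
 using A_0_theta aix_eq by (auto simp: alc_def dominant_A)

lemma alc_pair: assumes "alc v" "a \<in> RI" "posr a" shows "v \<cdot> a = 0 | v \<cdot> a = 1"
proof -
 obtain k where k: "v \<cdot> a = of_int k" using int_P alc_dom(3) RI_R assms by blast
 thus ?thesis using dominant_coroot[OF alc_dom(1) RI_R] alcove_le1[OF alc_dom(1,2)] assms by force
qed

text \<open>Alcove weights pair to 0 or 1 with positive indivisible roots, so each letter of a
  reduced word either fixes the exponent or moves it without creating other terms. In the first case
  \<open>chi\<close> gains the parameter of the letter, in the second it loses it.\<close>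

lemma T_alc: assumes v: "alc v" and w: "w \<in> W"
 shows "T (inv w) (ee (w v)) = scale (chi D (w o w_fin D v) * inverse (chi D (w_fin D v))) (ee v)"
 using w
proof (induction w rule: W_left_induct)
 case id
 have c: "chi D (w_fin D v) * inverse (chi D (w_fin D v)) = 1" using chi_nz wf_W by simp
 have i: "inv (id :: 'v => 'v) = id" by (rule inv_equality) auto
 have "T (inv id) (ee (id v)) = scale (chi D (w_fin D v) * inverse (chi D (w_fin D v))) (ee v)"
  unfolding i c using T_id[OF ee_wt[OF alc_dom(3)[OF v]]] by simp
 thus ?case unfolding id_comp .
next
 case (up i w)
 let ?f = "w_fin D v" let ?l = "w v" let ?b = "inv w (al i)"
 have w: "s i \<in> W" "w o ?f \<in> W" "inv w \<in> aff_weyl D" using s_W up(1,2) wf_W weyl_comp W_aff W_inv_in by blast+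
 have i': "i \<in> aix" using up ix_aix by blast
 have lP: "?l \<in> P" using weights_weyl W_aff up(2) alc_dom(3) v by blast
 have bI: "?b \<in> RI" "?b \<in> R" using RI_W W_inv_in up(2) al_RI[OF up(1)] RI_R by blast+
 have wc: "w x \<cdot> al i = x \<cdot> ?b" for x using W_inner_inv up(2) W_coroot W_inv_in by simp
 have bp: "posr ?b" using up(3) pp_coroot[OF bI(2)] wc A_fin[OF up(1)] by simp
 have iv: "inv (s i o w) = inv w o s i" using inv_comp[OF W_aff W_aff] w up(2) inv_s[OF i'] by simp
 have T: "T (inv (s i o w)) g = T (inv w) (TT i g)" if "g \<in> wt" for g
  unfolding iv using T_up_right[OF i' w(3) _ that] inv_inv_eq[OF W_bij[OF up(2)]] up(3) by simp
 have Af: "A i ((w o ?f) pp) = pp \<cdot> (inv ?f ?b)"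
  using A_fin[OF up(1)] wc[of "?f pp"] W_inner_inv[OF wf_W] W_coroot[OF W_inv_in[OF wf_W]] by simp
 have fb: "inv ?f ?b \<in> R" using W_R W_inv_in wf_W bI by blast
 have sl: "s i ?l = ?l - (v \<cdot> ?b) *\<^sub>R al i" using wc by (simp add: weyl_gen_fin[OF up(1)] reflection_def)
 have si: "s i ?l \<in> P" using weights_s[OF i' lP] .
 obtain m where m: "gg i = m *\<^sub>R rt i" "m = 1 | m = 2" using gg_rt by metis
 define c c' where "c = chi D (w o ?f)" and "c' = chi D (s i o (w o ?f))"
 have IH: "T (inv w) (ee ?l) = scale (c * inverse (chi D ?f)) (ee v)" unfolding c_def by (rule up(4))
 have "T (inv (s i o w)) (ee (s i ?l)) = scale (c' * inverse (chi D ?f)) (ee v)"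
 proof (cases "v \<cdot> ?b = 0")
  case True
  hence "A i ((w o ?f) pp) > 0" using Af wf_sign[OF bI(1) bp] pp_coroot[OF fb] by simp
  hence "c' = t_half D i * c" unfolding c_def c'_def by (rule chi_left[OF up(1) w(2)])
  moreover have "TT i (ee ?l) = scale (hh i) (ee ?l)"
   by (rule TT_ee_0[OF i' lP]) (use True wc[of v] m rt_ix[OF up(1)] in \<open>simp add: coroot_scaleR\<close>)
  ultimately show ?thesis
   using T[OF ee_wt[OF si]] True sl IH linop_scale[OF linop_T[OF w(3)]] ix_nz[OF up(1)] by (simp add: hh_def mult_ac)
 next
  case False
  hence p: "v \<cdot> ?b = 1" using alc_pair[OF v bI(1) bp] by blast
  hence "~ posr (inv ?f ?b)" using wf_sign[OF bI(1) bp] by simp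
  hence "A i ((w o ?f) pp) < 0" using Af pp_coroot[OF fb] pp_coroot_nz[OF fb] by force
  hence "A i ((s i o (w o ?f)) pp) > 0" using A_s[OF i'] by simp
  hence "chi D (s i o (s i o (w o ?f))) = t_half D i * chi D (s i o (w o ?f))"
   by (rule chi_left[OF up(1) weyl_comp[OF w(1,2)]])
  moreover have "s i o (s i o (w o ?f)) = w o ?f" unfolding comp_assoc[of "s i" "s i", symmetric] s_comp_s[OF i'] by simp
  ultimately have c: "c = t_half D i * c'" unfolding c_def c'_def by metis
  have "2 *\<^sub>R al i \<notin> R" using odd_not_double[OF lP al_R[OF up(1)], of 1] wc[of v] p by simp
  hence g: "gg i = al i" "uu i = 0" using gg_al up(1) by auto
  have "s i ?l \<cdot> gg i = -1"
   using wc[of v] p inner_coroot_self[OF root_nonzero[OF al_R[OF up(1)]]] sl g by (simp add: inner_diff_left)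
  from TT_ee_m1[OF i' si this g(2)] have "TT i (ee (s i ?l)) = scale (inverse (t_half D i)) (ee ?l)"
   using g sl p ix_nz[OF up(1)] by (simp add: QQ_def hh_def)
  thus ?thesis using T[OF ee_wt[OF si]] IH linop_scale[OF linop_T[OF w(3)]] c t_half_nz[of i] by (simp add: mult.assoc)
 qed
 thus ?case unfolding c'_def comp_assoc comp_apply .
qed

text \<open>By \<open>T_alc\<close> every factor in the closed formula for \<open>Y\<close> at a
  negative short root keeps e^v a multiple of a single exponential; the values of \<open>chi\<close>
  that arise combine to the eigenvalue through \<open>chi_bt\<close>.\<close>

lemma eig_alc: assumes v: "alc v" shows "eig (yy v) (ee v)"
proof (rule eigI[OF chr_yy[OF alc_dom(3)[OF v]] ee_wt[OF alc_dom(3)[OF v]]])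
 let ?f = "w_fin D v"
 note vP = alc_dom(3)[OF v] and fW = wf_W[of v]
 have main: "Y (- g) (ee v) = scale (yy v (- g)) (ee v)" if g: "g \<in> Sh" "posr g" for g
 proof -
  obtain x where x: "x \<in> W" "x bt = g" using short_trans[OF bt_Sh g(1)] by blast
  define w where "w = inv x"
  have w: "w \<in> W" "inv w = x" "inv w bt = g" using x W_inv_in inv_inv_eq[OF W_bij[OF x(1)]] by (auto simp: w_def)
  have ws: "w o ?f \<in> W" "sth o w \<in> W" "sth o (w o ?f) \<in> W" using w(1) weyl_comp s_theta_W fW by blast+
  have lP: "w v \<in> P" using weights_weyl W_aff w(1) vP by blast
  have iu: "inv (w o ?f) bt = inv ?f g" using inv_comp[OF W_aff[OF w(1)] W_aff[OF fW]] w by simp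
  have iw: "inv w \<in> aff_weyl D" "inv (sth o w) \<in> aff_weyl D" using W_aff W_inv_in w(1) ws by blast+
  have nz: "chi D ?f ~= 0" "chi D (w o ?f) ~= 0" "hh 0 ~= 0" using chi_nz fW ws hh_nz by blast+
  let ?c = "chi D (w o ?f) * inverse (chi D ?f)"
  have "scale (inverse ?c) (T (inv w) (ee (w v))) = ee v" using T_alc[OF v w(1)] nz by (simp add: field_simps)
  hence "T (inv w) (scale (inverse ?c) (ee (w v))) = ee v" by (simp add: linop_scale[OF linop_T[OF iw(1)]])
  from this[symmetric] have Tj: "Tj (inv w) (ee v) = scale (inverse ?c) (ee (w v))"
   by (rule ssubst[of _ _ "%z. Tj (inv w) z = _"]) (rule Tj_T[OF iw(1) scale_wt[OF ee_wt[OF lP]]])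
  have Y: "Y (- g) (ee v) = scale (inverse ?c) (T (inv (sth o w)) (TT 0 (ee (w v))))"
   using Y_short[OF w(1) _ ee_wt[OF vP]] w(3) g(2)
   by (simp add: Tj linop_scale[OF linop_T[OF iw(2)]] linop_scale[OF linop_TT])
  have T2: "T (inv (sth o w)) (ee (sth (w v))) = scale (chi D (sth o (w o ?f)) * inverse (chi D ?f)) (ee v)"
   using T_alc[OF v ws(2)] by (simp add: comp_assoc)
  have pr: "w v \<cdot> bt = v \<cdot> g" using W_inner_inv[OF w(1)] W_coroot[OF W_inv_in[OF w(1)], of bt] w(3) by simp
  have fg: "inv ?f g \<in> RL" "inv ?f (- g) = - inv ?f g" using RL_W W_inv_in fW R_RL Sh_R g W_minus by auto
  note RIg = Sh_RI[OF g(1)]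
  show ?thesis
  proof (cases "v \<cdot> g = 0")
   case True
   have b0: "w v \<bullet> bt = 0" "v \<bullet> g = 0" using pr True coroot_zero bt_R Sh_R[OF g(1)] by auto
   have "w v \<cdot> gg 0 = 0" using b0 bt_theta by (simp add: gg_def coroot_theta)
   hence "TT 0 (ee (w v)) = scale (hh 0) (ee (sth (w v)))" using TT_ee_0[OF zero_aix lP] sth_orth[OF b0(1)] by simp
   hence "Y (- g) (ee v) = scale (chi D (sth o (w o ?f)) * hh 0 * inverse (chi D (w o ?f))) (ee v)"
    using Y T2 nz by (simp add: linop_scale[OF linop_T[OF iw(2)]] mult_ac)
   also have "chi D (sth o (w o ?f)) * hh 0 * inverse (chi D (w o ?f)) = yy v (- g)"
   proof -
    have "posr (inv ?f g)" using wf_sign[OF RIg g(2), of v] True by simp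
    hence "chi D (sth o (w o ?f)) * hh 0 * tm (inv ?f g) = chi D (w o ?f)" using chi_bt[OF ws(1)] iu by simp
    hence "chi D (sth o (w o ?f)) * hh 0 * inverse (chi D (w o ?f)) = inverse (tm (inv ?f g))"
     using nz(2) tm_nz[OF fg(1)] by (simp add: field_simps)
    thus ?thesis using b0 fg chr_inv[OF chr_tm fg(1)] by (simp add: yy_eq qpow_0 inner_commute)
   qed
   finally show ?thesis .
  next
   case False
   hence p: "v \<cdot> g = 1" using alc_pair[OF v RIg g(2)] by blast
   have r: "reduced D"
    using odd_not_double[OF vP Sh_R[OF g(1)], of 1] nonred_double[OF _ g(1)] p by fastforce
   have th: "coroot bt = bt" "theta D = bt" "coroot g = g"
    using coroot_bt theta_eq r Sh_sq[OF g(1)] msq_red by (auto simp: c0_def coroot_def)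
   have "w v \<cdot> gg 0 = -1" using pr p th by (simp add: gg_def)
   from TT_ee_m1[OF zero_aix lP this] have "TT 0 (ee (w v)) = scale (inverse (hh 0) * inverse (qpow D 1)) (ee (sth (w v)))"
    using pr p th by (simp add: uu_def QQ_def gg_def s_theta_bt reflection_def)
   hence "Y (- g) (ee v) = scale (chi D (sth o (w o ?f)) * inverse (hh 0) * inverse (chi D (w o ?f)) * inverse (qpow D 1)) (ee v)"
    using Y T2 nz by (simp add: linop_scale[OF linop_T[OF iw(2)]] mult_ac)
   also have "chi D (sth o (w o ?f)) * inverse (hh 0) * inverse (chi D (w o ?f)) * inverse (qpow D 1) = yy v (- g)"
   proof -
    have n: "~ posr (inv ?f g)" using wf_sign[OF RIg g(2), of v] p by simp
    have "inv (sth o (w o ?f)) bt = - inv ?f g"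
     using inv_comp[OF sth_aff W_aff[OF ws(1)]] inv_sth iu W_minus[OF W_inv_in[OF ws(1)]] by (simp add: sth_bt)
    moreover have "posr (- inv ?f g)" using n not_posr W_R W_inv_in fW Sh_R[OF g(1)] by blast
    ultimately have "chi D (sth o (sth o (w o ?f))) * hh 0 * tm (- inv ?f g) = chi D (sth o (w o ?f))"
     using chi_bt[OF ws(3)] by simp
    hence "chi D (w o ?f) * hh 0 * tm (- inv ?f g) = chi D (sth o (w o ?f))"
     unfolding comp_assoc[of sth sth, symmetric] sth_comp by simp
    hence "chi D (sth o (w o ?f)) * inverse (hh 0) * inverse (chi D (w o ?f)) = tm (- inv ?f g)"
     using nz by (simp add: field_simps)
    moreover have "qpow D ((- g) \<bullet> v) = inverse (qpow D 1)" using p th qpow_int[of "-1"] by (simp add: inner_commute power_int_minus)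
    ultimately show ?thesis using fg by (simp add: yy_eq)
   qed
   finally show ?thesis .
  qed
 qed
 fix g assume g: "g \<in> Sh"
 show "Y g (ee v) = scale (yy v g) (ee v) | Y (- g) (ee v) = scale (yy v (- g)) (ee v)"
  using main[OF g] main[OF Sh_minus[OF g]] not_posr[OF Sh_R[OF g]] by auto
qed

lemma good_alc: assumes v: "alc v" shows "good v (scale (inverse (chi D (w_fin D v))) (ee v))"
proof -
 note e = eig_alc[OF v]
 have "eig (yy v) (scale (inverse (chi D (w_fin D v))) (ee v))"
  unfolding eig_def using Y_lin(2)[OF _ eig_wt[OF e] eig_wt[OF e]] eig_Y[OF e] scale_wt[OF eig_wt[OF e]]
  by (simp add: mult.commute)
 thus ?thesis using alc_dom(3)[OF v] by (auto simp: good_def supp_def lookup_scale ee_def intro!: Lg_scale Lg_ee[unfolded ee_def])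
qed

section \<open>Existence, uniqueness and completeness\<close>

lemma isW_aff: "\<exists>w. isW aix w l"
 using isW_ex by blast

lemma isW_Nil: assumes "isW aix id l" "l \<in> P" shows "alc l"
 unfolding alc_def
proof (intro conjI ballI)
 fix i assume i: "i \<in> aix"
 show "A i l >= 0" using isW_A[OF order_refl assms(1) i] A_pp[OF i] by auto
qed (rule assms)

lemma isW_Cons: assumes "isW aix (wd (i # us)) l" "red aix (i # us)" "l \<in> P"
 shows "isW aix (wd us) (s i l)" "red aix us" "s i l \<in> P" "A i (s i l) > 0" "i \<in> aix"
proof -
 have r: "i \<in> aix" "red aix us" "A i (wd us pp) > 0" using assms(2) red_Cons[OF order_refl] by blast+
 have "A i (wd (i # us) pp) < 0" using A_s[OF r(1)] r(3) by simp
 hence n: "A i l < 0" using isW_A[OF order_refl assms(1) r(1)] by blast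
 have "isW aix (s i o wd us) l" using assms(1) unfolding word_prod_Cons .
 from isW_step_back[OF order_refl this r(1)] n show "isW aix (wd us) (s i l)" by simp
 show "A i (s i l) > 0" using A_s[OF r(1)] n by simp
 show "s i l \<in> P" using weights_s r(1) assms(3) by blast
 show "red aix us" "i \<in> aix" by fact+
qed

text \<open>A reduced word of the shortest element that carries the alcove representative to
  \<open>l\<close> moves away from the alcove at every letter.\<close>

lemma P_induct [consumes 1, case_names alc step]:
 assumes l: "l \<in> P" and base: "!!v. alc v ==> Q v"
  and step: "!!v i. v \<in> P ==> i \<in> aix ==> A i v > 0 ==> Q v ==> Q (s i v)"
 shows "Q l"
proof -
 have "isW aix (wd us) l ==> red aix us ==> l \<in> P ==> Q l" for us l
 proof (induction us arbitrary: l)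
  case Nil
  thus ?case using base isW_Nil unfolding word_prod_Nil by blast
 next
  case (Cons i us)
  note c = isW_Cons[OF Cons.prems]
  show ?case using step[OF c(3,5,4) Cons.IH[OF c(1-3)]] c(5) by simp
 qed
 moreover obtain w where w: "isW aix w l" using isW_aff by blast
 moreover obtain us where "red aix us" "wd us = w" using red_ex w unfolding isW_def[OF order_refl] by blast
 ultimately show ?thesis using l by blast
qed

lemma good_ex: "l \<in> P ==> \<exists>f. good l f"
 by (induction rule: P_induct) (use good_alc good_step in blast)+

definition EV :: "'v => ('v, 'p) galg" where "EV l = (SOME f. good l f)"

lemma good_EV: "l \<in> P ==> good l (EV l)"
 unfolding EV_def using good_ex by (rule someI_ex)

lemma chi_wf_nz: "chi D (w_fin D l) ~= 0"
 using chi_nz wf_W by blast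

text \<open>Triangularity is inverted by induction on the number of weights closer to
  \<open>pp\<close>, which is finite.\<close>

lemma EV_surj: "f \<in> wt ==> \<exists>h\<in>Lg P. f = lin_ext EV h"
proof -
 let ?V = "lin_ext EV ` Lg P"
 note L = linop_lin_ext[of EV]
 have V: "0 \<in> ?V" "!!f g. f \<in> ?V ==> g \<in> ?V ==> f + g \<in> ?V" "!!c f. f \<in> ?V ==> scale c f \<in> ?V"
 proof -
  have "lin_ext EV 0 = 0" using linop_0[OF L] .
  thus "0 \<in> ?V" using Lg_0 by (metis image_eqI)
  fix f g c assume "f \<in> ?V"
  then obtain a where a: "a \<in> Lg P" "f = lin_ext EV a" by blast
  hence "scale c f = lin_ext EV (scale c a)" using linop_scale[OF L] by simp
  thus "scale c f \<in> ?V" using Lg_scale[OF a(1)] by blast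
  assume "g \<in> ?V"
  then obtain b where b: "b \<in> Lg P" "g = lin_ext EV b" by blast
  hence "f + g = lin_ext EV (a + b)" using linop_add[OF L] a by simp
  thus "f + g \<in> ?V" using Lg_add[OF a(1) b(1)] by blast
 qed
 have VL: "f \<in> ?V" if "f \<in> Lg K" "!!v. v \<in> K ==> ee v \<in> ?V" for f K
  using that(1) by (induction rule: Lg_induct) (use V that(2) in auto)
 have "l \<in> P --> ee l \<in> ?V" for l
 proof (induction "card {v \<in> P. dst v < dst l}" arbitrary: l rule: less_induct)
  case less
  show ?case
  proof
   assume l: "l \<in> P"
   let ?c = "inverse (chi D (w_fin D l))"
   have g: "supp l (EV l)" "lookup (EV l) l = ?c" using good_EV[OF l] by (auto simp: good_def)
   have "EV l - scale ?c (ee l) \<in> Lg {v \<in> P. dst v < dst l}"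
    unfolding Lg_def
   proof (intro CollectI subsetI)
    fix v assume v: "v \<in> keys (EV l - scale ?c (ee l))"
    hence "v ~= l" using g(2) by (auto simp: in_keys_iff lookup_minus lookup_scale ee_def)
    moreover from this have "v \<in> keys (EV l)" using v by (auto simp: in_keys_iff lookup_minus lookup_scale ee_def lookup_single)
    ultimately show "v \<in> P & dst v < dst l" using g(1) below_dst unfolding supp_def Lg_def by blast
   qed
   moreover have "ee v \<in> ?V" if v: "v \<in> {v \<in> P. dst v < dst l}" for v
   proof -
    have "{u \<in> P. dst u < dst v} \<subset> {v \<in> P. dst v < dst l}" using v by auto
    moreover have "finite {v \<in> P. dst v < dst l}" by (rule finite_subset[OF _ finite_dst[of "dst l"]]) auto
    ultimately have "card {u \<in> P. dst u < dst v} < card {v \<in> P. dst v < dst l}" by (intro psubset_card_mono)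
    from less.hyps[OF this] show ?thesis using v by blast
   qed
   ultimately have "EV l - scale ?c (ee l) \<in> ?V" by (rule VL)
   moreover have "EV l \<in> ?V" using lin_ext_ee[of EV l] Lg_ee[OF l] by (metis image_eqI)
   ultimately have "EV l + scale (-1) (EV l - scale ?c (ee l)) \<in> ?V" using V by blast
   hence "scale ?c (ee l) \<in> ?V" by simp
   from V(3)[OF this] have "scale (chi D (w_fin D l)) (scale ?c (ee l)) \<in> ?V" .
   thus "ee l \<in> ?V" using chi_wf_nz[of l] by simp
  qed
 qed
 thus "f \<in> wt ==> \<exists>h\<in>Lg P. f = lin_ext EV h" unfolding wt_Lg using VL by blast
qed

text \<open>At a simple root distinguishing the two weights the eigenvalues contain different powers
  of q, and a nonzero factor free of q cannot make up for the difference.\<close>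

lemma yy_separate: assumes v: "v \<in> P" "v' \<in> P" "v ~= v'" shows "\<exists>u\<in>RL. yy v u ~= yy v' u"
proof -
 obtain i where i: "i \<in> ix" "(v - v') \<bullet> al i ~= 0" using eq_al_iff[of "v - v'"] v(3) by auto
 have u: "al i \<in> RL" using R_RL al_R i by blast
 have lt: "yy v (al i) ~= yy v' (al i)" if v: "v \<in> P" "v' \<in> P" "al i \<bullet> v' < al i \<bullet> v" for v v'
 proof
  assume e: "yy v (al i) = yy v' (al i)"
  have "\<forall>mu\<in>RL. \<forall>l\<in>P. real (denom D) * (mu \<bullet> l) \<in> \<int>" "denom D > 0" using mac unfolding macdonald_datum_def by blast+
  then obtain z z' where z: "real (denom D) * (al i \<bullet> v) = of_int z" "real (denom D) * (al i \<bullet> v') = of_int z'"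
   and dp: "denom D > 0" using u v Ints_cases by metis
  have "real (denom D) * (al i \<bullet> v') < real (denom D) * (al i \<bullet> v)" using dp v(3) by simp
  hence zz: "z' < z" unfolding z by simp
  have uL: "inv (w_fin D x) (al i) \<in> RL" for x using RL_W W_inv_in wf_W u by blast
  have "qroot powi z = (qroot powi z' * qroot ^ nat (z - z') :: 'p qtfield)"
   using zz power_int_add[OF disjI1[OF qroot_nz], of z' "z - z'"] by (simp add: power_int_def)
  hence "qroot ^ nat (z - z') * tm (inv (w_fin D v) (al i)) = tm (inv (w_fin D v') (al i))"
   using e by (simp add: yy_eq qpow_def z qroot_nz)
  from qroot_tf[OF _ tm_tf tm_tf this] zz have "tm (inv (w_fin D v) (al i)) = 0" by simp
  thus False using tm_nz[OF uL] by blast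
 qed
 have "al i \<bullet> v < al i \<bullet> v' | al i \<bullet> v' < al i \<bullet> v" using i(2) by (simp add: inner_diff_left inner_commute[of "al i"]) linarith
 thus ?thesis using lt v u by metis
qed

lemma eig_scale: "eig y f ==> eig y (scale c f)" and eig_diff: "eig y f ==> eig y g ==> eig y (f - g)" and eig_0: "eig y 0"
proof -
 show s: "eig y (scale c f)" if "eig y f" for c f
  using that Y_lin(2) scale_wt by (auto simp: eig_def mult.commute)
 have a: "eig y (f + g)" if "eig y f" "eig y g" for f g
  using that Y_lin(1) add_wt by (auto simp: eig_def galg.scale_right_distrib)
 show "eig y f ==> eig y g ==> eig y (f - g)" using a[of f "scale (-1) g"] s[of g "-1"] by simp
 show "eig y 0" using Y_lin(2)[of _ 0 0 0] by (simp add: eig_def wt_Lg Lg_0)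
qed

lemma Y_sum: assumes "u \<in> RL" "!!v. v \<in> J ==> g v \<in> wt" shows "Y u (\<Sum>v\<in>J. g v) = (\<Sum>v\<in>J. Y u (g v)) & (\<Sum>v\<in>J. g v) \<in> wt"
 using assms(2)
proof (induction J rule: infinite_finite_induct)
 case (insert v J)
 thus ?case using Y_lin(1)[OF assms(1)] add_wt by simp
qed (use eig_Y[OF eig_0[of "%_. 0"] assms(1)] eig_wt[OF eig_0] in auto)

lemma eig_indep: assumes "finite J" "J \<subseteq> P" "!!v. v \<in> J ==> eig (yy v) (g v)" "(\<Sum>v\<in>J. g v) = 0" "v \<in> J"
 shows "g v = 0"
 using assms
proof (induction J arbitrary: g v rule: finite_induct)
 case (insert w J)
 have z: "g v = 0" if v: "v \<in> J" for v
 proof -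
  have "v \<in> P" "w \<in> P" "v ~= w" using insert v by auto
  then obtain u where u: "u \<in> RL" "yy v u ~= yy w u" using yy_separate by blast
  define h where "h = (%v. scale (yy v u - yy w u) (g v))"
  have gw: "g v \<in> wt" if "v \<in> insert w J" for v using insert.prems(2) eig_wt that by blast
  have "0 = Y u (\<Sum>v\<in>insert w J. g v) - scale (yy w u) (\<Sum>v\<in>insert w J. g v)"
   using insert.prems(3) eig_Y[OF eig_0[of "%_. 0"] u(1)] by simp
  also have "... = (\<Sum>v\<in>insert w J. Y u (g v) - scale (yy w u) (g v))"
   using Y_sum[of u "insert w J" g, OF u(1) gw] by (simp only: sum_subtractf galg.scale_sum_right)
  also have "... = (\<Sum>v\<in>insert w J. h v)"
   by (rule sum.cong[OF refl]) (use insert.prems(2) eig_Y[OF _ u(1)] in \<open>simp add: h_def galg.scale_left_diff_distrib\<close>)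
  also have "... = (\<Sum>v\<in>J. h v)" using insert.hyps by (simp add: h_def)
  finally have "(\<Sum>v\<in>J. h v) = 0" by simp
  moreover have "eig (yy v) (h v)" if "v \<in> J" for v using insert.prems(2) that eig_scale by (simp add: h_def)
  ultimately have "h v = 0" using insert.IH[of h v] v insert.prems(1) by blast
  thus ?thesis using u(2) by (simp add: h_def)
 qed
 show ?case
 proof (cases "v = w")
  case True
  have "(\<Sum>v\<in>J. g v) = 0" using z by simp
  thus ?thesis using insert True by simp
 qed (use z insert in auto)
qed simp

text \<open>Expanded in the family \<open>EV\<close>, a joint eigenvector has only its component at
  \<open>l\<close> by \<open>eig_indep\<close>, so the joint eigenspaces are lines.\<close>

lemma eig_unique: assumes l: "l \<in> P" and f: "eig (yy l) f" and g: "eig (yy l) g"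
 and e: "lookup f l = lookup g l" shows "f = g"
proof -
 have mult: "\<exists>c. f = scale c (EV l)" if f: "eig (yy l) f" for f
 proof -
  obtain h where h: "h \<in> Lg P" "f = lin_ext EV h" using EV_surj[OF eig_wt[OF f]] by blast
  let ?J = "insert l (keys h)"
  define g where "g = (%v. scale (lookup h v) (EV v) - (if v = l then f else 0))"
  have J: "finite ?J" "?J \<subseteq> P" using h l by (auto simp: Lg_def)
  have "eig (yy v) (g v)" if "v \<in> ?J" for v
  proof -
   have "eig (yy v) (EV v)" using good_EV J(2) that by (auto simp: good_def)
   thus ?thesis unfolding g_def using f eig_0 by (intro eig_diff eig_scale) auto
  qed
  moreover have "(\<Sum>v\<in>?J. g v) = 0"
   unfolding g_def sum_subtractf using lin_ext_supset[OF J(1) subset_insertI, of EV] h(2) J(1) by (simp add: sum.delta)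
  ultimately have "g l = 0" using eig_indep[OF J] by blast
  thus ?thesis by (auto simp: g_def)
 qed
 obtain c c' where c: "f = scale c (EV l)" "g = scale c' (EV l)" using mult[OF f] mult[OF g] by blast
 have "lookup (EV l) l ~= 0" using good_EV[OF l] chi_wf_nz[of l] by (simp add: good_def)
 thus ?thesis using e by (simp add: c lookup_scale)
qed

lemma good_E: assumes l: "l \<in> P" and g: "good l f" shows "E_tilde D l = f"
proof -
 let ?c = "chi D (w_fin D l)"
 have f: "eig (yy l) f" "lookup f l = inverse ?c" using g by (auto simp: good_def)
 have e: "eig (yy l) h \<longleftrightarrow> h \<in> wt & (\<forall>mu\<in>RL. Y mu h = scale (yy l mu) h)" for h by (simp add: eig_def)
 have "macdonald_E D l = (THE h. eig (yy l) h & lookup h l = 1)"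
  unfolding macdonald_E_def e by (rule arg_cong[of _ _ The]) auto
 also have "... = scale ?c f"
 proof (rule the_equality)
  show "eig (yy l) (scale ?c f) & lookup (scale ?c f) l = 1"
   using eig_scale[OF f(1)] f(2) chi_wf_nz[of l] by (simp add: lookup_scale)
  thus "h = scale ?c f" if "eig (yy l) h & lookup h l = 1" for h
   using eig_unique[OF l] that by metis
 qed
 finally show ?thesis unfolding E_tilde_def using chi_wf_nz[of l] by simp
qed

abbreviation "E \<equiv> E_tilde D"

lemma E_good: "l \<in> P ==> good l (E l)"
 using good_E good_EV by metis

lemma E_step: "l \<in> P ==> i \<in> aix ==> A i l > 0 ==> E (s i l) = stepop i l (E l)"
 by (rule good_E[OF weights_s good_step[OF E_good]])

lemma E_alc: "alc v ==> E v = scale (inverse (chi D (w_fin D v))) (ee v)"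
 by (rule good_E[OF alc_dom(3) good_alc])

lemma E_wt: "l \<in> P ==> E l \<in> wt" and E_eig: "l \<in> P ==> eig (yy l) (E l)" and E_nz: "l \<in> P ==> E l ~= 0"
 using E_good[of l] eig_wt chi_wf_nz[of l] by (auto simp: good_def)

lemma E_inj: "inj_on E P"
proof (rule inj_onI, rule ccontr)
 fix l l' assume l: "l \<in> P" "l' \<in> P" "E l = E l'" "l ~= l'"
 then obtain u where u: "u \<in> RL" "yy l u ~= yy l' u" using yy_separate by blast
 have "scale (yy l u) (E l) = scale (yy l' u) (E l)" using eig_Y[OF E_eig u(1)] l by metis
 thus False using u(2) E_nz l(1) by simp
qed

lemma E_indep: "galg.independent (E ` P)"
proof
 assume "galg.dependent (E ` P)"
 then obtain t c where t: "finite t" "t \<subseteq> E ` P" "(\<Sum>f\<in>t. scale (c f) f) = 0" "\<exists>f\<in>t. c f ~= 0"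
  unfolding galg.dependent_explicit by blast
 obtain J where J: "finite J" "J \<subseteq> P" "t = E ` J" using finite_subset_image[OF t(1,2)] by blast
 have "(\<Sum>v\<in>J. scale (c (E v)) (E v)) = 0"
  using t(3) sum.reindex[OF inj_on_subset[OF E_inj J(2)], of "%f. scale (c f) f"] J(3) by (simp add: comp_def)
 hence "scale (c (E v)) (E v) = 0" if "v \<in> J" for v
  using eig_indep[OF J(1,2) _ _ that, of "%v. scale (c (E v)) (E v)"] eig_scale E_eig J(2) by blast
 hence "c (E v) = 0" if "v \<in> J" for v using that E_nz J(2) by (auto simp: subset_iff)
 thus False using t(4) J(3) by auto
qed

lemma E_span: "galg.span (E ` P) = wt"
proof
 have "galg.subspace wt" unfolding galg.subspace_def wt_Lg by (auto simp: Lg_0 Lg_add Lg_scale)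
 thus "galg.span (E ` P) \<subseteq> wt" using E_wt by (intro galg.span_minimal) auto
 show "wt \<subseteq> galg.span (E ` P)"
 proof
  fix f assume "f \<in> wt"
  then obtain h where h: "h \<in> Lg P" "f = lin_ext EV h" using EV_surj by blast
  have "EV v \<in> galg.span (E ` P)" if "v \<in> keys h" for v
   using h(1) that good_E[OF _ good_EV] galg.span_base[of "EV v" "E ` P"] unfolding Lg_def by (metis (no_types, lifting) image_eqI mem_Collect_eq subsetD)
  thus "f \<in> galg.span (E ` P)" unfolding h(2) lin_ext_def by (intro galg.span_sum galg.span_scale)
 qed
qed

end

section \<open>The bar involution of the field of parameters\<close>

definition hm :: "('a::comm_ring_1 => 'b::comm_ring_1) => bool" where
 "hm h \<longleftrightarrow> h 1 = 1 & (\<forall>x y. h (x + y) = h x + h y) & (\<forall>x y. h (x * y) = h x * h y)"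

lemma hm_1: "hm h ==> h 1 = 1" and hm_add: "hm h ==> h (x + y) = h x + h y" and hm_mult: "hm h ==> h (x * y) = h x * h y"
 by (auto simp: hm_def)

lemma hm_0: "hm h ==> h 0 = 0"
 using hm_add[of h 0 0] by simp

lemma hm_minus: "hm h ==> h (- x) = - h x"
 using hm_add[of h x "- x"] hm_0[of h] by (simp add: eq_neg_iff_add_eq_0 add.commute)

lemma hm_diff: "hm h ==> h (x - y) = h x - h y"
 using hm_add[of h x "- y"] hm_minus[of h y] by simp

lemma hm_power: "hm h ==> h (x ^ n) = h x ^ n"
 by (induction n) (auto simp: hm_1 hm_mult)

lemma hm_inverse: fixes h :: "'a::field => 'b::field" assumes "hm h" shows "h (inverse x) = inverse (h x)"
proof (cases "x = 0")
 case False
 hence "h x * h (inverse x) = 1" using assms by (simp add: hm_1 flip: hm_mult)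
 thus ?thesis by (metis inverse_unique)
qed (simp add: hm_0[OF assms])

lemma hm_nz: fixes h :: "'a::field => 'b::field" assumes "hm h" "x ~= 0" shows "h x ~= 0"
proof -
 have "h x * h (inverse x) = 1" using assms by (simp add: hm_1 flip: hm_mult)
 thus ?thesis by auto
qed

lemma hm_comp: "hm h ==> hm k ==> hm (%x. h (k x))"
 by (simp add: hm_def)

lemma hm_of_int: assumes "hm h" shows "h (of_int k) = of_int k"
proof -
 have n: "h (of_nat n) = of_nat n" for n by (induction n) (auto simp: assms hm_0 hm_1 hm_add)
 show ?thesis using n hm_minus[OF assms] by (cases k rule: int_cases2) auto
qed

lemma hm_of_tfield: "hm of_tfield"
 by (simp add: hm_def of_tfield_1 of_tfield_add of_tfield_mult)

lemma hm_Fract: "hm (%a. Fract a (1 :: 'a::idom))"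
 by (simp add: hm_def One_fract_def)

lemma Fract_0_iff: "Fract a 1 = 0 \<longleftrightarrow> a = 0"
 by (simp add: Zero_fract_def eq_fract)

lemma Fract_div: "b ~= 0 ==> Fract a b = Fract a 1 * inverse (Fract b 1)"
 by simp

text \<open>Extension to the fraction field by a chosen representative; independence of the choice
  rests on injectivity, which \<open>ev_nz\<close> and \<open>pev_nz\<close> provide.\<close>

definition fext :: "('a::idom => 'b::field) => 'a fract => 'b" where
 "fext h x = (let r = (SOME r. snd r ~= 0 & x = Fract (fst r) (snd r)) in h (fst r) * inverse (h (snd r)))"

lemma fext_Fract: assumes h: "hm h" "!!a. a ~= 0 ==> h a ~= 0" and b: "b ~= 0"
 shows "fext h (Fract a b) = h a * inverse (h b)"
proof -
 define r where "r = (SOME r. snd r ~= 0 & Fract a b = Fract (fst r) (snd r))"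
 have r: "snd r ~= 0 & Fract a b = Fract (fst r) (snd r)"
  unfolding r_def by (rule someI[of _ "(a, b)"]) (use b in simp)
 hence "a * snd r = fst r * b" using r b eq_fract(1)[of b "snd r" a "fst r"] by blast
 hence "h a * h (snd r) = h (fst r) * h b" by (simp flip: hm_mult[OF h(1)])
 thus ?thesis unfolding fext_def Let_def r_def[symmetric] using h(2) r b by (simp add: field_simps)
qed

lemma hm_fext: fixes h :: "'a::idom => 'b::field" assumes h: "hm h" "!!a. a ~= 0 ==> h a ~= 0" shows "hm (fext h)"
 unfolding hm_def
proof (intro conjI allI)
 show "fext h 1 = 1" using fext_Fract[OF h, of 1 1] by (simp add: One_fract_def hm_1[OF h(1)])
 fix x y :: "'a fract"
 obtain a b c d where x: "x = Fract a b" "b ~= 0" "y = Fract c d" "d ~= 0" by (metis Fract_cases)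
 thus "fext h (x + y) = fext h x + fext h y" "fext h (x * y) = fext h x * fext h y"
  using h(2) by (simp_all add: fext_Fract[OF h] hm_add[OF h(1)] hm_mult[OF h(1)] field_simps)
qed

lemma pm_induct: fixes f :: "'a \<Rightarrow>\<^sub>0 'b::comm_monoid_add" assumes "!!a b. Q (single a b)" "!!f g. Q f ==> Q g ==> Q (f + g)" shows "Q f"
proof (induction f rule: update_induct)
 case const
 show ?case using assms(1)[of undefined 0] by simp
next
 case (update f a b)
 have "Poly_Mapping.update a b f = single a b + f"
  using update(1) by (intro poly_mapping_eqI) (auto simp: lookup_update lookup_add lookup_single in_keys_iff when_def)
 thus ?case using assms(2)[OF assms(1) update(3)] by simp
qed

type_synonym 'p mpoly = "('p \<Rightarrow>\<^sub>0 nat) \<Rightarrow>\<^sub>0 rat"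

definition mon :: "('p::linorder \<Rightarrow>\<^sub>0 nat) => 'p tfield" where "mon m = Fract (single m 1) 1"

definition emb :: "rat => 'p::linorder tfield" where "emb c = Fract (single 0 c) 1"

lemma hm_emb: "hm emb"
 by (auto simp: hm_def emb_def One_fract_def single_add mult_single)

lemma mon_add: "mon (m + m') = mon m * mon m'" and mon_0: "mon 0 = 1" and mon_nz: "mon m ~= 0"
 by (auto simp: mon_def mult_single One_fract_def Zero_fract_def eq_fract single_nz)

lemma Fract_single: "Fract (single m c) 1 = emb c * mon m"
 by (simp add: emb_def mon_def mult_single)

definition ev :: "'p::linorder mpoly => 'p tfield" where
 "ev f = (\<Sum>m\<in>keys f. emb (lookup f m) * inverse (mon m))"

lemma ev_supset: assumes "finite K" "keys f \<subseteq> K"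
 shows "ev f = (\<Sum>m\<in>K. emb (lookup f m) * inverse (mon m))"
 unfolding ev_def using assms by (intro sum.mono_neutral_left) (auto simp: in_keys_iff hm_0[OF hm_emb])

lemma ev_single: "ev (single m c) = emb c * inverse (mon m)"
 using ev_supset[of "{m}" "single m c"] by simp

lemma ev_add: "ev (f + g) = ev f + ev g"
proof -
 let ?K = "keys f \<union> keys g"
 show ?thesis using ev_supset[of ?K f] ev_supset[of ?K g] ev_supset[OF _ keys_add, of f g]
  by (simp add: lookup_add hm_add[OF hm_emb] distrib_right sum.distrib)
qed

lemma hm_ev: "hm (ev :: 'a::linorder mpoly => _)"
proof -
 have "ev (f * g) = ev f * ev g" for f g :: "'a mpoly"
 proof (induction f rule: pm_induct)
  case (1 m c)
  show ?case
   by (induction g rule: pm_induct) (auto simp: ev_single mult_single distrib_left ev_add hm_mult[OF hm_emb] mon_add)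
 qed (simp add: distrib_right ev_add)
 moreover have "ev (1 :: 'a mpoly) = 1" using ev_single[of 0 1] by (simp add: mon_0 hm_1[OF hm_emb])
 ultimately show ?thesis by (simp add: hm_def ev_add)
qed

text \<open>Inverting all monomials is undone by repeating it, up to a monomial factor: a monomial
  times \<open>ev f\<close> is a polynomial \<open>g\<close>, and the same monomial times
  \<open>ev g\<close> is \<open>f\<close>. Both halves are carried through the induction, and the
  second excludes g = 0.\<close>

lemma ev_nz: assumes "f ~= 0" shows "ev f ~= 0"
proof
 assume e: "ev f = 0"
 have "\<exists>m g. mon m * ev f = Fract g 1 & mon m * ev g = Fract f 1" for f :: "'a mpoly"
 proof (induction f rule: pm_induct)
  case (1 m c)
  show ?case by (intro exI[of _ m] exI[of _ "single 0 c"])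
    (use mon_nz[of m] in \<open>simp add: ev_single mon_0 Fract_single mult.commute\<close>)
 next
  case (2 f1 f2)
  then obtain m1 g1 m2 g2 where h: "mon m1 * ev f1 = Fract g1 1" "mon m1 * ev g1 = Fract f1 1"
   "mon m2 * ev f2 = Fract g2 1" "mon m2 * ev g2 = Fract f2 1" by blast
  let ?s = "%m. single m 1 :: 'a mpoly"
  have s: "Fract (?s m * g) 1 = mon m * Fract g 1" for m g by (simp add: mon_def)
  have es: "ev (?s m * g) = inverse (mon m) * ev g" for m g by (simp add: hm_mult[OF hm_ev] ev_single hm_1[OF hm_emb])
  have "mon (m1 + m2) * ev (f1 + f2) = Fract (?s m2 * g1 + ?s m1 * g2) 1"
   unfolding hm_add[OF hm_Fract] s h[symmetric] by (simp add: ev_add mon_add algebra_simps)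
  moreover have "mon (m1 + m2) * ev (?s m2 * g1 + ?s m1 * g2) = Fract (f1 + f2) 1"
   unfolding hm_add[OF hm_Fract] h[symmetric] unfolding ev_add es mon_add using mon_nz[of m1] mon_nz[of m2] by (simp add: field_simps)
  ultimately show ?case by blast
 qed
 then obtain m g where g: "mon m * ev f = Fract g 1" "mon m * ev g = Fract f 1" by blast
 hence "Fract g 1 = 0" using e by simp
 hence "g = 0" by (simp add: Fract_0_iff)
 hence "Fract f 1 = 0" using g(2) by (simp add: hm_0[OF hm_ev])
 thus False using assms by (simp add: Fract_0_iff)
qed

definition tbar :: "'p::linorder tfield => 'p tfield" where "tbar = fext ev"

lemma hm_tbar: "hm tbar"
 unfolding tbar_def by (rule hm_fext[OF hm_ev ev_nz])

lemma tbar_nz: "c ~= 0 ==> tbar c ~= 0"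
 by (rule hm_nz[OF hm_tbar])

lemma tbar_mon: "tbar (mon m) = inverse (mon m)"
 unfolding tbar_def mon_def by (subst fext_Fract[OF hm_ev ev_nz]) (auto simp: ev_single hm_1[OF hm_emb] hm_1[OF hm_ev] mon_def)

definition pev :: "'p::linorder tfield poly => 'p qtfield" where
 "pev p = poly (map_poly (%c. of_tfield (tbar c)) p) (inverse qroot)"

lemma pev_pCons: "pev (pCons a p) = of_tfield (tbar a) + inverse qroot * pev p"
 by (simp add: pev_def map_poly_pCons hm_0[OF hm_tbar] of_tfield_0)

lemma pev_0: "pev 0 = 0" by (simp add: pev_def)

lemma pev_add: "pev (p + q) = pev p + pev q"
 by (induction p q rule: poly_induct2) (simp_all add: pev_pCons pev_0 hm_add[OF hm_tbar] of_tfield_add algebra_simps)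

lemma hm_pev: "hm (pev :: 'a::linorder tfield poly => _)"
proof -
 have s: "pev (smult a q) = of_tfield (tbar a) * pev q" for a and q :: "'a tfield poly"
  by (induction q) (simp_all add: pev_pCons pev_0 hm_mult[OF hm_tbar] of_tfield_mult algebra_simps)
 have "pev (p * q) = pev p * pev q" for p q :: "'a tfield poly"
  by (induction p) (simp_all add: pev_pCons pev_0 pev_add s hm_0[OF hm_tbar] of_tfield_0 algebra_simps)
 thus ?thesis unfolding hm_def
  by (simp add: pev_add one_pCons pev_pCons pev_0 hm_1[OF hm_tbar] of_tfield_1)
qed

text \<open>A power of q times \<open>pev p\<close> is a reversal of the polynomial with conjugated
  coefficients, which does not vanish.\<close>

lemma pev_nz: assumes "p ~= 0" shows "pev p ~= 0"
proof -
 have "\<exists>N g. degree g <= N & qroot ^ N * pev p = Fract g 1 & (p ~= 0 --> g ~= 0)" for p :: "'a tfield poly"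
 proof (induction p)
  case 0
  show ?case by (intro exI[of _ 0]) (simp add: pev_0 Zero_fract_def)
 next
  case (pCons a p)
  then obtain N g where g: "degree g <= N" "qroot ^ N * pev p = Fract g 1" "p ~= 0 --> g ~= 0" by blast
  let ?g = "monom (tbar a) (Suc N) + g"
  have c: "coeff ?g (Suc N) = tbar a" using g(1) by (simp add: coeff_eq_0)
  have "?g ~= 0"
  proof (cases "a = 0")
   case True thus ?thesis using pCons.hyps g(3) by (simp add: hm_0[OF hm_tbar])
  next
   case False thus ?thesis using c tbar_nz by (metis coeff_0)
  qed
  moreover have "degree ?g <= Suc N" using g(1) by (intro degree_add_le) (auto intro: degree_monom_le order_trans)
  moreover have "qroot ^ Suc N * pev (pCons a p) = Fract ?g 1"
   unfolding hm_add[OF hm_Fract] qroot_power[symmetric] g(2)[symmetric]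
   by (simp add: pev_pCons distrib_left qroot_nz)
  ultimately show ?case by blast
 qed
 then obtain N g where g: "qroot ^ N * pev p = Fract g 1" "g ~= 0" using assms by blast
 hence "Fract g 1 ~= 0" by (simp add: Fract_0_iff)
 thus ?thesis using g(1) by auto
qed

text \<open>The elements on which the two maps agree form a subfield that contains all generators of
  the field.\<close>

lemma bar_unique: fixes h h' :: "'p::linorder qtfield => 'p qtfield"
 assumes h: "hm h" "hm h'" and q: "h qroot = h' qroot" and s: "!!p. h (sqrt_param p) = h' (sqrt_param p)"
 shows "h = h'"
proof -
 define K where "K = {x. h x = h' x}"
 have K: "1 \<in> K" "!!x y. x \<in> K ==> y \<in> K ==> x + y \<in> K" "!!x y. x \<in> K ==> y \<in> K ==> x * y \<in> K" "!!x. x \<in> K ==> inverse x \<in> K"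
  using h by (auto simp: K_def hm_1 hm_add hm_mult hm_inverse)
 have Kp: "x \<in> K ==> x ^ n \<in> K" for x n by (induction n) (auto simp: K)
 have e: "of_tfield (emb c) \<in> K" for c
 proof -
  have hc: "hm (%c. of_tfield (emb c) :: 'p qtfield)" by (rule hm_comp[OF hm_of_tfield hm_emb])
  have i: "of_tfield (emb (of_int k)) \<in> K" for k using hm_of_int[OF hc] hm_of_int[OF h(1)] hm_of_int[OF h(2)] by (simp add: K_def)
  obtain a b where c: "c = of_int a * inverse (of_int b)" using quotient_of_div[of c] by (metis surj_pair divide_inverse)
  show ?thesis unfolding c hm_mult[OF hc] hm_inverse[OF hc] using K i by blast
 qed
 have m: "of_tfield (mon m) \<in> K" for m
 proof (induction m rule: pm_induct)
  case (1 p n)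
  have sp: "sqrt_param p = of_tfield (mon (single p 1))" by (simp only: sqrt_param_def mon_def)
  have "of_tfield (mon (single p n)) = sqrt_param p ^ n"
  proof (induction n)
   case (Suc n)
   have e: "single p (Suc n) = single p 1 + single p n" by (simp flip: single_add)
   show ?case unfolding e mon_add of_tfield_mult Suc sp[symmetric] by simp
  qed (simp add: mon_0 of_tfield_1)
  thus ?case using Kp s by (simp add: K_def)
 qed (simp add: mon_add of_tfield_mult K)
 have f: "of_tfield (Fract f 1) \<in> K" for f
 proof (induction f rule: pm_induct)
  case (1 a b)
  show ?case unfolding Fract_single of_tfield_mult by (rule K(3)[OF e m])
 next
  case (2 f g)
  thus ?case unfolding hm_add[OF hm_Fract] of_tfield_add by (rule K(2))
 qed
 have t: "of_tfield x \<in> K" for x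
 proof (cases x)
  case (Fract a b)
  show ?thesis unfolding Fract(1) Fract_div[OF Fract(2)] of_tfield_mult of_tfield_inverse by (intro K(3) K(4) f)
 qed
 have p: "Fract p 1 \<in> K" for p
 proof (induction p)
  case 0
  show ?case by (simp add: K_def hm_0[OF h(1)] hm_0[OF h(2)] flip: Zero_fract_def)
 next
  case (pCons a p)
  have "Fract (pCons a p) 1 = of_tfield a + qroot * Fract p 1" by (simp add: of_tfield_def qroot_def)
  thus ?case using pCons K t q by (simp add: K_def hm_add h hm_mult)
 qed
 have "x \<in> K" for x
 proof (cases x)
  case (Fract a b)
  show ?thesis unfolding Fract(1) Fract_div[OF Fract(2)] by (intro K(3) K(4) p)
 qed
 thus ?thesis by (auto simp: K_def)
qed

lemma bar: fixes p :: "'a::linorder"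
 shows "hm (bar :: 'a qtfield => _)" "bar (qroot :: 'a qtfield) = inverse qroot" "bar (sqrt_param p) = inverse (sqrt_param p)"
proof -
 let ?Q = "%h::'a qtfield => 'a qtfield. h 1 = 1 & (\<forall>x y. h (x + y) = h x + h y) & (\<forall>x y. h (x * y) = h x * h y) &
         h qroot = inverse qroot & (\<forall>p. h (sqrt_param p) = inverse (sqrt_param p))"
 have Q: "?Q h \<longleftrightarrow> hm h & h qroot = inverse qroot & (\<forall>p. h (sqrt_param p) = inverse (sqrt_param p))" for h
  by (auto simp: hm_def)
 let ?h = "fext pev :: 'a qtfield => 'a qtfield"
 have F: "?h (Fract a 1) = pev a" for a by (subst fext_Fract[OF hm_pev pev_nz]) (auto simp: hm_1[OF hm_pev])
 have Qh: "?Q ?h"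
  unfolding Q
 proof (intro conjI allI)
  show "hm ?h" by (rule hm_fext[OF hm_pev pev_nz])
  show "?h qroot = inverse qroot"
   unfolding qroot_def F by (simp add: pev_pCons pev_0 hm_0[OF hm_tbar] hm_1[OF hm_tbar] of_tfield_0 of_tfield_1 qroot_def[symmetric])
  show "?h (sqrt_param p) = inverse (sqrt_param p)" for p
   unfolding sqrt_param_def mon_def[symmetric] unfolding of_tfield_def F
   by (simp add: pev_pCons pev_0 tbar_mon flip: of_tfield_def) (simp add: of_tfield_inverse)
 qed
 have u: "k = ?h" if "?Q k" for k
  by (rule bar_unique) (use that Qh in \<open>auto simp: Q\<close>)
 have "?Q bar" unfolding bar_def by (rule theI[of ?Q ?h, OF Qh]) (rule u)
 hence "hm (bar :: 'a qtfield => _) & bar (qroot :: 'a qtfield) = inverse qroot & (\<forall>p::'a. bar (sqrt_param p) = inverse (sqrt_param p))"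
  unfolding Q .
 thus "hm (bar :: 'a qtfield => _)" "bar (qroot :: 'a qtfield) = inverse qroot" "bar (sqrt_param p) = inverse (sqrt_param p)"
  by auto
qed

context mac
begin

section \<open>The Kazhdan--Lusztig involution\<close>

abbreviation "lg \<equiv> longest D"

text \<open>The element whose chamber is opposite to that of \<open>pp\<close> inverts every
  positive root, so any \<open>v\<close> extends to it with additive lengths; therefore it is the
  unique longest element.\<close>

lemma lg: "lg \<in> W"
 and lg_neg: "b \<in> Phi ix ==> b pp > 0 ==> b (lg pp) < 0"
proof -
 obtain w where w: "isW ix w (- pp)" using isW_ex by blast
 have wW: "w \<in> W" using w unfolding isW_def[OF ix_sub] by blast
 have neg: "b (w pp) < 0" if b: "b \<in> Phi ix" "b pp > 0" for b
 proof -
  obtain a where "b = aff a 0" using b(1) zero_ix unfolding Phi_def by auto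
  hence "b (- pp) < 0" using b(2) by (simp add: aff_def)
  thus ?thesis using w b unfolding isW_def[OF ix_sub] by blast
 qed
 have le: "wlen D ix v <= wlen D ix w & (wlen D ix v = wlen D ix w --> v = w)" if v: "v \<in> W" for v
 proof -
  have u: "w o inv v \<in> W" using weyl_comp wW W_inv_in v by blast
  obtain us vs where us: "red ix us" "wd us = w o inv v" "red ix vs" "wd vs = v" using red_ex[OF u] red_ex[OF v] by blast
  have uv: "(w o inv v) o v = w" using v by (auto simp: fun_eq_iff)
  have "red ix (us @ vs)"
  proof (rule red_append_additive[OF ix_sub us(1,3)])
   fix b assume "b \<in> Phi ix" "b pp > 0"
   thus "b (wd us (wd vs pp)) < 0" using neg v unfolding us by simp
  qed
  hence "wlen D ix w = wlen D ix (w o inv v) + wlen D ix v"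
   using us uv unfolding red_def word_prod_append by simp
  moreover have "v = w" if "wlen D ix (w o inv v) = 0" using wlen_0[OF ix_sub u that] uv by simp
  ultimately show ?thesis by auto
 qed
 have "lg = w" unfolding longest_def
 proof (rule the_equality)
  show "w \<in> W & (\<forall>v\<in>W. wlen D (fin_ix D) v <= wlen D (fin_ix D) w)" using wW le by blast
  show "v = w" if "v \<in> W & (\<forall>u\<in>W. wlen D (fin_ix D) u <= wlen D (fin_ix D) v)" for v
   using that le[of v] wW by (metis order_antisym)
 qed
 thus "lg \<in> W" "b \<in> Phi ix ==> b pp > 0 ==> b (lg pp) < 0" using wW neg by auto
qed

lemma lg_red: assumes "v \<in> W" obtains us vs where "red ix us" "wd us = lg o inv v" "red ix vs" "wd vs = v" "red ix (us @ vs)" "wd (us @ vs) = lg"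
proof -
 have u: "lg o inv v \<in> W" using weyl_comp lg W_inv_in assms by blast
 obtain us vs where us: "red ix us" "wd us = lg o inv v" "red ix vs" "wd vs = v" using red_ex[OF u] red_ex[OF assms] by blast
 have "red ix (us @ vs)"
 proof (rule red_append_additive[OF ix_sub us(1,3)])
  fix b assume "b \<in> Phi ix" "b pp > 0"
  thus "b (wd us (wd vs pp)) < 0" using lg_neg assms unfolding us by simp
 qed
 moreover have "wd (us @ vs) = lg" unfolding word_prod_append us using assms by (auto simp: fun_eq_iff)
 ultimately show ?thesis using that us by blast
qed

lemma chi_lg: assumes "v \<in> W" shows "chi D lg = chi D (lg o inv v) * chi D v"
proof -
 obtain us vs where "red ix us" "wd us = lg o inv v" "red ix vs" "wd vs = v" "red ix (us @ vs)" "wd (us @ vs) = lg"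
  using lg_red[OF assms] .
 thus ?thesis using chi_word[of us] chi_word[of vs] chi_word[of "us @ vs"] by simp
qed

lemma T_lg: assumes "v \<in> W" "f \<in> wt" shows "T lg f = T (lg o inv v) (T v f)"
proof -
 obtain us vs where r: "red ix us" "wd us = lg o inv v" "red ix vs" "wd vs = v" "red ix (us @ vs)" "wd (us @ vs) = lg"
  using lg_red[OF assms(1)] .
 have "T (wd (us @ vs)) f = T (wd us) (T (wd vs) f)"
  using T_red[OF red_ix_aix[OF r(5)] assms(2)] T_red[OF red_ix_aix[OF r(3)] assms(2)]
   T_red[OF red_ix_aix[OF r(1)] T_wt[OF W_aff[OF assms(1)] assms(2)]] r(4)
  by (simp add: word_prod_append)
 thus ?thesis using r by simp
qed

lemma inv_lg: "inv lg = lg" and lg_lg: "lg (lg x) = x"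
proof -
 obtain us vs where r: "red ix us" "wd us = lg o inv (inv lg)" "red ix vs" "wd vs = inv lg" "red ix (us @ vs)" "wd (us @ vs) = lg"
  using lg_red[OF W_inv_in[OF lg]] .
 have "length us = 0" using r(3-6) wlen_inv[OF ix_sub lg] unfolding red_def by simp
 hence "lg o lg = id" using r(2) inv_inv_eq[OF W_bij[OF lg]] unfolding word_prod_Nil by (metis length_0_conv word_prod_Nil)
 thus "inv lg = lg" "lg (lg x) = x" by (auto intro: inv_unique_comp dest: fun_cong[of _ _ x])
qed

text \<open>A length count shows that \<open>lg o s i o lg\<close> is a generator
  \<open>s j\<close>; comparing reflections, \<open>lg (al i)\<close> is proportional to
  \<open>al j\<close>, and indivisibility and sign leave one possibility.\<close>

lemma lg_al: assumes i: "i \<in> ix" obtains j where "j \<in> ix" "lg (al i) = - al j" "s i o lg = lg o s j"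
proof -
 let ?v = "lg o s i"
 have v: "?v \<in> W" "s i o lg \<in> W" using weyl_comp lg s_W i by blast+
 have iv: "inv ?v = s i o lg"
  using inv_comp[OF W_aff[OF lg] W_aff[OF s_W[OF i]]] inv_lg inv_s i ix_aix by auto
 obtain us vs where r: "red ix us" "wd us = lg o inv ?v" "red ix vs" "wd vs = ?v" "red ix (us @ vs)" "wd (us @ vs) = lg"
  using lg_red[OF v(1)] .
 have An: "A i (lg pp) < 0" using lg_neg[OF Phi_A[OF ix_sub i]] A_pp i ix_aix by blast
 have "wlen D ix (s i o lg) + 1 = wlen D ix lg" by (rule desc_neg[OF ix_sub lg i An])
 moreover have "wlen D ix ?v = wlen D ix (s i o lg)" using wlen_inv[OF ix_sub v(1)] iv by simp
 ultimately have "length us = 1" using r(3-6) unfolding red_def by simp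
 then obtain j where uj: "us = [j]" by (metis One_nat_def length_0_conv length_Suc_conv)
 have j: "j \<in> ix" "s j = lg o (s i o lg)" using red_lists[OF r(1)] r(2) iv unfolding uj by auto
 have e: "s i o lg = lg o s j" unfolding j(2) by (simp add: fun_eq_iff lg_lg)
 let ?b = "lg (al i)"
 have bI: "?b \<in> RI" "?b \<in> R" using RI_W[OF lg al_RI[OF i]] RI_R by auto
 have "reflection ?b x = s j x" for x
  using fun_cong[OF W_refl[OF lg, of "al i"], of "lg x"] j(2) weyl_gen_fin[OF i] by (simp add: lg_lg)
 hence "reflection ?b (al j) = - al j" using s_al[OF j(1)] by simp
 hence "al j - (al j \<cdot> ?b) *\<^sub>R ?b = - al j" unfolding reflection_def .
 hence "(al j \<cdot> ?b) *\<^sub>R ?b = al j + al j" by (simp add: algebra_simps eq_neg_iff_add_eq_0)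
 hence 2: "(al j \<cdot> ?b) *\<^sub>R ?b = 2 *\<^sub>R al j" by (simp add: scaleR_2)
 have c: "al j \<cdot> ?b ~= 0" using 2 root_nonzero[OF al_R[OF j(1)]] by auto
 have "(2 / (al j \<cdot> ?b)) *\<^sub>R al j = (1 / (al j \<cdot> ?b)) *\<^sub>R (2 *\<^sub>R al j)" by simp
 also have "... = ?b" unfolding 2[symmetric] using c by simp
 finally have "- ?b = (- (2 / (al j \<cdot> ?b))) *\<^sub>R al j" by simp
 moreover have "posr (- ?b)"
 proof -
  have "A i (lg pp) = pp \<cdot> ?b" using A_fin[OF i] W_inner_inv[OF lg] W_coroot[OF lg] inv_lg by simp
  thus ?thesis using An pp_coroot[OF minus_R[OF bI(2)]] by simp
 qed
 ultimately have n: "- ?b = al j" using RI_multiple[OF RI_minus[OF bI(1)] _ j(1)] by blast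
 have "?b = - al j" unfolding n[symmetric] by simp
 thus ?thesis using that j(1) e by blast
qed

lemma lg_bt: "lg bt = - bt"
proof -
 have "lg bt \<in> Sh" using Sh_W lg bt_Sh by blast
 moreover have "dominant (- lg bt)"
  unfolding dominant_def
 proof
  fix i assume i: "i \<in> ix"
  obtain j where j: "j \<in> ix" "lg (al i) = - al j" using lg_al[OF i] by blast
  have "- lg bt \<bullet> al i = bt \<bullet> al j" using W_inner_inv[OF lg, of bt "al i"] inv_lg j by simp
  thus "- lg bt \<bullet> al i >= 0" using bt_dom j by (simp add: dominant_def)
 qed
 ultimately have "- lg bt = bt" using dominant_short_unique[OF Sh_minus _ bt_Sh bt_dom] by blast
 thus ?thesis by (metis minus_minus)
qed

subsection \<open>The bar involution on the parameters\<close>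

lemma bar_powi: "bar (x powi k) = bar x powi k" for x :: "'p qtfield"
 by (simp add: power_int_def hm_power[OF bar(1)] hm_inverse[OF bar(1)])

lemma bar_t: "bar (t_half D i) = inverse (t_half D i)" "bar (t03_half D) = inverse (t03_half D)" "bar (hh i) = inverse (hh i)"
 "bar (tau i) = inverse (tau i)"
 by (auto simp: t_half_def t0_half_def t03_half_def hh_def tau_def tn_star_half_def bar(3) hm_1[OF bar(1)] hm_mult[OF bar(1)] hm_power[OF bar(1)] power_inverse)

lemma bar_d: "bar (dd i) = - dd i" "bar (uu i) = - uu i" "bar (dX i) = - dX i"
 by (auto simp: dX_def d3_def dd_def uu_def hm_diff[OF bar(1)] hm_inverse[OF bar(1)] bar_t hm_0[OF bar(1)])

lemma bar_tm: "bar (tm u) = inverse (tm u)"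
proof -
 have "bar (\<Prod>i\<in>J. g i) = (\<Prod>i\<in>J. bar (g i))" for J and g :: "nat => 'p qtfield"
  by (induction J rule: infinite_finite_induct) (auto simp: hm_1[OF bar(1)] hm_mult[OF bar(1)])
 thus ?thesis by (simp add: tm_def bar_powi bar_t power_int_inverse prod_inversef[symmetric] comp_def)
qed

subsection \<open>The semilinear part\<close>

text \<open>The part of \<open>kappa\<close> before the operator of the longest element is applied;
  it is a semilinear ring homomorphism.\<close>

definition BB :: "('v, 'p) galg => ('v, 'p) galg" where
 "BB f = (\<Sum>l\<in>keys f. scale (bar (lookup f l)) (ee (lg l)))"

lemma BB_supset: assumes "finite K" "keys f \<subseteq> K"
 shows "BB f = (\<Sum>l\<in>K. scale (bar (lookup f l)) (ee (lg l)))"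
 unfolding BB_def using assms by (intro sum.mono_neutral_left) (auto simp: in_keys_iff hm_0[OF bar(1)])

lemma BB_ee: "BB (scale c (ee l)) = scale (bar c) (ee (lg l))"
 using BB_supset[of "{l}" "scale c (ee l)"] by (simp add: lookup_scale ee_def scale_ee[unfolded ee_def])

lemma BB_add: "BB (f + g) = BB f + BB g"
proof -
 let ?K = "keys f \<union> keys g"
 show ?thesis using BB_supset[of ?K f] BB_supset[of ?K g] BB_supset[OF _ keys_add, of f g]
  by (simp add: lookup_add hm_add[OF bar(1)] galg.scale_left_distrib sum.distrib)
qed

lemma BB_0: "BB 0 = 0" by (simp add: BB_def)

lemma BB_scale: "BB (scale c f) = scale (bar c) (BB f)"
proof -
 have "keys (scale c f) \<subseteq> keys f" by (rule keys_scale)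
 thus ?thesis using BB_supset[of "keys f" "scale c f"]
  by (simp add: BB_def lookup_scale hm_mult[OF bar(1)] galg.scale_sum_right)
qed

lemma BB_diff: "BB (f - g) = BB f - BB g"
 using BB_add[of f "scale (-1) g"] BB_scale[of "-1" g] by (simp add: hm_minus[OF bar(1)] hm_1[OF bar(1)])

lemma galg_induct: fixes f :: "('v, 'p) galg"
 assumes "Q 0" "!!f g. Q f ==> Q g ==> Q (f + g)" "!!c l. Q (scale c (ee l))" shows "Q f"
proof -
 have "f \<in> Lg UNIV" by (simp add: Lg_def)
 thus ?thesis by (induction rule: Lg_induct) (use assms in auto)
qed

lemma BB_mult: "BB (f * g) = BB f * BB g"
proof (induction f rule: galg_induct)
 case (3 c l)
 show ?case
 proof (induction g rule: galg_induct)
  case (3 c' l')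
  have "lg (l + l') = lg l + lg l'" using linear_add[OF W_linear[OF lg]] .
  thus ?case
   by (simp add: scale_mult_left scale_mult_right BB_scale hm_mult[OF bar(1)] BB_ee[of 1, simplified] hm_1[OF bar(1)] flip: ee_add)
 qed (simp_all add: BB_0 BB_add distrib_left)
qed (simp_all add: BB_0 BB_add distrib_right)

lemma BB_ee': "BB (ee l) = ee (lg l)"
 using BB_ee[of 1] by (simp add: hm_1[OF bar(1)])

lemma BB_1: "BB 1 = 1"
 using BB_ee'[of 0] linear_0[OF W_linear[OF lg]] by (simp add: ee_0)

lemma BB_wt: "f \<in> wt ==> BB f \<in> wt"
 unfolding wt_Lg BB_def using weights_weyl[OF W_aff[OF lg]] by (intro Lg_sum Lg_scale Lg_ee) (auto simp: Lg_def)

text \<open>The longest element turns \<open>gg i\<close> into minus \<open>gg j\<close>, which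
  multiplies the denominator by minus e^(gg j). Together with the inversion of the parameters this
  produces the inverse generator.\<close>

lemma BB_TT: assumes i: "i \<in> ix" and j: "j \<in> ix" and ij: "lg (al i) = - al j" and f: "f \<in> wt"
 shows "BB (TT i f) = TTi j (BB f)"
proof -
 have i': "i \<in> aix" "j \<in> aix" and nz: "i ~= 0" "j ~= 0" using i j ix_aix ix_nz by auto
 have "al j = - lg (al i)" using ij by simp
 hence "al j \<bullet> al j = al i \<bullet> al i" using W_inner[OF lg] by simp
 hence t: "t_half D j = t_half D i" by (simp add: t_half_def)
 have lj: "lg (al j) = - al i" using ij lg_lg[of "al i"] W_minus[OF lg, of "al j"] by (metis minus_minus)
 have "lg (2 *\<^sub>R al i) = - (2 *\<^sub>R al j)" "lg (2 *\<^sub>R al j) = - (2 *\<^sub>R al i)"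
  by (simp_all add: linear_cmul[OF W_linear[OF lg]] ij lj)
 hence R: "2 *\<^sub>R al j \<in> R \<longleftrightarrow> 2 *\<^sub>R al i \<in> R"
  using W_R[OF lg, of "2 *\<^sub>R al i"] W_R[OF lg, of "2 *\<^sub>R al j"] by auto
 let ?g = "gg j"
 have g: "lg (gg i) = - ?g" using ij R nz linear_cmul[OF W_linear[OF lg]] by (simp add: gg_def)
 have h: "hh j = hh i" "uu j = uu i" "dd j = dd i" "QQ i = 1" "QQ j = 1" using t R nz by (simp_all add: hh_def uu_def dd_def QQ_def)
 note di = dl_P[OF i'(1), unfolded h] and dj = dl_P[OF i'(2), unfolded h]
 let ?F = "BB f"
 have F: "?F \<in> wt" using BB_wt f .
 note f' = f[unfolded wt_Lg] and F' = F[unfolded wt_Lg]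
 have so: "BB (sop (gg i) 1 f) = sop ?g 1 (BB f)" for f :: "('v, 'p) galg"
 proof (induction f rule: galg_induct)
  case (3 c l)
  have "lg (reflection (gg i) l) = reflection ?g (lg l)"
   using fun_cong[OF W_refl[OF lg, of "gg i"], of l] g by (simp add: reflection_minus)
  thus ?case
   by (simp add: linop_scale[OF dl.linop_so[OF di]] linop_scale[OF dl.linop_so[OF dj]] BB_scale BB_ee' sop_def lin_ext_ee linop_scale[OF linop_lin_ext])
 qed (simp_all add: linop_0[OF dl.linop_so[OF di]] linop_0[OF dl.linop_so[OF dj]] linop_add[OF dl.linop_so[OF di]]
   linop_add[OF dl.linop_so[OF dj]] BB_0 BB_add)
 let ?X = "ee (- ?g) :: ('v, 'p) galg" and ?H = "ee (- ((1/2) *\<^sub>R ?g)) :: ('v, 'p) galg"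
 let ?so = "sop ?g 1 ?F" and ?Do = "Dop ?g 1 ?F" and ?Di = "BB (Dop (gg i) 1 f)"
 have XX: "ee ?g * ?X = 1" by (simp add: ee_0 flip: ee_add)
 have D1: "BB (dnm (gg i) 1) = - ee ?g * dnm ?g 1"
  using XX by (simp add: dnm_def BB_diff BB_1 BB_ee' W_minus[OF lg] g right_diff_distrib)
 have Dof: "?F - ?so = ?Do * (1 - ?X)" using dl.Do_dnm[OF dj F'] by (simp add: dnm_def)
 have "?Do * dnm ?g 1 = ?F - ?so" by (rule dl.Do_dnm[OF dj F'])
 also have "... = BB (f - sop (gg i) 1 f)" unfolding BB_diff so ..
 also have "... = BB (Dop (gg i) 1 f * dnm (gg i) 1)" using dl.Do_dnm[OF di f'] by simp
 also have "... = (- (?Di * ee ?g)) * dnm ?g 1" unfolding BB_mult D1 by (simp add: mult.assoc)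
 finally have "?Do = - (?Di * ee ?g)" using cancel_dnm dj[unfolded dl_def] by blast
 hence "?Do * ?X = - (?Di * (ee ?g * ?X))" by (simp add: mult.assoc)
 hence Di: "?Di = - (?X * ?Do)" unfolding XX by (simp add: mult.commute)
 have HX: "ee ((1/2) *\<^sub>R ?g) * ?X = ?H" unfolding ee_add[symmetric] by (rule arg_cong[of _ _ ee]) (simp add: algebra_simps flip: scaleR_add_left)
 have cc: "BB (dl.cc (gg i) (hh i) (uu i)) = scale (- dd i) 1 + scale (- uu i) (ee ((1/2) *\<^sub>R ?g))"
  unfolding dl.cc_def[OF di] BB_add BB_scale BB_1 BB_ee' W_minus[OF lg] linear_cmul[OF W_linear[OF lg]] g dd_def[symmetric] bar_d by simp
 have "BB (TT i f) = scale (inverse (hh i)) ?so + BB (dl.cc (gg i) (hh i) (uu i)) * ?Di"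
  unfolding TT_DL_wt[OF i'(1) f, unfolded h] dl.T_eq[OF di] BB_add BB_mult BB_scale so bar_t ..
 also have "... = scale (inverse (hh i)) ?so + scale (dd i) (?X * ?Do) + scale (uu i) (?H * ?Do)"
  unfolding cc Di distrib_right scale_mult_left HX[symmetric] by (simp add: mult.assoc)
 \<comment> \<open>The term with e^(-gg j) and coefficient \<open>dd i\<close> is eliminated by the
   defining equation of \<open>Dop\<close>; what is left is \<open>TT j\<close> minus
   \<open>dd i\<close> times the argument.\<close>
 also have "... = scale (hh i) ?so + scale (dd i) ?Do + scale (uu i) (?H * ?Do) - scale (dd i) ?F"
 proof -
  have "?F = ?so + (?Do - ?X * ?Do)" using Dof by (simp add: algebra_simps)
  hence "scale (dd i) ?F = scale (dd i) ?so + (scale (dd i) ?Do - scale (dd i) (?X * ?Do))"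
   by (metis galg.scale_right_distrib galg.scale_right_diff_distrib)
  thus ?thesis by (simp add: dd_def galg.scale_left_diff_distrib)
 qed
 also have "... = TTi j ?F"
  unfolding TTi_def TT_DL_wt[OF i'(2) F, unfolded h] dl.T_eq[OF dj] dl.cc_def[OF dj] h distrib_right scale_mult_left
  by (simp add: dd_def)
 finally show ?thesis .
qed

subsection \<open>Intertwining property\<close>

abbreviation "kp \<equiv> kappa D"

lemma kp_eq: assumes "f \<in> wt" shows "kp f = scale (inverse (chi D lg)) (T lg (BB f))"
proof -
 note L = linop_T[OF W_aff[OF lg]]
 have "T_fin D lg (ee (lg l)) = T lg (ee (lg l))" if "l \<in> keys f" for l
  by (rule T_fin_T[OF lg ee_wt]) (use weights_weyl[OF W_aff[OF lg]] assms that in \<open>auto simp: wt_alg_def\<close>)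
 hence "kp f = (\<Sum>l\<in>keys f. scale (inverse (chi D lg)) (T lg (scale (bar (lookup f l)) (ee (lg l)))))"
  unfolding kappa_def by (intro sum.cong) (simp_all add: linop_scale[OF L] mult.commute)
 thus ?thesis by (simp add: BB_def linop_sum[OF L] galg.scale_sum_right)
qed

lemma kp_wt: "f \<in> wt ==> kp f \<in> wt"
 using kp_eq scale_wt T_wt W_aff lg BB_wt by simp

lemma kp_add: "f \<in> wt ==> g \<in> wt ==> kp (f + g) = kp f + kp g"
 and kp_scale: "f \<in> wt ==> kp (scale c f) = scale (bar c) (kp f)"
 using linop_add[OF linop_T[OF W_aff[OF lg]]] linop_scale[OF linop_T[OF W_aff[OF lg]]]
 by (simp_all add: kp_eq add_wt scale_wt BB_add BB_scale galg.scale_right_distrib mult.commute)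

text \<open>\<open>BB_TT\<close> leads to an inverse generator at the opposite index
  \<open>j\<close>, and \<open>s i o lg = lg o s j\<close> carries it across \<open>T lg\<close>
  back to \<open>i\<close>.\<close>

lemma kp_TT: assumes i: "i \<in> ix" and f: "f \<in> wt" shows "kp (TT i f) = TTi i (kp f)"
proof -
 have i': "i \<in> aix" using i ix_aix by blast
 obtain j where j: "j \<in> ix" "lg (al i) = - al j" "s i o lg = lg o s j" using lg_al[OF i] .
 have j': "j \<in> aix" using j ix_aix by blast
 have F: "BB f \<in> wt" "TTi j (BB f) \<in> wt" using BB_wt f TTi_wt j' by auto
 have w: "s i o lg \<in> W" using weyl_comp s_W i lg by blast
 have "lg (al j) = - al i" using j(2) lg_lg[of "al i"] W_minus[OF lg] by (metis minus_minus)
 hence "posr (- lg (al j))" using posr_al i by simp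
 from W_down_right[OF lg j(1) this F(2)] have 1: "T lg (TTi j (BB f)) = T (s i o lg) (BB f)" using j(3) j' F by simp
 have "A i (lg pp) < 0" using lg_neg[OF Phi_A[OF ix_sub i]] A_pp i' by blast
 hence "A i ((s i o lg) pp) > 0" using A_s[OF i'] by simp
 moreover have "s i o (s i o lg) = lg" unfolding comp_assoc[symmetric] s_comp_s[OF i'] by simp
 ultimately have "T lg (BB f) = TT i (T (s i o lg) (BB f))" using T_up_left[OF i' W_aff[OF w] _ F(1)] by metis
 hence "TTi i (T lg (BB f)) = T (s i o lg) (BB f)" using i' T_wt[OF W_aff[OF w] F(1)] by simp
 thus ?thesis using 1 by (simp add: kp_eq TT_wt i' f BB_TT[OF i j(1,2) f] linop_scale[OF linop_TTi])
qed

lemma kp_T: assumes "w \<in> W" "f \<in> wt" shows "T (inv w) (kp (T w f)) = kp f"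
 using assms(1)
proof (induction w rule: W_left_induct)
 case id
 have i: "inv (id :: 'v => 'v) = id" by (rule inv_equality) auto
 show ?case unfolding i T_id[OF assms(2)] by (rule T_id[OF kp_wt[OF assms(2)]])
next
 case (up i w)
 have i': "i \<in> aix" using up ix_aix by blast
 have iv: "inv (s i o w) = inv w o s i" using inv_comp[OF W_aff W_aff] s_W up(1,2) inv_s[OF i'] by simp
 have g: "T w f \<in> wt" using T_wt W_aff up(2) assms(2) by blast
 have "T (inv (s i o w)) (kp (T (s i o w) f)) = T (inv w) (TT i (kp (TT i (T w f))))"
  unfolding iv using T_up_left[OF i' W_aff[OF up(2)] up(3) assms(2)] T_up_right[OF i' W_aff[OF W_inv_in[OF up(2)]] _ kp_wt[OF TT_wt[OF i' g]]]
   inv_inv_eq[OF W_bij[OF up(2)]] up(3) by simp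
 also have "... = kp f" using kp_TT[OF up(1) g] TT_TTi[OF i' kp_wt[OF g]] up(4) by simp
 finally show ?case .
qed

text \<open>Each letter of a reduced word of an element fixing \<open>bt\<close> fixes
  \<open>bt\<close> as well: \<open>w bt = s i bt\<close> has nonnegative inner product with
  \<open>al i\<close> by reducedness, and nonpositive one by dominance of \<open>bt\<close>.\<close>

lemma T_stab: assumes "w \<in> W" "w bt = bt" "f \<in> wt" shows "T w (ee (- bt) * f) = ee (- bt) * T w f"
 using assms(1,2)
proof (induction w rule: W_left_induct)
 case id
 show ?case unfolding T_id[OF assms(3)] by (rule T_id[OF X_wt[OF weights_minus[OF bt_P] assms(3)]])
next
 case (up i w)
 let ?c = "inv w (al i)"
 have mP: "- bt \<in> P" using weights_minus bt_P by blast
 have i': "i \<in> aix" using up ix_aix by blast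
 have cR: "?c \<in> R" using W_R W_inv_in up(2) al_R up(1) by blast
 have "posr ?c" using up(3) pp_coroot[OF cR] A_fin[OF up(1)] W_inner_inv[OF up(2)] W_coroot[OF W_inv_in[OF up(2)]] by simp
 hence "bt \<bullet> ?c >= 0" using posr_inner_dominant[OF cR] bt_dom by (simp add: dominant_def)
 hence "w bt \<bullet> al i >= 0" using W_inner_inv[OF up(2)] by simp
 moreover have sw: "w bt = s i bt" using up(5) s_s[OF i', of "w bt"] by (simp add: comp_def)
 moreover have "s i bt \<bullet> al i = - (bt \<bullet> al i)" by (simp add: weyl_gen_fin[OF up(1)] reflection_swap reflection_self)
 ultimately have z: "bt \<bullet> al i = 0" using bt_dom up(1) by (force simp: dominant_def)
 hence "w bt = bt" using sw by (simp add: weyl_gen_fin[OF up(1)] reflection_orth)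
 hence IH: "T w (ee (- bt) * f) = ee (- bt) * T w f" using up(4) by blast
 have "- bt \<cdot> rt i = 0" using z coroot_zero[OF al_R[OF up(1)], of bt] rt_ix[OF up(1)] by simp
 from X_0[OF i' mP this T_wt[OF W_aff[OF up(2)] assms(3)]] show ?case
  unfolding T_up_left[OF i' W_aff[OF up(2)] up(3) assms(3)] T_up_left[OF i' W_aff[OF up(2)] up(3) X_wt[OF mP assms(3)]] IH .
qed

text \<open>\<open>lg\<close> negates \<open>bt\<close> and \<open>sth o lg\<close> fixes it, so by
  \<open>T_stab\<close> the factor e^(-bt) created by \<open>BB\<close> passes through the operator
  of \<open>sth o lg\<close> and cancels the e^bt of \<open>T03\<close>. Hence applying
  \<open>T03\<close>, \<open>kappa\<close> and \<open>T03\<close> in turn is \<open>kappa\<close>,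
  and the quadratic relation gives the claim.\<close>

lemma kp_T03: assumes f: "f \<in> wt" shows "kp (T03 D f) = T03 D (kp f) - scale d3 (kp f)"
proof -
 let ?h = "Tj sth f" let ?u = "sth o lg" let ?x = "inverse (chi D lg)"
 have h: "?h \<in> wt" "BB ?h \<in> wt" using Tj_wt sth_aff f BB_wt by auto
 have mP: "- bt \<in> P" using weights_minus bt_P by blast
 have u: "?u \<in> W" using weyl_comp s_theta_W lg by blast
 have iu: "lg o inv ?u = sth"
  using inv_comp[OF sth_aff W_aff[OF lg]] inv_lg inv_sth by (auto simp: fun_eq_iff lg_lg)
 have TL: "Tj sth (T lg g) = T ?u g" if "g \<in> wt" for g
  using T_lg[OF u that] iu Tj_T[OF sth_aff T_wt[OF W_aff[OF u] that]] by simp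
 have ub: "?u bt = bt" using W_minus[OF s_theta_W, of bt] by (simp add: lg_bt sth_bt)
 have lin: "Tj sth (scale c g) = scale c (Tj sth g)" for c g using linop_scale[OF linop_Tj[OF sth_aff]] .
 have "kp (T03 D f) = scale ?x (T lg (ee (- bt) * BB ?h))"
  using kp_eq[OF T03_wt[OF f]] T03_eq[OF f] by (simp add: BB_mult BB_ee' lg_bt)
 hence "T03 D (kp (T03 D f)) = ee bt * Tj sth (scale ?x (T lg (ee (- bt) * BB ?h)))"
  using T03_eq[OF kp_wt[OF T03_wt[OF f]]] by simp
 also have "... = scale ?x (ee bt * T ?u (ee (- bt) * BB ?h))"
  unfolding lin TL[OF X_wt[OF mP h(2)]] scale_mult_right ..
 also have "... = scale ?x (T ?u (BB ?h))" unfolding T_stab[OF u ub h(2)] ee_cancel ..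
 also have "... = Tj sth (kp ?h)" unfolding kp_eq[OF h(1)] lin TL[OF h(2)] ..
 also have "... = kp f"
  using kp_T[OF s_theta_W h(1)] inv_sth T_Tj[OF sth_aff f] Tj_T[OF sth_aff kp_wt[OF f]] by simp
 finally have 1: "T03 D (kp (T03 D f)) = kp f" .
 let ?k = "kp f"
 have k: "?k \<in> wt" "T03 D ?k \<in> wt" using kp_wt T03_wt f by auto
 have "T03 D (T03 D ?k - scale d3 ?k) = T03 D (T03 D ?k) + scale (- d3) (T03 D ?k)"
  using T03_lin(1)[OF k(2) scale_wt[OF k(1)], of "- d3"] T03_lin(2)[OF k(1) k(1), of "- d3"] by simp
 hence "T03 D (T03 D ?k - scale d3 ?k) = kp f" using T03_T03[OF k(1)] by simp
 thus ?thesis using T03_inj[OF kp_wt[OF T03_wt[OF f]] diff_wt[OF k(2) scale_wt[OF k(1)]]] 1 by simp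
qed

lemma kp_TX: "i \<in> aix ==> f \<in> wt ==> kp (TX i f) = TX i (kp f) - scale (dX i) (kp f)"
 using kp_T03 kp_TT aix_eq by (auto simp: TX_def dX_def TTi_def)

text \<open>For alcove weights \<open>T_alc\<close> evaluates the operator of the longest element,
  and \<open>chi_lg\<close> makes the scalars cancel.\<close>

lemma kp_E: "l \<in> P ==> kp (E l) = E l"
proof (induction rule: P_induct)
 case (alc v)
 let ?f = "w_fin D v"
 have vw: "ee v \<in> wt" using ee_wt alc_dom(3) alc by blast
 have c: "chi D lg = chi D (lg o ?f) * chi D ?f"
  using chi_lg[OF W_inv_in[OF wf_W], of v] inv_inv_eq[OF W_bij[OF wf_W]] chi_inv[OF wf_W, of v] by simp
 have nz: "chi D lg ~= 0" "chi D ?f ~= 0" using chi_nz lg wf_W by auto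
 have "bar (chi D ?f) = inverse (chi D ?f)"
 proof -
  have "bar (prod_list (map (t_half D) ws)) = inverse (prod_list (map (t_half D) ws))" for ws
   by (induction ws) (auto simp: hm_1[OF bar(1)] hm_mult[OF bar(1)] bar_t)
  thus ?thesis by (simp add: chi_def)
 qed
 hence "kp (E v) = scale (chi D ?f) (kp (ee v))"
  using kp_scale[OF vw] E_alc[OF alc] by (simp add: hm_inverse[OF bar(1)])
 also have "kp (ee v) = scale (inverse (chi D lg)) (T lg (ee (lg v)))" using kp_eq[OF vw] by (simp add: BB_ee')
 also have "T lg (ee (lg v)) = scale (chi D (lg o ?f) * inverse (chi D ?f)) (ee v)" using T_alc[OF alc lg] inv_lg by simp
 finally have "kp (E v) = scale (chi D ?f * (inverse (chi D lg) * (chi D (lg o ?f) * inverse (chi D ?f)))) (ee v)" by simp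
 also have "chi D ?f * (inverse (chi D lg) * (chi D (lg o ?f) * inverse (chi D ?f))) = inverse (chi D ?f)"
  using nz c by (simp add: field_simps)
 finally show ?case using E_alc[OF alc] by simp
next
 case (step l i)
 let ?X = "xx i (yy l)" let ?a = "- dX i / (1 - ?X)"
 obtain k :: nat and u where k: "u \<in> RL" "?X = qroot ^ k * tm u" using xx_yy[OF step(1-3)] by blast
 have X: "bar ?X = inverse ?X" unfolding k(2) hm_mult[OF bar(1)] hm_power[OF bar(1)] bar bar_tm by (simp add: power_inverse)
 have X1: "?X ~= 1" "?X ~= 0" using xx_ne1[OF step(1-3)] k tm_nz by (simp_all add: qroot_nz)
 \<comment> \<open>As \<open>bar\<close> inverts \<open>?X\<close>, the conjugate of 1/(1 - ?X) is 1
   minus it, and \<open>dX i\<close> changes sign.\<close>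
 have a: "bar ?a = ?a + dX i"
  using X1 by (simp add: divide_inverse hm_mult[OF bar(1)] hm_minus[OF bar(1)] hm_inverse[OF bar(1)] hm_diff[OF bar(1)]
    hm_1[OF bar(1)] X bar_d) (simp add: field_simps)
 have cancel: "x - y + (z + y) = x + z" for x y z :: "('v, 'p) galg" by simp
 have w: "E l \<in> wt" "TX i (E l) \<in> wt" using E_wt TX_wt step by auto
 have "kp (E (s i l)) = kp (TX i (E l)) + scale (bar ?a) (kp (E l))"
  unfolding E_step[OF step(1-3)] stepop_def kp_add[OF w(2) scale_wt[OF w(1)]] kp_scale[OF w(1)] ..
 also have "... = TX i (E l) + scale ?a (E l)"
  unfolding a kp_TX[OF step(2) w(1)] step(4) galg.scale_left_distrib by (rule cancel)
 finally show ?case unfolding E_step[OF step(1-3)] stepop_def .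
qed

end

section \<open>Limits\<close>

lemma coeff_mult_le: fixes p q :: "'a::idom poly" assumes "degree p <= m" "degree q <= n"
 shows "coeff (p * q) (m + n) = coeff p m * coeff q n"
proof (cases "degree p = m & degree q = n")
 case False
 hence "degree p < m | degree q < n" using assms by auto
 moreover have "degree (p * q) <= degree p + degree q" by (rule degree_mult_le)
 ultimately show ?thesis using assms by (auto simp: coeff_eq_0)
qed (use coeff_mult_degree_sum in blast)

lemma has_lim_0I: "poly b 0 ~= 0 ==> c * poly b 0 = poly a 0 ==> has_lim_0 (Fract a b) c"
 unfolding has_lim_0_def by (metis nonzero_mult_div_cancel_right)

lemma has_lim_infinityI: "b ~= 0 ==> degree a <= degree b ==> c * lead_coeff b = coeff a (degree b) ==> has_lim_infinity (Fract a b) c"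
 unfolding has_lim_infinity_def by (metis leading_coeff_0_iff nonzero_mult_div_cancel_right)

text \<open>The properties that the limits at 0 and at infinity share, so that one induction serves
  both.\<close>

definition limlike :: "('p::linorder qtfield => 'p tfield => bool) => bool" where
 "limlike L \<longleftrightarrow> (\<forall>c. L (of_tfield c) c) & (\<forall>x y c d. L x c --> L y d --> L (x + y) (c + d) & L (x * y) (c * d))"

lemma limlike_0: "limlike has_lim_0"
proof -
 have "has_lim_0 (x + y) (c + d) & has_lim_0 (x * y) (c * d)" if xy: "has_lim_0 x c" "has_lim_0 y d" for x y :: "'a qtfield" and c d
 proof -
  obtain a b a' b' where h: "x = Fract a b" "poly b 0 ~= 0" "c = poly a 0 / poly b 0"
   "y = Fract a' b'" "poly b' 0 ~= 0" "d = poly a' 0 / poly b' 0" using xy unfolding has_lim_0_def by blast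
  hence "b ~= 0" "b' ~= 0" by auto
  hence e: "x + y = Fract (a * b' + a' * b) (b * b')" "x * y = Fract (a * a') (b * b')" using h by auto
  have "poly a 0 = c * poly b 0" "poly a' 0 = d * poly b' 0" using h by auto
  thus ?thesis unfolding e by (intro conjI has_lim_0I) (use h(2,5) in \<open>simp_all add: algebra_simps\<close>)
 qed
 moreover have "has_lim_0 (of_tfield c) c" for c :: "'a tfield"
  unfolding has_lim_0_def of_tfield_def by (intro exI[of _ "[:c:]"] exI[of _ 1]) simp
 ultimately show ?thesis unfolding limlike_def by blast
qed

lemma limlike_infinity: "limlike has_lim_infinity"
proof -
 have "has_lim_infinity (x + y) (c + d) & has_lim_infinity (x * y) (c * d)"
  if xy: "has_lim_infinity x c" "has_lim_infinity y d" for x y :: "'a qtfield" and c d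
 proof -
  obtain a b a' b' where h: "x = Fract a b" "b ~= 0" "degree a <= degree b" "c = coeff a (degree b) / lead_coeff b"
   "y = Fract a' b'" "b' ~= 0" "degree a' <= degree b'" "d = coeff a' (degree b') / lead_coeff b'"
   using xy unfolding has_lim_infinity_def by blast
  let ?n = "degree b + degree b'"
  have e: "x + y = Fract (a * b' + a' * b) (b * b')" "x * y = Fract (a * a') (b * b')" using h by auto
  have n: "degree (b * b') = ?n" using h by (simp add: degree_mult_eq)
  have c: "coeff (a * b') ?n = coeff a (degree b) * lead_coeff b'" "coeff (a * a') ?n = coeff a (degree b) * coeff a' (degree b')"
   "coeff (a' * b) ?n = coeff a' (degree b') * lead_coeff b"
   using coeff_mult_le[OF h(3) order_refl, of b'] coeff_mult_le[OF h(3,7)] coeff_mult_le[OF h(7) order_refl, of b]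
   by (simp_all add: add.commute)
  have d: "degree (a * b' + a' * b) <= ?n"
   by (rule degree_add_le) (use degree_mult_le[of a b'] degree_mult_le[of a' b] h(3,7) in linarith)+
  have d': "degree (a * a') <= ?n" using degree_mult_le[of a a'] h(3,7) by linarith
  have l: "coeff a (degree b) = c * lead_coeff b" "coeff a' (degree b') = d * lead_coeff b'" using h by auto
  show ?thesis unfolding e
   by (intro conjI has_lim_infinityI; (unfold n)?)
    (use h(2,6) d d' in \<open>simp_all add: coeff_mult_degree_sum c l distrib_right\<close>)
 qed
 moreover have "has_lim_infinity (of_tfield c) c" for c :: "'a tfield"
  unfolding has_lim_infinity_def of_tfield_def by (intro exI[of _ "[:c:]"] exI[of _ 1]) simp
 ultimately show ?thesis unfolding limlike_def by blast
qed

lemma lim_sum: assumes "limlike L" "!!i. i \<in> J ==> L (f i) (g i)" shows "L (sum f J) (sum g J)"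
proof -
 have "L (of_tfield 0) 0" using assms(1) unfolding limlike_def by blast
 thus ?thesis using assms
  by (induction J rule: infinite_finite_induct) (auto simp: of_tfield_0 limlike_def)
qed

lemma of_tfield_sum: "of_tfield (sum g J) = (\<Sum>i\<in>J. of_tfield (g i))"
 by (induction J rule: infinite_finite_induct) (auto simp: of_tfield_0 of_tfield_add)

lemma coeffwise_add: assumes "limlike L" "coeffwise_lim L f g" "coeffwise_lim L f' g'" shows "coeffwise_lim L (f + f') (g + g')"
 using assms unfolding coeffwise_lim_def limlike_def lookup_add by (metis of_tfield_add)

lemma coeffwise_scale: assumes "limlike L" "L a c" "coeffwise_lim L f g" shows "coeffwise_lim L (scale a f) (scale (of_tfield c) g)"
 using assms unfolding coeffwise_lim_def limlike_def lookup_scale by (metis of_tfield_mult)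

definition tfc :: "('v::euclidean_space, 'p::linorder) galg => bool" where
 "tfc f \<longleftrightarrow> (\<forall>v. lookup f v \<in> tf)"

lemma tf_0: "0 \<in> tf" and tf_diff: "x \<in> tf ==> y \<in> tf ==> x - y \<in> tf"
 using tf_add[OF tf_1 tf_minus[OF tf_1]] tf_add[OF _ tf_minus, of x y] by auto

lemma tfc_add: "tfc f ==> tfc g ==> tfc (f + g)" and tfc_minus: "tfc f ==> tfc (- f)" and tfc_diff: "tfc f ==> tfc g ==> tfc (f - g)"
 and tfc_scale: "c \<in> tf ==> tfc f ==> tfc (scale c f)" and tfc_ee: "tfc (ee l)" and tfc_0: "tfc 0"
 by (auto simp: tfc_def lookup_add lookup_minus lookup_scale ee_def lookup_single when_def tf_add tf_minus tf_mult tf_1 tf_0 tf_diff)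

lemma tfc_sum: "(!!i. i \<in> J ==> tfc (f i)) ==> tfc (sum f J)"
 by (induction J rule: infinite_finite_induct) (auto simp: tfc_0 tfc_add)

lemma tfc_linop: assumes F: "linop F" and FL: "!!l. l \<in> K ==> tfc (F (ee l))" and f: "tfc f" "f \<in> Lg K" shows "tfc (F f)"
proof -
 have "F f = (\<Sum>l\<in>keys f. scale (lookup f l) (F (ee l)))"
  by (subst galg_expand) (simp add: linop_sum[OF F] linop_scale[OF F])
 thus ?thesis using f FL by (auto simp: tfc_def[of f] Lg_def intro!: tfc_sum tfc_scale)
qed

lemma tfc_mult: assumes "tfc f" "tfc g" shows "tfc (f * g)"
proof -
 have 1: "tfc (ee l * g)" for l :: 'a
  by (rule tfc_linop[OF linop_mult _ assms(2), of UNIV]) (auto simp: Lg_def tfc_ee simp flip: ee_add)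
 have "tfc (g * f)" by (rule tfc_linop[OF linop_mult _ assms(1), of UNIV]) (use 1 in \<open>auto simp: Lg_def mult.commute\<close>)
 thus ?thesis by (simp add: mult.commute)
qed

lemma tfc_power: "tfc f ==> tfc (f ^ n)"
 by (induction n) (auto simp: tfc_mult ee_0[symmetric] tfc_ee)

text \<open>With matrix entries free of q, each coefficient of \<open>F f\<close> is a finite sum of
  coefficients of \<open>f\<close> with fixed factors, so the limit can be taken termwise.\<close>

lemma coeffwise_linop: assumes L: "limlike L" and F: "linop F" and FL: "!!l. l \<in> K ==> tfc (F (ee l))"
 and f: "f \<in> Lg K" "g \<in> Lg K" and lim: "coeffwise_lim L f g" shows "coeffwise_lim L (F f) (F g)"
proof -
 let ?J = "keys f \<union> keys g"
 have J: "finite ?J" "?J \<subseteq> K" using f by (auto simp: Lg_def)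
 have e: "F h = (\<Sum>l\<in>?J. scale (lookup h l) (F (ee l)))" if "keys h \<subseteq> ?J" for h
 proof -
  have "F h = F (\<Sum>l\<in>?J. scale (lookup h l) (ee l))"
   by (subst galg_expand) (use that J(1) in \<open>auto intro!: arg_cong[of _ _ F] sum.mono_neutral_left simp: in_keys_iff\<close>)
  thus ?thesis by (simp add: linop_sum[OF F] linop_scale[OF F])
 qed
 obtain c where c: "!!l. L (lookup f l) (c l)" "!!l. lookup g l = of_tfield (c l)"
  using lim unfolding coeffwise_lim_def by metis
 show ?thesis
  unfolding coeffwise_lim_def
 proof
  fix v
  have "\<forall>l\<in>?J. \<exists>d. lookup (F (ee l)) v = of_tfield d" using FL J(2) unfolding tfc_def tf_def by blast
  then obtain d where d: "!!l. l \<in> ?J ==> lookup (F (ee l)) v = of_tfield (d l)" by metis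
  have "lookup (F f) v = (\<Sum>l\<in>?J. lookup f l * of_tfield (d l))"
   unfolding e[OF Un_upper1] lookup_sum lookup_scale by (rule sum.cong[OF refl]) (simp only: d)
  moreover have "lookup (F g) v = of_tfield (\<Sum>l\<in>?J. c l * d l)"
   unfolding e[OF Un_upper2] lookup_sum lookup_scale of_tfield_sum of_tfield_mult by (rule sum.cong[OF refl]) (simp only: d c(2))
  moreover have "L (\<Sum>l\<in>?J. lookup f l * of_tfield (d l)) (\<Sum>l\<in>?J. c l * d l)"
   by (rule lim_sum[OF L]) (use L c(1) in \<open>auto simp: limlike_def\<close>)
  ultimately show "\<exists>c. L (lookup (F f) v) c & lookup (F g) v = of_tfield c" by auto
 qed
qed

lemma coeffwise_tfc: assumes "limlike L" "tfc f" shows "coeffwise_lim L f f"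
proof -
 have "\<exists>c. L x c & x = of_tfield c" if "x \<in> tf" for x using assms(1) that unfolding tf_def limlike_def by blast
 thus ?thesis using assms(2) unfolding coeffwise_lim_def tfc_def by blast
qed

text \<open>As \<open>n\<close> is positive and \<open>t\<close> is nonzero, 1 - t q^n has the value
  1 at q = 0 and positive degree, so a constant divided by it keeps its value at 0 and dies at
  infinity.\<close>

lemma lim_step: assumes n: "n > 0" and t: "t \<in> tf" "t ~= 0" and d: "d \<in> tf"
 shows "\<exists>c. has_lim_0 (- d / (1 - qroot ^ n * t)) c & of_tfield c = - d"
  and "has_lim_infinity (- d / (1 - qroot ^ n * t)) 0"
proof -
 obtain t' d' where td: "t = of_tfield t'" "d = of_tfield d'" using t d unfolding tf_def by blast
 have t0: "t' ~= 0" using t(2) td(1) by (auto simp: of_tfield_0)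
 let ?b = "1 - monom t' n"
 have cb: "coeff ?b n = - t'" using n by (simp add: coeff_1)
 hence b0: "?b ~= 0" using t0 by (metis coeff_0 neg_equal_0_iff_equal)
 have "1 - qroot ^ n * t = Fract ?b 1" unfolding td qroot_power by (simp add: hm_diff[OF hm_Fract] hm_1[OF hm_Fract])
 moreover have "- d = Fract [:- d':] 1" unfolding td(2) of_tfield_minus[symmetric] by (simp add: of_tfield_def)
 ultimately have e: "- d / (1 - qroot ^ n * t) = Fract [:- d':] ?b" by simp
 have "poly ?b 0 = 1" using n by (simp add: poly_monom)
 thus "\<exists>c. has_lim_0 (- d / (1 - qroot ^ n * t)) c & of_tfield c = - d"
  unfolding e has_lim_0_def by (intro exI[of _ "- d'"] conjI exI[of _ "[:- d':]"] exI[of _ ?b]) (simp_all add: td of_tfield_minus)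
 have "n <= degree ?b" using cb t0 by (intro le_degree) simp
 hence "coeff [:- d':] (degree ?b) = 0" using n by (simp add: coeff_eq_0)
 thus "has_lim_infinity (- d / (1 - qroot ^ n * t)) 0"
  unfolding e has_lim_infinity_def using b0 by (intro exI[of _ "[:- d':]"] exI[of _ ?b]) simp
qed

context mac
begin

section \<open>Limits along reduced words\<close>

lemma dX_tf: "dX i \<in> tf" and dd_tf: "dd i \<in> tf" and uu_tf: "uu i \<in> tf"
 by (auto simp: dX_def d3_def dd_def uu_def tf_diff tf_inverse hh_tf t03_tf tf_0)

lemma tfc_TT: assumes i: "i \<in> ix" and l: "l \<in> P" shows "tfc (TT i (ee l))"
proof -
 have i': "i \<in> aix" and nz: "i ~= 0" using i ix_aix ix_nz by auto
 note d = dl_P[OF i']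
 have Q: "QQ i = 1" using nz by (simp add: QQ_def)
 have so: "tfc (sop (gg i) (QQ i) (ee l))" by (simp add: sop_def lin_ext_ee Q tfc_ee)
 have cc: "tfc (dl.cc (gg i) (hh i) (uu i))"
  unfolding dl.cc_def[OF d] dd_def[symmetric] ee_0[symmetric] by (intro tfc_add tfc_scale tfc_ee dd_tf uu_tf)
 have xy: "tfc (dl.x (gg i) (QQ i))" "tfc (dl.y (gg i) (QQ i))" unfolding dl.x_def[OF d] dl.y_def[OF d] unfolding Q by (simp_all add: tfc_ee)
 have "tfc (Dop (gg i) (QQ i) (ee l))"
 proof (cases "\<lfloor>l \<cdot> gg i\<rfloor>" rule: int_cases2)
  case (nonneg n)
  show ?thesis unfolding dl.Do_ee_pos[OF d nonneg l] by (intro tfc_mult tfc_sum tfc_power xy tfc_ee)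
 next
  case (nonpos n)
  show ?thesis unfolding dl.Do_ee_neg[OF d nonpos l] minus_mult_left[symmetric] by (intro tfc_minus tfc_mult tfc_sum tfc_power xy tfc_ee)
 qed
 thus ?thesis unfolding TT_DL_wt[OF i' ee_wt[OF l]] dl.T_eq[OF d] by (intro tfc_add tfc_scale tfc_mult so cc hh_tf)
qed

lemma inv_op_fin: assumes u: "u \<in> W" and f: "f \<in> wt" shows "inv_op D (T_fin D u) f = Tj u f"
 unfolding inv_op_def
proof (rule the_inv_into_f_eq)
 show "inj_on (T_fin D u) wt" by (rule inj_on_inverseI[of _ "Tj u"]) (simp add: T_fin_T u W_aff)
qed (use u f T_fin_T[OF u Tj_wt[OF W_aff[OF u] f]] Tj_wt W_aff in auto)

text \<open>A linear operator on the whole group algebra that coincides with \<open>TX i\<close> on the weights.\<close>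

definition TL :: "nat => ('v, 'p) galg => ('v, 'p) galg" where
 "TL i = (if i = 0 then %f. ee bt * Tj sth f else TT i)"

lemma TL_TX: "f \<in> wt ==> TX i f = TL i f"
 using T03_eq by (simp add: TX_def TL_def)

lemma linop_TL: "linop (TL i)"
 using linop_comp[OF linop_mult linop_Tj[OF sth_aff]] linop_TT by (simp add: TL_def)

text \<open>For i = 0 the operator is e^bt times a product of inverse finite generators, in which q
  does not occur. This is why limits are taken with \<open>T03\<close> and not with the form
  \<open>XT 0\<close>.\<close>

lemma tfc_TL: assumes i: "i \<in> aix" and l: "l \<in> P" shows "tfc (TL i (ee l))"
proof (cases "i = 0")
 case True
 obtain ws where ws: "red ix ws" "wd ws = sth" using red_ex[OF s_theta_W] by blast
 have wl: "ws \<in> lists aix" using red_lists[OF red_ix_aix[OF ws(1)]] .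
 note I = iso_word[OF wl]
 have "T sth (word_prod TTi (rev ws) (ee l)) = ee l"
  using T_red[OF red_ix_aix[OF ws(1)] isoS_D(2)[OF I ee_wt[OF l]]] isoS_D(3)[OF I ee_wt[OF l]] ws(2) by simp
 hence e: "Tj sth (ee l) = word_prod TTi (rev ws) (ee l)"
  using T_inv_eq[OF sth_aff isoS_D(2)[OF I ee_wt[OF l]] ee_wt[OF l]] by simp
 have "tfc (word_prod TTi us (ee l)) & word_prod TTi us (ee l) \<in> wt" if "us \<in> lists ix" for us
  using that
 proof (induction us)
  case Nil
  thus ?case using tfc_ee ee_wt[OF l] by simp
 next
  case (Cons j us)
  define h where "h = word_prod TTi us (ee l)"
  have j: "j \<in> ix" "j \<in> aix" and h: "tfc h" "h \<in> wt" using Cons ix_aix unfolding h_def by auto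
  have "tfc (TT j h)" by (rule tfc_linop[OF linop_TT _ h(1) h(2)[unfolded wt_Lg]]) (rule tfc_TT[OF j(1)])
  hence "tfc (TTi j h)" using h(1) by (simp add: TTi_def tfc_diff tfc_scale dd_tf)
  thus ?case using TTi_wt[OF j(2) h(2)] unfolding word_prod_Cons comp_apply h_def by blast
 qed
 from this[of "rev ws"] have "tfc (Tj sth (ee l))" unfolding e using red_lists[OF ws(1)] by (simp add: in_lists_conv_set)
 thus ?thesis using True by (simp add: TL_def tfc_mult tfc_ee)
next
 case False
 thus ?thesis using tfc_TT[OF _ l] i aix_eq by (simp add: TL_def)
qed

definition TXi :: "nat => ('v, 'p) galg => ('v, 'p) galg" where "TXi i f = TX i f - scale (dX i) f"

lemma TX_TXi: assumes "i \<in> aix" "f \<in> wt" shows "TX i (TXi i f) = f" "TXi i (TX i f) = f" "TXi i f \<in> wt"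
proof -
 have TX2: "TX i (TX i f) = f + scale (dX i) (TX i f)"
 proof (cases "i = 0")
  case True thus ?thesis using T03_T03 assms(2) by (simp add: TX_def dX_def)
 next
  case False
  thus ?thesis using TTi_TT[OF assms] by (simp add: TX_def dX_def TTi_def algebra_simps)
 qed
 show w: "TXi i f \<in> wt" unfolding TXi_def using TX_wt[OF assms] scale_wt[OF assms(2)] diff_wt by blast
 show "TXi i (TX i f) = f" by (simp add: TXi_def TX2)
 have "TX i (TXi i f) = TX i (TX i f) - scale (dX i) (TX i f)"
  unfolding TL_TX[OF w] unfolding TXi_def linop_diff[OF linop_TL] linop_scale[OF linop_TL]
  using TL_TX TX_wt[OF assms] assms(2) by simp
 thus "TX i (TXi i f) = f" by (simp add: TX2)
qed

lemma TX_word: assumes "rs \<in> lists aix" "f \<in> wt"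
 shows "word_prod TX rs f \<in> wt & word_prod TXi (rev rs) f \<in> wt & word_prod TX rs (word_prod TXi (rev rs) f) = f &
  word_prod TXi (rev rs) (word_prod TX rs f) = f"
 using assms
proof (induction rs arbitrary: f rule: list.induct)
 case (Cons i rs)
 hence i: "i \<in> aix" "rs \<in> lists aix" by auto
 have "TXi i f \<in> wt" "word_prod TX rs f \<in> wt" using TX_TXi(3)[OF i(1)] Cons i by auto
 thus ?case using Cons.IH[OF i(2)] Cons.prems(2) TX_TXi[OF i(1)] TX_wt[OF i(1)]
  by (simp add: word_prod_append)
qed simp

lemma T_X_word: "T_X D w = word_prod TX (red_word D aix w)"
proof -
 have "(%i. if i = 0 then T03 D else T_fin_gen D i) = TX" by (auto simp: TX_def TT_def)
 thus ?thesis unfolding T_X_def by simp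
qed

text \<open>\<open>T_alc\<close> for the weight 0 shows that the operator of
  \<open>inv (w_fin D v)\<close> acts on 1 by the scalar \<open>chi\<close>, whose inverse is the
  factor in \<open>E_alc\<close>.\<close>

lemma omega_1: assumes v: "alc v" shows "omega D v 1 = E v"
proof -
 let ?f = "w_fin D v"
 have z: "alc 0" using weights_0 by (simp add: alc_def A_def)
 have "isW ix id (- 0)" unfolding isW_def[OF ix_sub]
 proof (intro conjI ballI impI)
  fix b assume b: "b \<in> Phi ix" "b pp > 0"
  then obtain a where "b = aff a 0" using zero_ix unfolding Phi_def by auto
  thus "b (id pp) < 0 \<longleftrightarrow> b (- 0) < 0" using b(2) by (simp add: aff_def)
 qed (rule weyl_id)
 hence w0: "w_fin D 0 = id" by (rule W_w_fin)
 have 1: "(1 :: ('v, 'p) galg) \<in> wt" using ee_wt[OF weights_0] by (simp add: ee_0)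
 have u: "inv ?f \<in> W" "inv ?f \<in> aff_weyl D" using W_inv_in wf_W W_aff by blast+
 have "T (inv ?f) (ee (?f 0)) = scale (chi D (?f o id) * inverse (chi D id)) (ee 0)" using T_alc[OF z wf_W] w0 by simp
 hence "T (inv ?f) 1 = scale (chi D ?f) 1" using linear_0[OF W_linear[OF wf_W]] chi_id by (simp add: ee_0)
 hence "T (inv ?f) (scale (inverse (chi D ?f)) 1) = 1" using chi_wf_nz by (simp add: linop_scale[OF linop_T[OF u(2)]])
 hence "Tj (inv ?f) 1 = scale (inverse (chi D ?f)) 1" using T_inv_eq[OF u(2) scale_wt[OF 1] 1] by simp
 thus ?thesis unfolding omega_def inv_op_fin[OF u(1) 1] E_alc[OF v] by (simp add: scale_mult_right)
qed

lemma tfc_E: "alc v ==> tfc (E v)"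
proof -
 have "prod_list (map (t_half D) ws) \<in> tf" for ws by (induction ws) (auto simp: tf_1 tf_mult t_half_tf)
 thus "alc v ==> tfc (E v)" by (simp add: E_alc tfc_scale tf_inverse chi_def tfc_ee)
qed

text \<open>All reduced expressions are treated at once, so that no braid relations are needed for \<open>T\<^sub>0\<^sub>3\<close>.\<close>

lemma lim_word:
 assumes L: "limlike L" and Z: "!!i f. Z i f = TX i f + scale (b i) f"
  and b: "!!l i. l \<in> P ==> i \<in> aix ==> A i l > 0 ==> \<exists>c. L (- dX i / (1 - xx i (yy l))) c & of_tfield c = b i"
 shows "isW aix (wd ws) l ==> red aix ws ==> l \<in> P ==>
  alc (inv (wd ws) l) & word_prod Z ws (E (inv (wd ws) l)) \<in> wt & coeffwise_lim L (E l) (word_prod Z ws (E (inv (wd ws) l)))"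
proof (induction ws arbitrary: l)
 case Nil
 have "alc l" using isW_Nil Nil unfolding word_prod_Nil by blast
 moreover have "inv id l = l" by simp
 ultimately show ?case unfolding word_prod_Nil by (simp add: tfc_E coeffwise_tfc[OF L] E_wt alc_dom(3))
next
 case (Cons i us)
 note c = isW_Cons[OF Cons.prems]
 let ?l = "s i l"
 define g where "g = word_prod Z us (E (inv (wd us) ?l))"
 have IH: "alc (inv (wd us) ?l)" "g \<in> wt" "coeffwise_lim L (E ?l) g" using Cons.IH[OF c(1-3)] unfolding g_def by blast+
 have "inv (s i o wd us) = inv (wd us) o s i"
  using inv_comp[OF weyl_gen_in[OF c(5)] red_weyl[OF c(2)]] inv_s[OF c(5)] by simp
 hence v: "inv (wd (i # us)) l = inv (wd us) ?l" unfolding word_prod_Cons by simp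
 note El = E_wt[OF c(3)]
 have "coeffwise_lim L (TL i (E ?l)) (TL i g)"
  by (rule coeffwise_linop[OF L linop_TL tfc_TL[OF c(5)] El[unfolded wt_Lg] IH(2)[unfolded wt_Lg] IH(3)])
 hence 1: "coeffwise_lim L (TX i (E ?l)) (TX i g)" using TL_TX[OF El] TL_TX[OF IH(2)] by simp
 obtain x where x: "L (- dX i / (1 - xx i (yy ?l))) x" "of_tfield x = b i" using b[OF c(3,5,4)] by blast
 have "coeffwise_lim L (stepop i ?l (E ?l)) (TX i g + scale (b i) g)"
  unfolding stepop_def x(2)[symmetric] by (rule coeffwise_add[OF L 1 coeffwise_scale[OF L x(1) IH(3)]])
 moreover have "stepop i ?l (E ?l) = E l" using E_step[OF c(3,5,4)] c(5) by simp
 moreover have "word_prod Z (i # us) (E (inv (wd us) ?l)) = TX i g + scale (b i) g"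
  unfolding word_prod_Cons comp_apply g_def[symmetric] Z ..
 moreover have "TX i g + scale (b i) g \<in> wt" using add_wt TX_wt[OF c(5)] scale_wt IH(2) by blast
 ultimately show ?case using IH(1) unfolding v by simp
qed

lemma w_aff: assumes "l \<in> P" shows "isW aix (w_aff D l) l" "tilde D l = inv (w_aff D l) l" "w_aff D l \<in> aff_weyl D"
proof -
 obtain w where w: "isW aix w l" using isW_aff by blast
 thus "isW aix (w_aff D l) l" "tilde D l = inv (w_aff D l) l" using w_aff_tilde[OF w assms] by auto
 thus "w_aff D l \<in> aff_weyl D" unfolding isW_def[OF order_refl] by blast
qed

lemma xx_lims: assumes "l \<in> P" "i \<in> aix" "A i l > 0"
 shows "\<exists>c. has_lim_0 (- dX i / (1 - xx i (yy l))) c & of_tfield c = - dX i"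
  "\<exists>c. has_lim_infinity (- dX i / (1 - xx i (yy l))) c & of_tfield c = 0"
proof -
 obtain k :: nat and u where k: "k > 0" "u \<in> RL" "xx i (yy l) = qroot ^ k * tm u" using xx_yy[OF assms] by blast
 note s = lim_step[OF k(1) tm_tf tm_nz[OF k(2)] dX_tf[of i]]
 show "\<exists>c. has_lim_0 (- dX i / (1 - xx i (yy l))) c & of_tfield c = - dX i"
  "\<exists>c. has_lim_infinity (- dX i / (1 - xx i (yy l))) c & of_tfield c = 0"
  unfolding k(3) using s of_tfield_0 by blast+
qed

lemma lim_std: assumes l: "l \<in> P" shows "coeffwise_lim has_lim_infinity (E l) (std_basis D l)"
proof -
 note w = w_aff[OF l] and r = red_word[OF w_aff(3)[OF l]]
 have "isW aix (wd (red_word D aix (w_aff D l))) l" using w(1) r(2) by simp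
 from lim_word[OF limlike_infinity _ xx_lims(2) this r(1) l, of TX]
 have "alc (inv (w_aff D l) l) & coeffwise_lim has_lim_infinity (E l) (word_prod TX (red_word D aix (w_aff D l)) (E (inv (w_aff D l) l)))"
  unfolding r(2) by simp
 thus ?thesis unfolding std_basis_def w(2) T_X_word using omega_1 by simp
qed

text \<open>The definition chooses a reduced word of \<open>inv (w_aff D l)\<close> and then inverts
  the operator; the limit is therefore followed along the reversed word, with the inverses
  \<open>TXi\<close>.\<close>

lemma lim_dual: assumes l: "l \<in> P" shows "coeffwise_lim has_lim_0 (E l) (dual_std_basis D l)"
proof -
 note w = w_aff[OF l]
 have iw: "inv (w_aff D l) \<in> aff_weyl D" using weyl_bij(2)[OF order_refl w(3)] .
 note r = red_word[OF iw]
 let ?rs = "red_word D aix (inv (w_aff D l))"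
 have rl: "?rs \<in> lists aix" using red_lists[OF r(1)] .
 have e: "wd (rev ?rs) = w_aff D l"
  using wd_rev_inv[OF order_refl rl] r(2) inv_inv_eq[OF weyl_bij(1)[OF order_refl w(3)]] by simp
 have "isW aix (wd (rev ?rs)) l" using w(1) e by simp
 from lim_word[OF limlike_0 _ xx_lims(1) this red_rev[OF order_refl r(1)] l, of TXi]
 have h: "alc (inv (w_aff D l) l)" "coeffwise_lim has_lim_0 (E l) (word_prod TXi (rev ?rs) (E (inv (w_aff D l) l)))"
  unfolding e by (simp_all add: TXi_def)
 let ?f = "E (inv (w_aff D l) l)"
 have f: "?f \<in> wt" using E_wt alc_dom(3) h(1) by blast
 have "inv_op D (T_X D (inv (w_aff D l))) ?f = word_prod TXi (rev ?rs) ?f"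
  unfolding inv_op_def T_X_word
 proof (rule the_inv_into_f_eq)
  show "inj_on (word_prod TX ?rs) wt" by (rule inj_on_inverseI[of _ "word_prod TXi (rev ?rs)"]) (use TX_word[OF rl] in blast)
 qed (use TX_word[OF rl f] in auto)
 thus ?thesis using h omega_1[OF h(1)] unfolding dual_std_basis_def w(2) by simp
qed

end

theorem theorem4p8:
  fixes D :: "('v::euclidean_space, 'p::linorder) datum"
  assumes "macdonald_datum D"
  shows "inj_on (E_tilde D) (weights D) \<and>
         galg.independent (E_tilde D ` weights D) \<and>
         galg.span (E_tilde D ` weights D) = wt_alg D \<and>
         (\<forall>l\<in>weights D. kappa D (E_tilde D l) = E_tilde D l) \<and>
         (\<forall>l\<in>weights D. coeffwise_lim has_lim_infinity (E_tilde D l) (std_basis D l)) \<and>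
         (\<forall>l\<in>weights D. coeffwise_lim has_lim_0 (E_tilde D l) (dual_std_basis D l))"
proof -
 interpret mac D by (rule mac.intro[OF assms])
 show ?thesis using E_inj E_indep E_span kp_E lim_std lim_dual by blast
qed

end
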